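(* For each integer $n \geq 2$ there exists a one-parameter family of complete immersed minimal surfaces of finite total curvature $\mathcal{AW}_0(2n,w) \subset \mathbb{R}^3$, $0 < w < \infty$, such that for every $w \in (0,\infty)$: 1) $\mathcal{AW}_0(2n,w)$ has genus zero; 2) $\mathcal{AW}_0(2n,w)$ has exactly $2n$ ends, all of which are catenoid ends, and the normal vectors at these ends all lie in a common plane and are symmetrically placed, i.e. up to a rotation of the surface their stereographic projections to the complex plane are the $2n$-th roots of unity; 3) $n$ of the ends have weight one and the other $n$ ends have weight $w$, and the two kinds alternate (in the cyclic order of the normal vectors); 4) the symmetry group of $\mathcal{AW}_0(2n,w)$ is $D_n \times \mathbb{Z}_2$.
   Context: Catenoid end: an end of a complete minimal immersion in $\mathbb{R}^3$ is a catenoid end if, after a rotation, a neighborhood of it is a graph of bounded slope over the exterior of a compact set in the $x_1x_2$-plane of a function $f(x_1,x_2) = a\log\sqrt{x_1^2+x_2^2} + b + \frac{c_1x_1+c_2x_2}{x_1^2+x_2^2} + O\left(\frac{1}{x_1^2+x_2^2}\right)$ with $a \neq 0$. Normal at an end: the Gauss map of a complete finite-total-curvature minimal surface extends continuously to each end; its value there is called the normal vector at that end. Weight: for a closed curve $\alpha$ on a minimal surface with unit conormal $\upsilon$ along $\alpha$, the weight (flux) vector is $w(\alpha)=\int_\alpha \upsilon\,ds$; it depends only on the homology class of $\alpha$ (with a consistent choice of conormal). The weight vector $w(E)$ of an end $E$ is that of a loop around the end, with conormal pointing toward the end; the weight of the end means the length $|w(E)|$. Symmetry group: the group of Euclidean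 isometries of $\mathbb{R}^3$ mapping the surface to itself. $D_n \times \mathbb{Z}_2$ denotes the natural $\mathbb{Z}_2$ extension into $O(3)$ of the dihedral group $D_n \subset SO(3)$. Up to a rigid motion, it is the group of order $4n$ generated by the reflections in the planes $P_0=\{x_3=0\}$, $P_i=\{x_1=\cot(i\pi/n)\,x_2\}$ for $1\le i\le n-1$, and $P_n=\{x_2=0\}$. *)

theory Defs
  imports "HOL-Analysis.Analysis" "HOL-Library.Landau_Symbols"
    "HOL-Algebra.Bij" "HOL-Algebra.Generated_Groups"
begin

section \<open>Smooth functions of two real variables\<close>

text \<open>The plane \<open>\<real>\<^sup>2\<close> is represented by the type \<^typ>\<open>complex\<close>, with real coordinates
  \<open>u = Re z\<close> and \<open>v = Im z\<close>.\<close>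

primrec Ck_on :: "nat \<Rightarrow> complex set \<Rightarrow> (complex \<Rightarrow> 'b::real_normed_vector) \<Rightarrow> bool" where
  "Ck_on 0 U f \<longleftrightarrow> continuous_on U f"
| "Ck_on (Suc k) U f \<longleftrightarrow>
     (\<exists>f1 f2. (\<forall>z\<in>U. (f has_derivative (\<lambda>h. Re h *\<^sub>R f1 z + Im h *\<^sub>R f2 z)) (at z)) \<and>
       Ck_on k U f1 \<and> Ck_on k U f2)"

definition smooth_on :: "complex set \<Rightarrow> (complex \<Rightarrow> 'b::real_normed_vector) \<Rightarrow> bool" where
  "smooth_on U f \<longleftrightarrow> (\<forall>k. Ck_on k U f)"

definition pd_u :: "(complex \<Rightarrow> 'b::real_normed_vector) \<Rightarrow> complex \<Rightarrow> 'b" where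
  "pd_u f z = frechet_derivative f (at z) 1"

definition pd_v :: "(complex \<Rightarrow> 'b::real_normed_vector) \<Rightarrow> complex \<Rightarrow> 'b" where
  "pd_v f z = frechet_derivative f (at z) \<i>"

definition jacobian :: "(complex \<Rightarrow> complex) \<Rightarrow> complex \<Rightarrow> real" where
  "jacobian f z = Re (pd_u f z) * Im (pd_v f z) - Im (pd_u f z) * Re (pd_v f z)"


section \<open>Oriented smooth surfaces\<close>

type_synonym 'p chart = "'p set \<times> ('p \<Rightarrow> complex)"

record 'p surface =
  topo :: "'p topology"
  charts :: "'p chart set"

definition chart_range :: "'p chart \<Rightarrow> complex set" where
  "chart_range c = snd c ` fst c"

definition chart_inv :: "'p chart \<Rightarrow> complex \<Rightarrow> 'p" where
  "chart_inv c = inv_into (fst c) (snd c)"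

definition oriented_surface :: "'p surface \<Rightarrow> bool" where
  "oriented_surface M \<longleftrightarrow>
     topspace (topo M) \<noteq> {} \<and> connected_space (topo M) \<and>
     Hausdorff_space (topo M) \<and> second_countable (topo M) \<and>
     (\<Union>c\<in>charts M. fst c) = topspace (topo M) \<and>
     (\<forall>c\<in>charts M. openin (topo M) (fst c) \<and> open (chart_range c) \<and>
        homeomorphic_map (subtopology (topo M) (fst c)) (top_of_set (chart_range c)) (snd c)) \<and>
     (\<forall>c\<in>charts M. \<forall>c'\<in>charts M.
        smooth_on (snd c ` (fst c \<inter> fst c')) (snd c' \<circ> chart_inv c) \<and>
        (\<forall>z\<in>snd c ` (fst c \<inter> fst c'). jacobian (snd c' \<circ> chart_inv c) z > 0))"

text \<open>For a surface obtained from a compact surface by removing finitely many points, the genus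
  is that of the compact surface.\<close>

definition genus_zero :: "'p surface \<Rightarrow> bool" where
  "genus_zero M \<longleftrightarrow>
     (\<exists>P. finite P \<and> P \<subseteq> sphere (0::real^3) 1 \<and>
        topo M homeomorphic_space top_of_set (sphere 0 1 - P))"


section \<open>Complete minimal immersions of finite total curvature\<close>

text \<open>The immersion in the coordinates of a chart.\<close>

definition local_rep :: "('p \<Rightarrow> real^3) \<Rightarrow> 'p chart \<Rightarrow> complex \<Rightarrow> real^3" where
  "local_rep X c = X \<circ> chart_inv c"

definition immersion :: "'p surface \<Rightarrow> ('p \<Rightarrow> real^3) \<Rightarrow> bool" where
  "immersion M X \<longleftrightarrow>
     (\<forall>c\<in>charts M. smooth_on (chart_range c) (local_rep X c) \<and>
        (\<forall>z\<in>chart_range c. inj (frechet_derivative (local_rep X c) (at z))))"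

definition unit_normal :: "(complex \<Rightarrow> real^3) \<Rightarrow> complex \<Rightarrow> real^3" where
  "unit_normal Y z = sgn (cross3 (pd_u Y z) (pd_v Y z))"

text \<open>Coefficients of the first fundamental form \<open>E du\<^sup>2 + 2 F du dv + G dv\<^sup>2\<close> and of the second
  fundamental form \<open>L du\<^sup>2 + 2 M du dv + N dv\<^sup>2\<close>.\<close>

definition ffE :: "(complex \<Rightarrow> real^3) \<Rightarrow> complex \<Rightarrow> real" where
  "ffE Y z = pd_u Y z \<bullet> pd_u Y z"
definition ffF :: "(complex \<Rightarrow> real^3) \<Rightarrow> complex \<Rightarrow> real" where
  "ffF Y z = pd_u Y z \<bullet> pd_v Y z"
definition ffG :: "(complex \<Rightarrow> real^3) \<Rightarrow> complex \<Rightarrow> real" where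
  "ffG Y z = pd_v Y z \<bullet> pd_v Y z"
definition sfL :: "(complex \<Rightarrow> real^3) \<Rightarrow> complex \<Rightarrow> real" where
  "sfL Y z = pd_u (pd_u Y) z \<bullet> unit_normal Y z"
definition sfM :: "(complex \<Rightarrow> real^3) \<Rightarrow> complex \<Rightarrow> real" where
  "sfM Y z = pd_v (pd_u Y) z \<bullet> unit_normal Y z"
definition sfN :: "(complex \<Rightarrow> real^3) \<Rightarrow> complex \<Rightarrow> real" where
  "sfN Y z = pd_v (pd_v Y) z \<bullet> unit_normal Y z"

definition area_density :: "(complex \<Rightarrow> real^3) \<Rightarrow> complex \<Rightarrow> real" where
  "area_density Y z = sqrt (ffE Y z * ffG Y z - (ffF Y z)\<^sup>2)"

definition mean_curvature :: "(complex \<Rightarrow> real^3) \<Rightarrow> complex \<Rightarrow> real" where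
  "mean_curvature Y z =
     (ffE Y z * sfN Y z - 2 * ffF Y z * sfM Y z + ffG Y z * sfL Y z)
       / (2 * (ffE Y z * ffG Y z - (ffF Y z)\<^sup>2))"

definition gauss_curvature :: "(complex \<Rightarrow> real^3) \<Rightarrow> complex \<Rightarrow> real" where
  "gauss_curvature Y z =
     (sfL Y z * sfN Y z - (sfM Y z)\<^sup>2) / (ffE Y z * ffG Y z - (ffF Y z)\<^sup>2)"

definition minimal :: "'p surface \<Rightarrow> ('p \<Rightarrow> real^3) \<Rightarrow> bool" where
  "minimal M X \<longleftrightarrow> (\<forall>c\<in>charts M. \<forall>z\<in>chart_range c. mean_curvature (local_rep X c) z = 0)"

text \<open>The distance of the induced Riemannian metric. For an immersion \<open>X\<close> and a continuous path
  \<open>\<gamma>\<close>, smoothness of \<open>\<gamma>\<close> can be tested on \<open>X \<circ> \<gamma>\<close>, and the induced length of \<open>\<gamma>\<close> is the length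
  of \<open>X \<circ> \<gamma>\<close>. The predicate \<^const>\<open>piecewise_C1_differentiable_on\<close> does not bound the derivative
  near the exceptional points, so finite length is required separately.\<close>

definition admissible_path :: "'p surface \<Rightarrow> ('p \<Rightarrow> real^3) \<Rightarrow> (real \<Rightarrow> 'p) \<Rightarrow> bool" where
  "admissible_path M X \<gamma> \<longleftrightarrow>
     pathin (topo M) \<gamma> \<and> (X \<circ> \<gamma>) piecewise_C1_differentiable_on {0..1} \<and>
     (\<lambda>t. norm (vector_derivative (X \<circ> \<gamma>) (at t))) integrable_on {0..1}"

definition path_length :: "('p \<Rightarrow> real^3) \<Rightarrow> (real \<Rightarrow> 'p) \<Rightarrow> real" where
  "path_length X \<gamma> = integral {0..1} (\<lambda>t. norm (vector_derivative (X \<circ> \<gamma>) (at t)))"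

definition induced_dist :: "'p surface \<Rightarrow> ('p \<Rightarrow> real^3) \<Rightarrow> 'p \<Rightarrow> 'p \<Rightarrow> real" where
  "induced_dist M X p q =
     Inf {path_length X \<gamma> | \<gamma>. admissible_path M X \<gamma> \<and> \<gamma> 0 = p \<and> \<gamma> 1 = q}"

definition complete_immersion :: "'p surface \<Rightarrow> ('p \<Rightarrow> real^3) \<Rightarrow> bool" where
  "complete_immersion M X \<longleftrightarrow> Metric_space.mcomplete (topspace (topo M)) (induced_dist M X)"

text \<open>The integral of \<open>\<bar>K\<bar>\<close> over the surface, as the supremum of its integrals over finite disjoint
  unions of compact sets each of which lies in the domain of a chart.\<close>

definition total_abs_curvature :: "'p surface \<Rightarrow> ('p \<Rightarrow> real^3) \<Rightarrow> ennreal" where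
  "total_abs_curvature M X =
     (SUP \<F> \<in> {\<F>. finite \<F> \<and> disjoint_family_on snd \<F> \<and>
          (\<forall>(c, S)\<in>\<F>. c \<in> charts M \<and> compactin (topo M) S \<and> S \<subseteq> fst c)}.
        \<Sum>(c, S)\<in>\<F>. \<integral>\<^sup>+z\<in>snd c ` S.
           ennreal (\<bar>gauss_curvature (local_rep X c) z\<bar> * area_density (local_rep X c) z) \<partial>lborel)"

definition complete_minimal_ftc :: "'p surface \<Rightarrow> ('p \<Rightarrow> real^3) \<Rightarrow> bool" where
  "complete_minimal_ftc M X \<longleftrightarrow>
     oriented_surface M \<and> immersion M X \<and> minimal M X \<and> complete_immersion M X \<and>
     total_abs_curvature M X < \<infinity>"

text \<open>The Gauss map; by the orientation all charts around a point give the same normal.\<close>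

definition gauss_map :: "'p surface \<Rightarrow> ('p \<Rightarrow> real^3) \<Rightarrow> 'p \<Rightarrow> real^3" where
  "gauss_map M X p =
     (THE \<nu>. \<forall>c\<in>charts M. p \<in> fst c \<longrightarrow> \<nu> = unit_normal (local_rep X c) (snd c p))"


section \<open>Ends\<close>

text \<open>Ends in the sense of Freudenthal: a consistent choice of a component of the complement of
  every compact set.\<close>

definition ends :: "'p surface \<Rightarrow> ('p set \<Rightarrow> 'p set) set" where
  "ends M = {e \<in> extensional {K. compactin (topo M) K}.
     (\<forall>K. compactin (topo M) K \<longrightarrow>
        e K \<in> connected_components_of (subtopology (topo M) (topspace (topo M) - K))) \<and>
     (\<forall>K L. compactin (topo M) K \<and> compactin (topo M) L \<and> K \<subseteq> L \<longrightarrow> e L \<subseteq> e K)}"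

definition end_filter :: "'p surface \<Rightarrow> ('p set \<Rightarrow> 'p set) \<Rightarrow> 'p filter" where
  "end_filter M e = (INF K\<in>{K. compactin (topo M) K}. principal (e K))"

definition end_normal ::
    "'p surface \<Rightarrow> ('p \<Rightarrow> real^3) \<Rightarrow> ('p set \<Rightarrow> 'p set) \<Rightarrow> real^3 \<Rightarrow> bool" where
  "end_normal M X e \<nu> \<longleftrightarrow> (gauss_map M X \<longlongrightarrow> \<nu>) (end_filter M e)"

definition horizontal :: "real^3 \<Rightarrow> complex" where
  "horizontal x = Complex (x $ 1) (x $ 2)"

definition catenoid_end ::
    "'p surface \<Rightarrow> ('p \<Rightarrow> real^3) \<Rightarrow> ('p set \<Rightarrow> 'p set) \<Rightarrow> bool" where
  "catenoid_end M X e \<longleftrightarrow>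
     (\<exists>(A::real^3^3) K C (f::complex \<Rightarrow> real) a b c1 c2.
        rotation_matrix A \<and> compactin (topo M) K \<and> compact C \<and>
        bij_betw (\<lambda>p. horizontal (A *v X p)) (e K) (- C) \<and>
        (\<forall>p\<in>e K. (A *v X p) $ 3 = f (horizontal (A *v X p))) \<and>
        (\<exists>B. \<forall>z\<in>- C. \<exists>D. (f has_derivative D) (at z) \<and> (\<forall>h. \<bar>D h\<bar> \<le> B * norm h)) \<and>
        a \<noteq> 0 \<and>
        (\<lambda>z. f z - (a * ln (norm z) + b + (c1 * Re z + c2 * Im z) / (norm z)\<^sup>2))
          \<in> O[at_infinity](\<lambda>z. 1 / (norm z)\<^sup>2))"

text \<open>A loop around an end is the boundary curve of a closed punctured disc \<open>h\<close> in the surface whose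
  puncture is the end.\<close>

definition loop_around_end ::
    "'p surface \<Rightarrow> ('p \<Rightarrow> real^3) \<Rightarrow> ('p set \<Rightarrow> 'p set) \<Rightarrow> (real \<Rightarrow> 'p) \<Rightarrow> bool" where
  "loop_around_end M X e \<alpha> \<longleftrightarrow>
     (\<exists>h. embedding_map (top_of_set (cball 0 1 - {0})) (topo M) h \<and>
        filterlim h (end_filter M e) (at (0::complex)) \<and>
        (\<forall>t. \<alpha> t = h (cis (2 * pi * t))) \<and>
        (X \<circ> \<alpha>) C1_differentiable_on UNIV)"

text \<open>If \<open>T\<close> is the unit tangent of \<open>X \<circ> \<alpha>\<close> and \<open>\<nu>\<close> the Gauss map, the conormals are \<open>T \<times> \<nu>\<close> and its
  negative, so \<open>\<upsilon> ds = \<plusminus> (X \<circ> \<alpha>)' \<times> \<nu> dt\<close>. Whether the one pointing toward the end is \<open>T \<times> \<nu>\<close>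
  depends on the orientation of the loop.\<close>

definition flux :: "'p surface \<Rightarrow> ('p \<Rightarrow> real^3) \<Rightarrow> (real \<Rightarrow> 'p) \<Rightarrow> real^3" where
  "flux M X \<alpha> =
     integral {0..1} (\<lambda>t. cross3 (vector_derivative (X \<circ> \<alpha>) (at t)) (gauss_map M X (\<alpha> t)))"

text \<open>The weight of an end is the length of its weight vector; it depends neither on the loop nor
  on the sign of the conormal.\<close>

definition end_weight ::
    "'p surface \<Rightarrow> ('p \<Rightarrow> real^3) \<Rightarrow> ('p set \<Rightarrow> 'p set) \<Rightarrow> real \<Rightarrow> bool" where
  "end_weight M X e w \<longleftrightarrow> (\<exists>\<alpha>. loop_around_end M X e \<alpha> \<and> norm (flux M X \<alpha>) = w)"

text \<open>Stereographic projection of the unit sphere from the north pole; the pole itself, which should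
  go to infinity, is sent to 0.\<close>

definition stereographic :: "real^3 \<Rightarrow> complex" where
  "stereographic \<nu> = Complex (\<nu> $ 1) (\<nu> $ 2) / of_real (1 - \<nu> $ 3)"


section \<open>Symmetries\<close>

definition symmetry_group :: "'p surface \<Rightarrow> ('p \<Rightarrow> real^3) \<Rightarrow> (real^3 \<Rightarrow> real^3) set" where
  "symmetry_group M X =
     {f. (\<forall>x y. dist (f x) (f y) = dist x y) \<and>
         f ` (X ` topspace (topo M)) = X ` topspace (topo M)}"

text \<open>Reflection in a plane \<open>P\<close>: the foot of the perpendicular from \<open>x\<close> to \<open>P\<close> is the midpoint of
  \<open>x\<close> and its image.\<close>

definition reflection :: "(real^3) set \<Rightarrow> real^3 \<Rightarrow> real^3" where
  "reflection P x = 2 *\<^sub>R closest_point P x - x"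

definition mirror_planes :: "nat \<Rightarrow> (real^3) set set" where
  "mirror_planes n =
     {{x. x $ 3 = 0}, {x. x $ 2 = 0}} \<union>
     {{x. x $ 1 = cot (real i * pi / real n) * x $ 2} | i. 1 \<le> i \<and> i \<le> n - 1}"

definition dihedral_Z2 :: "nat \<Rightarrow> (real^3 \<Rightarrow> real^3) set" where
  "dihedral_Z2 n = generate (BijGroup UNIV) (reflection ` mirror_planes n)"

definition rigid_motion :: "(real^3 \<Rightarrow> real^3) \<Rightarrow> bool" where
  "rigid_motion T \<longleftrightarrow> (\<exists>(A::real^3^3) b. rotation_matrix A \<and> T = (\<lambda>x. A *v x + b))"

end

theory Submission
  imports Defs "HOL-Complex_Analysis.Cauchy_Integral_Formula"
begin

text \<open>
  The surfaces are given in closed form. On the sphere punctured at the points \<open>x\<close> of the equator with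
  \<open>x\<^sup>n = \<plusminus>1\<close> put \<open>s = n (\<beta> / (z\<^sup>n - 1) - \<gamma> / (z\<^sup>n + 1))\<close> and
  \<open>t = n z\<^bsup>n-1\<^esup> (\<beta> / (z\<^sup>n - 1) + \<gamma> / (z\<^sup>n + 1))\<close>. The Weierstrass form with spinors \<open>s, t\<close> has real
  residues, so it integrates to a sum of one explicit term per puncture, a half catenoid up to a part that
  is smooth there. The fluxes are \<open>2 \<pi> \<beta> ((n - 1) \<beta> + n \<gamma>)\<close> and \<open>2 \<pi> \<gamma> ((n - 1) \<gamma> + n \<beta>)\<close>;
  for every \<open>w\<close> there are \<open>\<beta> > 0 > \<gamma>\<close> making them \<open>1\<close> and \<open>- w\<close>. The symmetric choice of the
  punctures gives the dihedral symmetries. Conversely, a symmetry permutes the ends, so its linear part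
  permutes the axes, respecting the logarithmic growth rates and the constant terms next to them; this leaves
  only the dihedral group, and translations are excluded by the logarithmic growth.
\<close>

section \<open>Weierstrass representation by spinors\<close>

text \<open>The spinors are the partial fractions \<open>s = \<Sum> wt x * x / (z - x)\<close> and
  \<open>t = \<Sum> wt x / (z - x)\<close> over the punctures, summed in closed form; as
  \<open>s / t\<close> tends to \<open>x\<close> at the pole \<open>x\<close>, the normals at the
  ends are the punctures themselves. Positive \<beta> and \<gamma> would realize every ratio of
  fluxes too, but at ratio one they coincide and give a Jorge-Meeks surface, which has more
  symmetries. With opposite signs the kinds grow in opposite senses along their normals. At
  \<open>w = 1\<close> there remains an isometry that reverses an axis and exchanges the kinds; for
  even \<open>n\<close> it is excluded by the constant terms and a numerical estimate of a
  logarithm. The bijection \<open>emb\<close> has a formal reason. A metric must be nonnegative on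
  all pairs from the carrier type, while off the surface the infimum over paths would range over the
  empty set. So all of \<real>^3 becomes the point set of the surface, with the topology pulled back
  from the punctured sphere.\<close>

definition reV :: "complex^3 \<Rightarrow> real^3" where
  "reV v = (\<chi> i. Re (v $ i))"

text \<open>With \<open>g = s / t\<close> and the form \<open>t\<^sup>2 dz\<close> this is the
  classical Weierstrass integrand, a null vector of complex 3-space. Spinors avoid a separate
  treatment of the poles of \<open>g\<close>: regularity just says that \<open>s\<close> and
  \<open>t\<close> have no common zero.\<close>

definition weierstrass_vec :: "complex \<Rightarrow> complex \<Rightarrow> complex^3" where
  "weierstrass_vec s t = vector [(t\<^sup>2 - s\<^sup>2) / 2, \<i> * (s\<^sup>2 + t\<^sup>2) / 2, s * t]"

text \<open>The differentiated form of \<open>Y = Re \<integral>\<phi> dz\<close>: no primitive and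
  no period condition has to be mentioned, since \<open>Y\<close> will be given explicitly.
  Excluding common zeros of the spinors makes \<open>Y\<close> an immersion.\<close>

definition spinor_rep ::
    "complex set \<Rightarrow> (complex \<Rightarrow> real^3) \<Rightarrow> (complex \<Rightarrow> complex) \<Rightarrow> (complex \<Rightarrow> complex) \<Rightarrow> bool" where
  "spinor_rep U Y s t \<longleftrightarrow> open U \<and> s holomorphic_on U \<and> t holomorphic_on U \<and>
     (\<forall>z\<in>U. s z \<noteq> 0 \<or> t z \<noteq> 0) \<and>
     (\<forall>z\<in>U. (Y has_derivative (\<lambda>h. reV (h *s weierstrass_vec (s z) (t z)))) (at z))"

lemma reV_nth [simp]: "reV v $ i = Re (v $ i)"
  by (simp add: reV_def)

lemma reV_mult: "reV (h *s v) = Re h *\<^sub>R reV v + Im h *\<^sub>R reV (\<i> *s v)"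
  by (simp add: vec_eq_iff)

lemma weierstrass_vec_nth [simp]:
  "weierstrass_vec s t $ 1 = (t\<^sup>2 - s\<^sup>2) / 2"
  "weierstrass_vec s t $ 2 = \<i> * (s\<^sup>2 + t\<^sup>2) / 2"
  "weierstrass_vec s t $ 3 = s * t"
  by (simp_all add: weierstrass_vec_def)

lemma has_derivative_reV:
  assumes "\<And>i. ((\<lambda>z. \<psi> z $ i) has_field_derivative \<psi>' $ i) (at z)"
  shows "((\<lambda>z. reV (\<psi> z)) has_derivative (\<lambda>h. reV (h *s \<psi>'))) (at z)"
proof -
  have "((\<lambda>z. Re (\<psi> z $ i)) has_derivative (\<lambda>h. Re (h * \<psi>' $ i))) (at z)" for i
    using bounded_linear.has_derivative[OF bounded_linear_Re assms[of i, unfolded has_field_derivative_def]]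
    by (simp add: mult.commute)
  then show ?thesis
    by (subst has_derivative_componentwise_within) (auto simp: Basis_vec_def inner_axis)
qed

text \<open>Real parts of holomorphic vector functions are closed under both partial derivatives,
  which are the real parts of \<psi>' and \<i> \<psi>'; so the induction generalizes over
  \<psi>.\<close>

lemma Ck_on_reV:
  assumes "open U" "\<And>i. (\<lambda>z. \<psi> z $ i) holomorphic_on U"
  shows "Ck_on k U (\<lambda>z. reV (\<psi> z))"
  using assms(2)
proof (induction k arbitrary: \<psi>)
  case 0
  have "continuous_on U (\<lambda>z. \<psi> z $ i)" for i
    by (rule holomorphic_on_imp_continuous_on[OF 0])
  then show ?case
    unfolding reV_def Ck_on.simps by (intro continuous_on_vec_lambda continuous_on_Re)
next
  case (Suc k)
  define \<psi>' where "\<psi>' z = (\<chi> i. deriv (\<lambda>z. \<psi> z $ i) z)" for z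
  have hol: "(\<lambda>z. \<psi>' z $ i) holomorphic_on U" for i
    using holomorphic_deriv[OF Suc.prems \<open>open U\<close>] by (simp add: \<psi>'_def)
  have "((\<lambda>z. reV (\<psi> z)) has_derivative
      (\<lambda>h. Re h *\<^sub>R reV (\<psi>' z) + Im h *\<^sub>R reV (\<i> *s \<psi>' z))) (at z)" if "z \<in> U" for z
    unfolding reV_mult[symmetric]
    by (rule has_derivative_reV)
      (use holomorphic_derivI[OF Suc.prems \<open>open U\<close> that] in \<open>simp add: \<psi>'_def\<close>)
  moreover have "Ck_on k U (\<lambda>z. reV (\<psi>' z))"
    by (rule Suc.IH) (rule hol)
  moreover have "Ck_on k U (\<lambda>z. reV (\<i> *s \<psi>' z))"
    by (rule Suc.IH) (auto intro!: holomorphic_intros hol)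
  ultimately show ?case
    unfolding Ck_on.simps
    by (intro exI[of _ "\<lambda>z. reV (\<psi>' z)"] exI[of _ "\<lambda>z. reV (\<i> *s \<psi>' z)"]) simp
qed

lemma Ck_on_holomorphic:
  assumes "open U" "f holomorphic_on U"
  shows "Ck_on k U f"
  using assms(2)
proof (induction k arbitrary: f)
  case 0
  then show ?case by (simp add: holomorphic_on_imp_continuous_on)
next
  case (Suc k)
  have hol: "deriv f holomorphic_on U"
    by (rule holomorphic_deriv[OF Suc.prems \<open>open U\<close>])
  have "(f has_derivative (\<lambda>h. Re h *\<^sub>R deriv f z + Im h *\<^sub>R (\<i> * deriv f z))) (at z)"
    if "z \<in> U" for z
  proof -
    have "(\<lambda>h. Re h *\<^sub>R deriv f z + Im h *\<^sub>R (\<i> * deriv f z)) = (*) (deriv f z)"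
      by (auto simp: complex_eq_iff algebra_simps)
    then show ?thesis
      using holomorphic_derivI[OF Suc.prems \<open>open U\<close> that] by (simp add: has_field_derivative_def)
  qed
  moreover have "Ck_on k U (deriv f)" "Ck_on k U (\<lambda>z. \<i> * deriv f z)"
    by (rule Suc.IH, auto intro!: holomorphic_intros hol)+
  ultimately show ?case
    unfolding Ck_on.simps by (intro exI[of _ "deriv f"] exI[of _ "\<lambda>z. \<i> * deriv f z"]) simp
qed

lemma jacobian_holomorphic:
  assumes "(f has_field_derivative f') (at z)"
  shows "jacobian f z = (cmod f')\<^sup>2"
proof -
  have "frechet_derivative f (at z) = (*) f'"
    using assms frechet_derivative_at unfolding has_field_derivative_def by metis
  then show ?thesis
    unfolding jacobian_def pd_u_def pd_v_def cmod_power2 by (simp add: power2_eq_square)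
qed

context
  fixes U Y s t
  assumes rep: "spinor_rep U Y s t"
begin

lemma spinor_rep_open: "open U"
  using rep by (simp add: spinor_rep_def)

lemma spinor_rep_derivative:
  assumes "z \<in> U"
  shows "(Y has_derivative (\<lambda>h. reV (h *s weierstrass_vec (s z) (t z)))) (at z)"
  using rep assms by (simp add: spinor_rep_def)

lemma spinor_rep_holomorphic: "(\<lambda>z. weierstrass_vec (s z) (t z) $ i) holomorphic_on U"
proof -
  have "s holomorphic_on U" "t holomorphic_on U"
    using rep by (auto simp: spinor_rep_def)
  then show ?thesis
    using exhaust_3[of i] by (auto intro!: holomorphic_intros)
qed

lemma spinor_rep_smooth: "smooth_on U Y"
  unfolding smooth_on_def
proof
  fix k
  let ?\<phi> = "\<lambda>z. weierstrass_vec (s z) (t z)"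
  note hol = spinor_rep_holomorphic
  show "Ck_on k U Y"
  proof (cases k)
    case 0
    then show ?thesis
      using spinor_rep_derivative
      by (auto intro!: continuous_at_imp_continuous_on has_derivative_continuous)
  next
    case (Suc k')
    have "(Y has_derivative (\<lambda>h. Re h *\<^sub>R reV (?\<phi> z) + Im h *\<^sub>R reV (\<i> *s ?\<phi> z))) (at z)" if "z \<in> U" for z
      unfolding reV_mult[symmetric] by (rule spinor_rep_derivative[OF that])
    moreover have "Ck_on k' U (\<lambda>z. reV (?\<phi> z))" "Ck_on k' U (\<lambda>z. reV (\<i> *s ?\<phi> z))"
      by (rule Ck_on_reV, rule spinor_rep_open, auto intro!: holomorphic_intros hol simp del: weierstrass_vec_nth)+
    ultimately show ?thesis
      unfolding Suc Ck_on.simps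
      by (intro exI[of _ "\<lambda>z. reV (?\<phi> z)"] exI[of _ "\<lambda>z. reV (\<i> *s ?\<phi> z)"]) simp
  qed
qed

lemma spinor_rep_pd:
  assumes "z \<in> U"
  shows "pd_u Y z = reV (weierstrass_vec (s z) (t z))"
    and "pd_v Y z = reV (\<i> *s weierstrass_vec (s z) (t z))"
proof -
  have "frechet_derivative Y (at z) = (\<lambda>h. reV (h *s weierstrass_vec (s z) (t z)))"
    using spinor_rep_derivative[OF assms] frechet_derivative_at by metis
  then show "pd_u Y z = reV (weierstrass_vec (s z) (t z))"
    "pd_v Y z = reV (\<i> *s weierstrass_vec (s z) (t z))"
    by (simp_all add: pd_u_def pd_v_def)
qed

end

text \<open>The derivative of \<open>weierstrass_vec (s z) (t z)\<close> when the spinors have the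
  derivatives \<open>s'\<close> and \<open>t'\<close>; its normal component is the second
  fundamental form.\<close>

definition weierstrass_vec' :: "complex \<Rightarrow> complex \<Rightarrow> complex \<Rightarrow> complex \<Rightarrow> complex^3" where
  "weierstrass_vec' s t s' t' = vector [t * t' - s * s', \<i> * (s * s' + t * t'), s' * t + s * t']"

lemma weierstrass_vec'_nth [simp]:
  "weierstrass_vec' s t s' t' $ 1 = t * t' - s * s'"
  "weierstrass_vec' s t s' t' $ 2 = \<i> * (s * s' + t * t')"
  "weierstrass_vec' s t s' t' $ 3 = s' * t + s * t'"
  by (simp_all add: weierstrass_vec'_def)

section \<open>Fundamental forms and curvature in terms of the spinors\<close>

lemma pd_cong:
  assumes "open U" "z \<in> U" "\<And>x. x \<in> U \<Longrightarrow> f x = g x"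
  shows "pd_u f z = pd_u g z" "pd_v f z = pd_v g z"
proof -
  have "(f has_derivative D) (at z) \<longleftrightarrow> (g has_derivative D) (at z)" for D
    using has_derivative_transform_within_open[OF _ assms(1,2)] assms(3) by metis
  then show "pd_u f z = pd_u g z" "pd_v f z = pd_v g z"
    by (simp_all add: pd_u_def pd_v_def frechet_derivative_def)
qed

lemma pd_reV:
  assumes "\<And>i. ((\<lambda>z. \<psi> z $ i) has_field_derivative \<psi>' $ i) (at z)"
  shows "pd_u (\<lambda>z. reV (\<psi> z)) z = reV \<psi>'" "pd_v (\<lambda>z. reV (\<psi> z)) z = reV (\<i> *s \<psi>')"
proof -
  have "frechet_derivative (\<lambda>z. reV (\<psi> z)) (at z) = (\<lambda>h. reV (h *s \<psi>'))"
    using has_derivative_reV[OF assms] frechet_derivative_at by metis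
  then show "pd_u (\<lambda>z. reV (\<psi> z)) z = reV \<psi>'" "pd_v (\<lambda>z. reV (\<psi> z)) z = reV (\<i> *s \<psi>')"
    by (simp_all add: pd_u_def pd_v_def)
qed

text \<open>The inverse stereographic projection of \<open>s / t\<close>, written homogeneously so
  that zeros of \<open>t\<close> need no case distinction.\<close>

definition spinor_normal :: "complex \<Rightarrow> complex \<Rightarrow> real^3" where
  "spinor_normal s t = (1 / ((cmod s)\<^sup>2 + (cmod t)\<^sup>2)) *\<^sub>R
     vector [2 * Re (s * cnj t), 2 * Im (s * cnj t), (cmod s)\<^sup>2 - (cmod t)\<^sup>2]"

text \<open>The real and imaginary parts of a null vector are orthogonal and equally long; this is
  conformality of the immersion.\<close>

lemma weierstrass_dot:
  "reV (weierstrass_vec s t) \<bullet> reV (weierstrass_vec s t) = ((cmod s)\<^sup>2 + (cmod t)\<^sup>2)\<^sup>2 / 4"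
  "reV (weierstrass_vec s t) \<bullet> reV (\<i> *s weierstrass_vec s t) = 0"
  "reV (\<i> *s weierstrass_vec s t) \<bullet> reV (\<i> *s weierstrass_vec s t) = ((cmod s)\<^sup>2 + (cmod t)\<^sup>2)\<^sup>2 / 4"
proof -
  obtain a b c d where s: "s = Complex a b" and t: "t = Complex c d"
    by (metis complex.exhaust_sel)
  show
    "reV (weierstrass_vec s t) \<bullet> reV (weierstrass_vec s t) = ((cmod s)\<^sup>2 + (cmod t)\<^sup>2)\<^sup>2 / 4"
    "reV (weierstrass_vec s t) \<bullet> reV (\<i> *s weierstrass_vec s t) = 0"
    "reV (\<i> *s weierstrass_vec s t) \<bullet> reV (\<i> *s weierstrass_vec s t) = ((cmod s)\<^sup>2 + (cmod t)\<^sup>2)\<^sup>2 / 4"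
    unfolding s t cmod_power2
    by (simp_all add: inner_vec_def sum_3 power2_eq_square field_simps)
qed

lemma norm_reV_weierstrass:
  "norm (reV (h *s weierstrass_vec s t)) = cmod h * ((cmod s)\<^sup>2 + (cmod t)\<^sup>2) / 2"
proof -
  define c where "c = ((cmod s)\<^sup>2 + (cmod t)\<^sup>2)\<^sup>2 / 4"
  define P Q where "P = reV (weierstrass_vec s t)" and "Q = reV (\<i> *s weierstrass_vec s t)"
  have dots: "P \<bullet> P = c" "P \<bullet> Q = 0" "Q \<bullet> P = 0" "Q \<bullet> Q = c"
    unfolding P_def Q_def c_def by (simp_all add: weierstrass_dot inner_commute)
  have "(norm (reV (h *s weierstrass_vec s t)))\<^sup>2 = (Re h)\<^sup>2 * c + (Im h)\<^sup>2 * c"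
    unfolding reV_mult[of h] power2_norm_eq_inner P_def[symmetric] Q_def[symmetric]
    by (simp add: inner_add_left inner_add_right dots power2_eq_square)
  also have "\<dots> = (cmod h * ((cmod s)\<^sup>2 + (cmod t)\<^sup>2) / 2)\<^sup>2"
  proof -
    have "(Re h)\<^sup>2 * c + (Im h)\<^sup>2 * c = (cmod h)\<^sup>2 * c"
      unfolding cmod_power2[of h] by (simp add: algebra_simps)
    then show ?thesis
      unfolding c_def by (simp add: power_mult_distrib power_divide)
  qed
  finally have "(norm (reV (h *s weierstrass_vec s t)))\<^sup>2 = (cmod h * ((cmod s)\<^sup>2 + (cmod t)\<^sup>2) / 2)\<^sup>2" .
  then show ?thesis
    by (simp add: power2_eq_iff_nonneg)
qed

lemma weierstrass_cross:
  "cross3 (reV (weierstrass_vec s t)) (reV (\<i> *s weierstrass_vec s t)) =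
     (((cmod s)\<^sup>2 + (cmod t)\<^sup>2)\<^sup>2 / 4) *\<^sub>R spinor_normal s t"
proof (cases "s = 0 \<and> t = 0")
  case True
  then show ?thesis
    by (simp add: vec_eq_iff forall_3 cross3_def)
next
  case False
  obtain a b c d where s: "s = Complex a b" and t: "t = Complex c d"
    by (metis complex.exhaust_sel)
  have pos: "(cmod s)\<^sup>2 + (cmod t)\<^sup>2 \<noteq> 0"
    using False by (simp add: sum_power2_eq_zero_iff)
  have "(((cmod s)\<^sup>2 + (cmod t)\<^sup>2)\<^sup>2 / 4) *\<^sub>R spinor_normal s t = (((cmod s)\<^sup>2 + (cmod t)\<^sup>2) / 4) *\<^sub>R
     vector [2 * Re (s * cnj t), 2 * Im (s * cnj t), (cmod s)\<^sup>2 - (cmod t)\<^sup>2]"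
  proof -
    define D where "D = (cmod s)\<^sup>2 + (cmod t)\<^sup>2"
    have "(D\<^sup>2 / 4) * (1 / D) = D / 4"
      using pos by (simp add: D_def[symmetric] power2_eq_square)
    then show ?thesis
      unfolding spinor_normal_def D_def[symmetric] scaleR_scaleR by simp
  qed
  also have "\<dots> = cross3 (reV (weierstrass_vec s t)) (reV (\<i> *s weierstrass_vec s t))"
    unfolding s t cmod_power2
    by (simp add: cross3_def vec_eq_iff forall_3 power2_eq_square) (auto simp: algebra_simps)
  finally show ?thesis by simp
qed

lemma norm_spinor_normal:
  assumes "s \<noteq> 0 \<or> t \<noteq> 0"
  shows "norm (spinor_normal s t) = 1"
proof -
  have pos: "(cmod s)\<^sup>2 + (cmod t)\<^sup>2 > 0"
    using assms by (simp add: sum_power2_gt_zero_iff)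
  let ?v = "vector [2 * Re (s * cnj t), 2 * Im (s * cnj t), (cmod s)\<^sup>2 - (cmod t)\<^sup>2] :: real^3"
  have "(norm ?v)\<^sup>2 = ((cmod s)\<^sup>2 + (cmod t)\<^sup>2)\<^sup>2"
    unfolding cmod_power2 power2_norm_eq_inner
    by (simp add: inner_vec_def sum_3 power2_eq_square) (simp add: algebra_simps)
  then have "norm ?v = (cmod s)\<^sup>2 + (cmod t)\<^sup>2"
    by (simp add: power2_eq_iff_nonneg)
  moreover have "(1 / r) * r = 1" if "r > 0" for r :: real
    using that by simp
  ultimately show ?thesis
    unfolding spinor_normal_def norm_scaleR abs_divide abs_one using pos abs_of_pos by metis
qed

text \<open>The Wronskian of the spinors is the Hopf differential: the normal part of the second
  derivatives depends on nothing else. The factor \<open>c\<close> will be 1, \<i> and -1, for the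
  three second partial derivatives.\<close>

lemma weierstrass'_normal:
  assumes "s \<noteq> 0 \<or> t \<noteq> 0"
  shows "reV (c *s weierstrass_vec' s t s' t') \<bullet> spinor_normal s t = Re (c * (s * t' - s' * t))"
proof -
  define D where "D = (cmod s)\<^sup>2 + (cmod t)\<^sup>2"
  have "D \<noteq> 0"
    using assms by (simp add: D_def sum_power2_eq_zero_iff)
  define a b d where "a = 2 * Re (s * cnj t)" and "b = 2 * Im (s * cnj t)"
    and "d = (cmod s)\<^sup>2 - (cmod t)\<^sup>2"
  \<comment> \<open>Written with conjugates, the coordinates of the normal turn the claim into a
    polynomial identity in \<open>s\<close>, \<open>t\<close> and their conjugates, from which the
    denominator \<open>D\<close> factors out.\<close>
  have a: "complex_of_real a = s * cnj t + cnj s * t"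
    and b: "\<i> * complex_of_real b = s * cnj t - cnj s * t"
    unfolding a_def b_def by (simp_all add: complex_eq_iff)
  have d: "complex_of_real d = s * cnj s - t * cnj t" "complex_of_real D = s * cnj s + t * cnj t"
    unfolding d_def D_def by (simp_all only: of_real_add of_real_diff complex_norm_square)
  have lin: "Re (c * (x * of_real a + y * (\<i> * of_real b) + z * of_real d))
    = Re (c * x) * a + Re (c * (\<i> * y)) * b + Re (c * z) * d" for x y z
    by (simp add: algebra_simps)
  have "(t * t' - s * s') * of_real a + (s * s' + t * t') * (\<i> * of_real b) + (s' * t + s * t') * of_real d
      = of_real D * (s * t' - s' * t)"
    unfolding a b d by (simp add: algebra_simps)
  then have "Re (c * ((t * t' - s * s') * of_real a + (s * s' + t * t') * (\<i> * of_real b)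
      + (s' * t + s * t') * of_real d)) = Re (c * (of_real D * (s * t' - s' * t)))"
    by (simp only:)
  moreover have "Re (c * ((t * t' - s * s') * of_real a + (s * s' + t * t') * (\<i> * of_real b)
      + (s' * t + s * t') * of_real d))
    = Re (c * (t * t' - s * s')) * a + Re (c * (\<i> * (s * s' + t * t'))) * b + Re (c * (s' * t + s * t')) * d"
    using lin .
  moreover have "Re (c * (of_real D * (s * t' - s' * t))) = D * Re (c * (s * t' - s' * t))"
    by (simp add: algebra_simps)
  moreover have "reV (c *s weierstrass_vec' s t s' t') \<bullet> spinor_normal s t =
     (1 / D) * (Re (c * (t * t' - s * s')) * a + Re (c * (\<i> * (s * s' + t * t'))) * b
       + Re (c * (s' * t + s * t')) * d)"
    unfolding spinor_normal_def inner_scaleR_right D_def[symmetric] a_def[symmetric] b_def[symmetric] d_def[symmetric]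
    by (simp only: inner_vec_def sum_3 reV_nth vector_smult_component weierstrass_vec'_nth vector_3 inner_real_def)
  ultimately show ?thesis
    using \<open>D \<noteq> 0\<close> by simp
qed

context
  fixes U Y s t
  assumes rep: "spinor_rep U Y s t"
begin

lemma spinor_rep_nonzero: "z \<in> U \<Longrightarrow> s z \<noteq> 0 \<or> t z \<noteq> 0"
  using rep by (auto simp: spinor_rep_def)

lemma spinor_rep_first_form:
  assumes "z \<in> U"
  shows "ffE Y z = ((cmod (s z))\<^sup>2 + (cmod (t z))\<^sup>2)\<^sup>2 / 4" "ffF Y z = 0"
    "ffG Y z = ((cmod (s z))\<^sup>2 + (cmod (t z))\<^sup>2)\<^sup>2 / 4"
  using assms by (simp_all add: ffE_def ffF_def ffG_def spinor_rep_pd[OF rep] weierstrass_dot)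

lemma spinor_rep_normal:
  assumes "z \<in> U"
  shows "unit_normal Y z = spinor_normal (s z) (t z)"
proof -
  have "(cmod (s z))\<^sup>2 + (cmod (t z))\<^sup>2 > 0"
    using spinor_rep_nonzero[OF assms] by (simp add: sum_power2_gt_zero_iff)
  then show ?thesis
    using norm_spinor_normal[OF spinor_rep_nonzero[OF assms]]
    unfolding unit_normal_def spinor_rep_pd[OF rep assms] weierstrass_cross
    by (simp add: sgn_scaleR sgn_div_norm[of "spinor_normal _ _"] del: sum_power2_gt_zero_iff)
qed

lemma spinor_rep_second_form:
  assumes "z \<in> U"
  defines "W \<equiv> s z * deriv t z - deriv s z * t z"
  shows "sfL Y z = Re W" "sfM Y z = - Im W" "sfN Y z = - Re W"
proof -
  let ?\<phi> = "\<lambda>z. weierstrass_vec (s z) (t z)"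
  let ?\<phi>' = "weierstrass_vec' (s z) (t z) (deriv s z) (deriv t z)"
  have "open U" "s holomorphic_on U" "t holomorphic_on U"
    using rep by (auto simp: spinor_rep_def)
  then have d: "(s has_field_derivative deriv s z) (at z)" "(t has_field_derivative deriv t z) (at z)"
    using assms by (auto intro: holomorphic_derivI)
  have d\<phi>: "((\<lambda>z. ?\<phi> z $ i) has_field_derivative ?\<phi>' $ i) (at z)" for i
    using exhaust_3[of i]
    by (auto intro!: derivative_eq_intros d simp: field_simps)
  have d\<phi>2: "((\<lambda>z. (\<i> *s ?\<phi> z) $ i) has_field_derivative (\<i> *s ?\<phi>') $ i) (at z)" for i
    unfolding vector_smult_component by (intro DERIV_cmult d\<phi>)
  have "pd_u (pd_u Y) z = reV ?\<phi>'" "pd_v (pd_u Y) z = reV (\<i> *s ?\<phi>')"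
    using pd_cong[OF \<open>open U\<close> \<open>z \<in> U\<close>, of "pd_u Y" "\<lambda>z. reV (?\<phi> z)"] pd_reV[OF d\<phi>]
      spinor_rep_pd(1)[OF rep] by simp_all
  moreover have "pd_v (pd_v Y) z = reV (\<i> *s (\<i> *s ?\<phi>'))"
    using pd_cong[OF \<open>open U\<close> \<open>z \<in> U\<close>, of "pd_v Y" "\<lambda>z. reV (\<i> *s ?\<phi> z)"] pd_reV[OF d\<phi>2]
      spinor_rep_pd(2)[OF rep] by simp_all
  ultimately show "sfL Y z = Re W" "sfM Y z = - Im W" "sfN Y z = - Re W"
    unfolding sfL_def sfM_def sfN_def spinor_rep_normal[OF assms(1)] W_def vector_smult_assoc
    using weierstrass'_normal[OF spinor_rep_nonzero[OF assms(1)], of 1]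
      weierstrass'_normal[OF spinor_rep_nonzero[OF assms(1)], of \<i>]
      weierstrass'_normal[OF spinor_rep_nonzero[OF assms(1)], of "\<i> * \<i>"]
    by simp_all
qed

text \<open>The coordinates are conformal, E = G and F = 0, and \<open>Y\<close> is harmonic, so L +
  N = 0: differentiating twice in the second variable produces the factor
  \<open>\<i> * \<i>\<close>.\<close>

lemma spinor_rep_minimal: "z \<in> U \<Longrightarrow> mean_curvature Y z = 0"
  unfolding mean_curvature_def spinor_rep_first_form spinor_rep_second_form
  by (simp only: mult_minus_right mult_zero_left mult_zero_right) simp

lemma spinor_rep_immersion:
  assumes "z \<in> U"
  shows "inj (frechet_derivative Y (at z))"
proof -
  have pos: "(cmod (s z))\<^sup>2 + (cmod (t z))\<^sup>2 > 0"
    using spinor_rep_nonzero[OF assms] by (simp add: sum_power2_gt_zero_iff)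
  have eq: "frechet_derivative Y (at z) = (\<lambda>h. reV (h *s weierstrass_vec (s z) (t z)))"
    using spinor_rep_derivative[OF rep assms] frechet_derivative_at by metis
  have "linear (\<lambda>h. reV (h *s weierstrass_vec (s z) (t z)))"
    by (rule has_derivative_linear[OF spinor_rep_derivative[OF rep assms]])
  moreover have "h = 0" if "reV (h *s weierstrass_vec (s z) (t z)) = 0" for h
  proof -
    have "cmod h * ((cmod (s z))\<^sup>2 + (cmod (t z))\<^sup>2) / 2 = 0"
      unfolding norm_reV_weierstrass[symmetric] that by simp
    then show "h = 0"
      using spinor_rep_nonzero[OF assms] by auto
  qed
  ultimately show ?thesis
    unfolding eq by (subst linear_injective_0) auto
qed

text \<open>This is the area density of the unit sphere pulled back by the Gauss map
  \<open>s / t\<close>; in particular it does not change when both spinors are multiplied by a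
  common holomorphic function.\<close>

lemma spinor_rep_curvature:
  assumes "z \<in> U"
  shows "\<bar>gauss_curvature Y z\<bar> * area_density Y z =
    4 * (cmod (s z * deriv t z - deriv s z * t z))\<^sup>2 / ((cmod (s z))\<^sup>2 + (cmod (t z))\<^sup>2)\<^sup>2"
proof -
  define D where "D = (cmod (s z))\<^sup>2 + (cmod (t z))\<^sup>2"
  define W where "W = s z * deriv t z - deriv s z * t z"
  have pos: "D > 0"
    using spinor_rep_nonzero[OF assms] unfolding D_def by (simp add: sum_power2_gt_zero_iff)
  have K: "gauss_curvature Y z = - ((cmod W)\<^sup>2) / (D\<^sup>2 / 4)\<^sup>2"
    unfolding gauss_curvature_def spinor_rep_first_form[OF assms] spinor_rep_second_form[OF assms]
      D_def[symmetric] W_def[symmetric] cmod_power2[of W] by (simp add: power2_eq_square)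
  have A: "area_density Y z = D\<^sup>2 / 4"
    unfolding area_density_def spinor_rep_first_form[OF assms] D_def[symmetric]
    by (simp add: power2_eq_square[symmetric])
  have "\<bar>- ((cmod W)\<^sup>2) / (D\<^sup>2 / 4)\<^sup>2\<bar> * (D\<^sup>2 / 4) = 4 * (cmod W)\<^sup>2 / D\<^sup>2"
    using pos by (simp add: abs_divide field_simps power2_eq_square)
  then show ?thesis
    unfolding K A D_def[symmetric] W_def[symmetric] .
qed

end

section \<open>Punctured spheres\<close>

definition inv_stereographic :: "complex \<Rightarrow> real^3" where
  "inv_stereographic z = (1 / (1 + (cmod z)\<^sup>2)) *\<^sub>R vector [2 * Re z, 2 * Im z, (cmod z)\<^sup>2 - 1]"

text \<open>Rotation by \<pi> about the first axis, which is \<open>z \<mapsto> 1 / z\<close> on the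
  Riemann sphere. Unlike the reflection that exchanges the poles it preserves orientation, so
  composing with it yields a second chart with holomorphic transition.\<close>

definition half_turn :: "real^3 \<Rightarrow> real^3" where
  "half_turn x = vector [x $ 1, - (x $ 2), - (x $ 3)]"

definition north_pole :: "real^3" where
  "north_pole = vector [0, 0, 1]"

lemma inv_stereographic_nth [simp]:
  "inv_stereographic z $ 1 = 2 * Re z / (1 + (cmod z)\<^sup>2)"
  "inv_stereographic z $ 2 = 2 * Im z / (1 + (cmod z)\<^sup>2)"
  "inv_stereographic z $ 3 = ((cmod z)\<^sup>2 - 1) / (1 + (cmod z)\<^sup>2)"
  by (simp_all add: inv_stereographic_def)

lemma half_turn_nth [simp]:
  "half_turn x $ 1 = x $ 1" "half_turn x $ 2 = - (x $ 2)" "half_turn x $ 3 = - (x $ 3)"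
  by (simp_all add: half_turn_def)

lemma one_plus_norm2_pos: "1 + (cmod z)\<^sup>2 > 0"
  by (simp add: add_pos_nonneg)

lemma one_plus_norm2_nonzero [simp]: "1 + (cmod z)\<^sup>2 \<noteq> 0"
  using one_plus_norm2_pos[of z] by linarith

lemma sphere_iff: "x \<in> sphere (0::real^3) 1 \<longleftrightarrow> (x $ 1)\<^sup>2 + (x $ 2)\<^sup>2 + (x $ 3)\<^sup>2 = 1"
  by (simp add: norm_eq_1 inner_vec_def sum_3 power2_eq_square)

lemma inv_stereographic_sphere: "inv_stereographic z \<in> sphere 0 1"
proof -
  have "(2 * Re z)\<^sup>2 + (2 * Im z)\<^sup>2 + ((cmod z)\<^sup>2 - 1)\<^sup>2 = (1 + (cmod z)\<^sup>2)\<^sup>2"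
    unfolding cmod_power2 by (simp add: power2_eq_square algebra_simps)
  then show ?thesis
    unfolding sphere_iff inv_stereographic_nth power_divide add_divide_distrib[symmetric] by simp
qed

lemma sphere_nth3_eq_1:
  assumes "p \<in> sphere (0::real^3) 1" "p $ 3 = 1"
  shows "p = north_pole"
  using assms unfolding sphere_iff north_pole_def
  by (simp add: vec_eq_iff forall_3 sum_power2_eq_zero_iff)

lemma inv_stereographic_nth3: "inv_stereographic z $ 3 < 1"
  using one_plus_norm2_pos[of z] by (simp add: divide_less_eq)

lemma inv_stereographic_neq_north [simp]: "inv_stereographic z \<noteq> north_pole"
proof
  assume "inv_stereographic z = north_pole"
  then have "inv_stereographic z $ 3 = 1"
    by (simp only: north_pole_def vector_3)
  then show False
    using inv_stereographic_nth3[of z] by linarith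
qed

lemma stereographic_inv [simp]: "stereographic (inv_stereographic z) = z"
proof -
  have "1 - inv_stereographic z $ 3 = 2 / (1 + (cmod z)\<^sup>2)"
    by (simp add: field_simps)
  then show ?thesis
    unfolding stereographic_def by (simp add: complex_eq_iff)
qed

lemma inv_stereographic_stereographic:
  assumes "p \<in> sphere 0 1" "p \<noteq> north_pole"
  shows "inv_stereographic (stereographic p) = p"
proof -
  have eq: "(p $ 1)\<^sup>2 + (p $ 2)\<^sup>2 + (p $ 3)\<^sup>2 = 1" and ne: "p $ 3 \<noteq> 1"
    using assms sphere_nth3_eq_1 unfolding sphere_iff[symmetric] by blast+
  have re: "Re (stereographic p) = p $ 1 / (1 - p $ 3)" "Im (stereographic p) = p $ 2 / (1 - p $ 3)"
    by (simp_all add: stereographic_def)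
  have "(p $ 1)\<^sup>2 + (p $ 2)\<^sup>2 = (1 - p $ 3) * (1 + p $ 3)"
    using eq by (simp add: power2_eq_square algebra_simps)
  then have "(cmod (stereographic p))\<^sup>2 = (1 + p $ 3) / (1 - p $ 3)"
    unfolding cmod_power2 re power_divide add_divide_distrib[symmetric]
    using ne by (simp add: power2_eq_square)
  then have *: "1 + (cmod (stereographic p))\<^sup>2 = 2 / (1 - p $ 3)"
    "(cmod (stereographic p))\<^sup>2 - 1 = 2 * p $ 3 / (1 - p $ 3)"
    using ne by (simp_all add: field_simps)
  show ?thesis
    unfolding vec_eq_iff forall_3 inv_stereographic_nth * re using ne by simp
qed

lemma half_turn_half_turn [simp]: "half_turn (half_turn x) = x"
  by (simp add: vec_eq_iff forall_3)

lemma half_turn_sphere [simp]: "half_turn x \<in> sphere 0 1 \<longleftrightarrow> x \<in> sphere 0 1"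
  unfolding sphere_iff by simp

lemma linear_half_turn: "linear half_turn"
  by (rule linearI) (auto simp: vec_eq_iff forall_3)

lemma continuous_on_half_turn [continuous_intros]:
  "continuous_on S f \<Longrightarrow> continuous_on S (\<lambda>x. half_turn (f x))"
  using continuous_on_compose[of S f half_turn] linear_continuous_on[OF linear_conv_bounded_linear[THEN iffD1, OF linear_half_turn]]
  by (simp add: comp_def)

lemma half_turn_inv_stereographic:
  assumes "z \<noteq> 0"
  shows "half_turn (inv_stereographic z) = inv_stereographic (1 / z)"
proof -
  have pos: "(cmod z)\<^sup>2 > 0"
    using assms by simp
  have eq: "1 + (cmod (1/z))\<^sup>2 = (1 + (cmod z)\<^sup>2) / (cmod z)\<^sup>2"
    using pos by (simp add: norm_divide power_divide field_simps)
  have cancel: "x / (cmod z)\<^sup>2 / ((1 + (cmod z)\<^sup>2) / (cmod z)\<^sup>2) = x / (1 + (cmod z)\<^sup>2)" for x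
    using pos by simp
  have "Re (1/z) = Re z / (cmod z)\<^sup>2" "Im (1/z) = - Im z / (cmod z)\<^sup>2"
    by (simp_all add: Re_divide Im_divide cmod_power2)
  moreover have "(cmod (1/z))\<^sup>2 - 1 = (1 - (cmod z)\<^sup>2) / (cmod z)\<^sup>2"
    using pos by (simp add: norm_divide power_divide field_simps)
  ultimately show ?thesis
    unfolding vec_eq_iff forall_3 inv_stereographic_nth half_turn_nth eq
    by (simp only: times_divide_eq_right cancel minus_divide_left minus_diff_eq mult_minus_right simp_thms)
qed

lemma continuous_on_vec3:
  fixes f :: "'a::topological_space \<Rightarrow> real^3"
  assumes "continuous_on S (\<lambda>x. f x $ 1)" "continuous_on S (\<lambda>x. f x $ 2)" "continuous_on S (\<lambda>x. f x $ 3)"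
  shows "continuous_on S f"
proof -
  have "continuous_on S (\<lambda>x. f x $ i)" for i
    using assms exhaust_3[of i] by auto
  then have "continuous_on S (\<lambda>x. \<chi> i. f x $ i)"
    by (rule continuous_on_vec_lambda)
  then show ?thesis
    by simp
qed

lemma continuous_on_inv_stereographic [continuous_intros]:
  "continuous_on S f \<Longrightarrow> continuous_on S (\<lambda>x. inv_stereographic (f x))"
  by (rule continuous_on_vec3) (auto intro!: continuous_intros)

lemma continuous_on_stereographic [continuous_intros]:
  assumes "continuous_on S f" "\<And>x. x \<in> S \<Longrightarrow> f x $ 3 \<noteq> 1"
  shows "continuous_on S (\<lambda>x. stereographic (f x))"
  unfolding stereographic_def Complex_eq
  using assms by (intro continuous_intros) auto

definition south_pole :: "real^3" where
  "south_pole = vector [0, 0, -1]"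

lemma half_turn_poles [simp]:
  "half_turn north_pole = south_pole" "half_turn south_pole = north_pole"
  by (simp_all add: north_pole_def south_pole_def vec_eq_iff forall_3)

lemma half_turn_eq_iff: "half_turn x = y \<longleftrightarrow> x = half_turn y"
  by (metis half_turn_half_turn)

lemma half_turn_image_eq: "half_turn ` S = {x. half_turn x \<in> S}"
  by (auto intro: image_eqI[where f = half_turn and x = "half_turn _", OF half_turn_half_turn[symmetric]])

lemma poles_distinct: "north_pole \<noteq> south_pole"
  by (simp add: north_pole_def south_pole_def vec_eq_iff forall_3)

lemma inv_stereographic_0: "inv_stereographic 0 = south_pole"
  by (simp add: south_pole_def vec_eq_iff forall_3)

lemma inj_inv_stereographic: "inj inv_stereographic"
  by (metis injI stereographic_inv)

section \<open>Topology and charts of the punctured sphere\<close>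

lemma second_countable_euclidean:
  "second_countable (euclidean :: 'a::second_countable_topology topology)"
proof -
  obtain \<B> :: "'a set set" where \<B>: "countable \<B>" "topological_basis \<B>"
    using ex_countable_basis by blast
  show ?thesis
    unfolding second_countable_def
  proof (intro exI[of _ \<B>] conjI allI impI ballI)
    show "openin euclidean V" if "V \<in> \<B>" for V
      using that topological_basis_open[OF \<B>(2)] by simp
    fix U and x :: 'a assume "openin euclidean U \<and> x \<in> U"
    then obtain V where "V \<in> \<B>" "x \<in> V" "V \<subseteq> U"
      using topological_basisE[OF \<B>(2)] by (metis open_openin)
    then show "\<exists>V\<in>\<B>. x \<in> V \<and> V \<subseteq> U" by blast
  qed (rule \<B>(1))
qed

text \<open>Invariance under \<open>1 / z\<close> lets the half turn map the punctured sphere to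
  itself, and with 0 outside \<open>Z\<close> both poles are points of the surface. Both charts then
  have the same range \<open>- Z\<close>.\<close>

locale punctured_sphere =
  fixes Z :: "complex set"
  assumes finite_Z: "finite Z" and zero_notin_Z: "0 \<notin> Z" and inverse_Z: "z \<in> Z \<Longrightarrow> 1 / z \<in> Z"
begin

definition C :: "(real^3) set" where
  "C = sphere 0 1 - inv_stereographic ` Z"

definition base_surf :: "(real^3) surface" where
  "base_surf = \<lparr>topo = top_of_set C,
     charts = {(C - {north_pole}, stereographic), (C - {south_pole}, stereographic \<circ> half_turn)}\<rparr>"

lemma charts_surf:
  "charts base_surf = {(C - {north_pole}, stereographic), (C - {south_pole}, stereographic \<circ> half_turn)}"
  by (simp add: base_surf_def)

lemma open_compl_Z: "open (- Z)"
  by (simp add: finite_Z finite_imp_closed open_Compl)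

lemma inv_stereographic_C: "inv_stereographic z \<in> C \<longleftrightarrow> z \<notin> Z"
  using inv_stereographic_sphere inj_inv_stereographic by (auto simp: C_def inj_image_mem_iff)

lemma half_turn_C [simp]: "half_turn p \<in> C \<longleftrightarrow> p \<in> C"
proof -
  have *: "half_turn p \<in> inv_stereographic ` Z" if p: "p \<in> inv_stereographic ` Z" for p
  proof -
    obtain z where z: "z \<in> Z" "p = inv_stereographic z" using p by auto
    then have "half_turn p = inv_stereographic (1 / z)"
      using zero_notin_Z half_turn_inv_stereographic by metis
    then show ?thesis using inverse_Z[OF z(1)] by auto
  qed
  have "half_turn p \<in> inv_stereographic ` Z \<longleftrightarrow> p \<in> inv_stereographic ` Z"
    using *[of p] *[of "half_turn p"] by auto
  then show ?thesis
    using half_turn_sphere[of p] unfolding C_def by blast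
qed

lemma poles_C: "north_pole \<in> C" "south_pole \<in> C"
proof -
  show "south_pole \<in> C"
    unfolding inv_stereographic_0[symmetric] inv_stereographic_C by (rule zero_notin_Z)
  then show "north_pole \<in> C"
    using half_turn_C[of north_pole] by simp
qed

lemma C_cases:
  assumes "p \<in> C"
  obtains "p = north_pole" | z where "z \<notin> Z" "p = inv_stereographic z"
  using assms inv_stereographic_stereographic[of p] inv_stereographic_C by (metis C_def DiffD1)

lemma C_nth3: "p \<in> C - {north_pole} \<Longrightarrow> p $ 3 \<noteq> 1"
  using sphere_nth3_eq_1 by (auto simp: C_def)

lemma stereographic_C: "p \<in> C - {north_pole} \<Longrightarrow> stereographic p \<notin> Z \<and> inv_stereographic (stereographic p) = p"
  using inv_stereographic_stereographic[of p] inv_stereographic_C[of "stereographic p"]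
  unfolding C_def by (metis DiffD1 DiffD2 singletonI)

lemma inv_stereographic_image: "inv_stereographic ` (- Z) = C - {north_pole}"
  using inv_stereographic_C inv_stereographic_neq_north
  by (auto elim: C_cases)

lemma stereographic_image: "stereographic ` (C - {north_pole}) = - Z"
  unfolding inv_stereographic_image[symmetric] image_image by simp

lemma half_turn_image: "half_turn ` (C - {south_pole}) = C - {north_pole}"
  unfolding half_turn_image_eq by (auto simp: half_turn_eq_iff)

lemma chart_range_base_surf:
  assumes "c \<in> charts base_surf"
  shows "chart_range c = - Z"
proof -
  have "(stereographic \<circ> half_turn) ` (C - {south_pole}) = - Z"
    unfolding image_comp[symmetric] half_turn_image stereographic_image ..
  then show ?thesis
    using assms stereographic_image by (auto simp: charts_surf chart_range_def)
qed

lemma chart_inv_base_surf: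
  assumes "z \<notin> Z"
  shows "chart_inv (C - {north_pole}, stereographic) z = inv_stereographic z"
    and "chart_inv (C - {south_pole}, stereographic \<circ> half_turn) z = half_turn (inv_stereographic z)"
proof -
  have inj: "inj_on stereographic (C - {north_pole})"
    by (rule inj_on_inverseI[of _ inv_stereographic]) (use stereographic_C in blast)
  have inj2: "inj_on (stereographic \<circ> half_turn) (C - {south_pole})"
    by (rule comp_inj_on) (use inj in \<open>simp_all only: half_turn_image\<close>, metis half_turn_half_turn injI inj_on_subset subset_UNIV)
  have "inv_stereographic z \<in> C - {north_pole}"
    using assms inv_stereographic_C by simp
  moreover from this have "half_turn (inv_stereographic z) \<in> C - {south_pole}"
    by (auto simp: half_turn_eq_iff)
  ultimately show "chart_inv (C - {north_pole}, stereographic) z = inv_stereographic z"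
    "chart_inv (C - {south_pole}, stereographic \<circ> half_turn) z = half_turn (inv_stereographic z)"
    using inv_into_f_f[OF inj] inv_into_f_f[OF inj2]
    unfolding chart_inv_def fst_conv snd_conv by (metis stereographic_inv comp_apply half_turn_half_turn)+
qed

lemma connected_north: "connected (C - {north_pole})"
proof -
  have "connected (- Z)"
    by (rule connected_open_diff_countable[of UNIV Z, unfolded Compl_eq_Diff_UNIV[symmetric]])
      (use finite_Z in \<open>auto simp: countable_finite\<close>)
  then have "connected (inv_stereographic ` (- Z))"
    by (rule connected_continuous_image[rotated]) (intro continuous_intros)
  then show ?thesis
    unfolding inv_stereographic_image .
qed

lemma connected_C: "connected C"
proof -
  have "connected (half_turn ` (C - {north_pole}))"
    by (rule connected_continuous_image[OF _ connected_north]) (intro continuous_intros)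
  moreover have "half_turn ` (C - {north_pole}) = C - {south_pole}"
    unfolding half_turn_image[symmetric] image_image by simp
  ultimately have "connected (C - {south_pole})" by simp
  moreover have "(C - {north_pole}) \<inter> (C - {south_pole}) \<noteq> {}"
  proof -
    have "infinite (UNIV :: complex set)" by (rule infinite_UNIV_char_0)
    then obtain z where "z \<notin> insert 0 Z"
      using finite_Z ex_new_if_finite by (metis finite_insert)
    then have "inv_stereographic z \<in> (C - {north_pole}) \<inter> (C - {south_pole})"
      using inv_stereographic_C inj_inv_stereographic unfolding inv_stereographic_0[symmetric] by (auto dest: injD)
    then show ?thesis by blast
  qed
  ultimately have "connected ((C - {north_pole}) \<union> (C - {south_pole}))"
    using connected_north by (intro connected_Un)
  moreover have "(C - {north_pole}) \<union> (C - {south_pole}) = C"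
    using poles_distinct by blast
  ultimately show ?thesis by simp
qed

lemma charts_distinct:
  "(C - {north_pole}, stereographic) \<noteq> (C - {south_pole}, stereographic \<circ> half_turn)"
  using poles_C poles_distinct by blast

lemma homeomorphic_chart:
  assumes "c \<in> charts base_surf"
  shows "homeomorphic_map (top_of_set (fst c)) (top_of_set (chart_range c)) (snd c)"
proof -
  consider "c = (C - {north_pole}, stereographic)" | "c = (C - {south_pole}, stereographic \<circ> half_turn)"
    using assms by (auto simp: charts_surf)
  then have "homeomorphic_maps (top_of_set (fst c)) (top_of_set (- Z)) (snd c)
    (if c = (C - {north_pole}, stereographic) then inv_stereographic else half_turn \<circ> inv_stereographic)"
  proof cases
    case 1
    have "continuous_on (C - {north_pole}) stereographic"
      using C_nth3 by (intro continuous_intros) auto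
    moreover have "continuous_on (- Z) inv_stereographic"
      by (intro continuous_intros)
    ultimately show ?thesis
      unfolding homeomorphic_maps_def 1 using stereographic_C inv_stereographic_C by auto
  next
    case 2
    have ne: "c \<noteq> (C - {north_pole}, stereographic)"
      using charts_distinct unfolding 2 by metis
    have "half_turn x $ 3 \<noteq> 1" if "x \<in> C - {south_pole}" for x
      using C_nth3[of "half_turn x"] half_turn_image that by blast
    then have "continuous_on (C - {south_pole}) (\<lambda>x. stereographic (half_turn x))"
      by (intro continuous_intros) auto
    moreover have "continuous_on (- Z) (\<lambda>x. half_turn (inv_stereographic x))"
      by (intro continuous_intros)
    moreover have "stereographic (half_turn x) \<notin> Z \<and> half_turn (inv_stereographic (stereographic (half_turn x))) = x"
      if "x \<in> C - {south_pole}" for x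
      using stereographic_C[of "half_turn x"] half_turn_image that by force
    moreover have "half_turn (inv_stereographic x) \<in> C - {south_pole}" if "x \<in> - Z" for x
      using that inv_stereographic_C by (auto simp: half_turn_eq_iff)
    ultimately show ?thesis
      unfolding homeomorphic_maps_def if_not_P[OF ne] unfolding 2 by (auto simp: comp_def)
  qed
  then show ?thesis
    unfolding chart_range_base_surf[OF assms] homeomorphic_map_maps by blast
qed

lemma chart_cases [case_names north south]:
  assumes "c \<in> charts base_surf"
  obtains "c = (C - {north_pole}, stereographic)" | "c = (C - {south_pole}, stereographic \<circ> half_turn)"
  using assms by (auto simp: charts_surf)

lemma overlap_charts:
  "stereographic ` ((C - {north_pole}) \<inter> (C - {south_pole})) = - Z - {0}"
  "(stereographic \<circ> half_turn) ` ((C - {south_pole}) \<inter> (C - {north_pole})) = - Z - {0}"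
proof -
  have "(C - {north_pole}) \<inter> (C - {south_pole}) = inv_stereographic ` (- Z - {0})"
    unfolding image_set_diff[OF inj_inv_stereographic] inv_stereographic_image
    unfolding image_insert image_empty inv_stereographic_0 by blast
  then show *: "stereographic ` ((C - {north_pole}) \<inter> (C - {south_pole})) = - Z - {0}"
    by (simp add: image_image)
  have "half_turn ` ((C - {south_pole}) \<inter> (C - {north_pole})) = (C - {north_pole}) \<inter> (C - {south_pole})"
    (is "half_turn ` ?A = ?B")
    unfolding half_turn_image_eq by (auto simp: half_turn_eq_iff)
  then show "(stereographic \<circ> half_turn) ` ((C - {south_pole}) \<inter> (C - {north_pole})) = - Z - {0}"
    unfolding image_comp[symmetric] using * by simp
qed

text \<open>Between different charts the transition is \<open>z \<mapsto> 1 / z\<close>, by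
  \<open>half_turn_inv_stereographic\<close>. Being holomorphic with nonzero derivative, it gives
  smoothness and a positive Jacobian at once.\<close>

lemma chart_transition:
  assumes c: "c \<in> charts base_surf" and c': "c' \<in> charts base_surf"
  obtains f f' where "open (snd c ` (fst c \<inter> fst c'))" "f holomorphic_on snd c ` (fst c \<inter> fst c')"
    "\<And>z. z \<in> snd c ` (fst c \<inter> fst c') \<Longrightarrow> snd c' (chart_inv c z) = f z"
    "\<And>z. z \<in> snd c ` (fst c \<inter> fst c') \<Longrightarrow> (f has_field_derivative f' z) (at z) \<and> f' z \<noteq> 0"
proof -
  define S where "S = snd c ` (fst c \<inter> fst c')"
  define f where "f = (if c = c' then (\<lambda>z. z) else (\<lambda>z::complex. 1 / z))"
  have S: "S = (if c = c' then - Z else - Z - {0})"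
  proof (cases "c = c'")
    case True
    then show ?thesis
      using chart_range_base_surf[OF c] by (simp add: S_def chart_range_def)
  next
    case False
    have "S = - Z - {0}"
      using c
    proof (cases rule: chart_cases)
      case north
      then have "c' = (C - {south_pole}, stereographic \<circ> half_turn)"
        using c' False by (elim chart_cases) simp_all
      then show ?thesis unfolding S_def north using overlap_charts(1) by simp
    next
      case south
      then have "c' = (C - {north_pole}, stereographic)"
        using c' False by (elim chart_cases) simp_all
      then show ?thesis unfolding S_def south using overlap_charts(2) by simp
    qed
    then show ?thesis using False by simp
  qed
  have "open S"
    unfolding S using open_compl_Z by auto
  have f: "(snd c' \<circ> chart_inv c) z = f z" if "z \<in> S" for z
  proof -
    have z: "z \<notin> Z" "c \<noteq> c' \<Longrightarrow> z \<noteq> 0" using that S by (auto split: if_splits)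
    have inv1: "snd c (chart_inv c z) = z"
      using c chart_inv_base_surf[OF z(1)] by (elim chart_cases) simp_all
    show ?thesis
    proof (cases "c = c'")
      case True
      then show ?thesis using inv1 by (simp add: f_def)
    next
      case False
      have ht: "half_turn (inv_stereographic z) = inv_stereographic (1 / z)"
        by (rule half_turn_inv_stereographic[OF z(2)[OF False]])
      have "snd c' (chart_inv c z) = 1 / z"
        using c
      proof (cases rule: chart_cases)
        case north
        then have "c' = (C - {south_pole}, stereographic \<circ> half_turn)"
          using c' False by (elim chart_cases) simp_all
        then show ?thesis unfolding north chart_inv_base_surf[OF z(1)] by (simp add: ht)
      next
        case south
        then have "c' = (C - {north_pole}, stereographic)"
          using c' False by (elim chart_cases) simp_all
        then show ?thesis unfolding south chart_inv_base_surf[OF z(1)] by (simp add: ht)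
      qed
      then show ?thesis using False by (simp add: f_def)
    qed
  qed
  have hol: "f holomorphic_on S"
    unfolding f_def S by (auto intro!: holomorphic_intros)
  have df: "(f has_field_derivative (if c = c' then 1 else - (1 / z\<^sup>2))) (at z) \<and>
      (if c = c' then 1 else - (1 / z\<^sup>2)) \<noteq> 0" if "z \<in> S" for z
    unfolding f_def using that S
    by (auto intro!: derivative_eq_intros simp: power2_eq_square split: if_splits)
  show ?thesis
    using that[of f "\<lambda>z. if c = c' then 1 else - (1 / z\<^sup>2)"] \<open>open S\<close> hol f df
    unfolding S_def comp_apply by blast
qed

end

text \<open>The points of the surface are all vectors of \<real>^3, read as points of the sphere
  through \<open>emb\<close>; charts and topology are transported along this bijection.\<close>

locale parametrized_sphere = punctured_sphere +
  fixes emb :: "real^3 \<Rightarrow> real^3"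
  assumes bij_emb: "bij_betw emb UNIV C"
begin

definition pt :: "real^3 \<Rightarrow> real^3" where
  "pt = inv_into UNIV emb"

definition T :: "(real^3) topology" where
  "T = pullback_topology UNIV emb euclidean"

definition lift_chart :: "(real^3) chart \<Rightarrow> (real^3) chart" where
  "lift_chart c = (pt ` fst c, snd c \<circ> emb)"

definition surf :: "(real^3) surface" where
  "surf = \<lparr>topo = T, charts = lift_chart ` charts base_surf\<rparr>"

lemma emb_C: "emb x \<in> C"
  using bij_emb by (auto simp: bij_betw_def)

lemma pt_emb [simp]: "pt (emb x) = x"
  using bij_emb by (simp add: pt_def bij_betw_def)

lemma emb_pt [simp]: "p \<in> C \<Longrightarrow> emb (pt p) = p"
  using bij_emb by (simp add: pt_def bij_betw_def f_inv_into_f)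

lemma pt_eq_iff: "p \<in> C \<Longrightarrow> pt p = x \<longleftrightarrow> p = emb x"
  by auto

lemma openin_T: "openin T S \<longleftrightarrow> openin (top_of_set C) (emb ` S)"
proof
  assume "openin T S"
  then obtain U where U: "open U" "S = emb -` U"
    by (auto simp: T_def openin_pullback_topology)
  then have "emb ` S = C \<inter> U"
    using bij_emb by (force simp: bij_betw_def)
  then show "openin (top_of_set C) (emb ` S)"
    using U(1) by (simp add: openin_open_Int)
next
  assume "openin (top_of_set C) (emb ` S)"
  then obtain U where U: "open U" "emb ` S = C \<inter> U"
    by (auto simp: openin_open)
  have "S = emb -` U"
  proof -
    have "x \<in> S \<longleftrightarrow> emb x \<in> emb ` S" for x
      using pt_emb by (metis image_iff)
    then show ?thesis unfolding U(2) using emb_C by auto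
  qed
  then show "openin T S"
    using U(1) by (auto simp: T_def openin_pullback_topology)
qed

lemma topspace_T [simp]: "topspace T = UNIV"
  by (simp add: T_def topspace_pullback_topology)

lemma topo_surf [simp]: "topo surf = T"
  by (simp add: surf_def)

lemma charts_lift: "charts surf = lift_chart ` charts base_surf"
  by (simp add: surf_def)

lemma emb_pt_image: "A \<subseteq> C \<Longrightarrow> emb ` pt ` A = A"
  by (force simp: image_image subset_iff)

lemma continuous_map_emb: "continuous_map T (top_of_set C) emb"
  unfolding continuous_map_def
proof (intro conjI allI impI)
  fix U assume U: "openin (top_of_set C) U"
  then have "emb ` {x \<in> topspace T. emb x \<in> U} = U"
    using emb_pt_image[of U] openin_imp_subset[OF U] by (force simp: subset_iff image_iff intro: exI[of _ "pt _"])
  then show "openin T {x \<in> topspace T. emb x \<in> U}"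
    using U by (simp add: openin_T)
qed (use emb_C in auto)

lemma continuous_map_pt: "continuous_map (top_of_set C) T pt"
  unfolding continuous_map_def
proof (intro conjI allI impI)
  fix U assume U: "openin T U"
  have "{x \<in> topspace (top_of_set C). pt x \<in> U} = emb ` U"
    using emb_C by (force simp: image_iff)
  then show "openin (top_of_set C) {x \<in> topspace (top_of_set C). pt x \<in> U}"
    using U by (simp add: openin_T)
qed auto

lemma homeomorphic_maps_emb: "homeomorphic_maps T (top_of_set C) emb pt"
  by (simp add: homeomorphic_maps_def continuous_map_emb continuous_map_pt)

lemma T_homeomorphic: "T homeomorphic_space top_of_set C"
  using homeomorphic_maps_emb homeomorphic_maps_imp_homeomorphic_space by blast

lemma Hausdorff_T: "Hausdorff_space T"
  using homeomorphic_Hausdorff_space[OF T_homeomorphic] by (simp add: Hausdorff_space_subtopology)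

lemma openin_T_pt: "openin (top_of_set C) A \<Longrightarrow> openin T (pt ` A)"
  unfolding openin_T by (subst emb_pt_image) (auto dest: openin_imp_subset)

lemma compactin_T: "compactin T K \<longleftrightarrow> compact (emb ` K)"
proof
  assume "compactin T K"
  then show "compact (emb ` K)"
    using image_compactin[OF _ continuous_map_emb] by (simp add: compactin_subtopology)
next
  assume "compact (emb ` K)"
  then have "compactin (top_of_set C) (emb ` K)"
    using emb_C by (auto simp: compactin_subtopology)
  then have "compactin T (pt ` emb ` K)"
    by (rule image_compactin[OF _ continuous_map_pt])
  then show "compactin T K" by (simp add: image_image)
qed

lemma connectedin_T: "connectedin T S \<longleftrightarrow> connected (emb ` S)"
proof
  assume "connectedin T S"
  then show "connected (emb ` S)"
    using connectedin_continuous_map_image[OF continuous_map_emb] by (simp add: connectedin_subtopology)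
next
  assume "connected (emb ` S)"
  then have "connectedin (top_of_set C) (emb ` S)"
    using emb_C by (auto simp: connectedin_subtopology)
  then have "connectedin T (pt ` emb ` S)"
    by (rule connectedin_continuous_map_image[OF continuous_map_pt])
  then show "connectedin T S" by (simp add: image_image)
qed

lemma fst_chart_subset: "c \<in> charts base_surf \<Longrightarrow> fst c \<subseteq> C"
  by (auto simp: charts_surf)

lemma chart_range_lift:
  assumes "c \<in> charts surf"
  shows "chart_range c = - Z"
proof -
  obtain c0 where c0: "c0 \<in> charts base_surf" "c = lift_chart c0"
    using assms by (auto simp: charts_lift)
  have "chart_range c = snd c0 ` fst c0"
    unfolding c0 chart_range_def lift_chart_def fst_conv snd_conv image_comp[symmetric]
      emb_pt_image[OF fst_chart_subset[OF c0(1)]] ..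
  then show ?thesis
    using chart_range_base_surf[OF c0(1)] by (simp add: chart_range_def)
qed

lemma base_chart_inv:
  assumes c: "c \<in> charts base_surf"
  shows "p \<in> fst c \<Longrightarrow> chart_inv c (snd c p) = p \<and> snd c p \<notin> Z"
    and "z \<notin> Z \<Longrightarrow> snd c (chart_inv c z) = z \<and> chart_inv c z \<in> fst c"
proof -
  have inj: "inj_on (snd c) (fst c)"
    using homeomorphic_imp_injective_map[OF homeomorphic_chart[OF c]] by simp
  have img: "snd c ` fst c = - Z"
    using chart_range_base_surf[OF c] by (simp add: chart_range_def)
  show "p \<in> fst c \<Longrightarrow> chart_inv c (snd c p) = p \<and> snd c p \<notin> Z"
    using img by (auto simp: chart_inv_def inv_into_f_f[OF inj])
  show "z \<notin> Z \<Longrightarrow> snd c (chart_inv c z) = z \<and> chart_inv c z \<in> fst c"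
    unfolding chart_inv_def using img f_inv_into_f inv_into_into by (metis ComplI)
qed

lemma chart_inv_lift:
  assumes c: "c \<in> charts base_surf" and z: "z \<notin> Z"
  shows "chart_inv (lift_chart c) z = pt (chart_inv c z)"
proof -
  have "inj_on (snd c \<circ> emb) (pt ` fst c)"
  proof (rule comp_inj_on)
    show "inj_on emb (pt ` fst c)"
      using bij_emb by (meson bij_betw_def inj_on_subset subset_UNIV)
    show "inj_on (snd c) (emb ` pt ` fst c)"
      unfolding emb_pt_image[OF fst_chart_subset[OF c]]
      using homeomorphic_imp_injective_map[OF homeomorphic_chart[OF c]] by simp
  qed
  moreover have "chart_inv c z \<in> fst c" "chart_inv c z \<in> C" "snd c (chart_inv c z) = z"
    using base_chart_inv(2)[OF c z] fst_chart_subset[OF c] by auto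
  ultimately show ?thesis
    using inv_into_f_f[of "snd c \<circ> emb" "pt ` fst c" "pt (chart_inv c z)"]
    unfolding chart_inv_def lift_chart_def fst_conv snd_conv by simp
qed

lemma charts_topology:
  assumes "c \<in> charts surf"
  shows "openin T (fst c)" "snd c ` fst c = - Z"
    and "\<And>p. p \<in> fst c \<Longrightarrow> chart_inv c (snd c p) = p"
    and "\<And>z. z \<notin> Z \<Longrightarrow> snd c (chart_inv c z) = z \<and> chart_inv c z \<in> fst c"
    and "continuous_map (subtopology T (fst c)) euclidean (snd c)"
    and "continuous_map (top_of_set (- Z)) T (chart_inv c)"
proof -
  obtain c0 where c0: "c0 \<in> charts base_surf" and c: "c = lift_chart c0"
    using assms by (auto simp: charts_lift)
  note hom = homeomorphic_chart[OF c0, unfolded chart_range_base_surf[OF c0]]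
  have "openin (top_of_set C) (fst c0)"
    using c0 by (auto simp: charts_surf Diff_eq intro!: openin_open_Int)
  then show "openin T (fst c)"
    unfolding c lift_chart_def by (simp add: openin_T_pt)
  show img: "snd c ` fst c = - Z"
    using chart_range_lift[OF assms] by (simp add: chart_range_def)
  show inv2: "\<And>z. z \<notin> Z \<Longrightarrow> snd c (chart_inv c z) = z \<and> chart_inv c z \<in> fst c"
  proof -
    fix z assume z: "z \<notin> Z"
    then show "snd c (chart_inv c z) = z \<and> chart_inv c z \<in> fst c"
      using base_chart_inv(2)[OF c0 z] fst_chart_subset[OF c0] unfolding c chart_inv_lift[OF c0 z]
      by (auto simp: lift_chart_def subset_iff)
  qed
  show "\<And>p. p \<in> fst c \<Longrightarrow> chart_inv c (snd c p) = p"
  proof -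
    fix p assume "p \<in> fst c"
    then obtain q where q: "q \<in> fst c0" "q \<in> C" "p = pt q"
      using fst_chart_subset[OF c0] by (auto simp: c lift_chart_def)
    then show "chart_inv c (snd c p) = p"
      using base_chart_inv(1)[OF c0 q(1)] chart_inv_lift[OF c0, of "snd c0 q"] by (simp add: c lift_chart_def)
  qed
  have "continuous_map (subtopology T (fst c)) (top_of_set (fst c0)) emb"
    using continuous_map_from_subtopology[OF continuous_map_emb, of "fst c"] fst_chart_subset[OF c0]
    by (auto simp: continuous_map_in_subtopology c lift_chart_def)
  then show "continuous_map (subtopology T (fst c)) euclidean (snd c)"
    using continuous_map_compose[OF _ homeomorphic_imp_continuous_map[OF hom]]
    unfolding c lift_chart_def by (force simp: continuous_map_in_subtopology)
  have "continuous_on (- Z) (chart_inv c0)"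
    using c0
  proof (cases rule: chart_cases)
    case north
    have "continuous_on (- Z) inv_stereographic" by (intro continuous_intros)
    then show ?thesis
      unfolding north by (rule continuous_on_eq) (simp add: chart_inv_base_surf)
  next
    case south
    have "continuous_on (- Z) (\<lambda>z. half_turn (inv_stereographic z))" by (intro continuous_intros)
    then show ?thesis
      unfolding south by (rule continuous_on_eq) (simp add: chart_inv_base_surf)
  qed
  then have "continuous_map (top_of_set (- Z)) (top_of_set C) (chart_inv c0)"
    using base_chart_inv(2)[OF c0] fst_chart_subset[OF c0] by (auto simp: continuous_map_in_subtopology)
  then have "continuous_map (top_of_set (- Z)) T (pt \<circ> chart_inv c0)"
    using continuous_map_compose continuous_map_pt by blast
  then show "continuous_map (top_of_set (- Z)) T (chart_inv c)"
    by (rule continuous_map_eq) (simp add: c chart_inv_lift[OF c0])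
qed

lemma homeomorphic_lift_chart:
  assumes c: "c \<in> charts surf"
  shows "homeomorphic_map (subtopology T (fst c)) (top_of_set (- Z)) (snd c)"
proof -
  have "homeomorphic_maps (subtopology T (fst c)) (top_of_set (- Z)) (snd c) (chart_inv c)"
    unfolding homeomorphic_maps_def
    using charts_topology[OF c] by (auto simp: continuous_map_in_subtopology)
  then show ?thesis
    by (rule homeomorphic_maps_map[THEN iffD1, THEN conjunct1])
qed

lemma Union_charts: "(\<Union>c\<in>charts surf. fst c) = UNIV"
proof -
  have "x \<in> (\<Union>c\<in>charts surf. fst c)" for x
  proof -
    have "emb x \<in> C - {north_pole} \<or> emb x \<in> C - {south_pole}"
      using emb_C[of x] poles_distinct by (metis DiffI singletonD)
    then obtain c where "c \<in> charts base_surf" "emb x \<in> fst c"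
      unfolding charts_surf by force
    then show ?thesis
      unfolding charts_lift lift_chart_def by (auto intro!: bexI[of _ c] image_eqI[of x pt "emb x"])
  qed
  then show ?thesis by blast
qed

lemma oriented_surface_surf: "oriented_surface surf"
  unfolding oriented_surface_def topo_surf
proof (intro conjI ballI)
  show "topspace T \<noteq> {}" by simp
  show "connected_space T"
    using homeomorphic_connected_space[OF T_homeomorphic] connected_C
    by (simp add: connected_space_subtopology connectedin_iff_connected)
  show "Hausdorff_space T" by (rule Hausdorff_T)
  show "second_countable T"
    using homeomorphic_space_second_countability[OF T_homeomorphic]
    by (simp add: second_countable_subtopology second_countable_euclidean)
  show "(\<Union>c\<in>charts surf. fst c) = topspace T" by (simp add: Union_charts)
  fix c assume c: "c \<in> charts surf"
  show "openin T (fst c)" by (rule charts_topology[OF c])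
  show "open (chart_range c)" by (simp add: chart_range_lift[OF c] open_compl_Z)
  show "homeomorphic_map (subtopology T (fst c)) (top_of_set (chart_range c)) (snd c)"
    unfolding chart_range_lift[OF c] by (rule homeomorphic_lift_chart[OF c])
  fix c' assume c': "c' \<in> charts surf"
  obtain c0 c0' where c0: "c0 \<in> charts base_surf" "c = lift_chart c0"
    and c0': "c0' \<in> charts base_surf" "c' = lift_chart c0'"
    using c c' by (auto simp: charts_lift)
  define S where "S = snd c0 ` (fst c0 \<inter> fst c0')"
  have "pt ` fst c0 \<inter> pt ` fst c0' = pt ` (fst c0 \<inter> fst c0')"
    using fst_chart_subset[OF c0(1)] fst_chart_subset[OF c0'(1)] by (auto simp: pt_eq_iff subset_iff image_iff)
  then have S: "snd c ` (fst c \<inter> fst c') = S"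
    using emb_pt_image[of "fst c0 \<inter> fst c0'"] fst_chart_subset[OF c0(1)]
    unfolding c0(2) c0'(2) lift_chart_def S_def fst_conv snd_conv image_comp[symmetric] by (metis le_infI1)
  obtain f f' where f: "open S" "f holomorphic_on S"
    "\<And>z. z \<in> S \<Longrightarrow> snd c0' (chart_inv c0 z) = f z"
    "\<And>z. z \<in> S \<Longrightarrow> (f has_field_derivative f' z) (at z) \<and> f' z \<noteq> 0"
    using chart_transition[OF c0(1) c0'(1)] unfolding S_def by metis
  have eq: "(snd c' \<circ> chart_inv c) z = f z" if z: "z \<in> S" for z
  proof -
    have "z \<notin> Z" using z base_chart_inv(1)[OF c0(1)] by (auto simp: S_def)
    then have "chart_inv c0 z \<in> C"
      using base_chart_inv(2)[OF c0(1)] fst_chart_subset[OF c0(1)] by blast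
    then show ?thesis
      using f(3)[OF z] chart_inv_lift[OF c0(1) \<open>z \<notin> Z\<close>] by (simp add: c0 c0' lift_chart_def)
  qed
  have hol: "(snd c' \<circ> chart_inv c) holomorphic_on S"
    using holomorphic_transform[OF f(2)] eq by simp
  show "smooth_on (snd c ` (fst c \<inter> fst c')) (snd c' \<circ> chart_inv c)"
    unfolding smooth_on_def S using Ck_on_holomorphic[OF f(1) hol] by blast
  fix z assume "z \<in> snd c ` (fst c \<inter> fst c')"
  then have z: "z \<in> S" by (simp add: S)
  have "((snd c' \<circ> chart_inv c) has_field_derivative f' z) (at z)"
    by (rule has_field_derivative_transform_within_open[OF _ f(1) z]) (use f(4)[OF z] eq in auto)
  then have "jacobian (snd c' \<circ> chart_inv c) z = (cmod (f' z))\<^sup>2"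
    by (rule jacobian_holomorphic)
  then show "jacobian (snd c' \<circ> chart_inv c) z > 0"
    using f(4)[OF z] by simp
qed

lemma genus_zero_surf: "genus_zero surf"
  unfolding genus_zero_def
  using finite_Z inv_stereographic_sphere T_homeomorphic
  by (intro exI[of _ "inv_stereographic ` Z"]) (auto simp: C_def[symmetric])

lemma openin_chart_image:
  assumes c: "c \<in> charts surf" and A: "open A" "A \<subseteq> - Z"
  shows "openin T (chart_inv c ` A)"
proof -
  have "chart_inv c ` A = {p \<in> topspace (subtopology T (fst c)). snd c p \<in> A}"
    using charts_topology(3,4)[OF c] A(2) by (force simp: image_iff)
  then have "openin (subtopology T (fst c)) (chart_inv c ` A)"
    using openin_continuous_map_preimage[OF charts_topology(5)[OF c], of A] A(1) by simp
  then show ?thesis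
    using charts_topology(1)[OF c] openin_trans_full by blast
qed

lemma chart_at:
  obtains c z where "c \<in> charts surf" "z \<notin> Z" "chart_inv c z = p"
proof -
  obtain c where c: "c \<in> charts surf" "p \<in> fst c"
    using Union_charts by (metis UN_E UNIV_I)
  then show ?thesis
    using that[OF c(1), of "snd c p"] charts_topology(2,3)[OF c(1)] by auto
qed

end

section \<open>Lengths of paths\<close>

definition speed :: "(real \<Rightarrow> 'a::real_normed_vector) \<Rightarrow> real \<Rightarrow> real" where
  "speed f t = norm (vector_derivative f (at t))"

lemma path_length_speed: "path_length X \<gamma> = integral {0..1} (speed (X \<circ> \<gamma>))"
  by (simp add: path_length_def speed_def[abs_def])

lemma admissible_path_speed:
  "admissible_path M X \<gamma> \<longleftrightarrow> pathin (topo M) \<gamma> \<and> (X \<circ> \<gamma>) piecewise_C1_differentiable_on {0..1} \<and>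
     speed (X \<circ> \<gamma>) integrable_on {0..1}"
  by (simp add: admissible_path_def speed_def[abs_def])

lemma speed_affine:
  assumes "f differentiable at (m * x + c)"
  shows "speed (\<lambda>x. f (m * x + c)) x = \<bar>m\<bar> * speed f (m * x + c)"
proof -
  have "(f has_vector_derivative vector_derivative f (at (m * x + c))) (at (m * x + c))"
    using assms vector_derivative_works by blast
  moreover have "((\<lambda>x. m * x + c) has_vector_derivative m) (at x)"
    by (auto intro!: derivative_eq_intros)
  ultimately have "((\<lambda>x. f (m * x + c)) has_vector_derivative m *\<^sub>R vector_derivative f (at (m * x + c))) (at x)"
    using vector_diff_chain_at[of "\<lambda>x. m * x + c" m x f] by (simp add: comp_def)
  then show ?thesis
    unfolding speed_def by (simp add: vector_derivative_at)
qed

lemma speed_cong_open: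
  assumes "open S" "x \<in> S" "\<And>y. y \<in> S \<Longrightarrow> f y = g y"
  shows "speed f x = speed g x"
proof -
  have "(f has_vector_derivative D) (at x) \<longleftrightarrow> (g has_vector_derivative D) (at x)" for D
    using has_vector_derivative_transform_within_open[OF _ assms(1,2)] assms(3) by metis
  then show ?thesis
    by (simp add: speed_def vector_derivative_def)
qed

lemma piecewise_C1_differentiable:
  assumes "f piecewise_C1_differentiable_on {a..b}"
  obtains S where "finite S" "\<And>x. x \<in> {a..b} - S \<Longrightarrow> f differentiable at x"
  using assms unfolding piecewise_C1_differentiable_on_def C1_differentiable_on_eq by blast

text \<open>Substitution in the length integral; \<open>m\<close> may be negative, which covers
  reversed paths. The points where the curve is not differentiable form a finite set and are
  discarded as a spike.\<close>

lemma has_integral_speed_affine: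
  fixes f :: "real \<Rightarrow> 'a::real_normed_vector"
  assumes pw: "f piecewise_C1_differentiable_on {0..1}" and int: "(speed f has_integral I) {0..1}"
    and m: "m \<noteq> 0"
  shows "(speed (\<lambda>x. f (m * x + c)) has_integral I) ((\<lambda>x. (x - c) / m) ` {0..1})"
proof -
  obtain S where S: "finite S" "\<And>x. x \<in> {0..1} - S \<Longrightarrow> f differentiable at x"
    using piecewise_C1_differentiable[OF pw] by blast
  have img: "(\<lambda>x. (1 / m) *\<^sub>R x + -((1 / m) *\<^sub>R c)) = (\<lambda>x. (x - c) / m)"
    using m by (auto simp: field_simps)
  have "((\<lambda>x. speed f (m *\<^sub>R x + c)) has_integral (1 / \<bar>m\<bar> ^ DIM(real)) *\<^sub>R I) ((\<lambda>x. (x - c) / m) ` cbox 0 1)"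
    using has_integral_affinity[OF int[folded cbox_interval] m, of c] unfolding img .
  then have "((\<lambda>x. \<bar>m\<bar> * speed f (m * x + c)) has_integral \<bar>m\<bar> * ((1 / \<bar>m\<bar>) * I)) ((\<lambda>x. (x - c) / m) ` {0..1})"
    by (intro has_integral_mult_right) simp
  then have *: "((\<lambda>x. \<bar>m\<bar> * speed f (m * x + c)) has_integral I) ((\<lambda>x. (x - c) / m) ` {0..1})"
    using m by simp
  show ?thesis
  proof (rule has_integral_spike_finite[OF _ _ *])
    show "finite ((\<lambda>x. (x - c) / m) ` S)" using S by simp
    fix x assume x: "x \<in> (\<lambda>x. (x - c) / m) ` {0..1} - (\<lambda>x. (x - c) / m) ` S"
    then obtain y where "y \<in> {0..1} - S" "x = (y - c) / m" by blast
    then show "speed (\<lambda>x. f (m * x + c)) x = \<bar>m\<bar> * speed f (m * x + c)"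
      using m S(2)[of y] by (intro speed_affine) simp
  qed
qed

lemma admissible_path_reverse:
  assumes "admissible_path M X \<gamma>"
  shows "admissible_path M X (\<lambda>t. \<gamma> (1 - t))" "path_length X (\<lambda>t. \<gamma> (1 - t)) = path_length X \<gamma>"
proof -
  let ?f = "X \<circ> \<gamma>"
  have pw: "?f piecewise_C1_differentiable_on {0..1}" and p: "pathin (topo M) \<gamma>"
    and int: "speed ?f integrable_on {0..1}"
    using assms by (auto simp: admissible_path_speed)
  have img: "(\<lambda>x. (x - 1) / (- 1)) ` {0..1} = {0..1::real}"
    by (force simp: image_iff intro: bexI[of _ "1 - _"])
  have eq: "X \<circ> (\<lambda>t. \<gamma> (1 - t)) = (\<lambda>x. ?f ((- 1) * x + 1))"
    by (simp add: comp_def)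
  have int': "(speed (X \<circ> (\<lambda>t. \<gamma> (1 - t))) has_integral integral {0..1} (speed ?f)) {0..1}"
    using has_integral_speed_affine[OF pw integrable_integral[OF int], of "-1" 1] unfolding eq img by simp
  then show "path_length X (\<lambda>t. \<gamma> (1 - t)) = path_length X \<gamma>"
    by (simp add: path_length_speed integral_unique)
  have c: "continuous_map (top_of_set {0..1}) (top_of_set {0..1}) (\<lambda>t::real. 1 - t)"
    by (auto intro!: continuous_intros)
  have "pathin (topo M) (\<lambda>t. \<gamma> (1 - t))"
    using continuous_map_compose[OF c p[unfolded pathin_def]] by (simp add: pathin_def comp_def)
  moreover have "(X \<circ> (\<lambda>t. \<gamma> (1 - t))) piecewise_C1_differentiable_on {0..1}"
    using valid_path_imp_reverse[of ?f] pw unfolding valid_path_def reversepath_def by (simp add: comp_def)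
  ultimately show "admissible_path M X (\<lambda>t. \<gamma> (1 - t))"
    using int' unfolding admissible_path_speed by blast
qed

lemma admissible_path_join:
  assumes \<gamma>: "admissible_path M X \<gamma>" and \<delta>: "admissible_path M X \<delta>" and end_eq: "\<gamma> 1 = \<delta> 0"
  shows "admissible_path M X (\<gamma> +++ \<delta>)" "path_length X (\<gamma> +++ \<delta>) = path_length X \<gamma> + path_length X \<delta>"
proof -
  let ?f = "X \<circ> \<gamma>" and ?g = "X \<circ> \<delta>" and ?h = "X \<circ> (\<gamma> +++ \<delta>)"
  have pw: "?f piecewise_C1_differentiable_on {0..1}" "?g piecewise_C1_differentiable_on {0..1}"
    and int: "speed ?f integrable_on {0..1}" "speed ?g integrable_on {0..1}"
    using assms by (auto simp: admissible_path_speed)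
  have h: "?h = ?f +++ ?g"
    by (auto simp: joinpaths_def)
  have img: "(\<lambda>x. (x - 0) / 2) ` {0..1} = {0..1/2::real}" "(\<lambda>x. (x - (-1)) / 2) ` {0..1} = {1/2..1::real}"
    by (force simp: image_iff intro: bexI[of _ "2 * _"] bexI[of _ "2 * _ - 1"])+
  have "(speed ?h has_integral integral {0..1} (speed ?f)) {0..1/2}"
  proof (rule has_integral_spike_finite[of "{1/2}"])
    show "(speed (\<lambda>x. ?f (2 * x + 0)) has_integral integral {0..1} (speed ?f)) {0..1/2}"
      using has_integral_speed_affine[OF pw(1) integrable_integral[OF int(1)], of 2 0] unfolding img by simp
    \<comment> \<open>The junction 1/2 is left out because the joined path may have a corner
      there.\<close>
    fix x :: real assume "x \<in> {0..1/2} - {1/2}"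
    then show "speed ?h x = speed (\<lambda>x. ?f (2 * x + 0)) x"
      by (intro speed_cong_open[of "{..<1/2}"]) (auto simp: joinpaths_def)
  qed simp
  moreover have "(speed ?h has_integral integral {0..1} (speed ?g)) {1/2..1}"
  proof (rule has_integral_spike_finite[of "{1/2}"])
    show "(speed (\<lambda>x. ?g (2 * x + (-1))) has_integral integral {0..1} (speed ?g)) {1/2..1}"
      using has_integral_speed_affine[OF pw(2) integrable_integral[OF int(2)], of 2 "-1"] unfolding img by simp
    fix x :: real assume "x \<in> {1/2..1} - {1/2}"
    then show "speed ?h x = speed (\<lambda>x. ?g (2 * x + (-1))) x"
      by (intro speed_cong_open[of "{1/2<..}"]) (auto simp: joinpaths_def)
  qed simp
  ultimately have *: "(speed ?h has_integral integral {0..1} (speed ?f) + integral {0..1} (speed ?g)) {0..1}"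
    by (rule has_integral_combine[rotated 2]) auto
  then show "path_length X (\<gamma> +++ \<delta>) = path_length X \<gamma> + path_length X \<delta>"
    by (simp add: path_length_speed integral_unique)
  have "pathin (topo M) (\<gamma> +++ \<delta>)"
  proof -
    have p: "pathin (topo M) \<gamma>" "pathin (topo M) \<delta>"
      using assms by (auto simp: admissible_path_speed)
    have c1: "continuous_map (top_of_set {0..1/2}) (top_of_set {0..1}) (\<lambda>t::real. 2 * t)"
      and c2: "continuous_map (top_of_set {1/2..1}) (top_of_set {0..1}) (\<lambda>t::real. 2 * t - 1)"
      by (auto intro!: continuous_intros)
    have A: "continuous_map (subtopology (top_of_set {0..1}) {0..1/2}) (topo M) (\<lambda>t. \<gamma> (2 * t))"
      using continuous_map_compose[OF c1 p(1)[unfolded pathin_def]]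
      by (simp add: comp_def subtopology_subtopology Int_absorb1)
    have B: "continuous_map (subtopology (top_of_set {0..1}) {1/2..1}) (topo M) (\<lambda>t. \<delta> (2 * t - 1))"
      using continuous_map_compose[OF c2 p(2)[unfolded pathin_def]]
      by (simp add: comp_def subtopology_subtopology Int_absorb1)
    have "continuous_map (top_of_set {0..1}) (topo M) (\<lambda>t. if t \<le> 1/2 then \<gamma> (2 * t) else \<delta> (2 * t - 1))"
    proof (rule continuous_map_cases_le)
      show "continuous_map (top_of_set {0..1}) euclideanreal (\<lambda>t. t)" "continuous_map (top_of_set {0..1}) euclideanreal (\<lambda>t. 1/2)"
        by (auto simp: continuous_on_id)
      have "{x \<in> topspace (top_of_set {0..1}). x \<le> 1/2} = {0..1/2::real}" "{x \<in> topspace (top_of_set {0..1}). 1/2 \<le> x} = {1/2..1::real}"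
        by auto
      then show "continuous_map (subtopology (top_of_set {0..1}) {x \<in> topspace (top_of_set {0..1}). x \<le> 1/2}) (topo M) (\<lambda>t. \<gamma> (2 * t))"
        "continuous_map (subtopology (top_of_set {0..1}) {x \<in> topspace (top_of_set {0..1}). 1/2 \<le> x}) (topo M) (\<lambda>t. \<delta> (2 * t - 1))"
        using A B by simp_all
      show "\<gamma> (2 * t) = \<delta> (2 * t - 1)" if "t \<in> topspace (top_of_set {0..1})" "t = 1/2" for t
      proof -
        have "2 * t = 1" using that by simp
        then show ?thesis using end_eq by (simp only: diff_self)
      qed
    qed
    then show ?thesis
      by (simp add: pathin_def joinpaths_def[abs_def])
  qed
  moreover have "?h piecewise_C1_differentiable_on {0..1}"
    using valid_path_join[of ?f ?g] pw end_eq unfolding h valid_path_def by (simp add: pathfinish_def pathstart_def)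
  ultimately show "admissible_path M X (\<gamma> +++ \<delta>)"
    using * unfolding admissible_path_speed by blast
qed

text \<open>If the speed is not integrable, the integral takes its default value 0.\<close>

lemma path_length_nonneg: "path_length X \<gamma> \<ge> 0"
  unfolding path_length_speed
  by (cases "speed (X \<circ> \<gamma>) integrable_on {0..1}")
    (simp_all add: integral_nonneg not_integrable_integral speed_def)

text \<open>The fundamental theorem of calculus on an initial piece of the path. Intermediate times
  \<open>t\<close> are allowed because the proof that distances are positive stops a path where it
  meets a circle.\<close>

lemma dist_le_path_length:
  assumes "admissible_path M X \<gamma>" "t \<in> {0..1}"
  shows "dist (X (\<gamma> 0)) (X (\<gamma> t)) \<le> path_length X \<gamma>"
proof -
  let ?f = "X \<circ> \<gamma>"
  have pw: "?f piecewise_C1_differentiable_on {0..1}" and int: "speed ?f integrable_on {0..1}"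
    using assms by (auto simp: admissible_path_speed)
  obtain S where S: "finite S" "\<And>x. x \<in> {0..1} - S \<Longrightarrow> ?f differentiable at x"
    using piecewise_C1_differentiable[OF pw] by blast
  have sub: "{0..t} \<subseteq> {0..1}" using assms(2) by auto
  have 1: "((\<lambda>x. vector_derivative ?f (at x)) has_integral (?f t - ?f 0)) {0..t}"
  proof (rule fundamental_theorem_of_calculus_interior_strong[OF S(1)])
    show "continuous_on {0..t} ?f"
      using pw continuous_on_subset[OF _ sub] by (auto simp: piecewise_C1_differentiable_on_def)
    show "(?f has_vector_derivative vector_derivative ?f (at x)) (at x)" if "x \<in> {0<..<t} - S" for x
      using S(2)[of x] that assms(2) vector_derivative_works[THEN iffD1, of ?f "at x"] by simp
  qed (use assms(2) in simp)
  have int': "speed ?f integrable_on {0..t}"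
    using integrable_on_subinterval[OF int] sub by blast
  have "norm (?f t - ?f 0) = norm (integral {0..t} (\<lambda>x. vector_derivative ?f (at x)))"
    using 1 by (simp add: integral_unique)
  also have "\<dots> \<le> integral {0..t} (speed ?f)"
    using 1 int' by (intro integral_norm_bound_integral) (auto simp: speed_def has_integral_integrable)
  also have "\<dots> \<le> integral {0..1} (speed ?f)"
    using int int' sub by (intro integral_subset_le) (auto simp: speed_def)
  finally show ?thesis
    by (simp add: path_length_speed dist_norm norm_minus_commute)
qed

section \<open>Spinor surfaces\<close>

lemma cross_reV_mult:
  "cross3 (reV (c *s v)) (reV (\<i> *s (c *s v))) = ((cmod c)\<^sup>2) *\<^sub>R cross3 (reV v) (reV (\<i> *s v))"
proof -
  define P Q where "P = reV v" and "Q = reV (\<i> *s v)"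
  have "reV (c *s v) = Re c *\<^sub>R P + Im c *\<^sub>R Q" "reV (\<i> *s (c *s v)) = Re c *\<^sub>R Q - Im c *\<^sub>R P"
    unfolding P_def Q_def by (simp_all add: vec_eq_iff)
  moreover have "cross3 (Re c *\<^sub>R P + Im c *\<^sub>R Q) (Re c *\<^sub>R Q - Im c *\<^sub>R P) = ((Re c)\<^sup>2 + (Im c)\<^sup>2) *\<^sub>R cross3 P Q"
    by (simp add: vec_eq_iff forall_3 cross3_def power2_eq_square algebra_simps)
  ultimately show ?thesis
    unfolding P_def Q_def cmod_power2 by simp
qed

text \<open>A holomorphic change of coordinate multiplies the complex derivative by
  \<open>c\<close>. This rotates and scales the pair of partial derivatives, and their cross product
  is multiplied by \<open>(cmod c)\<^sup>2 > 0\<close>, so even its sign is kept.\<close>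

lemma unit_normal_conformal_change:
  assumes Y: "(Y has_derivative (\<lambda>h. reV (h *s v))) (at z)"
    and Y': "(Y' has_derivative (\<lambda>h. reV (h *s v'))) (at (f z))"
    and f: "(f has_field_derivative c) (at z)" "c \<noteq> 0"
    and eq: "open U" "z \<in> U" "\<And>x. x \<in> U \<Longrightarrow> Y' (f x) = Y x"
  shows "unit_normal Y z = unit_normal Y' (f z)"
proof -
  have "((\<lambda>x. Y' (f x)) has_derivative (\<lambda>h. reV ((c * h) *s v'))) (at z)"
    using has_derivative_compose[OF f(1)[unfolded has_field_derivative_def] Y'] by simp
  then have "(Y has_derivative (\<lambda>h. reV ((c * h) *s v'))) (at z)"
    by (rule has_derivative_transform_within_open[OF _ eq(1,2)]) (rule eq(3))
  then have h: "reV (h *s v) = reV ((c * h) *s v')" for h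
    using has_derivative_unique[OF Y] by metis
  have fd: "frechet_derivative Y (at z) = (\<lambda>h. reV (h *s v))" "frechet_derivative Y' (at (f z)) = (\<lambda>h. reV (h *s v'))"
    using frechet_derivative_at[OF Y] frechet_derivative_at[OF Y'] by simp_all
  have pd: "pd_u Y z = reV (c *s v')" "pd_v Y z = reV (\<i> *s (c *s v'))"
    unfolding pd_u_def pd_v_def fd h by (simp_all add: mult.commute)
  have pd': "pd_u Y' (f z) = reV v'" "pd_v Y' (f z) = reV (\<i> *s v')"
    unfolding pd_u_def pd_v_def fd by simp_all
  show ?thesis
    unfolding unit_normal_def pd pd' cross_reV_mult sgn_scaleR using f(2) by simp
qed

lemma chart_inv_cong:
  assumes "spinor_rep U Y s t" "\<And>z. z \<in> U \<Longrightarrow> Y' z = Y z"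
  shows "spinor_rep U Y' s t"
  unfolding spinor_rep_def
proof (intro conjI ballI)
  fix z assume z: "z \<in> U"
  show "(Y' has_derivative (\<lambda>h. reV (h *s weierstrass_vec (s z) (t z)))) (at z)"
    using assms z by (intro has_derivative_transform_within_open[OF spinor_rep_derivative[OF assms(1) z] spinor_rep_open[OF assms(1)] z]) simp
qed (use assms(1) in \<open>auto simp: spinor_rep_def\<close>)

text \<open>The half turn of \<real>^3 acts on Weierstrass vectors by exchanging the spinors and
  multiplying them by \<i>. The second assumption thus records, on the level of derivatives, that
  \<open>X\<close> commutes with the half turn.\<close>

locale spinor_surface = parametrized_sphere +
  fixes X :: "real^3 \<Rightarrow> real^3" and s t :: "complex \<Rightarrow> complex"
  assumes rep_north: "spinor_rep (- Z) (\<lambda>z. X (inv_stereographic z)) s t"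
    and rep_south: "spinor_rep (- Z) (\<lambda>z. X (half_turn (inv_stereographic z))) (\<lambda>z. \<i> * t z) (\<lambda>z. \<i> * s z)"
begin

abbreviation "imm \<equiv> X \<circ> emb"

abbreviation "chart_N \<equiv> lift_chart (C - {north_pole}, stereographic)"
abbreviation "chart_S \<equiv> lift_chart (C - {south_pole}, stereographic \<circ> half_turn)"

lemma surf_charts: "charts surf = {chart_N, chart_S}"
  by (simp add: charts_lift charts_surf)

lemma chart_inv_N: "z \<notin> Z \<Longrightarrow> chart_inv chart_N z = pt (inv_stereographic z)"
  and chart_inv_S: "z \<notin> Z \<Longrightarrow> chart_inv chart_S z = pt (half_turn (inv_stereographic z))"
  using chart_inv_lift chart_inv_base_surf by (simp_all add: charts_surf)

lemma local_rep_N: "z \<notin> Z \<Longrightarrow> local_rep imm chart_N z = X (inv_stereographic z)"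
  and local_rep_S: "z \<notin> Z \<Longrightarrow> local_rep imm chart_S z = X (half_turn (inv_stereographic z))"
  by (simp_all add: local_rep_def chart_inv_N chart_inv_S inv_stereographic_C)

lemma rep_chart_N: "spinor_rep (- Z) (local_rep imm chart_N) s t"
  by (rule chart_inv_cong[OF rep_north]) (simp add: local_rep_N)

lemma rep_chart_S: "spinor_rep (- Z) (local_rep imm chart_S) (\<lambda>z. \<i> * t z) (\<lambda>z. \<i> * s z)"
  by (rule chart_inv_cong[OF rep_south]) (simp add: local_rep_S)

lemma rep_chart:
  assumes "c \<in> charts surf"
  obtains s' t' where "spinor_rep (- Z) (local_rep imm c) s' t'"
    "s' = s \<and> t' = t \<or> s' = (\<lambda>z. \<i> * t z) \<and> t' = (\<lambda>z. \<i> * s z)"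
proof -
  consider "c = chart_N" | "c = chart_S"
    using assms unfolding surf_charts by blast
  then show ?thesis
    using rep_chart_N rep_chart_S that by cases blast+
qed

lemma immersion_surf: "immersion surf imm"
  unfolding immersion_def
proof (intro ballI conjI)
  fix c assume c: "c \<in> charts surf"
  then obtain s' t' where rep: "spinor_rep (- Z) (local_rep imm c) s' t'" by (rule rep_chart)
  show "smooth_on (chart_range c) (local_rep imm c)"
    unfolding chart_range_lift[OF c] by (rule spinor_rep_smooth[OF rep])
  show "inj (frechet_derivative (local_rep imm c) (at z))" if "z \<in> chart_range c" for z
    using that spinor_rep_immersion[OF rep] unfolding chart_range_lift[OF c] by blast
qed

lemma minimal_surf: "minimal surf imm"
  unfolding minimal_def
  by (metis chart_range_lift rep_chart spinor_rep_minimal)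

text \<open>The description in \<open>gauss_map\<close> requires all charts around a point to agree.
  Where the second chart applies, \<open>z\<close> is nonzero, and the two normals are compared by
  the conformal change \<open>z \<mapsto> 1 / z\<close>.\<close>

lemma gauss_map_surf:
  assumes "z \<notin> Z"
  shows "gauss_map surf imm (pt (inv_stereographic z)) = spinor_normal (s z) (t z)"
proof -
  let ?YN = "local_rep imm chart_N" and ?YS = "local_rep imm chart_S"
  let ?q = "inv_stereographic z"
  let ?p = "pt ?q"
  have q: "?q \<in> C" using assms by (simp add: inv_stereographic_C)
  have normal: "unit_normal (local_rep imm c) (snd c ?p) = spinor_normal (s z) (t z)"
    if c: "c \<in> charts surf" "?p \<in> fst c" for c
  proof -
    consider "c = chart_N" | "c = chart_S"
      using c(1) unfolding surf_charts by blast
    then show ?thesis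
    proof cases
      case 1
      then show ?thesis using spinor_rep_normal[OF rep_chart_N, of z] assms q by (simp add: lift_chart_def)
    next
      case 2
      have "?p \<in> pt ` (C - {south_pole})" using c(2) unfolding 2 lift_chart_def by simp
      then have "?q \<noteq> south_pole" using q by (auto simp: pt_eq_iff)
      then have "z \<noteq> 0" using inv_stereographic_0 by metis
      have "1 / z \<in> - Z"
        using inverse_Z[of "1 / z"] assms by auto
      have "unit_normal ?YN z = unit_normal ?YS (1 / z)"
      proof (rule unit_normal_conformal_change[where f = "\<lambda>z. 1 / z"])
        show "(?YN has_derivative (\<lambda>h. reV (h *s weierstrass_vec (s z) (t z)))) (at z)"
          using spinor_rep_derivative[OF rep_chart_N] assms by simp
        show "(?YS has_derivative (\<lambda>h. reV (h *s weierstrass_vec (\<i> * t (1/z)) (\<i> * s (1/z))))) (at (1 / z))"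
          using spinor_rep_derivative[OF rep_chart_S \<open>1 / z \<in> - Z\<close>] .
        show "((\<lambda>z. 1 / z) has_field_derivative (- (1 / z\<^sup>2))) (at z)"
          using \<open>z \<noteq> 0\<close> by (auto intro!: derivative_eq_intros simp: power2_eq_square)
        show "- (1 / z\<^sup>2) \<noteq> 0" using \<open>z \<noteq> 0\<close> by simp
        show "open (- Z - {0})" using open_compl_Z by auto
        show "z \<in> - Z - {0}" using \<open>z \<noteq> 0\<close> assms by simp
        show "?YS (1 / w) = ?YN w" if w: "w \<in> - Z - {0}" for w
        proof -
          have "1 / w \<notin> Z" using inverse_Z[of "1 / w"] w by auto
          then show ?thesis
            using w half_turn_inv_stereographic[of "1 / w"] by (simp add: local_rep_N local_rep_S)
        qed
      qed
      moreover have "snd c ?p = 1 / z"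
        unfolding 2 lift_chart_def using half_turn_inv_stereographic[OF \<open>z \<noteq> 0\<close>] q by simp
      ultimately show ?thesis
        using spinor_rep_normal[OF rep_chart_N, of z] assms unfolding 2 by simp
    qed
  qed
  have "chart_N \<in> charts surf" "?p \<in> fst chart_N"
    using q by (auto simp: surf_charts lift_chart_def)
  then show ?thesis
    unfolding gauss_map_def using normal by (intro the_equality) metis+
qed

text \<open>Exchanging the spinors and multiplying them by \<i> changes neither their Wronskian nor
  the sum of the squared moduli, so one bound serves both charts.\<close>

lemma nn_integral_curvature_bound:
  assumes c: "c \<in> charts surf" "S \<subseteq> fst c"
    and bound: "\<And>z. z \<notin> Z \<Longrightarrow>
      4 * (cmod (s z * deriv t z - deriv s z * t z))\<^sup>2 / ((cmod (s z))\<^sup>2 + (cmod (t z))\<^sup>2)\<^sup>2 \<le> g z"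
    and z: "z \<in> snd c ` S"
  shows "\<bar>gauss_curvature (local_rep imm c) z\<bar> * area_density (local_rep imm c) z \<le> g z"
proof -
  have "z \<in> chart_range c" using c(2) z by (auto simp: chart_range_def)
  then have zZ: "z \<in> - Z" unfolding chart_range_lift[OF c(1)] .
  obtain s' t' where rep: "spinor_rep (- Z) (local_rep imm c) s' t'"
    and st: "s' = s \<and> t' = t \<or> s' = (\<lambda>z. \<i> * t z) \<and> t' = (\<lambda>z. \<i> * s z)"
    using rep_chart[OF c(1)] by metis
  have hol: "s holomorphic_on - Z" "t holomorphic_on - Z"
    using rep_north by (auto simp: spinor_rep_def)
  have d: "(s has_field_derivative deriv s z) (at z)" "(t has_field_derivative deriv t z) (at z)"
    using hol zZ open_compl_Z by (auto intro: holomorphic_derivI)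
  have di: "deriv (\<lambda>z. \<i> * t z) z = \<i> * deriv t z" "deriv (\<lambda>z. \<i> * s z) z = \<i> * deriv s z"
    using d by (auto intro!: DERIV_imp_deriv DERIV_cmult)
  have "cmod (s' z * deriv t' z - deriv s' z * t' z) = cmod (s z * deriv t z - deriv s z * t z)"
    using st
  proof
    assume st': "s' = (\<lambda>z. \<i> * t z) \<and> t' = (\<lambda>z. \<i> * s z)"
    have "s' z * deriv t' z - deriv s' z * t' z = s z * deriv t z - deriv s z * t z"
      using st' di by (simp add: algebra_simps)
    then show ?thesis by simp
  qed simp
  moreover have "(cmod (s' z))\<^sup>2 + (cmod (t' z))\<^sup>2 = (cmod (s z))\<^sup>2 + (cmod (t z))\<^sup>2"
    using st by (auto simp: norm_mult)
  ultimately show ?thesis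
    using spinor_rep_curvature[OF rep zZ] bound[of z] zZ by simp
qed

text \<open>The supremum is at most twice the integral of \<open>g\<close>, two being the number of
  charts: disjoint pieces taken in the same chart have disjoint images, so a point of the plane lies
  in at most one image per chart.\<close>

lemma total_abs_curvature_surf:
  assumes bound: "\<And>z. z \<notin> Z \<Longrightarrow>
      4 * (cmod (s z * deriv t z - deriv s z * t z))\<^sup>2 / ((cmod (s z))\<^sup>2 + (cmod (t z))\<^sup>2)\<^sup>2 \<le> g z"
    and g: "continuous_on UNIV g" and fin: "(\<integral>\<^sup>+z. ennreal (g z) \<partial>lborel) < \<infinity>"
  shows "total_abs_curvature surf imm < \<infinity>"
proof -
  have le: "(\<Sum>(c, S)\<in>\<F>. \<integral>\<^sup>+z\<in>snd c ` S.
      ennreal (\<bar>gauss_curvature (local_rep imm c) z\<bar> * area_density (local_rep imm c) z) \<partial>lborel)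
      \<le> 2 * (\<integral>\<^sup>+z. ennreal (g z) \<partial>lborel)"
    if \<F>: "finite \<F>" "disjoint_family_on snd \<F>"
      "\<forall>(c, S)\<in>\<F>. c \<in> charts surf \<and> compactin (topo surf) S \<and> S \<subseteq> fst c" for \<F>
  proof -
    define I where "I x = snd (fst x) ` snd x" for x :: "((real^3) set \<times> (real^3 \<Rightarrow> complex)) \<times> (real^3) set"
    have comp: "compact (I x)" if "x \<in> \<F>" for x
    proof -
      obtain c S where x: "x = (c, S)" by (cases x)
      have c: "c \<in> charts surf" "compactin T S" "S \<subseteq> fst c"
        using \<F>(3) that x by auto
      have "compactin (subtopology T (fst c)) S"
        using c by (simp add: compactin_subtopology)
      then show ?thesis
        unfolding I_def x using image_compactin charts_topology(5)[OF c(1)] by fastforce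
    qed
    have "(\<Sum>(c, S)\<in>\<F>. \<integral>\<^sup>+z\<in>snd c ` S.
        ennreal (\<bar>gauss_curvature (local_rep imm c) z\<bar> * area_density (local_rep imm c) z) \<partial>lborel)
      \<le> (\<Sum>x\<in>\<F>. \<integral>\<^sup>+z. ennreal (g z) * indicator (I x) z \<partial>lborel)"
    proof (rule sum_mono)
      fix x assume x: "x \<in> \<F>"
      obtain c S where xc: "x = (c, S)" by (cases x)
      have c: "c \<in> charts surf" "S \<subseteq> fst c" using \<F>(3) x xc by auto
      show "(case x of (c, S) \<Rightarrow> \<integral>\<^sup>+z\<in>snd c ` S.
          ennreal (\<bar>gauss_curvature (local_rep imm c) z\<bar> * area_density (local_rep imm c) z) \<partial>lborel)
        \<le> (\<integral>\<^sup>+z. ennreal (g z) * indicator (I x) z \<partial>lborel)"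
        unfolding xc I_def prod.case fst_conv snd_conv
        by (intro nn_integral_mono)
          (auto simp: indicator_def intro!: ennreal_leI nn_integral_curvature_bound[OF c bound])
    qed
    also have "\<dots> = (\<integral>\<^sup>+z. (\<Sum>x\<in>\<F>. ennreal (g z) * indicator (I x) z) \<partial>lborel)"
    proof (rule nn_integral_sum[symmetric])
      fix x assume "x \<in> \<F>"
      then have "I x \<in> sets borel" using comp by (simp add: borel_compact)
      then show "(\<lambda>z. ennreal (g z) * indicator (I x) z) \<in> borel_measurable lborel"
        using borel_measurable_continuous_onI[OF g] by measurable
    qed
    also have "\<dots> \<le> (\<integral>\<^sup>+z. 2 * ennreal (g z) \<partial>lborel)"
    proof (rule nn_integral_mono)
      fix z
      define A where "A = {x \<in> \<F>. z \<in> I x}"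
      have "inj_on fst A"
      proof (rule inj_onI)
        fix x y assume xy: "x \<in> A" "y \<in> A" "fst x = fst y"
        obtain c S T where x: "x = (c, S)" and y: "y = (c, T)" using xy(3) by (metis prod.collapse)
        have c: "c \<in> charts surf" "S \<subseteq> fst c" "T \<subseteq> fst c" using \<F>(3) xy x y by (auto simp: A_def)
        have "inj_on (snd c) (fst c)"
          by (rule inj_on_inverseI[of _ "chart_inv c"]) (rule charts_topology(3)[OF c(1)])
        then have "S \<inter> T \<noteq> {}"
          using xy c unfolding A_def I_def x y by (fastforce dest: inj_onD)
        then show "x = y"
          using \<F>(2) xy unfolding disjoint_family_on_def A_def x y by fastforce
      qed
      moreover have "fst ` A \<subseteq> charts surf" using \<F>(3) by (auto simp: A_def)
      ultimately have "card A \<le> card (charts surf)"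
        by (intro card_inj_on_le) (auto simp: surf_charts)
      also have "\<dots> \<le> 2" by (simp add: surf_charts card_insert_if)
      finally have "card A \<le> 2" .
      have "(\<Sum>x\<in>\<F>. ennreal (g z) * indicator (I x) z) = (\<Sum>x\<in>A. ennreal (g z))"
        unfolding A_def by (intro sum.mono_neutral_cong_right) (use \<F>(1) in \<open>auto simp: indicator_def\<close>)
      also have "\<dots> = of_nat (card A) * ennreal (g z)" by simp
      also have "\<dots> \<le> 2 * ennreal (g z)"
        using \<open>card A \<le> 2\<close> of_nat_mono[OF \<open>card A \<le> 2\<close>, where 'a = ennreal] by (intro mult_right_mono) auto
      finally show "(\<Sum>x\<in>\<F>. ennreal (g z) * indicator (I x) z) \<le> 2 * ennreal (g z)" .
    qed
    also have "\<dots> = 2 * (\<integral>\<^sup>+z. ennreal (g z) \<partial>lborel)"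
      using borel_measurable_continuous_onI[OF g] by (intro nn_integral_cmult) measurable
    finally show ?thesis .
  qed
  have "total_abs_curvature surf imm \<le> 2 * (\<integral>\<^sup>+z. ennreal (g z) \<partial>lborel)"
    unfolding total_abs_curvature_def by (rule SUP_least) (use le in blast)
  also have "\<dots> < \<infinity>"
    using fin by (simp add: ennreal_mult_less_top)
  finally show ?thesis .
qed

end

lemma continuous_on_reV_weierstrass:
  assumes "continuous_on S h" "continuous_on S f" "continuous_on S g"
  shows "continuous_on S (\<lambda>x. reV (h x *s weierstrass_vec (f x) (g x)))"
  by (rule continuous_on_vec3)
    (simp_all only: reV_nth vector_smult_component weierstrass_vec_nth, (intro continuous_intros assms; simp)+)

section \<open>The induced distance: short paths, positivity, completeness\<close>

context spinor_surface
begin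

text \<open>Straight segments in a chart are admissible, and their length is at most the coordinate
  length times a bound of the conformal factor on a closed disc.\<close>

lemma segment_path:
  assumes c: "c \<in> charts surf" and z: "z \<notin> Z" and e: "e > 0"
  obtains r where "r > 0" "ball z r \<subseteq> - Z"
    "\<And>w. w \<in> ball z r \<Longrightarrow> \<exists>\<gamma>. admissible_path surf imm \<gamma> \<and> \<gamma> 0 = chart_inv c z \<and>
       \<gamma> 1 = chart_inv c w \<and> path_length imm \<gamma> < e"
proof -
  obtain s' t' where rep: "spinor_rep (- Z) (local_rep imm c) s' t'" using rep_chart[OF c] by metis
  let ?Y = "local_rep imm c"
  define F where "F x = ((cmod (s' x))\<^sup>2 + (cmod (t' x))\<^sup>2) / 2" for x
  have "s' holomorphic_on - Z" "t' holomorphic_on - Z" using rep by (auto simp: spinor_rep_def)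
  then have cst: "continuous_on (- Z) s'" "continuous_on (- Z) t'"
    by (auto intro: holomorphic_on_imp_continuous_on)
  then have cF: "continuous_on (- Z) F"
    unfolding F_def by (intro continuous_intros) auto
  obtain R where R: "R > 0" "cball z R \<subseteq> - Z"
    using open_contains_cball open_compl_Z z by blast
  obtain K where K: "K > 0" "\<And>x. x \<in> cball z R \<Longrightarrow> F x \<le> K"
  proof -
    have "bounded (F ` cball z R)"
      using compact_continuous_image[OF continuous_on_subset[OF cF R(2)]] compact_imp_bounded by auto
    then obtain K where "K > 0" "\<forall>x\<in>F ` cball z R. norm x \<le> K"
      by (metis bounded_pos)
    then show ?thesis using that[of K] by (metis image_eqI norm_le_zero_iff abs_le_D1 real_norm_def)
  qed
  \<comment> \<open>The factor 2 makes \<open>r * K < e\<close> strict.\<close>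
  define r where "r = min R (e / (2 * K))"
  have "r > 0" "r \<le> R" "r * K < e"
    using R K e unfolding r_def by (auto simp: min_def field_simps)
  show ?thesis
  proof (rule that[OF \<open>r > 0\<close>])
    show "ball z r \<subseteq> - Z" using R \<open>r \<le> R\<close> by (meson ball_subset_cball order_trans subset_ball)
    fix w assume w: "w \<in> ball z r"
    define l where "l \<tau> = z + of_real \<tau> * (w - z)" for \<tau> :: real
    have lin: "l \<tau> \<in> cball z R" if "\<tau> \<in> {0..1}" for \<tau>
    proof -
      have "cmod (of_real \<tau> * (w - z)) \<le> cmod (w - z)"
        using that by (simp add: norm_mult mult_left_le_one_le)
      also have "\<dots> < r" using w by (simp add: dist_norm norm_minus_commute)
      finally show ?thesis using \<open>r \<le> R\<close> by (simp add: l_def dist_norm)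
    qed
    have lZ: "l \<tau> \<in> - Z" if "\<tau> \<in> {0..1}" for \<tau> using lin[OF that] R by blast
    have cl: "continuous_on S l" for S unfolding l_def by (intro continuous_intros)
    define \<gamma> where "\<gamma> \<tau> = chart_inv c (l \<tau>)" for \<tau>
    let ?v = "\<lambda>\<tau>. reV ((w - z) *s weierstrass_vec (s' (l \<tau>)) (t' (l \<tau>)))"
    have X\<gamma>: "imm \<circ> \<gamma> = (\<lambda>\<tau>. ?Y (l \<tau>))"
      by (auto simp: \<gamma>_def local_rep_def)
    have dY: "((imm \<circ> \<gamma>) has_vector_derivative ?v \<tau>) (at \<tau>)" if \<tau>: "\<tau> \<in> {0..1}" for \<tau>
    proof -
      have "(l has_derivative (\<lambda>h. of_real h * (w - z))) (at \<tau>)"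
        unfolding l_def by (auto intro!: derivative_eq_intros)
      then have "((\<lambda>\<tau>. ?Y (l \<tau>)) has_derivative
          (\<lambda>h. reV ((of_real h * (w - z)) *s weierstrass_vec (s' (l \<tau>)) (t' (l \<tau>))))) (at \<tau>)"
        by (rule has_derivative_compose) (rule spinor_rep_derivative[OF rep lZ[OF \<tau>]])
      moreover have "reV ((of_real h * (w - z)) *s v) = h *\<^sub>R reV ((w - z) *s v)" for h v
        by (simp add: vec_eq_iff algebra_simps)
      ultimately show ?thesis
        unfolding X\<gamma> has_vector_derivative_def by simp
    qed
    have cv: "continuous_on {0..1} ?v"
    proof -
      have "continuous_on {0..1} (\<lambda>\<tau>. s' (l \<tau>))" "continuous_on {0..1} (\<lambda>\<tau>. t' (l \<tau>))"
        using lZ cst by (auto intro!: continuous_on_compose2[OF _ cl])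
      then show ?thesis by (intro continuous_on_reV_weierstrass continuous_on_const)
    qed
    have pw: "(imm \<circ> \<gamma>) piecewise_C1_differentiable_on {0..1}"
      by (rule C1_differentiable_imp_piecewise, unfold C1_differentiable_on_def)
        (intro exI[of _ ?v] conjI ballI dY cv)
    have speed: "speed (imm \<circ> \<gamma>) \<tau> = norm (?v \<tau>)" if "\<tau> \<in> {0..1}" for \<tau>
      using dY[OF that] by (simp add: speed_def vector_derivative_at)
    have int: "speed (imm \<circ> \<gamma>) integrable_on {0..1}"
    proof -
      have "(\<lambda>\<tau>. norm (?v \<tau>)) integrable_on {0..1}"
        by (intro integrable_continuous_interval continuous_intros cv)
      then show ?thesis by (rule integrable_eq) (simp only: speed)
    qed
    have cml: "continuous_map (top_of_set {0..1}) (top_of_set (- Z)) l"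
      using cl lZ by (auto simp: continuous_map_in_subtopology)
    then have "pathin (topo surf) \<gamma>"
      using continuous_map_compose[OF cml charts_topology(6)[OF c]] by (simp add: pathin_def \<gamma>_def[abs_def] comp_def)
    then have adm: "admissible_path surf imm \<gamma>"
      using pw int by (simp add: admissible_path_speed)
    have "path_length imm \<gamma> \<le> integral {0..1} (\<lambda>\<tau>::real. r * K)"
      unfolding path_length_speed
    proof (rule Henstock_Kurzweil_Integration.integral_le[OF int])
      fix \<tau> :: real assume \<tau>: "\<tau> \<in> {0..1}"
      have "norm (?v \<tau>) = cmod (w - z) * F (l \<tau>)"
        unfolding norm_reV_weierstrass F_def by simp
      also have "\<dots> \<le> r * K"
        using w K lin[OF \<tau>] \<open>r > 0\<close> by (intro mult_mono) (auto simp: dist_norm norm_minus_commute F_def)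
      finally show "speed (imm \<circ> \<gamma>) \<tau> \<le> r * K" using speed[OF \<tau>] by simp
    qed auto
    then have "path_length imm \<gamma> < e" using \<open>r * K < e\<close> by simp
    moreover have "\<gamma> 0 = chart_inv c z" "\<gamma> 1 = chart_inv c w"
      by (simp_all add: \<gamma>_def l_def)
    ultimately show "\<exists>\<gamma>. admissible_path surf imm \<gamma> \<and> \<gamma> 0 = chart_inv c z \<and> \<gamma> 1 = chart_inv c w \<and> path_length imm \<gamma> < e"
      using adm by blast
  qed
qed

lemma short_paths:
  assumes "e > 0"
  shows "\<exists>N. openin T N \<and> p \<in> N \<and>
    (\<forall>q\<in>N. \<exists>\<gamma>. admissible_path surf imm \<gamma> \<and> \<gamma> 0 = p \<and> \<gamma> 1 = q \<and> path_length imm \<gamma> < e)"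
proof -
  obtain c z where c: "c \<in> charts surf" "z \<notin> Z" "chart_inv c z = p"
    using chart_at[of p] .
  obtain r where r: "r > 0" "ball z r \<subseteq> - Z"
    "\<And>w. w \<in> ball z r \<Longrightarrow> \<exists>\<gamma>. admissible_path surf imm \<gamma> \<and> \<gamma> 0 = chart_inv c z \<and>
       \<gamma> 1 = chart_inv c w \<and> path_length imm \<gamma> < e"
    using segment_path[OF c(1,2) assms(1)] by metis
  show ?thesis
  proof (intro exI[of _ "chart_inv c ` ball z r"] conjI)
    show "openin T (chart_inv c ` ball z r)"
      by (rule openin_chart_image[OF c(1) open_ball r(2)])
    show "p \<in> chart_inv c ` ball z r" using c(3) r(1) by force
  qed (use r(3) c(3) in auto)
qed

text \<open>The immersion may identify points, so \<open>dist (X p) (X q)\<close> gives no lower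
  bound. But near \<open>p\<close> it expands by at least half the conformal factor at
  \<open>p\<close>, and every path to \<open>q\<close> crosses a small circle around
  \<open>p\<close>.\<close>

lemma leaving_cost:
  assumes p: "p \<noteq> q"
  obtains \<delta> where "\<delta> > 0"
    "\<And>\<gamma>. admissible_path surf imm \<gamma> \<Longrightarrow> \<gamma> 0 = p \<Longrightarrow> \<gamma> 1 = q \<Longrightarrow> \<delta> \<le> path_length imm \<gamma>"
proof -
  obtain c z where c: "c \<in> charts surf" "z \<notin> Z" "chart_inv c z = p"
    using chart_at[of p] .
  obtain s' t' where rep: "spinor_rep (- Z) (local_rep imm c) s' t'" using rep_chart[OF c(1)] by metis
  let ?Y = "local_rep imm c"
  define m where "m = ((cmod (s' z))\<^sup>2 + (cmod (t' z))\<^sup>2) / 2"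
  have "m > 0"
    using spinor_rep_nonzero[OF rep, of z] c(2) by (auto simp: m_def sum_power2_gt_zero_iff)
  obtain d where d: "d > 0" "\<And>w. cmod (w - z) < d \<Longrightarrow>
      norm (?Y w - ?Y z - reV ((w - z) *s weierstrass_vec (s' z) (t' z))) \<le> m / 2 * cmod (w - z)"
    using spinor_rep_derivative[OF rep, of z] c(2) \<open>m > 0\<close>
    unfolding has_derivative_at_alt by (metis ComplI half_gt_zero)
  have far: "m / 2 * cmod (w - z) \<le> norm (?Y w - ?Y z)" if "cmod (w - z) < d" for w
  proof -
    have "norm (reV ((w - z) *s weierstrass_vec (s' z) (t' z))) = m * cmod (w - z)"
      unfolding norm_reV_weierstrass m_def by simp
    then show ?thesis
      using d(2)[OF that] norm_triangle_ineq3[of "?Y w - ?Y z" "reV ((w - z) *s weierstrass_vec (s' z) (t' z))"]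
      by linarith
  qed
  obtain R where R: "R > 0" "cball z R \<subseteq> - Z"
    using open_contains_cball open_compl_Z c(2) by blast
  \<comment> \<open>The closed disc must avoid \<open>q\<close> even when \<open>q\<close> lies in
    the same chart disc.\<close>
  obtain r where r: "r > 0" "r < d" "r \<le> R" "q \<notin> chart_inv c ` cball z r"
  proof (cases "q \<in> chart_inv c ` cball z R")
    case True
    then obtain w where w: "w \<in> cball z R" "q = chart_inv c w" by blast
    then have "w \<noteq> z" using p c by auto
    define r where "r = min (min (d / 2) R) (cmod (w - z) / 2)"
    have "r > 0" "r < d" "r \<le> R" "r < cmod (w - z)"
      using d R \<open>w \<noteq> z\<close> by (auto simp: r_def min_def)
    moreover have "q \<notin> chart_inv c ` cball z r"
    proof
      assume "q \<in> chart_inv c ` cball z r"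
      then obtain v where v: "v \<in> cball z r" "q = chart_inv c v" by blast
      have "v \<in> cball z R" using v \<open>r \<le> R\<close> by auto
      then have "v \<notin> Z" "w \<notin> Z" using R w by auto
      then have "v = w" using v w charts_topology(4)[OF c(1)] by metis
      then show False using v \<open>r < cmod (w - z)\<close> by (simp add: dist_norm norm_minus_commute)
    qed
    ultimately show ?thesis using that by blast
  next
    case False
    define r where "r = min (d / 2) R"
    have "r > 0" "r < d" "r \<le> R" using d R by (auto simp: r_def min_def)
    moreover have "q \<notin> chart_inv c ` cball z r"
      using False subset_cball[OF \<open>r \<le> R\<close>] by blast
    ultimately show ?thesis using that by blast
  qed
  have sub: "cball z r \<subseteq> - Z" using R(2) subset_cball[OF r(3)] by blast
  show ?thesis
  proof (rule that[of "m / 2 * r"])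
    show "m / 2 * r > 0" using \<open>m > 0\<close> r by simp
    fix \<gamma> assume \<gamma>: "admissible_path surf imm \<gamma>" "\<gamma> 0 = p" "\<gamma> 1 = q"
    then have path: "pathin T \<gamma>"
      by (simp add: admissible_path_speed)
    have "\<exists>\<tau>\<in>{0..1}. \<gamma> \<tau> \<in> chart_inv c ` sphere z r"
    proof (rule ccontr)
      \<comment> \<open>A path missing the circle would be covered by the open disc and the
        complement of the closed disc, with \<open>p\<close> in one and \<open>q\<close> in the
        other.\<close>
      assume none: "\<not> ?thesis"
      have oA: "openin T (chart_inv c ` ball z r)"
        by (rule openin_chart_image[OF c(1) open_ball order_trans[OF ball_subset_cball sub]])
      have "compactin (top_of_set (- Z)) (cball z r)"
        using sub by (simp add: compactin_subtopology)
      then have "compactin T (chart_inv c ` cball z r)"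
        by (rule image_compactin[OF _ charts_topology(6)[OF c(1)]])
      then have oB: "openin T (- chart_inv c ` cball z r)"
        using compactin_imp_closedin[OF Hausdorff_T] by (simp add: closedin_def Compl_eq_Diff_UNIV)
      have conn: "connectedin T (\<gamma> ` {0..1})"
        using path connectedin_path_image by blast
      have cover: "\<gamma> ` {0..1} \<subseteq> chart_inv c ` ball z r \<union> - chart_inv c ` cball z r"
      proof
        fix x assume x: "x \<in> \<gamma> ` {0..1}"
        show "x \<in> chart_inv c ` ball z r \<union> - chart_inv c ` cball z r"
        proof (cases "x \<in> chart_inv c ` cball z r")
          case True
          then obtain w where w: "w \<in> cball z r" "x = chart_inv c w" by blast
          have "w \<notin> sphere z r"
          proof
            assume "w \<in> sphere z r"
            then have "x \<in> chart_inv c ` sphere z r" unfolding w(2) by (rule imageI)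
            moreover obtain \<tau> where "\<tau> \<in> {0..1}" "x = \<gamma> \<tau>" using x by (rule imageE)
            ultimately show False using none by metis
          qed
          then have "w \<in> ball z r" using w(1) by auto
          then show ?thesis using w(2) by blast
        qed blast
      qed
      have disj: "chart_inv c ` ball z r \<inter> - chart_inv c ` cball z r \<inter> \<gamma> ` {0..1} = {}"
        using ball_subset_cball by blast
      have p_in: "p \<in> \<gamma> ` {0..1} \<inter> chart_inv c ` ball z r"
      proof
        show "p \<in> \<gamma> ` {0..1}" by (rule image_eqI[of _ _ 0]) (simp_all add: \<gamma>(2))
        show "p \<in> chart_inv c ` ball z r" by (rule image_eqI[of _ _ z]) (simp_all add: c(3) r(1))
      qed
      have q_in: "q \<in> \<gamma> ` {0..1} \<inter> - chart_inv c ` cball z r"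
      proof
        show "q \<in> \<gamma> ` {0..1}" by (rule image_eqI[of _ _ 1]) (simp_all add: \<gamma>(3))
        show "q \<in> - chart_inv c ` cball z r" using r(4) by blast
      qed
      have "\<not> (\<exists>E1 E2. openin T E1 \<and> openin T E2 \<and> \<gamma> ` {0..1} \<subseteq> E1 \<union> E2 \<and>
          E1 \<inter> E2 \<inter> \<gamma> ` {0..1} = {} \<and> E1 \<inter> \<gamma> ` {0..1} \<noteq> {} \<and> E2 \<inter> \<gamma> ` {0..1} \<noteq> {})"
        using conn unfolding connectedin by simp
      moreover have "chart_inv c ` ball z r \<inter> \<gamma> ` {0..1} \<noteq> {}" "- chart_inv c ` cball z r \<inter> \<gamma> ` {0..1} \<noteq> {}"
        using p_in q_in by fast+
      ultimately show False
        using oA oB cover disj by meson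
    qed
    then obtain \<tau> w where \<tau>: "\<tau> \<in> {0..1}" "\<gamma> \<tau> = chart_inv c w" "w \<in> sphere z r" by blast
    have "cmod (w - z) = r" using \<tau>(3) by (simp add: dist_norm norm_minus_commute)
    then have "m / 2 * r \<le> norm (?Y w - ?Y z)" using far[of w] r by simp
    also have "\<dots> = dist (imm (\<gamma> 0)) (imm (\<gamma> \<tau>))"
      using c(3) \<gamma>(2) \<tau>(2) by (simp add: local_rep_def dist_norm norm_minus_commute)
    also have "\<dots> \<le> path_length imm \<gamma>"
      by (rule dist_le_path_length[OF \<gamma>(1) \<tau>(1)])
    finally show "m / 2 * r \<le> path_length imm \<gamma>" .
  qed
qed

text \<open>Being joined by an admissible path is an equivalence relation with open classes on a
  connected space. It makes the infimum in the induced distance range over a nonempty set.\<close>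

lemma admissible_connected: "\<exists>\<gamma>. admissible_path surf imm \<gamma> \<and> \<gamma> 0 = p \<and> \<gamma> 1 = q"
proof -
  let ?R = "\<lambda>x y. \<exists>\<gamma>. admissible_path surf imm \<gamma> \<and> \<gamma> 0 = pt x \<and> \<gamma> 1 = pt y"
  have "?R (emb p) (emb q)"
  proof (rule connected_equivalence_relation[OF connected_C emb_C emb_C])
    fix x y assume "?R x y"
    then obtain \<gamma> where "admissible_path surf imm \<gamma>" "\<gamma> 0 = pt x" "\<gamma> 1 = pt y" by blast
    then show "?R y x"
      using admissible_path_reverse(1) by (intro exI[of _ "\<lambda>t. \<gamma> (1 - t)"]) simp
  next
    fix x y z assume "?R x y" "?R y z"
    then obtain \<gamma> \<delta> where "admissible_path surf imm \<gamma>" "\<gamma> 0 = pt x" "\<gamma> 1 = pt y"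
      "admissible_path surf imm \<delta>" "\<delta> 0 = pt y" "\<delta> 1 = pt z" by blast
    then show "?R x z"
      using admissible_path_join(1)[of surf imm \<gamma> \<delta>]
      by (intro exI[of _ "\<gamma> +++ \<delta>"]) (simp add: joinpaths_def)
  next
    fix a assume a: "a \<in> C"
    obtain N where N: "openin T N" "pt a \<in> N"
      "\<forall>q\<in>N. \<exists>\<gamma>. admissible_path surf imm \<gamma> \<and> \<gamma> 0 = pt a \<and> \<gamma> 1 = q \<and> path_length imm \<gamma> < 1"
      using short_paths[of 1 "pt a"] by auto
    show "\<exists>T. openin (top_of_set C) T \<and> a \<in> T \<and> (\<forall>x\<in>T. ?R a x)"
    proof (intro exI[of _ "emb ` N"] conjI ballI)
      show "openin (top_of_set C) (emb ` N)" using N(1) by (simp add: openin_T)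
      show "a \<in> emb ` N" using N(2) a by (metis emb_pt image_eqI)
      show "?R a x" if "x \<in> emb ` N" for x using that N(3) by fastforce
    qed
  qed
  then show ?thesis by simp
qed

lemma induced_dist_le:
  assumes "admissible_path surf imm \<gamma>" "\<gamma> 0 = p" "\<gamma> 1 = q"
  shows "induced_dist surf imm p q \<le> path_length imm \<gamma>"
  unfolding induced_dist_def
  by (rule cInf_lower) (use assms in \<open>auto intro!: bdd_belowI[of _ 0] path_length_nonneg\<close>)

lemma induced_dist_ge:
  assumes "\<And>\<gamma>. admissible_path surf imm \<gamma> \<Longrightarrow> \<gamma> 0 = p \<Longrightarrow> \<gamma> 1 = q \<Longrightarrow> d \<le> path_length imm \<gamma>"
  shows "d \<le> induced_dist surf imm p q"
  unfolding induced_dist_def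
  by (rule cInf_greatest) (use admissible_connected[of p q] assms in auto)

lemma induced_dist_less:
  assumes "induced_dist surf imm p q < d"
  obtains \<gamma> where "admissible_path surf imm \<gamma>" "\<gamma> 0 = p" "\<gamma> 1 = q" "path_length imm \<gamma> < d"
proof (rule ccontr)
  assume nt: "\<not> thesis"
  have "d \<le> induced_dist surf imm p q"
  proof (rule induced_dist_ge)
    fix \<gamma> assume \<gamma>: "admissible_path surf imm \<gamma>" "\<gamma> 0 = p" "\<gamma> 1 = q"
    show "d \<le> path_length imm \<gamma>"
      using that[OF \<gamma>] nt by (cases "d \<le> path_length imm \<gamma>") auto
  qed
  then show False using assms by simp
qed

lemma induced_dist_sym_le: "induced_dist surf imm p q \<le> induced_dist surf imm q p"
proof (rule induced_dist_ge)
  fix \<gamma> assume "admissible_path surf imm \<gamma>" "\<gamma> 0 = q" "\<gamma> 1 = p"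
  then show "induced_dist surf imm p q \<le> path_length imm \<gamma>"
    using induced_dist_le[OF admissible_path_reverse(1)[of surf imm \<gamma>]] admissible_path_reverse(2)[of surf imm \<gamma>] by simp
qed

lemma induced_dist_nonneg: "0 \<le> induced_dist surf imm p q"
  by (rule induced_dist_ge) (rule path_length_nonneg)

lemma induced_dist_small:
  assumes "e > 0"
  shows "\<exists>N. openin T N \<and> p \<in> N \<and> (\<forall>q\<in>N. induced_dist surf imm p q < e)"
proof -
  obtain N where N: "openin T N" "p \<in> N"
    "\<forall>q\<in>N. \<exists>\<gamma>. admissible_path surf imm \<gamma> \<and> \<gamma> 0 = p \<and> \<gamma> 1 = q \<and> path_length imm \<gamma> < e"
    using short_paths[OF assms, of p] by blast
  have "induced_dist surf imm p q < e" if q: "q \<in> N" for q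
  proof -
    obtain \<gamma> where \<gamma>: "admissible_path surf imm \<gamma>" "\<gamma> 0 = p" "\<gamma> 1 = q" "path_length imm \<gamma> < e"
      using N(3) q by blast
    show ?thesis
      using induced_dist_le[OF \<gamma>(1,2,3)] \<gamma>(4) by linarith
  qed
  then show ?thesis using N(1,2) by blast
qed

lemma Metric_space_induced: "Metric_space UNIV (induced_dist surf imm)"
proof
  show "0 \<le> induced_dist surf imm x y" for x y by (rule induced_dist_nonneg)
  show "induced_dist surf imm x y = induced_dist surf imm y x" for x y
    using induced_dist_sym_le by (simp add: antisym)
  show "induced_dist surf imm x y = 0 \<longleftrightarrow> x = y" for x y
  proof
    assume zero: "induced_dist surf imm x y = 0"
    show "x = y"
    proof (rule ccontr)
      assume "x \<noteq> y"
      then obtain \<delta> where "\<delta> > 0"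
        "\<And>\<gamma>. admissible_path surf imm \<gamma> \<Longrightarrow> \<gamma> 0 = x \<Longrightarrow> \<gamma> 1 = y \<Longrightarrow> \<delta> \<le> path_length imm \<gamma>"
        using leaving_cost by metis
      then show False using induced_dist_ge[of x y \<delta>] zero by simp
    qed
  next
    assume "x = y"
    have "induced_dist surf imm x y \<le> 0"
    proof (rule field_le_epsilon)
      fix e :: real assume "e > 0"
      then show "induced_dist surf imm x y \<le> 0 + e"
        using induced_dist_small[of e x] \<open>x = y\<close> by fastforce
    qed
    then show "induced_dist surf imm x y = 0" using induced_dist_nonneg[of x y] by linarith
  qed
  show "induced_dist surf imm x z \<le> induced_dist surf imm x y + induced_dist surf imm y z" for x y z
  proof (rule field_le_epsilon)
    fix e :: real assume "e > 0"
    obtain \<gamma> where \<gamma>: "admissible_path surf imm \<gamma>" "\<gamma> 0 = x" "\<gamma> 1 = y"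
      "path_length imm \<gamma> < induced_dist surf imm x y + e / 2"
      using induced_dist_less[of x y "induced_dist surf imm x y + e / 2"] \<open>e > 0\<close> by (metis less_add_same_cancel1 half_gt_zero)
    obtain \<delta> where \<delta>: "admissible_path surf imm \<delta>" "\<delta> 0 = y" "\<delta> 1 = z"
      "path_length imm \<delta> < induced_dist surf imm y z + e / 2"
      using induced_dist_less[of y z "induced_dist surf imm y z + e / 2"] \<open>e > 0\<close> by (metis less_add_same_cancel1 half_gt_zero)
    have "admissible_path surf imm (\<gamma> +++ \<delta>)" "path_length imm (\<gamma> +++ \<delta>) = path_length imm \<gamma> + path_length imm \<delta>"
      using admissible_path_join[OF \<gamma>(1) \<delta>(1)] \<gamma> \<delta> by simp_all
    moreover have "(\<gamma> +++ \<delta>) 0 = x" "(\<gamma> +++ \<delta>) 1 = z"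
      using \<gamma> \<delta> by (simp_all add: joinpaths_def)
    ultimately have "induced_dist surf imm x z \<le> path_length imm \<gamma> + path_length imm \<delta>"
      using induced_dist_le by metis
    then show "induced_dist surf imm x z \<le> induced_dist surf imm x y + induced_dist surf imm y z + e"
      using \<gamma>(4) \<delta>(4) by simp
  qed
qed

lemma dist_le_induced_dist: "dist (imm p) (imm q) \<le> induced_dist surf imm p q"
  by (rule induced_dist_ge) (metis dist_le_path_length atLeastAtMost_iff order_refl zero_le_one)

text \<open>Euclidean distances of images are at most induced distances, so a Cauchy sequence has
  bounded image and by properness stays in a compact set; for a Cauchy sequence a convergent
  subsequence is enough.\<close>

lemma complete_immersion_surf:
  assumes proper: "\<And>B. \<exists>K. compact K \<and> K \<subseteq> C \<and> (\<forall>p\<in>C. norm (X p) \<le> B \<longrightarrow> p \<in> K)"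
  shows "complete_immersion surf imm"
proof -
  interpret Metric_space UNIV "induced_dist surf imm" by (rule Metric_space_induced)
  have "mcomplete"
    unfolding mcomplete_def
  proof (intro allI impI)
    fix \<sigma> assume \<sigma>: "MCauchy \<sigma>"
    then obtain N where N: "\<And>n n'. N \<le> n \<Longrightarrow> N \<le> n' \<Longrightarrow> induced_dist surf imm (\<sigma> n) (\<sigma> n') < 1"
      unfolding MCauchy_def by (metis zero_less_one)
    obtain K where K: "compact K" "K \<subseteq> C" "\<And>p. p \<in> C \<Longrightarrow> norm (X p) \<le> norm (imm (\<sigma> N)) + 1 \<Longrightarrow> p \<in> K"
      using proper by metis
    have inK: "emb (\<sigma> (N + n)) \<in> K" for n
    proof (rule K(3)[OF emb_C])
      have "dist (imm (\<sigma> N)) (imm (\<sigma> (N + n))) < 1"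
        using dist_le_induced_dist[of "\<sigma> N" "\<sigma> (N + n)"] N[of N "N + n"] by simp
      moreover have "norm (imm (\<sigma> (N + n))) \<le> norm (imm (\<sigma> N)) + dist (imm (\<sigma> N)) (imm (\<sigma> (N + n)))"
        by (metis dist_commute dist_norm norm_triangle_sub)
      ultimately show "norm (X (emb (\<sigma> (N + n)))) \<le> norm (imm (\<sigma> N)) + 1" by simp
    qed
    obtain l r where l: "l \<in> K" "strict_mono r" "((\<lambda>n. emb (\<sigma> (N + n))) \<circ> r) \<longlonglongrightarrow> l"
      using K(1) inK unfolding compact_def by (metis (mono_tags, lifting))
    have "limitin mtopology (\<sigma> \<circ> (\<lambda>n. N + r n)) (pt l) sequentially"
      unfolding limit_metric_sequentially
    proof (intro conjI allI impI)
      fix e :: real assume "e > 0"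
      obtain V where V: "openin T V" "pt l \<in> V" "\<And>q. q \<in> V \<Longrightarrow> induced_dist surf imm (pt l) q < e"
        using induced_dist_small[OF \<open>e > 0\<close>] by metis
      obtain U where U: "open U" "emb ` V = C \<inter> U"
        using V(1) unfolding openin_T openin_open by blast
      have "l \<in> U" using U(2) V(2) l(1) K(2) emb_pt by (metis IntD2 image_eqI subsetD)
      then have "\<forall>\<^sub>F n in sequentially. emb (\<sigma> (N + r n)) \<in> U"
        using topological_tendstoD[OF l(3) U(1)] by simp
      then obtain M where M: "\<And>n. n \<ge> M \<Longrightarrow> emb (\<sigma> (N + r n)) \<in> U"
        unfolding eventually_sequentially by blast
      have "induced_dist surf imm ((\<sigma> \<circ> (\<lambda>n. N + r n)) n) (pt l) < e" if "n \<ge> M" for n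
      proof -
        have "emb (\<sigma> (N + r n)) \<in> emb ` V" using M[OF that] emb_C U(2) by blast
        then have "\<sigma> (N + r n) \<in> V" by (metis imageE pt_emb)
        then show ?thesis using V(3) commute by (metis comp_apply)
      qed
      then show "\<exists>M. \<forall>n\<ge>M. (\<sigma> \<circ> (\<lambda>n. N + r n)) n \<in> UNIV \<and> induced_dist surf imm ((\<sigma> \<circ> (\<lambda>n. N + r n)) n) (pt l) < e"
        by blast
    qed simp
    moreover have "strict_mono (\<lambda>n. N + r n)"
      using l(2) by (simp add: strict_mono_def)
    ultimately have "limitin mtopology \<sigma> (pt l) sequentially"
      using MCauchy_convergent_subsequence[OF \<sigma>] by blast
    then show "\<exists>x. limitin mtopology \<sigma> x sequentially" ..
  qed
  then show ?thesis
    by (simp add: complete_immersion_def)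
qed

end

section \<open>Graphical ends\<close>

lemma holomorphic_lipschitz:
  assumes F: "F holomorphic_on ball 0 R" and r: "0 < r" "r < R"
  obtains L where "L > 0" "\<And>x y. x \<in> cball 0 r \<Longrightarrow> y \<in> cball 0 r \<Longrightarrow> cmod (F x - F y) \<le> L * cmod (x - y)"
    "\<And>x. x \<in> cball 0 r \<Longrightarrow> cmod (deriv F x) \<le> L"
proof -
  have sub: "cball 0 r \<subseteq> ball 0 R" using r by auto
  have "continuous_on (ball 0 R) (deriv F)"
    by (intro holomorphic_on_imp_continuous_on holomorphic_deriv F) auto
  then have "bounded (deriv F ` cball 0 r)"
    by (intro compact_imp_bounded compact_continuous_image continuous_on_subset[OF _ sub]) auto
  then obtain L where L: "L > 0" "\<And>x. x \<in> cball 0 r \<Longrightarrow> cmod (deriv F x) \<le> L"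
    by (auto simp: bounded_pos)
  have "cmod (F x - F y) \<le> L * cmod (x - y)" if "x \<in> cball 0 r" "y \<in> cball 0 r" for x y
  proof (rule field_differentiable_bound[OF convex_cball _ L(2) that])
    show "(F has_field_derivative deriv F z) (at z within cball 0 r)" if "z \<in> cball 0 r" for z
      using holomorphic_derivI[OF F open_ball] that sub by blast
  qed
  then show ?thesis using that L by blast
qed

text \<open>Mean value estimate for \<open>F x - deriv F 0 * x\<close>: by the Lipschitz bound for
  \<open>deriv F\<close> its derivative is at most \<open>L * cmod x\<close> on the disc of radius
  \<open>cmod x\<close>.\<close>

lemma holomorphic_quadratic:
  assumes F: "F holomorphic_on ball 0 R" and r: "0 < r" "r < R"
  obtains L where "L > 0" "\<And>x. x \<in> cball 0 r \<Longrightarrow> cmod (F x - F 0 - deriv F 0 * x) \<le> L * (cmod x)\<^sup>2"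
proof -
  have "deriv F holomorphic_on ball 0 R" by (intro holomorphic_deriv F) auto
  then obtain L where L: "L > 0"
    "\<And>x y. x \<in> cball 0 r \<Longrightarrow> y \<in> cball 0 r \<Longrightarrow> cmod (deriv F x - deriv F y) \<le> L * cmod (x - y)"
    using holomorphic_lipschitz[OF _ r] by metis
  have "cmod (F x - F 0 - deriv F 0 * x) \<le> L * (cmod x)\<^sup>2" if x: "x \<in> cball 0 r" for x
  proof -
    have sub: "cball 0 (cmod x) \<subseteq> cball 0 r" using x by (simp add: subset_cball)
    have "cmod ((F x - deriv F 0 * x) - (F 0 - deriv F 0 * 0)) \<le> (L * cmod x) * cmod (x - 0)"
    proof (rule field_differentiable_bound[OF convex_cball[of 0 "cmod x"]])
      fix z :: complex assume z: "z \<in> cball 0 (cmod x)"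
      then have zr: "z \<in> cball 0 r" using sub by blast
      then have "z \<in> ball 0 R" using r by auto
      then show "((\<lambda>z. F z - deriv F 0 * z) has_field_derivative deriv F z - deriv F 0) (at z within cball 0 (cmod x))"
        by (auto intro!: derivative_eq_intros holomorphic_derivI[OF F open_ball])
      have "cmod (deriv F z - deriv F 0) \<le> L * cmod (z - 0)"
        using L(2)[OF zr, of 0] r by auto
      also have "\<dots> \<le> L * cmod x" using z L(1) by simp
      finally show "cmod (deriv F z - deriv F 0) \<le> L * cmod x" .
    qed auto
    then show ?thesis by (simp add: power2_eq_square algebra_simps)
  qed
  then show ?thesis using that L(1) by blast
qed

lemma ln_norm_one_plus:
  assumes "cmod z \<le> 1/2"
  shows "\<bar>ln (cmod (1 + z)) - Re z\<bar> \<le> 2 * (cmod z)\<^sup>2"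
proof -
  have "1 + z \<noteq> 0"
  proof
    assume "1 + z = 0"
    then have "z = - 1" by (simp add: add_eq_0_iff)
    then show False using assms by simp
  qed
  then have "ln (cmod (1 + z)) - Re z = Re (Ln (1 + z) - z)" by simp
  then have "\<bar>ln (cmod (1 + z)) - Re z\<bar> \<le> cmod (Ln (1 + z) - z)"
    by (metis abs_Re_le_cmod)
  also have "\<dots> \<le> (cmod z)\<^sup>2 / (1 - cmod z)"
    using assms by (intro Ln_approx_linear) simp
  also have "\<dots> \<le> (cmod z)\<^sup>2 / (1 / 2)"
    using assms by (intro divide_left_mono) auto
  finally show ?thesis by simp
qed

lemma has_derivative_ln_norm:
  "z \<noteq> 0 \<Longrightarrow> ((\<lambda>z. ln (cmod z)) has_derivative (\<lambda>h. Re (h / z))) (at z)"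
proof -
  assume z: "z \<noteq> 0"
  have "((\<lambda>z. ln (cmod z)) has_derivative (\<lambda>h. sgn z \<bullet> h * inverse (cmod z))) (at z)"
    using z by (auto intro!: derivative_eq_intros has_derivative_norm simp: divide_inverse inner_commute)
  moreover have "sgn z \<bullet> h * inverse (cmod z) = Re (h / z)" for h
  proof -
    have "sgn z \<bullet> h * inverse (cmod z) = (Re z * Re h + Im z * Im h) * (inverse (cmod z) * inverse (cmod z))"
      by (simp add: sgn_div_norm inner_complex_def divide_inverse algebra_simps)
    also have "inverse (cmod z) * inverse (cmod z) = inverse ((Re z)\<^sup>2 + (Im z)\<^sup>2)"
    proof -
      have "cmod z * cmod z = (Re z)\<^sup>2 + (Im z)\<^sup>2"
        using cmod_power2[of z] by (simp only: power2_eq_square[of "cmod z"])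
      then show ?thesis by (metis inverse_mult_distrib)
    qed
    also have "(Re z * Re h + Im z * Im h) * inverse ((Re z)\<^sup>2 + (Im z)\<^sup>2) = Re (h / z)"
      by (simp add: Re_divide divide_inverse algebra_simps)
    finally show ?thesis .
  qed
  ultimately show ?thesis by simp
qed

text \<open>Model of an end in a coordinate \<open>x\<close> vanishing at the puncture: the
  horizontal projection is a simple pole plus a regular term, the height a logarithm plus a regular
  term. Only real parts of the holomorphic functions enter, so the projection is not holomorphic,
  and it is inverted by a contraction.\<close>

locale graph_end =
  fixes R0 :: real and c :: complex and a :: real and F1 F2 F3 :: "complex \<Rightarrow> complex"
  assumes R0: "R0 > 0" and c: "c \<noteq> 0"
    and F: "F1 holomorphic_on ball 0 R0" "F2 holomorphic_on ball 0 R0" "F3 holomorphic_on ball 0 R0"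
begin

definition S :: "complex \<Rightarrow> complex" where
  "S x = Complex (Re (F1 x)) (Re (F2 x))"

definition \<sigma> :: "complex \<Rightarrow> real" where
  "\<sigma> x = Re (F3 x)"

definition pr :: "complex \<Rightarrow> complex" where
  "pr x = c / x + S x"

definition ht :: "complex \<Rightarrow> real" where
  "ht x = a * ln (cmod x) + \<sigma> x"

definition DS :: "complex \<Rightarrow> complex \<Rightarrow> complex" where
  "DS x h = Complex (Re (deriv F1 x * h)) (Re (deriv F2 x * h))"

lemma has_derivative_S:
  assumes "x \<in> ball 0 R0"
  shows "(S has_derivative DS x) (at x)"
proof -
  have "(F1 has_derivative (*) (deriv F1 x)) (at x)" "(F2 has_derivative (*) (deriv F2 x)) (at x)"
    using holomorphic_derivI[OF F(1) open_ball assms] holomorphic_derivI[OF F(2) open_ball assms]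
    by (simp_all add: has_field_derivative_def)
  then have "((\<lambda>x. of_real (Re (F1 x)) + \<i> * of_real (Re (F2 x))) has_derivative
      (\<lambda>h. of_real (Re (deriv F1 x * h)) + \<i> * of_real (Re (deriv F2 x * h)))) (at x)"
    by (intro has_derivative_add has_derivative_mult_right has_derivative_of_real has_derivative_Re)
  then show ?thesis
    by (simp add: S_def[abs_def] DS_def[abs_def] Complex_eq)
qed

lemma has_derivative_height:
  assumes "x \<in> ball 0 R0"
  shows "(\<sigma> has_derivative (\<lambda>h. Re (deriv F3 x * h))) (at x)"
proof -
  have "(F3 has_derivative (*) (deriv F3 x)) (at x)"
    using holomorphic_derivI[OF F(3) open_ball assms] by (simp add: has_field_derivative_def)
  then show ?thesis
    unfolding \<sigma>_def[abs_def] by (rule has_derivative_Re)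
qed

lemma bounds_exist:
  "\<exists>L>0. (\<forall>x\<in>cball 0 (R0/2). \<forall>y\<in>cball 0 (R0/2). cmod (S x - S y) \<le> L * cmod (x - y) \<and> \<bar>\<sigma> x - \<sigma> y\<bar> \<le> L * cmod (x - y)) \<and>
     (\<forall>x\<in>cball 0 (R0/2). \<bar>\<sigma> x - \<sigma> 0 - Re (deriv F3 0 * x)\<bar> \<le> L * (cmod x)\<^sup>2) \<and>
     (\<forall>x\<in>cball 0 (R0/2). \<forall>h. cmod (DS x h) \<le> L * cmod h \<and> \<bar>Re (deriv F3 x * h)\<bar> \<le> L * cmod h)"
proof -
  have r: "0 < R0/2" "R0/2 < R0" using R0 by auto
  let ?B = "cball 0 (R0/2) :: complex set"
  obtain L1 where L1: "L1 > 0" "\<And>x y. x \<in> ?B \<Longrightarrow> y \<in> ?B \<Longrightarrow> cmod (F1 x - F1 y) \<le> L1 * cmod (x - y)"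
    "\<And>x. x \<in> ?B \<Longrightarrow> cmod (deriv F1 x) \<le> L1"
    using holomorphic_lipschitz[OF F(1) r] by metis
  obtain L2 where L2: "L2 > 0" "\<And>x y. x \<in> ?B \<Longrightarrow> y \<in> ?B \<Longrightarrow> cmod (F2 x - F2 y) \<le> L2 * cmod (x - y)"
    "\<And>x. x \<in> ?B \<Longrightarrow> cmod (deriv F2 x) \<le> L2"
    using holomorphic_lipschitz[OF F(2) r] by metis
  obtain L3 where L3: "L3 > 0" "\<And>x y. x \<in> ?B \<Longrightarrow> y \<in> ?B \<Longrightarrow> cmod (F3 x - F3 y) \<le> L3 * cmod (x - y)"
    "\<And>x. x \<in> ?B \<Longrightarrow> cmod (deriv F3 x) \<le> L3"
    using holomorphic_lipschitz[OF F(3) r] by metis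
  obtain L4 where L4: "L4 > 0" "\<And>x. x \<in> ?B \<Longrightarrow> cmod (F3 x - F3 0 - deriv F3 0 * x) \<le> L4 * (cmod x)\<^sup>2"
    using holomorphic_quadratic[OF F(3) r] by metis
  define L where "L = L1 + L2 + L3 + L4"
  have "L > 0" using L1(1) L2(1) L3(1) L4(1) by (simp add: L_def)
  have Complex_bound: "cmod (Complex (Re u) (Re v)) \<le> cmod u + cmod v" for u v
    using cmod_le[of "Complex (Re u) (Re v)"] abs_Re_le_cmod[of u] abs_Re_le_cmod[of v] by simp
  have S_le: "cmod (S x - S y) \<le> L * cmod (x - y)" if "x \<in> ?B" "y \<in> ?B" for x y
  proof -
    have "S x - S y = Complex (Re (F1 x - F1 y)) (Re (F2 x - F2 y))" by (simp add: S_def complex_eq_iff)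
    then have "cmod (S x - S y) \<le> L1 * cmod (x - y) + L2 * cmod (x - y)"
      using Complex_bound[of "F1 x - F1 y" "F2 x - F2 y"] L1(2)[OF that] L2(2)[OF that] by simp
    also have "\<dots> = (L1 + L2) * cmod (x - y)" by (simp add: algebra_simps)
    also have "\<dots> \<le> L * cmod (x - y)"
      using L3(1) L4(1) by (intro mult_right_mono) (auto simp: L_def)
    finally show ?thesis .
  qed
  have \<sigma>_le: "\<bar>\<sigma> x - \<sigma> y\<bar> \<le> L * cmod (x - y)" if "x \<in> ?B" "y \<in> ?B" for x y
  proof -
    have "\<bar>\<sigma> x - \<sigma> y\<bar> \<le> L3 * cmod (x - y)"
      using abs_Re_le_cmod[of "F3 x - F3 y"] L3(2)[OF that] by (simp add: \<sigma>_def)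
    also have "\<dots> \<le> L * cmod (x - y)"
      using L1(1) L2(1) L4(1) by (intro mult_right_mono) (auto simp: L_def)
    finally show ?thesis .
  qed
  have \<sigma>_quad: "\<bar>\<sigma> x - \<sigma> 0 - Re (deriv F3 0 * x)\<bar> \<le> L * (cmod x)\<^sup>2" if "x \<in> ?B" for x
  proof -
    have "\<bar>\<sigma> x - \<sigma> 0 - Re (deriv F3 0 * x)\<bar> \<le> L4 * (cmod x)\<^sup>2"
      using abs_Re_le_cmod[of "F3 x - F3 0 - deriv F3 0 * x"] L4(2)[OF that] by (simp add: \<sigma>_def)
    also have "\<dots> \<le> L * (cmod x)\<^sup>2"
      using L1(1) L2(1) L3(1) by (intro mult_right_mono) (auto simp: L_def)
    finally show ?thesis .
  qed
  have DS_le: "cmod (DS x h) \<le> L * cmod h" if "x \<in> ?B" for x h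
  proof -
    have "cmod (DS x h) \<le> cmod (deriv F1 x * h) + cmod (deriv F2 x * h)"
      unfolding DS_def by (rule Complex_bound)
    also have "\<dots> \<le> L1 * cmod h + L2 * cmod h"
      unfolding norm_mult by (intro add_mono mult_right_mono L1(3) L2(3) that) auto
    also have "\<dots> = (L1 + L2) * cmod h" by (simp add: algebra_simps)
    also have "\<dots> \<le> L * cmod h"
      using L3(1) L4(1) by (intro mult_right_mono) (auto simp: L_def)
    finally show ?thesis .
  qed
  have D\<sigma>_le: "\<bar>Re (deriv F3 x * h)\<bar> \<le> L * cmod h" if "x \<in> ?B" for x h
  proof -
    have "\<bar>Re (deriv F3 x * h)\<bar> \<le> cmod (deriv F3 x) * cmod h"
      using abs_Re_le_cmod[of "deriv F3 x * h"] by (simp only: norm_mult)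
    also have "\<dots> \<le> L * cmod h"
      using L3(3)[OF that] L1(1) L2(1) L4(1) by (intro mult_right_mono) (auto simp: L_def)
    finally show ?thesis .
  qed
  show ?thesis
    using \<open>L > 0\<close> S_le \<sigma>_le \<sigma>_quad DS_le D\<sigma>_le by blast
qed

text \<open>One constant for all estimates, taken on the disc of half the radius, where the
  derivatives are bounded.\<close>

definition L :: real where
  "L = (SOME L. L > 0 \<and> (\<forall>x\<in>cball 0 (R0/2). \<forall>y\<in>cball 0 (R0/2). cmod (S x - S y) \<le> L * cmod (x - y) \<and> \<bar>\<sigma> x - \<sigma> y\<bar> \<le> L * cmod (x - y)) \<and>
     (\<forall>x\<in>cball 0 (R0/2). \<bar>\<sigma> x - \<sigma> 0 - Re (deriv F3 0 * x)\<bar> \<le> L * (cmod x)\<^sup>2) \<and>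
     (\<forall>x\<in>cball 0 (R0/2). \<forall>h. cmod (DS x h) \<le> L * cmod h \<and> \<bar>Re (deriv F3 x * h)\<bar> \<le> L * cmod h))"

lemma L:
  shows "L > 0"
    and "\<And>x y. x \<in> cball 0 (R0/2) \<Longrightarrow> y \<in> cball 0 (R0/2) \<Longrightarrow> cmod (S x - S y) \<le> L * cmod (x - y)"
    and "\<And>x. x \<in> cball 0 (R0/2) \<Longrightarrow> \<bar>\<sigma> x - \<sigma> 0 - Re (deriv F3 0 * x)\<bar> \<le> L * (cmod x)\<^sup>2"
    and "\<And>x h. x \<in> cball 0 (R0/2) \<Longrightarrow> cmod (DS x h) \<le> L * cmod h"
    and "\<And>x h. x \<in> cball 0 (R0/2) \<Longrightarrow> \<bar>Re (deriv F3 x * h)\<bar> \<le> L * cmod h"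
  using someI_ex[OF bounds_exist[unfolded Bex_def]] unfolding L_def[symmetric] by auto

definition B :: real where
  "B = cmod (S 0) + L * R0"

lemma S_bound: "x \<in> cball 0 (R0/2) \<Longrightarrow> cmod (S x) \<le> B"
proof -
  assume x: "x \<in> cball 0 (R0/2)"
  have "cmod (S x - S 0) \<le> L * cmod (x - 0)" using L(2)[of x 0] x R0 by simp
  also have "\<dots> \<le> L * R0" using x R0 L(1) by (intro mult_left_mono) auto
  finally show ?thesis unfolding B_def using norm_triangle_sub[of "S x" "S 0"] by linarith
qed

lemma B_nonneg: "B \<ge> 0"
  unfolding B_def using L(1) R0 by simp

text \<open>In the coordinate \<open>y = 1 / x\<close> the projection is a small Lipschitz perturbation of \<open>y \<mapsto> c y\<close>.\<close>

definition \<rho> :: real where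
  "\<rho> = max (2 / R0) (max 1 (2 * L / cmod c))"

lemma \<rho>: "\<rho> \<ge> 1" "\<rho> > 0" "L / \<rho>\<^sup>2 \<le> cmod c / 2"
proof -
  show 1: "\<rho> \<ge> 1" "\<rho> > 0" by (auto simp: \<rho>_def)
  have "2 * L / cmod c \<le> \<rho>" by (simp add: \<rho>_def)
  also have "\<dots> \<le> \<rho>\<^sup>2" using 1 by (simp add: power2_eq_square)
  finally show "L / \<rho>\<^sup>2 \<le> cmod c / 2" using c 1 by (simp add: field_simps)
qed

lemma inverse_cball: "cmod y \<ge> \<rho> \<Longrightarrow> 1 / y \<in> cball 0 (R0/2) \<and> 1 / y \<in> ball 0 R0 \<and> y \<noteq> 0"
proof -
  assume y: "cmod y \<ge> \<rho>"
  have "2 / R0 \<le> cmod y" using y by (simp add: \<rho>_def)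
  moreover have pos: "cmod y > 0" using \<rho>(2) y by linarith
  ultimately have "cmod (1 / y) \<le> R0 / 2"
    using R0 by (simp add: norm_divide field_simps)
  then show ?thesis using R0 \<rho>(2) y by auto
qed

lemma S_inverse_lipschitz:
  assumes "cmod y \<ge> \<rho>" "cmod y' \<ge> \<rho>"
  shows "cmod (S (1/y) - S (1/y')) \<le> cmod c / 2 * cmod (y - y')"
proof -
  have ne: "y \<noteq> 0" "y' \<noteq> 0" using assms inverse_cball by auto
  have "1/y - 1/y' = (y' - y) / (y * y')" using ne by (simp add: field_simps)
  then have eq: "cmod (1/y - 1/y') = cmod (y - y') / (cmod y * cmod y')"
    by (simp add: norm_divide norm_mult norm_minus_commute)
  have "cmod (S (1/y) - S (1/y')) \<le> L * cmod (1/y - 1/y')"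
    using L(2) inverse_cball assms by blast
  also have "\<dots> \<le> L * (cmod (y - y') / (\<rho> * \<rho>))"
    unfolding eq using L(1) \<rho>(2) assms by (intro mult_left_mono divide_left_mono mult_mono) (auto intro!: mult_pos_pos)
  also have "\<dots> = (L / \<rho>\<^sup>2) * cmod (y - y')" by (simp add: power2_eq_square)
  also have "\<dots> \<le> cmod c / 2 * cmod (y - y')"
    using \<rho>(3) by (rule mult_right_mono) simp
  finally show ?thesis .
qed

lemma pr_inverse: "pr (1/y) = c * y + S (1/y)"
  by (simp add: pr_def)

lemma pr_expanding:
  assumes "cmod y \<ge> \<rho>" "cmod y' \<ge> \<rho>"
  shows "cmod c / 2 * cmod (y - y') \<le> cmod (pr (1/y) - pr (1/y'))"
proof -
  have "cmod (c * (y - y')) \<le> cmod (pr (1/y) - pr (1/y')) + cmod (S (1/y) - S (1/y'))"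
    using norm_triangle_ineq4[of "pr (1/y) - pr (1/y')" "S (1/y) - S (1/y')"]
    by (simp add: pr_inverse algebra_simps)
  then show ?thesis
    using S_inverse_lipschitz[OF assms] by (simp add: norm_mult)
qed

text \<open>As \<open>cmod (S x) \<le> B\<close>, for \<open>cmod w > Rw\<close> the vector
  \<open>(w - S (1/y)) / c\<close> has modulus above \<rho>, so the fixed point map preserves its
  domain.\<close>

definition Rw :: real where
  "Rw = B + cmod c * \<rho>"

lemma Rw_pos: "Rw > 0"
  unfolding Rw_def using B_nonneg c \<rho>(2) by (simp add: add_nonneg_pos)

text \<open>Banach's theorem for \<open>y \<mapsto> (w - S (1/y)) / c\<close>: in \<open>y\<close>
  the perturbation has Lipschitz constant \<open>cmod c / 2\<close>, which gives the contraction
  factor 1/2. The second part keeps solutions off the boundary circle, as the strict inequality in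
  \<open>V\<close> requires.\<close>

lemma pr_solve:
  assumes w: "cmod w > Rw"
  shows "\<exists>!y. cmod y \<ge> \<rho> \<and> pr (1/y) = w"
    and "cmod y \<ge> \<rho> \<Longrightarrow> pr (1/y) = w \<Longrightarrow> cmod y > \<rho>"
proof -
  define \<Phi> where "\<Phi> y = (w - S (1/y)) / c" for y
  have big: "cmod (\<Phi> y) > \<rho>" if "cmod y \<ge> \<rho>" for y
  proof -
    have "cmod w - B \<le> cmod (w - S (1/y))"
      using S_bound[of "1/y"] inverse_cball[OF that] norm_triangle_ineq2[of w "S (1/y)"] by auto
    then have "cmod c * \<rho> < cmod (w - S (1/y))" using w by (simp add: Rw_def)
    then show ?thesis using c by (simp add: \<Phi>_def norm_divide field_simps)
  qed
  have fix_iff: "\<Phi> y = y \<longleftrightarrow> pr (1/y) = w" for y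
    using c by (auto simp: \<Phi>_def pr_inverse field_simps)
  have "\<exists>!y\<in>{y. \<rho> \<le> cmod y}. \<Phi> y = y"
  proof (rule Banach_fix[where c = "1/2"])
    have "closed {y::complex. \<rho> \<le> cmod y}"
      by (intro closed_Collect_le continuous_intros)
    then show "complete {y::complex. \<rho> \<le> cmod y}" by (simp add: complete_eq_closed)
    have "of_real \<rho> \<in> {y::complex. \<rho> \<le> cmod y}" by simp
    then show "{y::complex. \<rho> \<le> cmod y} \<noteq> {}" by blast
    show "\<Phi> ` {y. \<rho> \<le> cmod y} \<subseteq> {y. \<rho> \<le> cmod y}" using big less_imp_le by blast
    fix x y assume "x \<in> {y. \<rho> \<le> cmod y}" "y \<in> {y. \<rho> \<le> cmod y}"
    then have "cmod (S (1/x) - S (1/y)) \<le> cmod c / 2 * cmod (x - y)"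
      using S_inverse_lipschitz by simp
    moreover have "\<Phi> x - \<Phi> y = - (S (1/x) - S (1/y)) / c"
      by (simp add: \<Phi>_def diff_divide_distrib)
    then have "cmod (\<Phi> x - \<Phi> y) = cmod (S (1/x) - S (1/y)) / cmod c"
      by (simp add: norm_divide norm_minus_commute)
    ultimately show "dist (\<Phi> x) (\<Phi> y) \<le> 1/2 * dist x y"
    proof -
      assume 1: "cmod (S (1/x) - S (1/y)) \<le> cmod c / 2 * cmod (x - y)"
        and 2: "cmod (\<Phi> x - \<Phi> y) = cmod (S (1/x) - S (1/y)) / cmod c"
      have "cmod (\<Phi> x - \<Phi> y) \<le> (cmod c / 2 * cmod (x - y)) / cmod c"
        unfolding 2 using 1 by (rule divide_right_mono) simp
      then show ?thesis using c by (simp add: dist_norm)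
    qed
  qed auto
  then show "\<exists>!y. cmod y \<ge> \<rho> \<and> pr (1/y) = w" by (simp add: fix_iff)
  show "cmod y \<ge> \<rho> \<Longrightarrow> pr (1/y) = w \<Longrightarrow> cmod y > \<rho>"
    using big[of y] fix_iff[of y] by simp
qed

definition Y :: "complex \<Rightarrow> complex" where
  "Y w = (THE y. cmod y \<ge> \<rho> \<and> pr (1/y) = w)"

lemma Y:
  assumes "cmod w > Rw"
  shows "cmod (Y w) > \<rho>" "pr (1 / Y w) = w"
  using theI'[OF pr_solve(1)[OF assms]] pr_solve(2)[OF assms] unfolding Y_def[symmetric] by auto

lemma Y_unique: "cmod w > Rw \<Longrightarrow> cmod y \<ge> \<rho> \<Longrightarrow> pr (1/y) = w \<Longrightarrow> Y w = y"
  using pr_solve(1)[of w] Y[of w] by (metis less_imp_le)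

lemma Y_lipschitz:
  assumes "cmod w > Rw" "cmod w' > Rw"
  shows "cmod (Y w - Y w') \<le> 2 / cmod c * cmod (w - w')"
  using pr_expanding[of "Y w" "Y w'"] Y[OF assms(1)] Y[OF assms(2)] c by (simp add: field_simps)

lemma open_ext: "open {w. cmod w > Rw}"
  by (intro open_Collect_less continuous_intros)

lemma continuous_on_Y: "continuous_on {w. cmod w > Rw} Y"
proof -
  have "(2 / cmod c)-lipschitz_on {w. cmod w > Rw} Y"
    using Y_lipschitz by (intro lipschitz_onI) (auto simp: dist_norm)
  then show ?thesis by (rule lipschitz_on_continuous_on)
qed

definition V :: "complex set" where
  "V = {x. x \<noteq> 0 \<and> cmod x < 1 / \<rho> \<and> cmod (pr x) > Rw}"

lemma V_eq: "V = (\<lambda>w. 1 / Y w) ` {w. cmod w > Rw}"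
proof (intro equalityI subsetI)
  fix x assume x: "x \<in> V"
  then have "cmod (1/x) \<ge> \<rho>" using \<rho>(2) by (simp add: V_def norm_divide field_simps)
  then have "Y (pr x) = 1/x" using x by (intro Y_unique) (auto simp: V_def)
  then show "x \<in> (\<lambda>w. 1 / Y w) ` {w. cmod w > Rw}"
    using x by (intro image_eqI[of _ _ "pr x"]) (auto simp: V_def)
next
  fix x assume "x \<in> (\<lambda>w. 1 / Y w) ` {w. cmod w > Rw}"
  then obtain w where w: "cmod w > Rw" "x = 1 / Y w" by blast
  have "Y w \<noteq> 0" "cmod (1 / Y w) < 1 / \<rho>"
    using Y(1)[OF w(1)] \<rho>(2) by (auto simp: norm_divide intro!: divide_strict_left_mono mult_pos_pos)
  then show "x \<in> V" using Y(2)[OF w(1)] w by (simp add: V_def)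
qed

lemma V_inverse: "x \<in> V \<Longrightarrow> 1 / Y (pr x) = x"
proof -
  assume x: "x \<in> V"
  then have "cmod (1/x) \<ge> \<rho>" using \<rho>(2) by (simp add: V_def norm_divide field_simps)
  then have "Y (pr x) = 1/x" using x by (intro Y_unique) (auto simp: V_def)
  then show ?thesis by simp
qed

lemma V_subset: "V \<subseteq> ball 0 R0 - {0}" "V \<subseteq> cball 0 (R0 / 2)"
proof -
  have "1 / \<rho> \<le> R0 / 2" using \<rho>(2) R0 by (simp add: \<rho>_def field_simps max_def)
  then show "V \<subseteq> ball 0 R0 - {0}" "V \<subseteq> cball 0 (R0 / 2)" using R0 by (auto simp: V_def)
qed

lemma bij_betw_pr: "bij_betw pr V (- cball 0 Rw)"
proof -
  have "- cball 0 Rw = {w. cmod w > Rw}" by auto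
  moreover have "pr (1 / Y w) = w \<and> 1 / Y w \<in> V" if "cmod w > Rw" for w
    using Y(2)[OF that] that V_eq by auto
  ultimately show ?thesis
    using V_inverse by (intro bij_betw_byWitness[of _ "\<lambda>w. 1 / Y w"]) (auto simp: V_def)
qed

lemma connected_V: "connected V"
proof -
  have "connected (- cball (0::complex) Rw)"
    by (rule connected_complement_bounded_convex) auto
  moreover have "- cball 0 Rw = {w. cmod w > Rw}" by auto
  moreover have "Y w \<noteq> 0" if "cmod w > Rw" for w using Y(1)[OF that] \<rho>(2) by auto
  ultimately show ?thesis
    unfolding V_eq by (intro connected_continuous_image continuous_intros continuous_on_Y) auto
qed

lemma continuous_on_S: "continuous_on (ball 0 R0) S"
  using has_derivative_continuous[OF has_derivative_S] by (intro continuous_at_imp_continuous_on) blast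

text \<open>With the puncture filled in, \<open>V\<close> becomes a full neighbourhood of it, the
  form needed later to isolate the end. Near 0 the pole dominates:
  \<open>cmod (c / x) > Rw + B\<close> forces \<open>cmod (pr x) > Rw\<close>.\<close>

lemma open_V0: "open (insert 0 V)"
proof -
  let ?D = "ball 0 (1 / \<rho>) - {0} :: complex set"
  have "1 / \<rho> \<le> R0 / 2" using \<rho>(2) R0 by (simp add: \<rho>_def field_simps max_def)
  then have "?D \<subseteq> ball 0 R0" using R0 by auto
  then have "continuous_on ?D pr"
    unfolding pr_def using continuous_on_subset[OF continuous_on_S] by (intro continuous_intros) auto
  then have "open (?D \<inter> pr -` {w. cmod w > Rw})"
    using open_ext by (intro continuous_open_preimage) auto
  moreover have "?D \<inter> pr -` {w. cmod w > Rw} = V" by (auto simp: V_def)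
  ultimately have "open V" by simp
  define \<delta> where "\<delta> = min (1 / \<rho>) (cmod c / (Rw + B))"
  have \<delta>: "\<delta> > 0" using \<rho>(2) c Rw_pos B_nonneg by (auto simp: \<delta>_def intro!: divide_pos_pos)
  have "x \<in> V" if x: "x \<in> ball 0 \<delta> - {0}" for x
  proof -
    have "cmod x < cmod c / (Rw + B)" "cmod x > 0" using x by (auto simp: \<delta>_def)
    then have "Rw + B < cmod (c / x)"
      using Rw_pos B_nonneg by (simp add: norm_divide field_simps)
    moreover have "cmod (S x) \<le> B"
      using x \<open>1 / \<rho> \<le> R0 / 2\<close> by (intro S_bound) (auto simp: \<delta>_def)
    ultimately have "cmod (pr x) > Rw"
      using norm_triangle_ineq2[of "c / x" "- S x"] by (simp add: pr_def)
    then show ?thesis using x by (auto simp: V_def \<delta>_def)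
  qed
  then have "ball 0 \<delta> - {0} \<subseteq> V" by blast
  moreover have "0 \<in> ball 0 \<delta>" using \<delta> by simp
  ultimately have "insert 0 V = V \<union> ball 0 \<delta>" by blast
  then show ?thesis using \<open>open V\<close> by (metis open_Un open_ball)
qed

section \<open>The graph function: bounded slope and expansion at infinity\<close>

definition f :: "complex \<Rightarrow> real" where
  "f w = ht (1 / Y w)"

lemma ht_eq: "x \<in> V \<Longrightarrow> ht x = f (pr x)"
  by (simp add: f_def V_inverse)

lemma f_inverse: "cmod w > Rw \<Longrightarrow> f w = - a * ln (cmod (Y w)) + \<sigma> (1 / Y w)"
  using Y(1)[of w] \<rho>(2) by (simp add: f_def ht_def norm_divide ln_div)

text \<open>The derivative \<open>P\<close> of \<open>y \<mapsto> c * y + S (1/y)\<close> differs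
  from multiplication by \<open>c\<close> by at most \<open>cmod c / 2\<close> in norm, so it is
  invertible with inverse bounded by \<open>2 / cmod c\<close>.\<close>

lemma has_derivative_Y:
  assumes w: "cmod w > Rw"
  obtains g where "(Y has_derivative g) (at w)" "\<And>k. cmod (g k) \<le> 2 / cmod c * cmod k"
proof -
  define y where "y = Y w"
  have y: "cmod y > \<rho>" using Y(1)[OF w] by (simp add: y_def)
  then have y': "1 / y \<in> cball 0 (R0/2)" "1 / y \<in> ball 0 R0" "y \<noteq> 0"
    using inverse_cball[of y] by auto
  define P where "P h = c * h + DS (1/y) (- h / y\<^sup>2)" for h
  have "((\<lambda>y. 1 / y) has_derivative (\<lambda>h. - h / y\<^sup>2)) (at y)"
    using y'(3) by (auto intro!: derivative_eq_intros simp: power2_eq_square)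
  then have "((\<lambda>y. S (1 / y)) has_derivative (\<lambda>h. DS (1/y) (- h / y\<^sup>2))) (at y)"
    by (rule has_derivative_compose) (rule has_derivative_S[OF y'(2)])
  then have dP: "((\<lambda>y. c * y + S (1 / y)) has_derivative P) (at y)"
    unfolding P_def by (auto intro!: derivative_eq_intros)
  have low: "cmod c / 2 * cmod h \<le> cmod (P h)" for h
  proof -
    have "cmod (DS (1/y) (- h / y\<^sup>2)) \<le> L * (cmod h / (cmod y)\<^sup>2)"
      using L(4)[OF y'(1), of "- h / y\<^sup>2"] by (simp add: norm_divide norm_power)
    also have "\<dots> \<le> L * (cmod h / \<rho>\<^sup>2)"
      using y \<rho>(2) L(1) by (intro mult_left_mono divide_left_mono power_mono mult_pos_pos) auto
    also have "\<dots> = L / \<rho>\<^sup>2 * cmod h" by simp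
    also have "\<dots> \<le> cmod c / 2 * cmod h" using \<rho>(3) by (rule mult_right_mono) simp
    finally have "cmod (DS (1/y) (- h / y\<^sup>2)) \<le> cmod c / 2 * cmod h" .
    moreover have "cmod c * cmod h \<le> cmod (P h) + cmod (DS (1/y) (- h / y\<^sup>2))"
      unfolding P_def using norm_triangle_ineq4[of "c * h + DS (1/y) (- h / y\<^sup>2)" "DS (1/y) (- h / y\<^sup>2)"]
      by (simp add: norm_mult)
    ultimately show ?thesis by simp
  qed
  have linP: "linear P" using dP has_derivative_linear by blast
  have injP: "inj P"
    unfolding linear_injective_0[OF linP]
  proof (intro allI impI)
    fix h assume "P h = 0"
    then have "cmod c / 2 * cmod h \<le> 0" using low[of h] by simp
    then show "h = 0" using c by (simp add: mult_le_0_iff)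
  qed
  obtain g where g: "linear g" "g \<circ> P = id"
    using linear_injective_left_inverse[OF linP injP] by blast
  have "surj P" by (rule linear_inj_imp_surj[OF linP injP])
  have gb: "cmod (g k) \<le> 2 / cmod c * cmod k" for k
  proof -
    obtain h where h: "k = P h" using \<open>surj P\<close> by blast
    have "g k = h" using g(2) h by (metis comp_apply id_apply)
    then show ?thesis using low[of h] h c by (simp add: field_simps)
  qed
  have "(Y has_derivative g) (at w)"
  proof (rule has_derivative_inverse_basic[OF _ _ g(2) _ open_ext])
    show "((\<lambda>y. c * y + S (1 / y)) has_derivative P) (at (Y w))" using dP by (simp add: y_def)
    show "bounded_linear g" using g(1) by (simp add: linear_conv_bounded_linear)
    show "isCont Y w"
      using continuous_on_Y open_ext w by (simp add: continuous_on_eq_continuous_at)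
    show "w \<in> {w. cmod w > Rw}" using w by simp
    show "c * Y z + S (1 / Y z) = z" if "z \<in> {w. cmod w > Rw}" for z
      using Y(2)[of z] that by (simp add: pr_inverse)
  qed
  then show ?thesis using that gb by blast
qed

lemma f_bounded_slope:
  "\<exists>K. \<forall>w. cmod w > Rw \<longrightarrow> (\<exists>D. (f has_derivative D) (at w) \<and> (\<forall>h. \<bar>D h\<bar> \<le> K * cmod h))"
proof (rule exI[of _ "(\<bar>a\<bar> + L) * (2 / cmod c)"], intro allI impI)
  \<comment> \<open>In the witness, \<open>\<bar>a\<bar> + L\<close> bounds the slope of the height
    as a function of \<open>y\<close>, because \<open>cmod y \<ge> 1\<close>, and
    \<open>2 / cmod c\<close> bounds the derivative of \<open>Y\<close>.\<close>
  fix w assume w: "cmod w > Rw"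
  define y where "y = Y w"
  have y: "cmod y > \<rho>" using Y(1)[OF w] by (simp add: y_def)
  then have y': "1 / y \<in> cball 0 (R0/2)" "1 / y \<in> ball 0 R0" "y \<noteq> 0" "cmod y \<ge> 1"
    using inverse_cball[of y] \<rho>(1) by auto
  obtain g where g: "(Y has_derivative g) (at w)" "\<And>k. cmod (g k) \<le> 2 / cmod c * cmod k"
    using has_derivative_Y[OF w] by metis
  define G where "G h = - a * Re (h / y) + Re (deriv F3 (1/y) * (- h / y\<^sup>2))" for h
  have "((\<lambda>y. 1 / y) has_derivative (\<lambda>h. - h / y\<^sup>2)) (at y)"
    using y'(3) by (auto intro!: derivative_eq_intros simp: power2_eq_square)
  then have "((\<lambda>y. \<sigma> (1 / y)) has_derivative (\<lambda>h. Re (deriv F3 (1/y) * (- h / y\<^sup>2)))) (at y)"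
    by (rule has_derivative_compose) (rule has_derivative_height[OF y'(2)])
  then have "((\<lambda>y. - a * ln (cmod y) + \<sigma> (1 / y)) has_derivative G) (at y)"
    unfolding G_def by (intro has_derivative_add has_derivative_mult_right has_derivative_ln_norm y'(3))
  then have "((\<lambda>w. - a * ln (cmod (Y w)) + \<sigma> (1 / Y w)) has_derivative (\<lambda>h. G (g h))) (at w)"
    unfolding y_def by (rule has_derivative_compose[OF g(1)])
  then have "(f has_derivative (\<lambda>h. G (g h))) (at w)"
    by (rule has_derivative_transform_within_open[OF _ open_ext]) (use w f_inverse in auto)
  moreover have "\<bar>G (g h)\<bar> \<le> (\<bar>a\<bar> + L) * (2 / cmod c) * cmod h" for h
  proof -
    have "\<bar>G k\<bar> \<le> (\<bar>a\<bar> + L) * cmod k" for k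
    proof -
      have "\<bar>Re (k / y)\<bar> \<le> cmod k / cmod y" using abs_Re_le_cmod[of "k / y"] by (simp add: norm_divide)
      also have "\<dots> \<le> cmod k / 1" using y' by (intro divide_left_mono) auto
      finally have 1: "\<bar>a * Re (k / y)\<bar> \<le> \<bar>a\<bar> * cmod k" by (simp add: abs_mult mult_left_mono)
      have "\<bar>Re (deriv F3 (1/y) * (- k / y\<^sup>2))\<bar> \<le> L * (cmod k / (cmod y)\<^sup>2)"
        using L(5)[OF y'(1), of "- k / y\<^sup>2"] by (simp only: norm_divide norm_power norm_minus_cancel)
      also have "\<dots> \<le> L * (cmod k / 1)"
        using y' L(1) by (intro mult_left_mono divide_left_mono) auto
      finally show ?thesis using 1 unfolding G_def by (simp add: distrib_right)
    qed
    then have "\<bar>G (g h)\<bar> \<le> (\<bar>a\<bar> + L) * cmod (g h)" .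
    also have "\<dots> \<le> (\<bar>a\<bar> + L) * (2 / cmod c * cmod h)"
      using g(2) L(1) by (intro mult_left_mono) auto
    finally show ?thesis by (simp only: mult.assoc)
  qed
  ultimately show "\<exists>D. (f has_derivative D) (at w) \<and> (\<forall>h. \<bar>D h\<bar> \<le> (\<bar>a\<bar> + L) * (2 / cmod c) * cmod h)"
    by blast
qed

text \<open>From \<open>c * y = w - S x\<close> one gets \<open>ln (cmod y) = ln (cmod w) - ln (cmod
  c) + ln (cmod (1 - S x / w))\<close>, and \<open>x\<close> is \<open>c / w\<close> to first order.
  Hence the dipole coefficient \<kappa> is \<open>a * S 0\<close> plus \<open>c\<close> times the
  derivative of \<open>F3\<close> at 0, and \<open>b\<close> collects \<open>a * ln (cmod c)\<close>
  and the regular height at 0.\<close>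

lemma f_asymptotics:
  "\<exists>b c1 c2. (\<lambda>w. f w - (- a * ln (norm w) + b + (c1 * Re w + c2 * Im w) / (norm w)\<^sup>2))
     \<in> O[at_infinity](\<lambda>w. 1 / (norm w)\<^sup>2)"
proof -
  define \<mu> where "\<mu> = deriv F3 0"
  define \<kappa> where "\<kappa> = of_real a * S 0 + \<mu> * c"
  define b where "b = a * ln (cmod c) + \<sigma> 0"
  define K where "K = \<bar>a\<bar> * (2 * L * cmod c) + \<bar>a\<bar> * (2 * B\<^sup>2) + 4 * L * (cmod c)\<^sup>2 + cmod \<mu> * (2 * cmod c * B)"
  have main: "\<bar>f w - (- a * ln (cmod w) + b + (Re \<kappa> * Re w + Im \<kappa> * Im w) / (cmod w)\<^sup>2)\<bar> \<le> K * (1 / (cmod w)\<^sup>2)"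
    if w: "cmod w \<ge> max (Rw + 1) (2 * B + 1)" for w
  proof -
    have wR: "cmod w > Rw" and wB: "2 * B < cmod w" and w0: "w \<noteq> 0" "cmod w > 0"
      using w Rw_pos by auto
    define y where "y = Y w"
    define x where "x = 1 / y"
    have y: "cmod y > \<rho>" and pry: "pr x = w" using Y[OF wR] by (auto simp: y_def x_def)
    then have y0: "y \<noteq> 0" and xb: "x \<in> cball 0 (R0/2)"
      using inverse_cball[of y] by (auto simp: x_def)
    have cy: "c * y = w - S x" using pry y0 by (simp add: pr_def x_def eq_diff_eq)
    have SB: "cmod (S x) \<le> B" by (rule S_bound[OF xb])
    have cyb: "cmod (c * y) \<ge> cmod w / 2"
      unfolding cy using SB wB norm_triangle_ineq2[of w "S x"] by linarith
    have "cmod x = cmod c / cmod (c * y)" using c y0 by (simp add: x_def norm_divide norm_mult)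
    also have "\<dots> \<le> cmod c / (cmod w / 2)"
    proof -
      have "cmod (c * y) > 0" using cyb w0 by linarith
      then show ?thesis using cyb w0 by (intro divide_left_mono mult_pos_pos) auto
    qed
    finally have xw: "cmod x \<le> 2 * cmod c / cmod w" by (simp add: mult.commute)
    define s where "s = - (S x / w)"
    have sb: "cmod s \<le> B / cmod w" using SB w0 by (simp add: s_def norm_divide divide_right_mono)
    also have "\<dots> \<le> 1/2" using wB w0 by (simp add: field_simps)
    finally have s2: "cmod s \<le> 1/2" .
    have "c * y = w * (1 + s)" unfolding cy s_def using w0 by (simp add: field_simps)
    then have eq: "cmod c * cmod y = cmod w * cmod (1 + s)" by (metis norm_mult)
    have pos: "cmod (1 + s) > 0"
    proof -
      have "1 - cmod s \<le> cmod (1 + s)" using norm_triangle_ineq2[of 1 "- s"] by simp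
      then show ?thesis using s2 by linarith
    qed
    have "ln (cmod c) + ln (cmod y) = ln (cmod c * cmod y)"
      using c y0 by (simp add: ln_mult_pos)
    also have "\<dots> = ln (cmod w) + ln (cmod (1 + s))"
      unfolding eq using w0 pos by (simp add: ln_mult_pos)
    finally have "ln (cmod c) + ln (cmod y) = ln (cmod w) + ln (cmod (1 + s))" .
    then have lny: "ln (cmod y) = ln (cmod w) - ln (cmod c) + ln (cmod (1 + s))" by simp
    \<comment> \<open>Four errors: the nonlinear part of the logarithm, \<open>S x\<close> replaced
      by \<open>S 0\<close>, the Taylor remainder of the height, and \<open>x\<close> replaced by
      \<open>c / w\<close>. The constant \<open>K\<close> is the sum of their bounds.\<close>
    define E1 where "E1 = ln (cmod (1 + s)) - Re s"
    define E2 where "E2 = Re (S x / w) - Re (S 0 / w)"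
    define E3 where "E3 = \<sigma> x - \<sigma> 0 - Re (\<mu> * x)"
    define E4 where "E4 = Re (\<mu> * (x - c / w))"
    have "\<bar>E1\<bar> \<le> 2 * (cmod s)\<^sup>2" unfolding E1_def by (rule ln_norm_one_plus[OF s2])
    also have "\<dots> \<le> 2 * (B / cmod w)\<^sup>2" using sb by (intro mult_left_mono power_mono) auto
    finally have "\<bar>E1\<bar> \<le> 2 * (B / cmod w)\<^sup>2" .
    then have "\<bar>a\<bar> * \<bar>E1\<bar> \<le> \<bar>a\<bar> * (2 * (B / cmod w)\<^sup>2)" by (rule mult_left_mono) simp
    then have E1: "\<bar>a * E1\<bar> \<le> \<bar>a\<bar> * (2 * B\<^sup>2) * (1 / (cmod w)\<^sup>2)"
      by (simp add: abs_mult power_divide)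
    have "\<bar>E2\<bar> \<le> cmod (S x - S 0) / cmod w"
      using abs_Re_le_cmod[of "(S x - S 0) / w"] unfolding E2_def minus_complex.sel[symmetric] diff_divide_distrib[symmetric]
      by (simp only: norm_divide)
    also have "\<dots> \<le> (L * cmod x) / cmod w"
      using L(2)[OF xb, of 0] R0 w0 by (intro divide_right_mono) auto
    also have "\<dots> \<le> (L * (2 * cmod c / cmod w)) / cmod w"
      using xw L(1) w0 by (intro divide_right_mono mult_left_mono) auto
    finally have "\<bar>E2\<bar> \<le> 2 * L * cmod c * (1 / (cmod w)\<^sup>2)"
      by (simp add: power2_eq_square mult_ac)
    then have E2: "\<bar>a * E2\<bar> \<le> \<bar>a\<bar> * (2 * L * cmod c) * (1 / (cmod w)\<^sup>2)"
      unfolding abs_mult mult.assoc by (intro mult_left_mono) (auto simp: mult.assoc)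
    have "\<bar>E3\<bar> \<le> L * (cmod x)\<^sup>2" unfolding E3_def \<mu>_def by (rule L(3)[OF xb])
    also have "\<dots> \<le> L * (2 * cmod c / cmod w)\<^sup>2"
      using xw L(1) by (intro mult_left_mono power_mono) auto
    finally have E3: "\<bar>E3\<bar> \<le> 4 * L * (cmod c)\<^sup>2 * (1 / (cmod w)\<^sup>2)"
      by (simp add: power_divide power_mult_distrib mult_ac)
    have "x - c / w = c * (w - c * y) / ((c * y) * w)"
      using c y0 w0 by (simp add: x_def field_simps)
    then have "x - c / w = c * S x / ((c * y) * w)" by (simp add: cy)
    then have "cmod (x - c / w) = cmod c * cmod (S x) / (cmod (c * y) * cmod w)"
      by (simp add: norm_divide norm_mult)
    also have "\<dots> \<le> cmod c * B / ((cmod w / 2) * cmod w)"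
    proof -
      have "cmod (c * y) > 0" using cyb w0 by linarith
      then show ?thesis
        using SB cyb w0 B_nonneg by (intro frac_le mult_left_mono mult_right_mono mult_pos_pos) auto
    qed
    finally have "cmod (x - c / w) \<le> 2 * cmod c * B * (1 / (cmod w)\<^sup>2)"
      by (simp add: power2_eq_square mult_ac)
    then have "cmod (\<mu> * (x - c / w)) \<le> cmod \<mu> * (2 * cmod c * B) * (1 / (cmod w)\<^sup>2)"
      unfolding norm_mult mult.assoc by (intro mult_left_mono) (auto simp: mult.assoc)
    then have E4: "\<bar>E4\<bar> \<le> cmod \<mu> * (2 * cmod c * B) * (1 / (cmod w)\<^sup>2)"
      unfolding E4_def using abs_Re_le_cmod[of "\<mu> * (x - c / w)"] by linarith
    have "Re (\<kappa> / w) = (Re \<kappa> * Re w + Im \<kappa> * Im w) / (cmod w)\<^sup>2"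
      by (simp add: Re_divide cmod_power2)
    moreover have "Re (\<kappa> / w) = a * Re (S 0 / w) + Re (\<mu> * (c / w))"
    proof -
      have "Re (of_real a * u) = a * Re u" for u by simp
      moreover have "\<kappa> / w = of_real a * (S 0 / w) + \<mu> * (c / w)"
        by (simp add: \<kappa>_def add_divide_distrib)
      ultimately show ?thesis by (simp only: plus_complex.sel)
    qed
    ultimately have \<kappa>: "(Re \<kappa> * Re w + Im \<kappa> * Im w) / (cmod w)\<^sup>2 = a * Re (S 0 / w) + Re (\<mu> * (c / w))"
      by simp
    have "f w = - a * (ln (cmod w) - ln (cmod c) + (E1 + Re s)) + \<sigma> x"
      using f_inverse[OF wR] lny by (simp add: E1_def y_def x_def)
    also have "\<dots> = - a * ln (cmod w) + b + (a * Re (S 0 / w) + Re (\<mu> * (c / w))) + (a * E2 - a * E1 + E3 + E4)"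
      unfolding E2_def E3_def E4_def b_def s_def by (simp add: algebra_simps)
    finally have "f w - (- a * ln (cmod w) + b + (Re \<kappa> * Re w + Im \<kappa> * Im w) / (cmod w)\<^sup>2) = a * E2 - a * E1 + E3 + E4"
      unfolding \<kappa> by simp
    moreover have "\<bar>a * E2 - a * E1 + E3 + E4\<bar> \<le> K * (1 / (cmod w)\<^sup>2)"
      using E1 E2 E3 E4 unfolding K_def distrib_right by linarith
    ultimately show ?thesis by simp
  qed
  have "(\<lambda>w. f w - (- a * ln (norm w) + b + (Re \<kappa> * Re w + Im \<kappa> * Im w) / (norm w)\<^sup>2))
     \<in> O[at_infinity](\<lambda>w. 1 / (norm w)\<^sup>2)"
  proof (rule bigoI[of _ K])
    show "\<forall>\<^sub>F w in at_infinity. norm (f w - (- a * ln (norm w) + b + (Re \<kappa> * Re w + Im \<kappa> * Im w) / (norm w)\<^sup>2))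
      \<le> K * norm (1 / (norm w)\<^sup>2)"
      unfolding eventually_at_infinity using main by (intro exI[of _ "max (Rw + 1) (2 * B + 1)"]) auto
  qed
  then show ?thesis by blast
qed

end

section \<open>The alternating surfaces\<close>

definition hv :: "complex \<Rightarrow> real^3" where
  "hv z = vector [Re z, Im z, 0]"

definition vertical :: "real^3" where
  "vertical = vector [0, 0, 1]"

lemma hv_nth [simp]: "hv z $ 1 = Re z" "hv z $ 2 = Im z" "hv z $ 3 = 0"
  by (simp_all add: hv_def)

lemma vertical_nth [simp]: "vertical $ 1 = 0" "vertical $ 2 = 0" "vertical $ 3 = 1"
  by (simp_all add: vertical_def)

lemma inner_3: "(x::real^3) \<bullet> y = x $ 1 * y $ 1 + x $ 2 * y $ 2 + x $ 3 * y $ 3"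
  by (simp add: inner_vec_def sum_3)

lemma hv_inner: "hv z \<bullet> hv w = Re (z * cnj w)"
  by (simp add: inner_3)

lemma hv_vertical [simp]: "hv z \<bullet> vertical = 0" "vertical \<bullet> hv z = 0" "vertical \<bullet> vertical = 1"
  by (simp_all add: inner_3)

lemma hv_add: "hv (z + w) = hv z + hv w" and hv_scale: "hv (of_real r * z) = r *\<^sub>R hv z"
  by (simp_all add: vec_eq_iff forall_3)

lemma hv_sum: "hv (\<Sum>i\<in>A. f i) = (\<Sum>i\<in>A. hv (f i))"
  by (induction A rule: infinite_finite_induct) (simp_all add: hv_add vec_eq_iff forall_3)

lemma frame_decomposition:
  assumes "cmod z = 1"
  shows "x = (x \<bullet> hv z) *\<^sub>R hv z + (x \<bullet> hv (\<i> * z)) *\<^sub>R hv (\<i> * z) + (x $ 3) *\<^sub>R vertical"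
proof -
  have "(Re z)\<^sup>2 + (Im z)\<^sup>2 = 1" using assms by (simp add: cmod_power2[symmetric])
  then have 1: "Re z * Re z + Im z * Im z = 1" by (simp add: power2_eq_square)
  have "(x $ 1 * Re z + x $ 2 * Im z) * Re z + (- (x $ 1 * Im z) + x $ 2 * Re z) * - Im z
      = x $ 1 * (Re z * Re z + Im z * Im z)"
    "(x $ 1 * Re z + x $ 2 * Im z) * Im z + (- (x $ 1 * Im z) + x $ 2 * Re z) * Re z
      = x $ 2 * (Re z * Re z + Im z * Im z)"
    by (simp_all add: algebra_simps)
  then show ?thesis
    unfolding 1 by (simp add: vec_eq_iff forall_3 inner_3)
qed

section \<open>Power sums and partial fractions over roots of unity\<close>

lemma sum_powers_roots:
  assumes "n > 0" "\<not> n dvd j"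
  shows "(\<Sum>z | z ^ n = (e::complex). z ^ j) = 0"
proof -
  define w where "w = cis (2 * pi / n)"
  have wn: "w ^ n = 1" unfolding w_def Complex.DeMoivre using assms by simp
  have wj: "w ^ j \<noteq> 1"
  proof
    assume "w ^ j = 1"
    then have "cis (real j * (2 * pi / n)) = 1" by (simp add: w_def Complex.DeMoivre)
    then have "cos (real j * (2 * pi / n)) = 1" by (simp add: complex_eq_iff)
    then obtain k :: int where "real j * (2 * pi / n) = k * 2 * pi"
      unfolding cos_one_2pi_int by auto
    then have "real j = real_of_int k * n" using assms by (simp add: field_simps)
    then have "int j = k * int n" by (metis of_int_eq_iff of_int_mult of_int_of_nat_eq)
    then have "int n dvd int j" by simp
    then show False using assms by simp
  qed
  have "w \<noteq> 0" using wn assms by (auto simp: power_0_left)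
  \<comment> \<open>Multiplication by the root of unity \<open>w\<close> permutes the solutions and
    multiplies the sum by \<open>w ^ j\<close>, which is not 1.\<close>
  have "(\<Sum>z | z ^ n = e. z ^ j) = (\<Sum>z | z ^ n = e. (w * z) ^ j)"
  proof (rule sum.reindex_bij_witness[of _ "\<lambda>z. w * z" "\<lambda>z. z / w"])
    fix z assume "z \<in> {z. z ^ n = e}"
    then show "z / w \<in> {z. z ^ n = e}" "w * z \<in> {z. z ^ n = e}"
      using wn by (simp_all add: power_divide power_mult_distrib)
  qed (use \<open>w \<noteq> 0\<close> in auto)
  also have "\<dots> = w ^ j * (\<Sum>z | z ^ n = e. z ^ j)"
    by (simp add: power_mult_distrib sum_distrib_left)
  finally show ?thesis using wj by simp
qed

text \<open>Expand \<open>(z ^ n - x ^ n) / (z - x)\<close> as a geometric sum; of the resulting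
  power sums over the roots only the one with exponent \<open>n\<close> survives, at
  \<open>i = m - 1\<close>.\<close>

lemma sum_roots_fraction:
  fixes z e :: complex
  assumes "n > 0" "e \<noteq> 0" "z ^ n \<noteq> e" "1 \<le> m" "m \<le> n"
  shows "(\<Sum>x | x ^ n = e. x ^ m / (z - x)) = of_nat n * e * z ^ (m - 1) / (z ^ n - e)"
proof -
  let ?R = "{x. x ^ n = e}"
  have card: "card ?R = n" using assms card_nth_roots by blast
  have "x ^ m / (z - x) = (\<Sum>i<n. z ^ i * x ^ (n - 1 - i + m)) / (z ^ n - e)" if "x \<in> ?R" for x
  proof -
    have xe: "x ^ n = e" and "z \<noteq> x" using that assms by auto
    have "z ^ n - e = (z - x) * (\<Sum>i<n. x ^ (n - Suc i) * z ^ i)"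
      using power_diff_sumr2[of z n x] xe by simp
    moreover have "(\<Sum>i<n. x ^ (n - Suc i) * z ^ i) * x ^ m = (\<Sum>i<n. z ^ i * x ^ (n - 1 - i + m))"
      unfolding sum_distrib_right
    proof (rule sum.cong[OF refl])
      fix i
      have "x ^ (n - 1 - i + m) = x ^ (n - Suc i) * x ^ m"
        by (metis power_add diff_diff_left plus_1_eq_Suc)
      then show "x ^ (n - Suc i) * z ^ i * x ^ m = z ^ i * x ^ (n - 1 - i + m)"
        by (simp only: mult_ac)
    qed
    ultimately have "(z ^ n - e) * x ^ m = (z - x) * (\<Sum>i<n. z ^ i * x ^ (n - 1 - i + m))"
      by (simp only: mult.assoc)
    then show ?thesis using assms \<open>z \<noteq> x\<close> by (simp add: field_simps)
  qed
  then have "(\<Sum>x\<in>?R. x ^ m / (z - x)) = (\<Sum>x\<in>?R. (\<Sum>i<n. z ^ i * x ^ (n - 1 - i + m)) / (z ^ n - e))"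
    by (rule sum.cong[OF refl])
  also have "\<dots> = (\<Sum>i<n. z ^ i * (\<Sum>x\<in>?R. x ^ (n - 1 - i + m))) / (z ^ n - e)"
    by (simp add: sum_divide_distrib[symmetric] sum_distrib_left sum.swap[of _ "{..<n}"])
  also have "(\<Sum>i<n. z ^ i * (\<Sum>x\<in>?R. x ^ (n - 1 - i + m))) = (\<Sum>i<n. if i = m - 1 then of_nat n * e * z ^ (m - 1) else 0)"
  proof (rule sum.cong[OF refl])
    fix i assume i: "i \<in> {..<n}"
    show "z ^ i * (\<Sum>x\<in>?R. x ^ (n - 1 - i + m)) = (if i = m - 1 then of_nat n * e * z ^ (m - 1) else 0)"
    proof (cases "i = m - 1")
      case True
      then have "n - 1 - i + m = n" using assms by simp
      then have "(\<Sum>x\<in>?R. x ^ (n - 1 - i + m)) = (\<Sum>x\<in>?R. e)" by simp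
      then show ?thesis using True card by simp
    next
      case False
      have "\<not> n dvd n - 1 - i + m"
      proof
        assume "n dvd n - 1 - i + m"
        then obtain k where k: "n - 1 - i + m = n * k" by (elim dvdE)
        \<comment> \<open>The exponent lies strictly between 0 and \<open>2 * n\<close>, so the only
          possible multiple is \<open>n\<close> itself.\<close>
        have "0 < n - 1 - i + m" "n - 1 - i + m < n * 2" using i assms by auto
        then have "0 < k" "k < 2" using k by (auto intro: Nat.gr0I)
        then have "k = 1" by simp
        then show False using k i False assms by simp
      qed
      then show ?thesis using False sum_powers_roots[OF assms(1)] by simp
    qed
  qed
  also have "\<dots> = of_nat n * e * z ^ (m - 1)" using assms by simp
  finally show ?thesis .
qed

text \<open>Minus the derivative of \<open>sum_roots_fraction\<close> in \<open>z\<close>, an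
  identity on an open set. For \<open>m = 1\<close> the truncated exponent \<open>m - 2\<close> is
  harmless, since its coefficient is 0.\<close>

lemma sum_roots_fraction_square:
  fixes z e :: complex
  assumes "n > 0" "e \<noteq> 0" "z ^ n \<noteq> e" "1 \<le> m" "m \<le> n"
  shows "(\<Sum>x | x ^ n = e. x ^ m / (z - x)\<^sup>2) = of_nat n * e *
    (z ^ (m - 1) * (of_nat n * z ^ (n - 1)) - of_nat (m - 1) * z ^ (m - 2) * (z ^ n - e)) / (z ^ n - e)\<^sup>2"
proof -
  let ?R = "{x. x ^ n = e}"
  define V where "V = {z::complex. z ^ n \<noteq> e}"
  have "open V"
    unfolding V_def by (intro open_Collect_neq continuous_intros)
  have zx: "z - x \<noteq> 0" if "x \<in> ?R" for x using that assms by auto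
  have "((\<lambda>z. \<Sum>x\<in>?R. x ^ m / (z - x)) has_field_derivative (\<Sum>x\<in>?R. - (x ^ m / (z - x)\<^sup>2))) (at z)"
    using zx by (auto intro!: DERIV_sum derivative_eq_intros simp: power2_eq_square)
  moreover have "((\<lambda>z. of_nat n * e * z ^ (m - 1) / (z ^ n - e)) has_field_derivative
     - (of_nat n * e * (z ^ (m - 1) * (of_nat n * z ^ (n - 1)) - of_nat (m - 1) * z ^ (m - 2) * (z ^ n - e)) / (z ^ n - e)\<^sup>2)) (at z)"
    using assms by (auto intro!: derivative_eq_intros simp: power2_eq_square diff_diff_add numeral_2_eq_2 algebra_simps
        minus_divide_left)
  then have "((\<lambda>z. \<Sum>x\<in>?R. x ^ m / (z - x)) has_field_derivative
     - (of_nat n * e * (z ^ (m - 1) * (of_nat n * z ^ (n - 1)) - of_nat (m - 1) * z ^ (m - 2) * (z ^ n - e)) / (z ^ n - e)\<^sup>2)) (at z)"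
  proof (rule has_field_derivative_transform_within_open[OF _ \<open>open V\<close>])
    show "z \<in> V" using assms by (simp add: V_def)
    show "of_nat n * e * y ^ (m - 1) / (y ^ n - e) = (\<Sum>x\<in>?R. x ^ m / (y - x))" if "y \<in> V" for y
      using sum_roots_fraction[of n e y m] assms that by (simp add: V_def)
  qed
  ultimately have "(\<Sum>x\<in>?R. - (x ^ m / (z - x)\<^sup>2)) =
     - (of_nat n * e * (z ^ (m - 1) * (of_nat n * z ^ (n - 1)) - of_nat (m - 1) * z ^ (m - 2) * (z ^ n - e)) / (z ^ n - e)\<^sup>2)"
    by (rule DERIV_unique)
  then show ?thesis by (simp add: sum_negf)
qed

text \<open>\<beta> and \<gamma> are the coefficients of the spinors at the two kinds of punctures,
  so both are nonzero. The condition \<open>\<beta> + \<gamma> \<noteq> 0\<close> rules out a common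
  zero of the spinors at 0.\<close>

locale alternating =
  fixes n :: nat and \<beta> \<gamma> :: real
  assumes n: "n \<ge> 2" and \<beta>: "\<beta> \<noteq> 0" and \<gamma>: "\<gamma> \<noteq> 0" and \<beta>\<gamma>: "\<beta> + \<gamma> \<noteq> 0"
begin

definition Zr :: "complex \<Rightarrow> complex set" where
  "Zr e = {z. z ^ n = e}"

definition Z :: "complex set" where
  "Z = Zr 1 \<union> Zr (- 1)"

definition wt :: "complex \<Rightarrow> real" where
  "wt z = (if z ^ n = 1 then \<beta> else \<gamma>)"

text \<open>The coefficient of the simple pole along \<open>hv x\<close>, that is, the flux up to
  sign and the factor \<open>2 * pi\<close>. It is \<open>2 * wt x\<close> times the sum of
  \<open>wt y * x / (x - y)\<close> over the other punctures \<open>y\<close>; that it is real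
  closes the periods.\<close>

definition fl :: "complex \<Rightarrow> real" where
  "fl z = (if z ^ n = 1 then \<beta> * ((real n - 1) * \<beta> + real n * \<gamma>) else \<gamma> * ((real n - 1) * \<gamma> + real n * \<beta>))"

text \<open>The term of \<open>hv x\<close> contributes, up to the factor \<open>wt x\<^sup>2 / 2\<close>, the negative of the
  stereographic projection from \<open>hv x\<close>, and a logarithm along the axis \<open>hv x\<close>.\<close>

definition X :: "real^3 \<Rightarrow> real^3" where
  "X p = (\<Sum>x\<in>Z. (fl x / 2 * ln (1 - p \<bullet> hv x)) *\<^sub>R hv x
     - ((wt x)\<^sup>2 / (2 * (1 - p \<bullet> hv x))) *\<^sub>R (p - (p \<bullet> hv x) *\<^sub>R hv x))"

definition spin1 :: "complex \<Rightarrow> complex" where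
  "spin1 z = of_nat n * (of_real \<beta> / (z ^ n - 1) - of_real \<gamma> / (z ^ n + 1))"

definition spin2 :: "complex \<Rightarrow> complex" where
  "spin2 z = of_nat n * z ^ (n - 1) * (of_real \<beta> / (z ^ n - 1) + of_real \<gamma> / (z ^ n + 1))"

lemma n_pos [simp]: "n > 0" "n \<noteq> 0"
  using n by auto

lemma finite_Zr: "e \<noteq> 0 \<Longrightarrow> finite (Zr e)" and card_Zr: "e \<noteq> 0 \<Longrightarrow> card (Zr e) = n"
  using card_nth_roots[of e n] finite_nth_roots[of n e] by (simp_all add: Zr_def)

lemma finite_Z: "finite Z"
  by (simp add: Z_def finite_Zr)

lemma Zr_disjoint: "Zr 1 \<inter> Zr (- 1) = {}"
  by (auto simp: Zr_def)

lemma sum_Z: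
  fixes g :: "complex \<Rightarrow> 'a::comm_monoid_add"
  shows "(\<Sum>x\<in>Z. g x) = (\<Sum>x\<in>Zr 1. g x) + (\<Sum>x\<in>Zr (- 1). g x)"
  unfolding Z_def using finite_Zr Zr_disjoint by (intro sum.union_disjoint) auto

lemma card_Z: "card Z = 2 * n"
  unfolding Z_def using finite_Zr card_Zr Zr_disjoint by (subst card_Un_disjoint) auto

lemma Z_iff: "z \<in> Z \<longleftrightarrow> z ^ n = 1 \<or> z ^ n = -1"
  by (auto simp: Z_def Zr_def)

lemma norm_Z: "z \<in> Z \<Longrightarrow> cmod z = 1"
proof -
  assume "z \<in> Z"
  then have "cmod z ^ n = 1" by (auto simp: Z_iff simp flip: norm_power)
  then show ?thesis using power_eq_1_iff[of "cmod z" n] by simp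
qed

lemma Z_nonzero: "z \<in> Z \<Longrightarrow> z \<noteq> 0"
  by (metis norm_Z norm_zero zero_neq_one)

lemma cnj_Z: "z \<in> Z \<Longrightarrow> cnj z = 1 / z"
  using norm_Z[of z] complex_norm_square[of z] Z_nonzero[of z] by (simp add: field_simps)

lemma inverse_Z: "z \<in> Z \<Longrightarrow> 1 / z \<in> Z"
  unfolding Z_iff power_one_over by (elim disjE) simp_all

lemma wt_Zr: "x \<in> Zr 1 \<Longrightarrow> wt x = \<beta>" "x \<in> Zr (- 1) \<Longrightarrow> wt x = \<gamma>"
  by (auto simp: wt_def Zr_def)

lemma fl_Zr: "x \<in> Zr 1 \<Longrightarrow> fl x = \<beta> * ((real n - 1) * \<beta> + real n * \<gamma>)"
  "x \<in> Zr (- 1) \<Longrightarrow> fl x = \<gamma> * ((real n - 1) * \<gamma> + real n * \<beta>)"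
  by (auto simp: fl_def Zr_def)

lemma sum_Zr: "(\<Sum>x\<in>Zr e. x) = 0"
  using sum_powers_roots[of n 1 e] n by (simp add: Zr_def)

text \<open>The balancing of fluxes: the roots of each kind sum to 0, because
  \<open>n \<ge> 2\<close>.\<close>

lemma sum_fl_hv: "(\<Sum>x\<in>Z. (r * fl x) *\<^sub>R hv x) = 0"
proof -
  have *: "(\<Sum>x\<in>Zr e. (r * fl x) *\<^sub>R hv x) = 0" if "\<And>x. x \<in> Zr e \<Longrightarrow> fl x = c" for c e
  proof -
    have "(\<Sum>x\<in>Zr e. (r * fl x) *\<^sub>R hv x) = (r * c) *\<^sub>R (\<Sum>x\<in>Zr e. hv x)"
      using that by (simp add: scaleR_sum_right)
    also have "(\<Sum>x\<in>Zr e. hv x) = 0"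
      unfolding hv_sum[symmetric] sum_Zr by (simp add: vec_eq_iff forall_3)
    finally show ?thesis by simp
  qed
  show ?thesis
    unfolding sum_Z using *[of 1, OF fl_Zr(1)] *[of "-1", OF fl_Zr(2)] by simp
qed

section \<open>From the closed form of the immersion to its Weierstrass data\<close>

lemma one_minus_inner:
  assumes "cmod x = 1"
  shows "1 - inv_stereographic z \<bullet> hv x = (cmod (z - x))\<^sup>2 / (1 + (cmod z)\<^sup>2)"
proof -
  have x1: "(Re x)\<^sup>2 + (Im x)\<^sup>2 = 1" using assms by (simp add: cmod_power2[symmetric])
  have "inv_stereographic z \<bullet> hv x = (2 * Re z * Re x + 2 * Im z * Im x) / (1 + (cmod z)\<^sup>2)"
    by (simp add: inner_3 add_divide_distrib)
  then have "1 - inv_stereographic z \<bullet> hv x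
      = ((1 + (cmod z)\<^sup>2) - (2 * Re z * Re x + 2 * Im z * Im x)) / (1 + (cmod z)\<^sup>2)"
    by (simp add: diff_divide_distrib)
  also have "(1 + (cmod z)\<^sup>2) - (2 * Re z * Re x + 2 * Im z * Im x) = (cmod (z - x))\<^sup>2"
    using x1 unfolding cmod_power2 by (simp add: power2_eq_square algebra_simps)
  finally show ?thesis .
qed

lemma fraction_parts:
  assumes "cmod x = 1" "z \<noteq> x"
  shows "Im (x / (z - x)) = Im (x * cnj z) / (cmod (z - x))\<^sup>2"
    "Re (x / (z - x)) + 1/2 = ((cmod z)\<^sup>2 - 1) / (2 * (cmod (z - x))\<^sup>2)"
proof -
  have pos: "(cmod (z - x))\<^sup>2 \<noteq> 0" using assms by simp
  have x1: "x * cnj x = 1" using assms complex_norm_square[of x] by simp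
  have *: "x / (z - x) = (x * cnj z - 1) / of_real ((cmod (z - x))\<^sup>2)"
  proof -
    have "x / (z - x) = x * cnj (z - x) / ((z - x) * cnj (z - x))" using assms by simp
    then show ?thesis by (simp only: complex_norm_square complex_cnj_diff right_diff_distrib x1)
  qed
  show "Im (x / (z - x)) = Im (x * cnj z) / (cmod (z - x))\<^sup>2"
    unfolding * Im_divide_of_real by simp
  have xx: "Re x * Re x + Im x * Im x = 1" using x1 by (simp add: complex_eq_iff)
  have "2 * (Re (x * cnj z) - 1) + (cmod (z - x))\<^sup>2 = (cmod z)\<^sup>2 - 1"
    unfolding cmod_power2 using xx by (simp add: power2_eq_square algebra_simps)
  then have "(Re (x * cnj z) - 1) / (cmod (z - x))\<^sup>2 + 1/2 = ((cmod z)\<^sup>2 - 1) / (2 * (cmod (z - x))\<^sup>2)"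
    using pos by (simp add: field_simps)
  then show "Re (x / (z - x)) + 1/2 = ((cmod z)\<^sup>2 - 1) / (2 * (cmod (z - x))\<^sup>2)"
    unfolding * Re_divide_of_real by simp
qed

text \<open>\<open>x / (z - x) + 1/2\<close> is \<open>(z + x) / (2 * (z - x))\<close>, which only
  changes sign when \<open>z\<close> and \<open>x\<close> are both inverted. The constant 1/2 is
  thus what makes the vertical component compatible with the half turn.\<close>

definition Xterm :: "complex \<Rightarrow> complex \<Rightarrow> real^3" where
  "Xterm x z = (fl x * ln (cmod (z - x))) *\<^sub>R hv x + ((wt x)\<^sup>2 * Im (x / (z - x))) *\<^sub>R hv (\<i> * x)
     - ((wt x)\<^sup>2 * (Re (x / (z - x)) + 1/2)) *\<^sub>R vertical"

text \<open>Writing \<open>1 - p \<bullet> hv x\<close> through the distance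
  \<open>cmod (z - x)\<close> splits \<open>ln (1 + (cmod z)\<^sup>2)\<close> off every logarithm.
  These terms cancel by \<open>sum_fl_hv\<close>, and the rest is harmonic in
  \<open>z\<close>.\<close>

lemma X_inv_stereographic:
  assumes "z \<notin> Z"
  shows "X (inv_stereographic z) = (\<Sum>x\<in>Z. Xterm x z)"
proof -
  let ?p = "inv_stereographic z" and ?m = "1 + (cmod z)\<^sup>2"
  have "(fl x / 2 * ln (1 - ?p \<bullet> hv x)) *\<^sub>R hv x - ((wt x)\<^sup>2 / (2 * (1 - ?p \<bullet> hv x))) *\<^sub>R (?p - (?p \<bullet> hv x) *\<^sub>R hv x)
      = Xterm x z + (- ln ?m / 2 * fl x) *\<^sub>R hv x" if x: "x \<in> Z" for x
  proof -
    have x1: "cmod x = 1" and zx: "z \<noteq> x" using norm_Z x assms by auto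
    have pos: "(cmod (z - x))\<^sup>2 > 0" using zx by simp
    have m: "?m > 0" by (rule one_plus_norm2_pos)
    have ln: "ln (1 - ?p \<bullet> hv x) = 2 * ln (cmod (z - x)) - ln ?m"
      unfolding one_minus_inner[OF x1] using pos m zx by (simp add: ln_div ln_realpow)
    have "?p - (?p \<bullet> hv x) *\<^sub>R hv x = (?p \<bullet> hv (\<i> * x)) *\<^sub>R hv (\<i> * x) + (?p $ 3) *\<^sub>R vertical"
    proof -
      have "y - a = b + c" if "y = a + b + c" for y a b c :: "real^3" using that by simp
      then show ?thesis using frame_decomposition[OF x1, of ?p] .
    qed
    moreover have "?p \<bullet> hv (\<i> * x) = - 2 * Im (x * cnj z) / ?m"
    proof -
      have "?p \<bullet> hv (\<i> * x) = (2 * Re z) / ?m * (- Im x) + (2 * Im z) / ?m * Re x"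
        by (simp add: inner_3)
      also have "\<dots> = ((2 * Re z) * (- Im x) + (2 * Im z) * Re x) / ?m"
        by (simp only: add_divide_distrib times_divide_eq_left)
      finally show ?thesis by (simp add: algebra_simps)
    qed
    moreover have coef: "(wt x)\<^sup>2 / (2 * (1 - ?p \<bullet> hv x)) * (u / ?m) = (wt x)\<^sup>2 * (u / (2 * (cmod (z - x))\<^sup>2))" for u
    proof -
      have "v / (2 * (d / m)) * (u / m) = v * (u / (2 * d))" if "d \<noteq> 0" "m \<noteq> 0" for v d m :: real
        using that by (simp add: field_simps)
      then show ?thesis unfolding one_minus_inner[OF x1] using m pos by simp
    qed
    ultimately have "((wt x)\<^sup>2 / (2 * (1 - ?p \<bullet> hv x))) *\<^sub>R (?p - (?p \<bullet> hv x) *\<^sub>R hv x) =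
        ((wt x)\<^sup>2 * (- 2 * Im (x * cnj z) / (2 * (cmod (z - x))\<^sup>2))) *\<^sub>R hv (\<i> * x)
        + ((wt x)\<^sup>2 * (((cmod z)\<^sup>2 - 1) / (2 * (cmod (z - x))\<^sup>2))) *\<^sub>R vertical"
      unfolding inv_stereographic_nth by (simp only: scaleR_add_right scaleR_scaleR coef)
    also have "\<dots> = - ((wt x)\<^sup>2 * Im (x / (z - x))) *\<^sub>R hv (\<i> * x) + ((wt x)\<^sup>2 * (Re (x / (z - x)) + 1/2)) *\<^sub>R vertical"
    proof -
      have f1: "- 2 * Im (x * cnj z) / (2 * (cmod (z - x))\<^sup>2) = - Im (x / (z - x))"
      proof -
        have "- 2 * u / (2 * d) = - (- (- u / d))" for u d :: real by simp
        then show ?thesis using fraction_parts(1)[OF x1 zx] by (simp only: minus_minus minus_divide_left)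
      qed
      show ?thesis unfolding f1 fraction_parts(2)[OF x1 zx] by simp
    qed
    finally show ?thesis
      unfolding Xterm_def ln by (simp add: algebra_simps scaleR_diff_left)
  qed
  then have "X ?p = (\<Sum>x\<in>Z. Xterm x z) + (\<Sum>x\<in>Z. (- ln ?m / 2 * fl x) *\<^sub>R hv x)"
    unfolding X_def sum.distrib[symmetric] by (intro sum.cong refl)
  then show ?thesis unfolding sum_fl_hv by simp
qed

text \<open>The simple pole points along the axis \<open>hv x\<close>; the double poles lie in the
  plane orthogonal to it and carry no residue.\<close>

definition dXterm :: "complex \<Rightarrow> complex \<Rightarrow> complex^3" where
  "dXterm x z = (\<chi> i. of_real (fl x) / (z - x) * of_real (hv x $ i)
     + \<i> * x * of_real ((wt x)\<^sup>2) / (z - x)\<^sup>2 * of_real (hv (\<i> * x) $ i)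
     + x * of_real ((wt x)\<^sup>2) / (z - x)\<^sup>2 * of_real (vertical $ i))"

lemma has_derivative_Xterm:
  assumes "z \<noteq> x"
  shows "(Xterm x has_derivative (\<lambda>h. reV (h *s dXterm x z))) (at z)"
proof -
  have zx: "z - x \<noteq> 0" using assms by simp
  have "((\<lambda>z. z - x) has_derivative (\<lambda>h. h)) (at z)" by (auto intro!: derivative_eq_intros)
  then have 1: "((\<lambda>z. ln (cmod (z - x))) has_derivative (\<lambda>h. Re (h / (z - x)))) (at z)"
    by (rule has_derivative_compose) (rule has_derivative_ln_norm[OF zx])
  have "((\<lambda>z. x / (z - x)) has_field_derivative - x / (z - x)\<^sup>2) (at z)"
    using zx by (auto intro!: derivative_eq_intros simp: power2_eq_square)
  then have d: "((\<lambda>z. x / (z - x)) has_derivative (\<lambda>h. - x / (z - x)\<^sup>2 * h)) (at z)"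
    unfolding has_field_derivative_def .
  have "(Xterm x has_derivative (\<lambda>h. (fl x * Re (h / (z - x))) *\<^sub>R hv x
      + ((wt x)\<^sup>2 * Im (- x / (z - x)\<^sup>2 * h)) *\<^sub>R hv (\<i> * x) - ((wt x)\<^sup>2 * (Re (- x / (z - x)\<^sup>2 * h) + 0)) *\<^sub>R vertical)) (at z)"
    unfolding Xterm_def
    by (intro has_derivative_add has_derivative_diff has_derivative_scaleR_left has_derivative_mult_right
        has_derivative_Re has_derivative_Im d 1 has_derivative_const)
  moreover have "(fl x * Re (h / (z - x))) *\<^sub>R hv x
      + ((wt x)\<^sup>2 * Im (- x / (z - x)\<^sup>2 * h)) *\<^sub>R hv (\<i> * x) - ((wt x)\<^sup>2 * (Re (- x / (z - x)\<^sup>2 * h) + 0)) *\<^sub>R vertical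
      = reV (h *s dXterm x z)" for h
  proof -
    define u v where "u = h / (z - x)" and "v = x / (z - x)\<^sup>2 * h"
    have e: "h * (of_real (fl x) / (z - x) * of_real p + \<i> * x * of_real ((wt x)\<^sup>2) / (z - x)\<^sup>2 * of_real q
        + x * of_real ((wt x)\<^sup>2) / (z - x)\<^sup>2 * of_real r)
      = of_real (fl x * p) * u + of_real ((wt x)\<^sup>2 * q) * (\<i> * v) + of_real ((wt x)\<^sup>2 * r) * v" for p q r
      unfolding u_def v_def by (simp add: algebra_simps)
    have "- x / (z - x)\<^sup>2 * h = - v" by (simp add: v_def)
    then show ?thesis
      unfolding vec_eq_iff dXterm_def reV_nth vector_smult_component vec_lambda_beta e u_def[symmetric]
      by (simp add: algebra_simps)
  qed
  ultimately show ?thesis by simp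
qed

lemma roots_neq: "z \<notin> Z \<Longrightarrow> z ^ n - 1 \<noteq> 0 \<and> z ^ n + 1 \<noteq> 0"
  by (auto simp: Z_iff eq_neg_iff_add_eq_0)

lemma conj_Zr:
  assumes "x \<in> Zr e" "e = 1 \<or> e = -1"
  shows "1 / x = e * x ^ (n - 1)" "1 = e * x ^ n" "x \<noteq> 0" "cnj x = 1 / x"
proof -
  have "x \<in> Z" using assms by (auto simp: Z_def)
  then show "x \<noteq> 0" "cnj x = 1 / x" using Z_nonzero cnj_Z by auto
  show "1 = e * x ^ n" using assms by (auto simp: Zr_def)
  moreover have "x ^ n = x * x ^ (n - 1)" by (metis n_pos(1) power_eq_if n_pos(2))
  ultimately show "1 / x = e * x ^ (n - 1)" using \<open>x \<noteq> 0\<close> by (simp add: field_simps)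
qed

text \<open>For a Weierstrass vector with spinors \<open>s\<close>, \<open>t\<close> the
  corresponding combinations are \<open>t\<^sup>2\<close>, \<open>- s\<^sup>2\<close> and
  \<open>s * t\<close>, so each can be matched with a root sum on its own.\<close>

lemma dXterm_combinations:
  assumes x: "x \<in> Z"
  shows "dXterm x z $ 1 - \<i> * dXterm x z $ 2 = of_real (fl x) * (1 / x) / (z - x) + of_real ((wt x)\<^sup>2) / (z - x)\<^sup>2"
    "dXterm x z $ 1 + \<i> * dXterm x z $ 2 = of_real (fl x) * x / (z - x) - of_real ((wt x)\<^sup>2) * x\<^sup>2 / (z - x)\<^sup>2"
    "dXterm x z $ 3 = of_real ((wt x)\<^sup>2) * x / (z - x)\<^sup>2"
proof -
  define u v where "u = of_real (fl x) / (z - x)" and "v = of_real ((wt x)\<^sup>2) / (z - x)\<^sup>2"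
  have d: "dXterm x z $ 1 = u * of_real (Re x) - \<i> * x * v * of_real (Im x)"
    "dXterm x z $ 2 = u * of_real (Im x) + \<i> * x * v * of_real (Re x)" "dXterm x z $ 3 = x * v"
    by (simp_all add: dXterm_def u_def v_def)
  have c: "of_real (Re x) = cnj x + \<i> * of_real (Im x)" by (simp add: complex_eq_iff)
  have c2: "x = cnj x + 2 * \<i> * of_real (Im x)" by (simp add: complex_eq_iff)
  have xc: "x * cnj x = 1" using cnj_Z[OF x] Z_nonzero[OF x] by simp
  have "dXterm x z $ 1 - \<i> * dXterm x z $ 2 = u * (of_real (Re x) - \<i> * of_real (Im x)) + v * (x * (of_real (Re x) - \<i> * of_real (Im x)))"
    unfolding d by (simp add: algebra_simps)
  also have "of_real (Re x) - \<i> * of_real (Im x) = cnj x" by (simp add: complex_eq_iff)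
  finally show "dXterm x z $ 1 - \<i> * dXterm x z $ 2 = of_real (fl x) * (1 / x) / (z - x) + of_real ((wt x)\<^sup>2) / (z - x)\<^sup>2"
    unfolding xc unfolding cnj_Z[OF x] u_def v_def by simp
  have "dXterm x z $ 1 + \<i> * dXterm x z $ 2 = u * (of_real (Re x) + \<i> * of_real (Im x)) - v * (x * (of_real (Re x) + \<i> * of_real (Im x)))"
    unfolding d by (simp add: algebra_simps)
  also have "of_real (Re x) + \<i> * of_real (Im x) = x" by (simp add: complex_eq_iff)
  finally show "dXterm x z $ 1 + \<i> * dXterm x z $ 2 = of_real (fl x) * x / (z - x) - of_real ((wt x)\<^sup>2) * x\<^sup>2 / (z - x)\<^sup>2"
    unfolding u_def v_def by (simp add: power2_eq_square)
  show "dXterm x z $ 3 = of_real ((wt x)\<^sup>2) * x / (z - x)\<^sup>2"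
    unfolding d v_def by simp
qed

text \<open>This is the partial fraction decomposition of the squares and the product of the
  spinors. It is proved by evaluating the root sums in closed form, and it is the place where the
  values of \<open>fl\<close> are forced.\<close>

lemma weierstrass_sum:
  assumes z: "z \<notin> Z"
  shows "(\<Sum>x\<in>Z. dXterm x z) = weierstrass_vec (spin1 z) (spin2 z)"
proof -
  define p q where "p = 1 / (z ^ n - 1)" and "q = 1 / (z ^ n + 1)"
  \<comment> \<open>Since \<open>n \<ge> 2\<close>, all powers of \<open>z\<close> that occur can be
    written with \<open>y\<close> and nonnegative powers, which keeps \<open>z = 0\<close>
    included.\<close>
  define y where "y = z ^ (n - 2)"
  have zn: "z ^ n = y * z\<^sup>2" and zn1: "z ^ (n - 1) = y * z"
  proof -
    have "n = (n - 2) + 2" "n - 1 = (n - 2) + 1" using n by auto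
    then show "z ^ n = y * z\<^sup>2" "z ^ (n - 1) = y * z"
      unfolding y_def by (metis power_add, metis power_add power_one_right)
  qed
  have ne: "z ^ n - 1 \<noteq> 0" "z ^ n + 1 \<noteq> 0" "z ^ n \<noteq> 1" "z ^ n \<noteq> -1" using roots_neq[OF z] by auto
  \<comment> \<open>The relation for \<open>p - q\<close>, and the one for \<open>p + q\<close>
    below, turn linear terms in \<open>p\<close> and \<open>q\<close> into the mixed products that
    appear in the squares of the spinors.\<close>
  have pq: "z ^ n * p = 1 + p" "z ^ n * q = 1 - q" "p - q = 2 * (p * q)"
    using ne unfolding p_def q_def by (simp_all add: field_simps)
  have psum: "p + q = 2 * z ^ n * (p * q)"
    using ne unfolding p_def q_def by (simp add: field_simps)
  define N b g where "N = (of_nat n :: complex)" and "b = complex_of_real \<beta>" and "g = complex_of_real \<gamma>"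
  have afl: "complex_of_real (fl x) = b * ((N - 1) * b + N * g)" "complex_of_real ((wt x)\<^sup>2) = b\<^sup>2" if "x \<in> Zr 1" for x
    using fl_Zr(1)[OF that] wt_Zr(1)[OF that] by (simp_all add: N_def b_def g_def)
  have bfl: "complex_of_real (fl x) = g * ((N - 1) * g + N * b)" "complex_of_real ((wt x)\<^sup>2) = g\<^sup>2" if "x \<in> Zr (-1)" for x
    using fl_Zr(2)[OF that] wt_Zr(2)[OF that] by (simp_all add: N_def b_def g_def)
  have n1: "of_nat (n - 1) = N - 1" using n by (simp add: N_def of_nat_diff)
  have s12: "spin1 z = N * (b * p - g * q)" "spin2 z = N * (y * z) * (b * p + g * q)"
    unfolding spin1_def spin2_def p_def q_def N_def b_def g_def zn1 by simp_all
  have F: "(\<Sum>x\<in>Zr e. x ^ m / (z - x)) = N * e * z ^ (m - 1) / (z ^ n - e)"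
    "(\<Sum>x\<in>Zr e. x ^ m / (z - x)\<^sup>2) = N * e * (z ^ (m - 1) * (N * z ^ (n - 1)) - of_nat (m - 1) * z ^ (m - 2) * (z ^ n - e)) / (z ^ n - e)\<^sup>2"
    if "e = 1 \<or> e = -1" "1 \<le> m" "m \<le> n" for e m
    using sum_roots_fraction[of n e z m] sum_roots_fraction_square[of n e z m] that ne unfolding Zr_def N_def by auto
  have W1: "(\<Sum>x\<in>Zr e. A * (1 / x) / (z - x) + B / (z - x)\<^sup>2) =
      A * (N * y / (z ^ n - e)) + B * (N * (N * (y * z)\<^sup>2 - (N - 1) * y * (z ^ n - e)) / (z ^ n - e)\<^sup>2)"
    if e: "e = 1 \<or> e = -1" for e A B
  proof -
    have ee: "e * e = 1" using e by auto
    have "(\<Sum>x\<in>Zr e. A * (1 / x) / (z - x) + B / (z - x)\<^sup>2)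
      = (\<Sum>x\<in>Zr e. (A * e) * (x ^ (n - 1) / (z - x)) + (B * e) * (x ^ n / (z - x)\<^sup>2))"
    proof (rule sum.cong[OF refl])
      fix x assume x: "x \<in> Zr e"
      have "B = B * e * x ^ n" using conj_Zr(2)[OF x e] by (simp add: mult.assoc)
      then show "A * (1 / x) / (z - x) + B / (z - x)\<^sup>2 = (A * e) * (x ^ (n - 1) / (z - x)) + (B * e) * (x ^ n / (z - x)\<^sup>2)"
        unfolding conj_Zr(1)[OF x e] by (metis mult.assoc times_divide_eq_right)
    qed
    also have "\<dots> = (A * e) * (\<Sum>x\<in>Zr e. x ^ (n - 1) / (z - x)) + (B * e) * (\<Sum>x\<in>Zr e. x ^ n / (z - x)\<^sup>2)"
      by (simp only: sum.distrib sum_distrib_left)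
    also have "\<dots> = (A * e) * (N * e * y / (z ^ n - e)) + (B * e) * (N * e * (N * (y * z)\<^sup>2 - (N - 1) * y * (z ^ n - e)) / (z ^ n - e)\<^sup>2)"
    proof -
      have i1: "n - 1 - 1 = n - 2" by simp
      have "(\<Sum>x\<in>Zr e. x ^ (n - 1) / (z - x)) = N * e * y / (z ^ n - e)"
        using F(1)[OF e, of "n - 1", unfolded i1 y_def[symmetric]] n by simp
      moreover have "(\<Sum>x\<in>Zr e. x ^ n / (z - x)\<^sup>2) = N * e * ((y * z) * (N * (y * z)) - (N - 1) * y * (z ^ n - e)) / (z ^ n - e)\<^sup>2"
        using F(2)[OF e, of n, unfolded n1 zn1 y_def[symmetric]] n by simp
      moreover have "(y * z) * (N * (y * z)) = N * (y * z)\<^sup>2" by (simp add: power2_eq_square)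
      ultimately show ?thesis by simp
    qed
    also have "\<dots> = (e * e) * (A * (N * y / (z ^ n - e)) + B * (N * (N * (y * z)\<^sup>2 - (N - 1) * y * (z ^ n - e)) / (z ^ n - e)\<^sup>2))"
      by (simp only: distrib_left times_divide_eq_right mult_ac)
    finally show ?thesis unfolding ee by simp
  qed
  have W2: "(\<Sum>x\<in>Zr e. A * x / (z - x) - B * x\<^sup>2 / (z - x)\<^sup>2) =
      A * (N * e / (z ^ n - e)) - B * (N * e * (N * z ^ n - (z ^ n - e)) / (z ^ n - e)\<^sup>2)"
    if e: "e = 1 \<or> e = -1" for e A B
  proof -
    have "z * z ^ (n - 1) = z ^ n" by (metis n_pos(2) power_eq_if)
    then have "z * (N * z ^ (n - 1)) = N * z ^ n" by (metis mult.left_commute)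
    then have "(\<Sum>x\<in>Zr e. x ^ 1 / (z - x)) = N * e / (z ^ n - e)"
      "(\<Sum>x\<in>Zr e. x\<^sup>2 / (z - x)\<^sup>2) = N * e * (N * z ^ n - (z ^ n - e)) / (z ^ n - e)\<^sup>2"
      using F(1)[OF e, of 1] F(2)[OF e, of 2] n by simp_all
    moreover have "(\<Sum>x\<in>Zr e. A * x / (z - x) - B * x\<^sup>2 / (z - x)\<^sup>2)
      = A * (\<Sum>x\<in>Zr e. x ^ 1 / (z - x)) - B * (\<Sum>x\<in>Zr e. x\<^sup>2 / (z - x)\<^sup>2)"
      by (simp only: sum_subtractf sum_distrib_left times_divide_eq_right power_one_right)
    ultimately show ?thesis by simp
  qed
  have W3: "(\<Sum>x\<in>Zr e. B * x / (z - x)\<^sup>2) = B * (N * e * (N * (y * z)) / (z ^ n - e)\<^sup>2)"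
    if e: "e = 1 \<or> e = -1" for e B
  proof -
    have "(\<Sum>x\<in>Zr e. B * x / (z - x)\<^sup>2) = B * (\<Sum>x\<in>Zr e. x ^ 1 / (z - x)\<^sup>2)"
      by (simp only: sum_distrib_left times_divide_eq_right power_one_right)
    then show ?thesis using F(2)[OF e, of 1] n zn1 by simp
  qed
  have div: "u / (z ^ n - 1) = u * p" "u / (z ^ n - 1)\<^sup>2 = u * p\<^sup>2" "u / (z ^ n - - 1) = u * q" "u / (z ^ n - - 1)\<^sup>2 = u * q\<^sup>2" for u
    by (simp_all add: p_def q_def power_divide)
  have pp: "(z ^ n - 1) * p = 1" "(z ^ n - - 1) * q = 1" using ne by (simp_all add: p_def q_def)
  let ?D = "\<Sum>x\<in>Z. dXterm x z"
  have "?D $ 1 - \<i> * ?D $ 2 = (\<Sum>x\<in>Z. dXterm x z $ 1 - \<i> * dXterm x z $ 2)"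
    by (simp add: sum_subtractf sum_distrib_left)
  also have "\<dots> = (\<Sum>x\<in>Zr 1. of_real (fl x) * (1 / x) / (z - x) + of_real ((wt x)\<^sup>2) / (z - x)\<^sup>2)
      + (\<Sum>x\<in>Zr (-1). of_real (fl x) * (1 / x) / (z - x) + of_real ((wt x)\<^sup>2) / (z - x)\<^sup>2)"
    by (simp only: sum_Z[symmetric]) (intro sum.cong refl dXterm_combinations)
  also have "\<dots> = (\<Sum>x\<in>Zr 1. (b * ((N - 1) * b + N * g)) * (1 / x) / (z - x) + b\<^sup>2 / (z - x)\<^sup>2)
      + (\<Sum>x\<in>Zr (-1). (g * ((N - 1) * g + N * b)) * (1 / x) / (z - x) + g\<^sup>2 / (z - x)\<^sup>2)"
    by (intro arg_cong2[of _ _ _ _ "(+)"] sum.cong refl) (simp_all only: afl bfl)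
  also have "\<dots> = (b * ((N - 1) * b + N * g)) * (N * y * p) + b\<^sup>2 * (N * (N * (y * z)\<^sup>2 - (N - 1) * y * (z ^ n - 1)) * p\<^sup>2)
     + ((g * ((N - 1) * g + N * b)) * (N * y * q) + g\<^sup>2 * (N * (N * (y * z)\<^sup>2 - (N - 1) * y * (z ^ n - - 1)) * q\<^sup>2))"
    by (simp only: W1[of 1] W1[of "-1"] div simp_thms)
  \<comment> \<open>The parts of the fluxes with factor \<open>N - 1\<close> cancel against the
    double poles; the parts with factor \<open>N\<close> combine to the mixed term.\<close>
  also have "\<dots> = N\<^sup>2 * (y * z)\<^sup>2 * (b\<^sup>2 * p\<^sup>2 + g\<^sup>2 * q\<^sup>2) + N\<^sup>2 * b * g * y * (p + q)"
  proof -
    have h: "(M - K * y * d) * r\<^sup>2 = M * r\<^sup>2 - K * y * r" if "d * r = 1" for M K d r :: complex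
    proof -
      have "(M - K * y * d) * r\<^sup>2 = M * r\<^sup>2 - K * y * r * (d * r)" by (simp add: algebra_simps power2_eq_square)
      then show ?thesis using that by simp
    qed
    have "N * (N * (y * z)\<^sup>2 - (N - 1) * y * (z ^ n - 1)) * p\<^sup>2 = N * (N * (y * z)\<^sup>2 * p\<^sup>2 - (N - 1) * y * p)"
      "N * (N * (y * z)\<^sup>2 - (N - 1) * y * (z ^ n - - 1)) * q\<^sup>2 = N * (N * (y * z)\<^sup>2 * q\<^sup>2 - (N - 1) * y * q)"
      using h[OF pp(1), of "N * (y * z)\<^sup>2" "N - 1"] h[OF pp(2), of "N * (y * z)\<^sup>2" "N - 1"] by (simp_all only: mult.assoc)
    then show ?thesis
      by (simp only:) (simp add: algebra_simps power2_eq_square)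
  qed
  also have "\<dots> = (spin2 z)\<^sup>2"
    unfolding s12 psum zn by (simp add: algebra_simps power2_eq_square)
  finally have E1: "?D $ 1 - \<i> * ?D $ 2 = (spin2 z)\<^sup>2" .
  have "?D $ 1 + \<i> * ?D $ 2 = (\<Sum>x\<in>Z. dXterm x z $ 1 + \<i> * dXterm x z $ 2)"
    by (simp add: sum.distrib sum_distrib_left)
  also have "\<dots> = (\<Sum>x\<in>Zr 1. of_real (fl x) * x / (z - x) - of_real ((wt x)\<^sup>2) * x\<^sup>2 / (z - x)\<^sup>2)
      + (\<Sum>x\<in>Zr (-1). of_real (fl x) * x / (z - x) - of_real ((wt x)\<^sup>2) * x\<^sup>2 / (z - x)\<^sup>2)"
    by (simp only: sum_Z[symmetric]) (intro sum.cong refl dXterm_combinations)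
  also have "\<dots> = (\<Sum>x\<in>Zr 1. (b * ((N - 1) * b + N * g)) * x / (z - x) - b\<^sup>2 * x\<^sup>2 / (z - x)\<^sup>2)
      + (\<Sum>x\<in>Zr (-1). (g * ((N - 1) * g + N * b)) * x / (z - x) - g\<^sup>2 * x\<^sup>2 / (z - x)\<^sup>2)"
    by (intro arg_cong2[of _ _ _ _ "(+)"] sum.cong refl) (simp_all only: afl bfl)
  also have "\<dots> = (b * ((N - 1) * b + N * g)) * (N * 1 * p) - b\<^sup>2 * (N * 1 * (N * z ^ n - (z ^ n - 1)) * p\<^sup>2)
     + ((g * ((N - 1) * g + N * b)) * (N * - 1 * q) - g\<^sup>2 * (N * - 1 * (N * z ^ n - (z ^ n - - 1)) * q\<^sup>2))"
    by (simp only: W2[of 1] W2[of "-1"] div simp_thms)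
  also have "\<dots> = - (N\<^sup>2 * (b\<^sup>2 * p\<^sup>2 + g\<^sup>2 * q\<^sup>2)) + N\<^sup>2 * b * g * (p - q)"
  proof -
    have "(N * z ^ n - (z ^ n - 1)) * p\<^sup>2 = N * (z ^ n * p) * p - ((z ^ n - 1) * p) * p"
      "(N * z ^ n - (z ^ n - - 1)) * q\<^sup>2 = N * (z ^ n * q) * q - ((z ^ n - - 1) * q) * q"
      by (simp_all add: algebra_simps power2_eq_square)
    then have r: "(N * z ^ n - (z ^ n - 1)) * p\<^sup>2 = N * (1 + p) * p - p"
      "(N * z ^ n - (z ^ n - - 1)) * q\<^sup>2 = N * (1 - q) * q - q"
      unfolding pq(1,2) pp by simp_all
    show ?thesis
      unfolding mult.assoc[of N] mult.assoc[of 1] mult.assoc[of "-1"] r by (simp add: algebra_simps power2_eq_square)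
  qed
  also have "\<dots> = - ((spin1 z)\<^sup>2)"
    unfolding s12 pq(3) by (simp add: algebra_simps power2_eq_square)
  finally have E2: "?D $ 1 + \<i> * ?D $ 2 = - ((spin1 z)\<^sup>2)" .
  have "?D $ 3 = (\<Sum>x\<in>Z. dXterm x z $ 3)" by simp
  also have "\<dots> = (\<Sum>x\<in>Zr 1. of_real ((wt x)\<^sup>2) * x / (z - x)\<^sup>2) + (\<Sum>x\<in>Zr (-1). of_real ((wt x)\<^sup>2) * x / (z - x)\<^sup>2)"
    by (simp only: sum_Z[symmetric]) (intro sum.cong refl dXterm_combinations)
  also have "\<dots> = (\<Sum>x\<in>Zr 1. b\<^sup>2 * x / (z - x)\<^sup>2) + (\<Sum>x\<in>Zr (-1). g\<^sup>2 * x / (z - x)\<^sup>2)"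
    by (intro arg_cong2[of _ _ _ _ "(+)"] sum.cong refl) (simp_all only: afl bfl)
  also have "\<dots> = b\<^sup>2 * (N * 1 * (N * (y * z)) * p\<^sup>2) + g\<^sup>2 * (N * - 1 * (N * (y * z)) * q\<^sup>2)"
    by (simp only: W3[of 1] W3[of "-1"] div simp_thms)
  also have "\<dots> = spin1 z * spin2 z"
    unfolding s12 by (simp add: algebra_simps power2_eq_square)
  finally have E3: "?D $ 3 = spin1 z * spin2 z" .
  have e1: "?D $ 1 = ((spin2 z)\<^sup>2 - (spin1 z)\<^sup>2) / 2"
  proof -
    have "2 * (?D $ 1) = (?D $ 1 - \<i> * ?D $ 2) + (?D $ 1 + \<i> * ?D $ 2)" by simp
    then show ?thesis unfolding E1 E2 by (simp add: field_simps)
  qed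
  have e2: "?D $ 2 = \<i> * ((spin1 z)\<^sup>2 + (spin2 z)\<^sup>2) / 2"
  proof -
    have "2 * (?D $ 2) = \<i> * ((?D $ 1 - \<i> * ?D $ 2) - (?D $ 1 + \<i> * ?D $ 2))" by (simp add: algebra_simps)
    then show ?thesis unfolding E1 E2 by (simp add: field_simps)
  qed
  show ?thesis
    unfolding vec_eq_iff forall_3 weierstrass_vec_nth using e1 e2 E3 by simp
qed

lemma spin_nonzero: "z \<notin> Z \<Longrightarrow> spin1 z \<noteq> 0 \<or> spin2 z \<noteq> 0"
proof (rule ccontr)
  assume z: "z \<notin> Z" and "\<not> (spin1 z \<noteq> 0 \<or> spin2 z \<noteq> 0)"
  then have s: "spin1 z = 0" "spin2 z = 0" by auto
  define p q where "p = complex_of_real \<beta> / (z ^ n - 1)" and "q = complex_of_real \<gamma> / (z ^ n + 1)"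
  have ne: "z ^ n - 1 \<noteq> 0" "z ^ n + 1 \<noteq> 0" using roots_neq[OF z] by auto
  have pq: "p = q" using s(1) by (simp add: spin1_def p_def q_def)
  have "z = 0 \<or> p + q = 0" using s(2) by (auto simp: spin2_def p_def q_def)
  then show False
  proof
    assume "z = 0"
    then have "p = - of_real \<beta>" "q = of_real \<gamma>" by (simp_all add: p_def q_def power_0_left)
    then have "complex_of_real (\<beta> + \<gamma>) = 0" using pq by (simp add: add_eq_0_iff)
    then show False using \<beta>\<gamma> by (simp only: of_real_eq_0_iff)
  next
    assume "p + q = 0"
    then have "p = 0" using pq by simp
    then show False using \<beta> ne by (simp add: p_def)
  qed
qed

lemma spin_holomorphic: "spin1 holomorphic_on - Z" "spin2 holomorphic_on - Z"
  unfolding spin1_def spin2_def using roots_neq by (auto intro!: holomorphic_intros)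

lemma open_compl: "open (- Z)"
  using finite_Z by (simp add: finite_imp_closed open_Compl)

lemma X_derivative:
  assumes "z \<notin> Z"
  shows "((\<lambda>z. X (inv_stereographic z)) has_derivative (\<lambda>h. reV (h *s weierstrass_vec (spin1 z) (spin2 z)))) (at z)"
proof -
  have "((\<lambda>z. \<Sum>x\<in>Z. Xterm x z) has_derivative (\<lambda>h. \<Sum>x\<in>Z. reV (h *s dXterm x z))) (at z)"
    using assms by (intro has_derivative_sum has_derivative_Xterm) auto
  moreover have "(\<Sum>x\<in>Z. reV (h *s dXterm x z)) = reV (h *s (\<Sum>x\<in>Z. dXterm x z))" for h
    by (simp add: vec_eq_iff sum_distrib_left Re_sum)
  ultimately have "((\<lambda>z. \<Sum>x\<in>Z. Xterm x z) has_derivative (\<lambda>h. reV (h *s weierstrass_vec (spin1 z) (spin2 z)))) (at z)"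
    unfolding weierstrass_sum[OF assms] by simp
  then show ?thesis
    by (rule has_derivative_transform_within_open[OF _ open_compl]) (use assms X_inv_stereographic in auto)
qed

text \<open>The summands are built from inner products with the axes, with coefficients depending
  only on the kind; so an orthogonal map that permutes the axes within each kind permutes the
  summands.\<close>

lemma X_equivariant:
  assumes \<sigma>: "linear \<sigma>" "\<And>x y. \<sigma> x \<bullet> \<sigma> y = x \<bullet> y"
    and \<pi>: "bij_betw \<pi> Z Z" "\<And>x. x \<in> Z \<Longrightarrow> \<sigma> (hv x) = hv (\<pi> x)"
    "\<And>x. x \<in> Z \<Longrightarrow> (\<pi> x) ^ n = x ^ n"
  shows "X (\<sigma> p) = \<sigma> (X p)"
proof -
  interpret linear \<sigma> by (rule \<sigma>(1))
  define G where "G x p = (fl x / 2 * ln (1 - p \<bullet> hv x)) *\<^sub>R hv x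
     - ((wt x)\<^sup>2 / (2 * (1 - p \<bullet> hv x))) *\<^sub>R (p - (p \<bullet> hv x) *\<^sub>R hv x)" for x p
  have "\<sigma> (G x p) = G (\<pi> x) (\<sigma> p)" if "x \<in> Z" for x
  proof -
    have "\<sigma> p \<bullet> hv (\<pi> x) = p \<bullet> hv x" using \<pi>(2)[OF that] \<sigma>(2) by metis
    moreover have "fl (\<pi> x) = fl x" "wt (\<pi> x) = wt x" using \<pi>(3)[OF that] by (simp_all add: fl_def wt_def)
    ultimately show ?thesis
      unfolding G_def by (simp add: diff scale \<pi>(2)[OF that])
  qed
  then have "\<sigma> (\<Sum>x\<in>Z. G x p) = (\<Sum>x\<in>Z. G (\<pi> x) (\<sigma> p))" by (simp add: sum)
  also have "\<dots> = (\<Sum>x\<in>Z. G x (\<sigma> p))" by (rule sum.reindex_bij_betw[OF \<pi>(1)])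
  finally show ?thesis by (simp add: X_def G_def)
qed

text \<open>On the punctures the half turn is conjugation, and it keeps the kinds because
  \<open>x ^ n\<close> is real.\<close>

lemma X_half_turn: "X (half_turn p) = half_turn (X p)"
proof (rule X_equivariant[where \<pi> = cnj])
  show "linear half_turn" by (rule linear_half_turn)
  show "half_turn x \<bullet> half_turn y = x \<bullet> y" for x y by (simp add: inner_3)
  have "cnj x \<in> Z" if "x \<in> Z" for x using cnj_Z[OF that] inverse_Z[OF that] by simp
  then show "bij_betw cnj Z Z" by (intro bij_betw_byWitness[of _ cnj]) auto
  show "half_turn (hv x) = hv (cnj x)" for x by (simp add: vec_eq_iff forall_3)
  show "(cnj x) ^ n = x ^ n" if "x \<in> Z" for x
  proof -
    have "(cnj x) ^ n = cnj (x ^ n)" by simp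
    moreover have "cnj (x ^ n) = x ^ n" using that unfolding Z_iff by (metis complex_cnj_minus complex_cnj_one)
    ultimately show ?thesis by simp
  qed
qed

lemma spinor_rep_north: "spinor_rep (- Z) (\<lambda>z. X (inv_stereographic z)) spin1 spin2"
  unfolding spinor_rep_def using open_compl spin_holomorphic spin_nonzero X_derivative by simp

lemma spinor_rep_south:
  "spinor_rep (- Z) (\<lambda>z. X (half_turn (inv_stereographic z))) (\<lambda>z. \<i> * spin2 z) (\<lambda>z. \<i> * spin1 z)"
  unfolding spinor_rep_def
proof (intro conjI ballI)
  show "open (- Z)" by (rule open_compl)
  show "(\<lambda>z. \<i> * spin2 z) holomorphic_on - Z" "(\<lambda>z. \<i> * spin1 z) holomorphic_on - Z"
    using spin_holomorphic by (auto intro!: holomorphic_intros)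
  show "\<i> * spin2 z \<noteq> 0 \<or> \<i> * spin1 z \<noteq> 0" if "z \<in> - Z" for z using spin_nonzero[of z] that by auto
  fix z assume "z \<in> - Z"
  then have "((\<lambda>z. half_turn (X (inv_stereographic z))) has_derivative
      (\<lambda>h. half_turn (reV (h *s weierstrass_vec (spin1 z) (spin2 z))))) (at z)"
    using bounded_linear.has_derivative[OF linear_half_turn[unfolded linear_conv_bounded_linear] X_derivative] by simp
  moreover have "half_turn (reV (h *s weierstrass_vec u v)) = reV (h *s weierstrass_vec (\<i> * v) (\<i> * u))" for h u v
  proof -
    have "half_turn (reV (h *s w)) = reV (h *s w')" if "w' $ 1 = w $ 1" "w' $ 2 = - (w $ 2)" "w' $ 3 = - (w $ 3)" for w w'
      using that by (simp add: vec_eq_iff forall_3)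
    moreover have "weierstrass_vec (\<i> * v) (\<i> * u) $ 1 = weierstrass_vec u v $ 1"
      "weierstrass_vec (\<i> * v) (\<i> * u) $ 2 = - (weierstrass_vec u v $ 2)"
      "weierstrass_vec (\<i> * v) (\<i> * u) $ 3 = - (weierstrass_vec u v $ 3)"
      unfolding weierstrass_vec_nth power_mult_distrib by (simp_all add: mult.commute minus_divide_left algebra_simps)
    ultimately show ?thesis by blast
  qed
  ultimately show "((\<lambda>z. X (half_turn (inv_stereographic z))) has_derivative
      (\<lambda>h. reV (h *s weierstrass_vec (\<i> * spin2 z) (\<i> * spin1 z)))) (at z)"
    by (simp add: X_half_turn)
qed

end

section \<open>Ends of punctured spheres\<close>

context parametrized_sphere
begin

definition nbh :: "complex set \<Rightarrow> (real^3) set" where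
  "nbh A = pt ` inv_stereographic ` A"

text \<open>General neighbourhoods instead of discs: the catenoid condition asks for an end region
  that projects exactly onto the complement of a compact set, and such a region is in general not a
  disc in the coordinate \<open>z\<close>.\<close>

definition isolating :: "(complex \<Rightarrow> complex set) \<Rightarrow> bool" where
  "isolating A \<longleftrightarrow> (\<forall>z\<in>Z. open (A z) \<and> z \<in> A z \<and> connected (A z - {z})) \<and> disjoint_family_on A Z"

abbreviation core :: "(complex \<Rightarrow> complex set) \<Rightarrow> (real^3) set" where
  "core A \<equiv> - (\<Union>z\<in>Z. nbh (A z - {z}))"

text \<open>Ends are extensional functions, hence the restriction to compact sets. The component is
  singled out by containing a punctured disc around \<open>z\<close>.\<close>

definition end_at :: "complex \<Rightarrow> (real^3) set \<Rightarrow> (real^3) set" where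
  "end_at z = (\<lambda>K\<in>{K. compactin T K}. THE V. V \<in> connected_components_of (subtopology T (- K)) \<and>
     (\<exists>r>0. nbh (ball z r - {z}) \<subseteq> V))"

lemma openin_inv_stereographic: "open A \<Longrightarrow> openin (top_of_set (sphere 0 1)) (inv_stereographic ` A)"
proof -
  assume A: "open A"
  let ?S = "sphere 0 1 - {north_pole}"
  have "continuous_on ?S stereographic"
    using sphere_nth3_eq_1 by (intro continuous_intros) auto
  then have "openin (top_of_set ?S) (?S \<inter> stereographic -` A)"
    using A by (rule continuous_openin_preimage_gen)
  moreover have "?S \<inter> stereographic -` A = inv_stereographic ` A"
    using inv_stereographic_stereographic inv_stereographic_sphere inv_stereographic_neq_north
    by (force simp: image_iff)
  moreover have "openin (top_of_set (sphere 0 1)) ?S"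
    unfolding Diff_eq by (rule openin_open_Int) auto
  ultimately show ?thesis using openin_trans by metis
qed

lemma emb_nbh: "A \<subseteq> - Z \<Longrightarrow> emb ` nbh A = inv_stereographic ` A"
  unfolding nbh_def by (rule emb_pt_image) (auto simp: inv_stereographic_C)

lemma nbh_mono: "A \<subseteq> B \<Longrightarrow> nbh A \<subseteq> nbh B"
  by (auto simp: nbh_def)

lemma nbh_Int: "A \<subseteq> - Z \<Longrightarrow> B \<subseteq> - Z \<Longrightarrow> nbh A \<inter> nbh B = nbh (A \<inter> B)"
proof -
  assume A: "A \<subseteq> - Z" "B \<subseteq> - Z"
  have "inj_on (\<lambda>z. pt (inv_stereographic z)) (- Z)"
    by (rule inj_on_inverseI[of _ "\<lambda>x. stereographic (emb x)"]) (simp add: inv_stereographic_C)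
  then show ?thesis
    using A inj_on_image_Int[of "\<lambda>z. pt (inv_stereographic z)" "- Z" A B] by (simp add: nbh_def image_image)
qed

lemma openin_nbh:
  assumes "open A" "A \<subseteq> - Z"
  shows "openin T (nbh A)"
  unfolding openin_T emb_nbh[OF assms(2)]
proof (rule openin_subset_trans[OF openin_inv_stereographic[OF assms(1)]])
  show "inv_stereographic ` A \<subseteq> C" using assms(2) by (auto simp: inv_stereographic_C)
  show "C \<subseteq> sphere 0 1" by (auto simp: C_def)
qed

lemma connectedin_nbh: "connected A \<Longrightarrow> A \<subseteq> - Z \<Longrightarrow> connectedin T (nbh A)"
  unfolding connectedin_T by (simp add: emb_nbh connected_continuous_image continuous_on_inv_stereographic continuous_on_id)

context
  fixes A
  assumes A: "isolating A"
begin

lemma isolating_subset: "z \<in> Z \<Longrightarrow> A z - {z} \<subseteq> - Z"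
  using A unfolding isolating_def disjoint_family_on_def by blast

lemma isolating_nonempty:
  assumes "z \<in> Z" "r > 0"
  shows "(A z - {z}) \<inter> ball z r \<noteq> {}"
proof -
  have "open (A z \<inter> ball z r)" "z \<in> A z \<inter> ball z r"
    using A assms by (auto simp: isolating_def)
  then have "A z \<inter> ball z r \<noteq> {z}" using not_open_singleton by metis
  then show ?thesis using \<open>z \<in> A z \<inter> ball z r\<close> by blast
qed

lemma compactin_core: "compactin T (core A)"
proof -
  have eq: "emb ` core A = sphere 0 1 \<inter> - (\<Union>z\<in>Z. inv_stereographic ` A z)"
  proof -
    have "emb ` core A = C - (\<Union>z\<in>Z. emb ` nbh (A z - {z}))"
    proof -
      have "inj emb" "emb ` UNIV = C" using bij_emb by (auto simp: bij_betw_def)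
      then show ?thesis by (simp add: Compl_eq_Diff_UNIV image_set_diff image_UN)
    qed
    also have "\<dots> = C - (\<Union>z\<in>Z. inv_stereographic ` (A z - {z}))"
      using isolating_subset by (simp add: emb_nbh)
    also have "\<dots> = sphere 0 1 \<inter> - (\<Union>z\<in>Z. inv_stereographic ` A z)"
      using A unfolding C_def isolating_def by blast
    finally show ?thesis .
  qed
  have "openin (top_of_set (sphere 0 1)) (\<Union>z\<in>Z. inv_stereographic ` A z)"
    using A openin_inv_stereographic by (auto simp: isolating_def intro!: openin_Union)
  then have "closedin (top_of_set (sphere 0 1)) (sphere 0 1 - (\<Union>z\<in>Z. inv_stereographic ` A z))"
    by (intro closedin_diff) auto
  then show ?thesis
    unfolding compactin_T eq using closedin_compact[OF compact_sphere] by (simp add: Diff_eq)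
qed

text \<open>The punctured neighbourhoods are connected, open and pairwise disjoint, and they cover
  the complement of the core; so they are its components.\<close>

lemma component_core:
  assumes V: "V \<in> connected_components_of (subtopology T (- core A))"
  obtains z where "z \<in> Z" "V = nbh (A z - {z})"
proof -
  let ?N = "\<lambda>z. nbh (A z - {z})"
  have V': "V \<noteq> {}" "connectedin T V" "V \<subseteq> (\<Union>z\<in>Z. ?N z)"
    using V nonempty_connected_components_of connectedin_connected_components_of[OF V]
    by (auto simp: connectedin_subtopology)
  then obtain z where z: "z \<in> Z" "V \<inter> ?N z \<noteq> {}" by blast
  have con: "connectedin (subtopology T (- core A)) (?N z)"
    using A z(1) isolating_subset[OF z(1)] unfolding connectedin_subtopology
    by (auto simp: isolating_def intro!: connectedin_nbh)
  have "?N z \<subseteq> V"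
    using connected_components_of_maximal[OF V con] z(2) by (auto simp: disjnt_def)
  moreover have "V \<subseteq> ?N z"
  proof (rule ccontr)
    assume "\<not> V \<subseteq> ?N z"
    define W where "W = (\<Union>y\<in>Z - {z}. ?N y)"
    have "openin T (?N y)" if "y \<in> Z" for y
      using A that isolating_subset[OF that] by (intro openin_nbh) (auto simp: isolating_def)
    then have "openin T (?N z)" "openin T W"
      using z(1) by (auto simp: W_def)
    moreover have "V \<subseteq> ?N z \<union> W" using V'(3) z(1) by (auto simp: W_def)
    moreover have "?N z \<inter> W = {}"
    proof -
      have "?N z \<inter> ?N y = {}" if "y \<in> Z - {z}" for y
      proof -
        have "A z \<inter> A y = {}"
          using that z(1) A by (auto simp: isolating_def disjoint_family_on_def)
        then have "(A z - {z}) \<inter> (A y - {y}) = {}" by blast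
        then show ?thesis
          using that nbh_Int[OF isolating_subset[OF z(1)] isolating_subset[of y]] by (simp add: nbh_def)
      qed
      then show ?thesis by (auto simp: W_def)
    qed
    moreover have "W \<inter> V \<noteq> {}" using \<open>\<not> V \<subseteq> ?N z\<close> \<open>V \<subseteq> ?N z \<union> W\<close> by blast
    ultimately show False
      using V'(2) z(2) unfolding connectedin by blast
  qed
  ultimately show ?thesis using that z(1) by blast
qed

end

lemma radius_exists: "\<exists>R>0. \<forall>r. 0 < r \<longrightarrow> r \<le> R \<longrightarrow> isolating (\<lambda>z. ball z r)"
proof -
  have "\<exists>R>0. \<forall>x\<in>Z. \<forall>y\<in>Z. x \<noteq> y \<longrightarrow> 2 * R \<le> dist x y"
  proof -
    define P where "P = {dist x y | x y. x \<in> Z \<and> y \<in> Z \<and> x \<noteq> y}"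
    have "P \<subseteq> (\<lambda>(x, y). dist x y) ` (Z \<times> Z)" by (auto simp: P_def)
    then have "finite P" using finite_Z finite_subset by blast
    define R where "R = Min (insert 1 P) / 2"
    have "R > 0" using \<open>finite P\<close> by (auto simp: R_def P_def)
    moreover have "2 * R \<le> dist x y" if "x \<in> Z" "y \<in> Z" "x \<noteq> y" for x y
      using \<open>finite P\<close> that unfolding R_def by (auto simp: P_def intro!: Min_le)
    ultimately show ?thesis by blast
  qed
  then obtain R where R: "R > 0" "\<And>x y. x \<in> Z \<Longrightarrow> y \<in> Z \<Longrightarrow> x \<noteq> y \<Longrightarrow> 2 * R \<le> dist x y" by metis
  have "isolating (\<lambda>z. ball z r)" if r: "0 < r" "r \<le> R" for r
    unfolding isolating_def disjoint_family_on_def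
  proof (intro conjI ballI impI)
    fix z assume "z \<in> Z"
    show "connected (ball z r - {z})"
      by (rule connected_punctured_ball) simp
  next
    fix x y assume xy: "x \<in> Z" "y \<in> Z" "x \<noteq> y"
    have "2 * r \<le> dist x y" using R(2)[OF xy] r by simp
    then show "ball x r \<inter> ball y r = {}"
      by (auto simp: disjoint_iff) (smt (verit) dist_commute dist_triangle)
  qed (use r in auto)
  then show ?thesis using R(1) by blast
qed

definition R0 :: real where
  "R0 = (SOME R. R > 0 \<and> (\<forall>r. 0 < r \<longrightarrow> r \<le> R \<longrightarrow> isolating (\<lambda>z. ball z r)))"

lemma R0: "R0 > 0" "0 < r \<Longrightarrow> r \<le> R0 \<Longrightarrow> isolating (\<lambda>z. ball z r)"
  using someI_ex[OF radius_exists[unfolded Bex_def]] unfolding R0_def by auto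

text \<open>The image of \<open>K\<close> is closed and misses every puncture; finiteness of
  \<open>Z\<close> yields one radius for all of them.\<close>

lemma punctured_disc_avoids:
  assumes K: "compactin T K"
  obtains r where "0 < r" "r \<le> R0" "\<And>z. z \<in> Z \<Longrightarrow> nbh (ball z r - {z}) \<subseteq> - K"
proof -
  have "\<exists>r>0. \<forall>w. dist w z < r \<longrightarrow> inv_stereographic w \<notin> emb ` K" if z: "z \<in> Z" for z
  proof -
    have "compact (emb ` K)" using K by (simp add: compactin_T)
    then have "open (- (emb ` K))" by (simp add: compact_imp_closed open_Compl)
    moreover have "continuous_on UNIV inv_stereographic" by (intro continuous_intros)
    ultimately have "open (inv_stereographic -` (- (emb ` K)))"
      using open_vimage by blast
    moreover have "z \<in> inv_stereographic -` (- (emb ` K))"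
      using inv_stereographic_C[of z] emb_C z by (metis ComplI imageE vimageI)
    ultimately show ?thesis
      unfolding open_dist by blast
  qed
  then obtain f where f: "\<And>z. z \<in> Z \<Longrightarrow> f z > 0"
    "\<And>z w. z \<in> Z \<Longrightarrow> dist w z < f z \<Longrightarrow> inv_stereographic w \<notin> emb ` K" by metis
  define r where "r = Min (insert R0 (f ` Z))"
  have r: "r > 0" "r \<le> R0" "\<And>z. z \<in> Z \<Longrightarrow> r \<le> f z"
    using finite_Z f(1) R0(1) by (auto simp: r_def)
  show ?thesis
  proof (rule that[OF r(1,2)])
    fix z assume z: "z \<in> Z"
    have sub: "ball z r - {z} \<subseteq> - Z" using isolating_subset[OF R0(2)[OF r(1,2)] z] .
    show "nbh (ball z r - {z}) \<subseteq> - K"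
    proof
      fix x assume x: "x \<in> nbh (ball z r - {z})"
      then have "emb x \<in> inv_stereographic ` (ball z r - {z})"
        unfolding emb_nbh[OF sub, symmetric] by blast
      then have "emb x \<notin> emb ` K" using f(2)[OF z] r(3)[OF z] by (force simp: dist_commute)
      then show "x \<in> - K" by blast
    qed
  qed
qed

lemma punctured_disc_subset: "z \<in> Z \<Longrightarrow> 0 < r \<Longrightarrow> r \<le> R0 \<Longrightarrow> ball z r - {z} \<subseteq> - Z"
  using isolating_subset[OF R0(2)] .

lemma nbh_meet:
  assumes "z \<in> Z" "r > 0" "r' > 0"
  shows "nbh (ball z r - {z}) \<inter> nbh (ball z r' - {z}) \<noteq> {}"
proof -
  define q where "q = min r (min r' R0)"
  have q: "0 < q" "q \<le> R0" "q \<le> r" "q \<le> r'" using assms R0(1) by (auto simp: q_def)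
  have "ball z q - {z} \<noteq> {}" using isolating_nonempty[OF R0(2)[OF q(1,2)] assms(1) q(1)] by blast
  then have "nbh (ball z q - {z}) \<noteq> {}" by (simp add: nbh_def)
  moreover have "nbh (ball z q - {z}) \<subseteq> nbh (ball z r - {z})" "nbh (ball z q - {z}) \<subseteq> nbh (ball z r' - {z})"
    using subset_ball[OF q(3), of z] subset_ball[OF q(4), of z] by (auto intro!: nbh_mono)
  ultimately show ?thesis by blast
qed

lemma end_at_ex1:
  assumes "z \<in> Z" "compactin T K"
  shows "\<exists>!V. V \<in> connected_components_of (subtopology T (- K)) \<and> (\<exists>r>0. nbh (ball z r - {z}) \<subseteq> V)"
proof -
  obtain r where r: "0 < r" "r \<le> R0" "nbh (ball z r - {z}) \<subseteq> - K"
    using punctured_disc_avoids[OF assms(2)] assms(1) by metis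
  have "connectedin (subtopology T (- K)) (nbh (ball z r - {z}))"
    using r R0(2)[OF r(1,2)] assms(1) punctured_disc_subset[OF assms(1) r(1,2)] unfolding connectedin_subtopology
    by (auto simp: isolating_def intro!: connectedin_nbh)
  moreover obtain x where x: "x \<in> nbh (ball z r - {z})"
    using nbh_meet[OF assms(1) r(1) r(1)] by blast
  ultimately have sub: "nbh (ball z r - {z}) \<subseteq> connected_component_of_set (subtopology T (- K)) x"
    by (rule connected_component_of_maximal)
  have "connected_component_of_set (subtopology T (- K)) x \<in> connected_components_of (subtopology T (- K))"
    using x r(3) by (auto simp: connected_component_in_connected_components_of)
  then have ex: "\<exists>V. V \<in> connected_components_of (subtopology T (- K)) \<and> (\<exists>r>0. nbh (ball z r - {z}) \<subseteq> V)"
    using sub r(1) by blast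
  have "V = V'" if V: "V \<in> connected_components_of (subtopology T (- K))" "V' \<in> connected_components_of (subtopology T (- K))"
    "r > 0" "nbh (ball z r - {z}) \<subseteq> V" "r' > 0" "nbh (ball z r' - {z}) \<subseteq> V'" for V V' r r'
    using connected_components_of_overlap[OF V(1,2)] nbh_meet[OF assms(1) V(3,5)] V(4,6) by blast
  then show ?thesis using ex by blast
qed

lemma end_at_props:
  assumes "z \<in> Z" "compactin T K"
  shows "end_at z K \<in> connected_components_of (subtopology T (- K))" "\<exists>r>0. nbh (ball z r - {z}) \<subseteq> end_at z K"
  using theI'[OF end_at_ex1[OF assms]] assms(2) by (simp_all add: end_at_def)

lemma end_at_eqI:
  assumes "z \<in> Z" "compactin T K" "V \<in> connected_components_of (subtopology T (- K))"
    "r > 0" "nbh (ball z r - {z}) \<subseteq> V"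
  shows "end_at z K = V"
  using end_at_ex1[OF assms(1,2)] end_at_props[OF assms(1,2)] assms(3-5) by blast

text \<open>By \<open>component_core\<close> the value is one of the punctured neighbourhoods, and a
  point close to \<open>z\<close> decides which.\<close>

lemma end_at_core:
  assumes "isolating A" "z \<in> Z"
  shows "end_at z (core A) = nbh (A z - {z})"
proof -
  note K = compactin_core[OF assms(1)]
  obtain y where y: "y \<in> Z" "end_at z (core A) = nbh (A y - {y})"
    using component_core[OF assms(1) end_at_props(1)[OF assms(2) K]] .
  obtain r where r: "r > 0" "nbh (ball z r - {z}) \<subseteq> nbh (A y - {y})"
    using end_at_props(2)[OF assms(2) K] y(2) by auto
  define q where "q = min r R0"
  have q: "0 < q" "q \<le> R0" "q \<le> r" using r R0(1) by (auto simp: q_def)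
  obtain w where w: "w \<in> A z - {z}" "w \<in> ball z q"
    using isolating_nonempty[OF assms q(1)] by blast
  have "w \<in> - Z" using isolating_subset[OF assms] w by blast
  have "pt (inv_stereographic w) \<in> nbh (A y - {y})"
    using r(2) w q(3) by (auto simp: nbh_def)
  then obtain v where v: "v \<in> A y - {y}" "pt (inv_stereographic w) = pt (inv_stereographic v)"
    by (auto simp: nbh_def)
  have "v \<in> - Z" using isolating_subset[OF assms(1) y(1)] v by blast
  then have "w = v"
    using v(2) \<open>w \<in> - Z\<close> by (metis ComplD emb_pt inv_stereographic_C stereographic_inv)
  then have "A y \<inter> A z \<noteq> {}" using v w by blast
  then have "y = z" using assms y(1) by (auto simp: isolating_def disjoint_family_on_def)
  then show ?thesis using y(2) by simp
qed

text \<open>An end selects one puncture on the core with discs of radius \<open>R0\<close>.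
  Monotonicity forces the same choice on all cores with smaller discs, and every compact set lies in
  one of these.\<close>

lemma ends_surf: "ends surf = end_at ` Z"
proof (intro equalityI subsetI)
  fix e assume "e \<in> end_at ` Z"
  then obtain z where z: "z \<in> Z" "e = end_at z" by blast
  have mono: "end_at z L \<subseteq> end_at z K" if KL: "compactin T K" "compactin T L" "K \<subseteq> L" for K L
  proof -
    have "connectedin (subtopology T (- K)) (end_at z L)"
      using connectedin_connected_components_of[OF end_at_props(1)[OF z(1) KL(2)]] KL(3)
      by (auto simp: connectedin_subtopology)
    moreover obtain r r' where "r > 0" "nbh (ball z r - {z}) \<subseteq> end_at z L" "r' > 0" "nbh (ball z r' - {z}) \<subseteq> end_at z K"
      using end_at_props(2)[OF z(1) KL(1)] end_at_props(2)[OF z(1) KL(2)] by blast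
    then have "\<not> disjnt (end_at z K) (end_at z L)"
      using nbh_meet[OF z(1), of r r'] by (auto simp: disjnt_def)
    ultimately show ?thesis
      using connected_components_of_maximal[OF end_at_props(1)[OF z(1) KL(1)]] by blast
  qed
  show "e \<in> ends surf"
    unfolding ends_def z(2) using mono end_at_props(1)[OF z(1)]
    by (auto simp: end_at_def[of z] Compl_eq_Diff_UNIV[symmetric])
next
  fix e assume "e \<in> ends surf"
  then have ext: "e \<in> extensional {K. compactin T K}"
    and comp: "\<And>K. compactin T K \<Longrightarrow> e K \<in> connected_components_of (subtopology T (- K))"
    and mono: "\<And>K L. compactin T K \<Longrightarrow> compactin T L \<Longrightarrow> K \<subseteq> L \<Longrightarrow> e L \<subseteq> e K"
    by (auto simp: ends_def Compl_eq_Diff_UNIV)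
  define Kr where "Kr r = core (\<lambda>z. ball z r)" for r
  have iso: "isolating (\<lambda>z. ball z R0)" by (rule R0(2)) (use R0(1) in auto)
  obtain z where z: "z \<in> Z" "e (Kr R0) = nbh (ball z R0 - {z})"
    using component_core[OF iso comp[OF compactin_core[OF iso]]] unfolding Kr_def by blast
  have ez: "e (Kr r) = nbh (ball z r - {z})" if r: "0 < r" "r \<le> R0" for r
  proof -
    note isor = R0(2)[OF r]
    obtain y where y: "y \<in> Z" "e (Kr r) = nbh (ball y r - {y})"
      using component_core[OF isor comp[OF compactin_core[OF isor]]] unfolding Kr_def by blast
    have "ball x r - {x} \<subseteq> ball x R0 - {x}" for x :: complex using subset_ball[OF r(2)] by blast
    then have sub: "nbh (ball x r - {x}) \<subseteq> nbh (ball x R0 - {x})" for x by (rule nbh_mono)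
    have "Kr R0 \<subseteq> Kr r" using sub unfolding Kr_def by blast
    then have "nbh (ball y r - {y}) \<subseteq> nbh (ball z R0 - {z})"
      using mono[of "Kr R0" "Kr r"] compactin_core[OF isor] compactin_core[OF iso] y(2) z(2) by (simp add: Kr_def)
    then have "nbh (ball y r - {y}) \<subseteq> nbh ((ball z R0 - {z}) \<inter> (ball y R0 - {y}))"
      using sub[of y] nbh_Int[OF punctured_disc_subset[OF z(1) R0(1) order_refl] punctured_disc_subset[OF y(1) R0(1) order_refl]]
      by blast
    moreover have "nbh (ball y r - {y}) \<noteq> {}" using nbh_meet[OF y(1) r(1) r(1)] by blast
    ultimately have "(ball z R0 - {z}) \<inter> (ball y R0 - {y}) \<noteq> {}" by (auto simp: nbh_def)
    then have "y = z" using iso y(1) z(1) unfolding isolating_def disjoint_family_on_def by blast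
    then show ?thesis using y(2) by simp
  qed
  have "e K = end_at z K" if K: "compactin T K" for K
  proof -
    obtain r where r: "0 < r" "r \<le> R0" "\<And>y. y \<in> Z \<Longrightarrow> nbh (ball y r - {y}) \<subseteq> - K"
      using punctured_disc_avoids[OF K] by blast
    have "K \<subseteq> Kr r" using r(3) unfolding Kr_def by blast
    then have "nbh (ball z r - {z}) \<subseteq> e K"
      using mono[OF K, of "Kr r"] compactin_core[OF R0(2)[OF r(1,2)]] ez[OF r(1,2)] by (simp add: Kr_def)
    then show ?thesis
      using end_at_eqI[OF z(1) K comp[OF K] r(1)] by simp
  qed
  then have "e = end_at z"
    using ext by (intro extensionalityI[of e "{K. compactin T K}"]) (auto simp: end_at_def)
  then show "e \<in> end_at ` Z" using z(1) by blast
qed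

lemma inj_on_end_at: "inj_on end_at Z"
proof (rule inj_onI)
  fix y z assume yz: "y \<in> Z" "z \<in> Z" "end_at y = end_at z"
  have iso: "isolating (\<lambda>z. ball z R0)" by (rule R0(2)) (use R0(1) in auto)
  have "nbh (ball y R0 - {y}) = nbh (ball z R0 - {z})"
    using end_at_core[OF iso yz(1)] end_at_core[OF iso yz(2)] yz(3) by simp
  then have "nbh ((ball z R0 - {z}) \<inter> (ball y R0 - {y})) \<noteq> {}"
    using nbh_Int[OF punctured_disc_subset[OF yz(2) R0(1) order_refl] punctured_disc_subset[OF yz(1) R0(1) order_refl]]
      nbh_meet[OF yz(1) R0(1) R0(1)] by auto
  then have "(ball z R0 - {z}) \<inter> (ball y R0 - {y}) \<noteq> {}" by (auto simp: nbh_def)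
  then show "y = z" using iso yz unfolding isolating_def disjoint_family_on_def by blast
qed

lemma card_ends: "card (ends surf) = card Z"
  by (simp add: ends_surf card_image inj_on_end_at)

text \<open>On the core of small discs the end takes a punctured disc as its value, so punctured
  discs belong to the end filter.\<close>

lemma eventually_end_filter:
  assumes "z \<in> Z" "r > 0" "\<And>w. w \<in> ball z r - {z} \<Longrightarrow> w \<notin> Z \<Longrightarrow> P (pt (inv_stereographic w))"
  shows "eventually P (end_filter surf (end_at z))"
proof -
  define q where "q = min r R0"
  have q: "0 < q" "q \<le> R0" "q \<le> r" using assms R0(1) by (auto simp: q_def)
  let ?K = "core (\<lambda>z. ball z q)"
  have eq: "end_at z ?K = nbh (ball z q - {z})"
    by (rule end_at_core[OF R0(2)[OF q(1,2)] assms(1)])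
  have "eventually P (principal (end_at z ?K))"
    unfolding eventually_principal eq
  proof
    fix x assume "x \<in> nbh (ball z q - {z})"
    then obtain w where w: "w \<in> ball z q - {z}" "x = pt (inv_stereographic w)"
      unfolding nbh_def by blast
    then show "P x"
      using assms(3)[of w] q(3) punctured_disc_subset[OF assms(1) q(1,2)] by auto
  qed
  then show ?thesis
    unfolding end_filter_def
    using compactin_core[OF R0(2)[OF q(1,2)]] by (intro eventually_INF1[of ?K]) (simp_all only: mem_Collect_eq topo_surf)
qed

lemma filterlim_end_filter:
  assumes z: "z \<in> Z" and lim: "(h \<longlongrightarrow> z) F" and ne: "eventually (\<lambda>x. h x \<noteq> z) F"
  shows "filterlim (\<lambda>x. pt (inv_stereographic (h x))) (end_filter surf (end_at z)) F"
  unfolding end_filter_def filterlim_INF filterlim_principal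
proof (intro ballI)
  fix K assume "K \<in> {K. compactin (topo surf) K}"
  then obtain r where r: "r > 0" "nbh (ball z r - {z}) \<subseteq> end_at z K"
    using end_at_props(2)[OF z] by auto
  have "eventually (\<lambda>x. h x \<in> ball z r) F"
    using tendstoD[OF lim r(1)] by (simp add: dist_commute)
  with ne show "\<forall>\<^sub>F x in F. pt (inv_stereographic (h x)) \<in> end_at z K"
    by eventually_elim (use r(2) in \<open>auto simp: nbh_def\<close>)
qed

end

section \<open>Curvature and Gauss map\<close>

text \<open>Majorization by dyadic balls: on the ball of radius \<open>2 ^ k\<close> the weight is
  of order \<open>(1/16) ^ k\<close> and the area of order \<open>4 ^ k\<close>, so the integrals
  form a geometric series with ratio 1/4.\<close>

lemma nn_integral_inverse_quartic:
  "(\<integral>\<^sup>+z. ennreal (K / (1 + (cmod z)\<^sup>2)\<^sup>2) \<partial>lborel) < \<infinity>"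
proof (cases "K \<ge> 0")
  case False
  then have "ennreal (K / (1 + (cmod z)\<^sup>2)\<^sup>2) = 0" for z :: complex
    by (intro ennreal_neg divide_nonpos_nonneg) auto
  then show ?thesis by simp
next
  case True
  define f where "f k z = ennreal (16 * K * (1/16) ^ k) * indicator (ball 0 (2 ^ k)) z" for k and z :: complex
  have le: "ennreal (K / (1 + (cmod z)\<^sup>2)\<^sup>2) \<le> (\<Sum>k. f k z)" for z
  proof -
    obtain m where "cmod z < 2 ^ m" using real_arch_pow[of 2 "cmod z"] by auto
    \<comment> \<open>By minimality \<open>cmod z \<ge> 2 ^ (k - 1)\<close> when
      \<open>k > 0\<close>; the fourth power of this bound explains the factor 16 in
      \<open>f\<close>.\<close>
    define k where "k = (LEAST m. cmod z < 2 ^ m)"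
    have k: "cmod z < 2 ^ k" unfolding k_def by (rule LeastI) fact
    have "1 / (1 + (cmod z)\<^sup>2)\<^sup>2 \<le> 16 * (1/16) ^ k"
    proof (cases k)
      case 0
      have "1 \<le> (1 + (cmod z)\<^sup>2)\<^sup>2" by (simp add: one_le_power)
      then have "1 / (1 + (cmod z)\<^sup>2)\<^sup>2 \<le> 1" by simp
      then show ?thesis unfolding 0 power_0 by linarith
    next
      case (Suc j)
      then have "\<not> cmod z < 2 ^ j" using not_less_Least[of j "\<lambda>m. cmod z < 2 ^ m"] unfolding k_def by simp
      then have "(2 ^ j)\<^sup>2 \<le> (cmod z)\<^sup>2" by (intro power_mono) auto
      then have "((2 ^ j)\<^sup>2)\<^sup>2 \<le> (1 + (cmod z)\<^sup>2)\<^sup>2" by (intro power_mono) (linarith, simp)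
      moreover have "((2 ^ j)\<^sup>2)\<^sup>2 = (16 ^ j :: real)" by (simp add: power_mult[symmetric] power_mult mult.commute[of j])
      ultimately have "1 / (1 + (cmod z)\<^sup>2)\<^sup>2 \<le> 1 / 16 ^ j" by (intro divide_left_mono) auto
      then show ?thesis using Suc by (simp add: power_divide)
    qed
    then have "K * (1 / (1 + (cmod z)\<^sup>2)\<^sup>2) \<le> K * (16 * (1/16) ^ k)" by (intro mult_left_mono True)
    then have "ennreal (K / (1 + (cmod z)\<^sup>2)\<^sup>2) \<le> f k z" unfolding f_def using k by (simp add: mult_ac ennreal_leI)
    also have "\<dots> = (\<Sum>i\<in>{k}. f i z)" by simp
    also have "\<dots> \<le> (\<Sum>k. f k z)" by (rule sum_le_suminf) auto
    finally show ?thesis .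
  qed
  have int: "(\<integral>\<^sup>+z. f k z \<partial>lborel) = ennreal (16 * K * unit_ball_vol 2 * (1/4) ^ k)" for k
  proof -
    have "(\<integral>\<^sup>+z. f k z \<partial>lborel) = ennreal (16 * K * (1/16) ^ k) * ennreal (unit_ball_vol 2 * (2 ^ k)\<^sup>2)"
      unfolding f_def by (subst nn_integral_cmult_indicator) (auto simp: emeasure_ball)
    also have "\<dots> = ennreal (16 * K * (1/16) ^ k * (unit_ball_vol 2 * (2 ^ k)\<^sup>2))"
      using True by (intro ennreal_mult[symmetric]) auto
    also have "16 * K * (1/16) ^ k * (unit_ball_vol 2 * (2 ^ k)\<^sup>2) = 16 * K * unit_ball_vol 2 * ((1/16) ^ k * (2 ^ k)\<^sup>2)"
      by (simp only: ac_simps)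
    also have "(1/16) ^ k * (2 ^ k)\<^sup>2 = (1/4 :: real) ^ k"
      by (simp only: power_mult[symmetric] mult.commute[of k 2]) (simp add: power_mult power_mult_distrib[symmetric])
    finally show ?thesis .
  qed
  have sm: "summable (\<lambda>k. 16 * K * unit_ball_vol 2 * (1/4 :: real) ^ k)"
    by (intro summable_mult summable_geometric) simp
  have "(\<integral>\<^sup>+z. ennreal (K / (1 + (cmod z)\<^sup>2)\<^sup>2) \<partial>lborel) \<le> (\<integral>\<^sup>+z. (\<Sum>k. f k z) \<partial>lborel)"
    by (intro nn_integral_mono le)
  also have "\<dots> = (\<Sum>k. \<integral>\<^sup>+z. f k z \<partial>lborel)" unfolding f_def
    by (intro nn_integral_suminf borel_measurable_times_ennreal borel_measurable_const borel_measurable_indicator) simp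
  also have "\<dots> < \<infinity>" unfolding int
    using sm True by (simp add: less_top[symmetric] ennreal_suminf_neq_top)
  finally show ?thesis .
qed

lemma spinor_normal_scale:
  assumes "c \<noteq> 0"
  shows "spinor_normal (c * s) (c * t) = spinor_normal s t"
proof -
  have "(c * s) * cnj (c * t) = (c * cnj c) * (s * cnj t)" by simp
  then have p: "(c * s) * cnj (c * t) = of_real ((cmod c)\<^sup>2) * (s * cnj t)" by (simp only: complex_norm_square)
  have q: "(cmod (c * u))\<^sup>2 = (cmod c)\<^sup>2 * (cmod u)\<^sup>2" for u by (simp add: norm_mult power_mult_distrib)
  have r: "2 * Re (of_real k * u) = k * (2 * Re u)" "2 * Im (of_real k * u) = k * (2 * Im u)" for k u by simp_all
  have v: "vector [k * a, k * b, k * d] = k *\<^sub>R (vector [a, b, d] :: real^3)" for k a b d :: real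
    by (simp only: vec_eq_iff forall_3 vector_3 vector_scaleR_component real_scaleR_def)
  show ?thesis
    unfolding spinor_normal_def p r q right_diff_distrib[symmetric] distrib_left[symmetric] v scaleR_scaleR using assms by simp
qed

text \<open>The cross product with the normal is a quarter turn of the tangent plane, which amounts
  to multiplying \<open>h\<close> by \<open>- \<i>\<close>. So the flux is the real part of
  \<open>- \<i>\<close> times a contour integral of the Weierstrass form.\<close>

lemma cross_spinor_normal:
  assumes "s \<noteq> 0 \<or> t \<noteq> 0"
  shows "cross3 (reV (h *s weierstrass_vec s t)) (spinor_normal s t) = reV ((- \<i> * h) *s weierstrass_vec s t)"
proof -
  define c where "c = ((cmod s)\<^sup>2 + (cmod t)\<^sup>2)\<^sup>2 / 4"
  define P Q where "P = reV (weierstrass_vec s t)" and "Q = reV (\<i> *s weierstrass_vec s t)"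
  have c: "c \<noteq> 0" using assms by (simp add: c_def sum_power2_eq_zero_iff)
  have dots: "P \<bullet> P = c" "P \<bullet> Q = 0" "Q \<bullet> P = 0" "Q \<bullet> Q = c"
    unfolding P_def Q_def c_def by (simp_all add: weierstrass_dot inner_commute)
  have N: "cross3 P Q = c *\<^sub>R spinor_normal s t" unfolding P_def Q_def c_def by (rule weierstrass_cross)
  have "c *\<^sub>R cross3 (reV (h *s weierstrass_vec s t)) (spinor_normal s t) = cross3 (Re h *\<^sub>R P + Im h *\<^sub>R Q) (cross3 P Q)"
    unfolding reV_mult[of h] P_def[symmetric] Q_def[symmetric] N by (simp add: cross_mult_right)
  also have "\<dots> = c *\<^sub>R (Im h *\<^sub>R P - Re h *\<^sub>R Q)"
    unfolding Lagrange by (simp add: inner_add_left inner_add_right dots algebra_simps)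
  also have "Im h *\<^sub>R P - Re h *\<^sub>R Q = reV ((- \<i> * h) *s weierstrass_vec s t)"
    unfolding reV_mult[of "- \<i> * h"] P_def Q_def by simp
  finally show ?thesis using c by simp
qed

section \<open>Total curvature and limiting normals\<close>

context alternating
begin

text \<open>The numerators of the two spinors over a common denominator. \<open>P\<close> and
  \<open>Q\<close> have no common zero, so \<open>P / Q\<close> extends the Gauss map across the
  punctures.\<close>

definition P :: "complex \<Rightarrow> complex" where
  "P z = of_real (\<beta> - \<gamma>) * z ^ n + of_real (\<beta> + \<gamma>)"

definition Q :: "complex \<Rightarrow> complex" where
  "Q z = z ^ (n - 1) * (of_real (\<beta> + \<gamma>) * z ^ n + of_real (\<beta> - \<gamma>))"

definition dP :: "complex \<Rightarrow> complex" where
  "dP z = of_real (\<beta> - \<gamma>) * (of_nat n * z ^ (n - 1))"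

definition dQ :: "complex \<Rightarrow> complex" where
  "dQ z = of_nat (n - 1) * z ^ (n - 2) * (of_real (\<beta> + \<gamma>) * z ^ n + of_real (\<beta> - \<gamma>))
     + z ^ (n - 1) * (of_real (\<beta> + \<gamma>) * (of_nat n * z ^ (n - 1)))"

definition spin_den :: "complex \<Rightarrow> complex" where
  "spin_den z = of_nat n / (z ^ n * z ^ n - 1)"

lemma spin_PQ:
  assumes "z \<notin> Z"
  shows "spin1 z = spin_den z * P z" "spin2 z = spin_den z * Q z" "spin_den z \<noteq> 0"
proof -
  have d: "z ^ n * z ^ n - 1 = (z ^ n - 1) * (z ^ n + 1)" by (simp add: algebra_simps)
  show "spin_den z \<noteq> 0" using roots_neq[OF assms] unfolding spin_den_def d by simp
  show "spin1 z = spin_den z * P z"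
    using roots_neq[OF assms] unfolding spin1_def spin_den_def d P_def by (simp add: divide_simps) (simp add: algebra_simps)
  have *: "of_real \<beta> / (z ^ n - 1) + of_real \<gamma> / (z ^ n + 1)
      = (of_real (\<beta> + \<gamma>) * z ^ n + of_real (\<beta> - \<gamma>)) / ((z ^ n - 1) * (z ^ n + 1))"
    using roots_neq[OF assms] by (simp add: divide_simps) (simp add: algebra_simps)
  show "spin2 z = spin_den z * Q z"
    unfolding spin2_def spin_den_def d Q_def * by simp
qed

text \<open>At 0 only \<open>Q\<close> vanishes, as \<open>\<beta> + \<gamma> \<noteq> 0\<close>.
  Elsewhere, eliminating \<open>z ^ n\<close> from the two conditions leaves
  \<open>4 * (\<beta> * \<gamma>) = 0\<close>.\<close>

lemma PQ_nonzero: "P z \<noteq> 0 \<or> Q z \<noteq> 0"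
proof (rule ccontr)
  assume "\<not> ?thesis"
  then have p: "P z = 0" and q: "Q z = 0" by auto
  have "z \<noteq> 0" using p \<beta>\<gamma> n unfolding P_def of_real_eq_0_iff[symmetric, where 'a=complex] by (auto simp: power_0_left simp del: of_real_add of_real_eq_0_iff)
  then have q': "of_real (\<beta> + \<gamma>) * z ^ n + of_real (\<beta> - \<gamma>) = 0" using q unfolding Q_def by simp
  have "of_real (\<beta> + \<gamma>) * P z = of_real (\<beta> - \<gamma>) * (of_real (\<beta> + \<gamma>) * z ^ n + of_real (\<beta> - \<gamma>)) + of_real ((\<beta> + \<gamma>)\<^sup>2 - (\<beta> - \<gamma>)\<^sup>2)"
    unfolding P_def by (simp add: algebra_simps power2_eq_square)
  then have "complex_of_real ((\<beta> + \<gamma>)\<^sup>2 - (\<beta> - \<gamma>)\<^sup>2) = 0" unfolding p q' by simp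
  then have "(\<beta> + \<gamma>)\<^sup>2 - (\<beta> - \<gamma>)\<^sup>2 = 0" using of_real_eq_0_iff by blast
  then have "4 * (\<beta> * \<gamma>) = 0" by (simp add: power2_eq_square algebra_simps)
  then show False using \<beta> \<gamma> by simp
qed

lemma P_derivative: "(P has_field_derivative dP z) (at z)"
  unfolding P_def dP_def by (auto intro!: derivative_eq_intros)

lemma Q_derivative: "(Q has_field_derivative dQ z) (at z)"
proof -
  have e: "n - Suc (Suc 0) = n - 2" by simp
  show ?thesis
    unfolding Q_def dQ_def by (rule derivative_eq_intros refl | simp add: e del: diff_Suc_eq_diff_pred)+
qed

lemma spin_den_holomorphic: "spin_den holomorphic_on - Z"
proof -
  have "z ^ n * z ^ n - 1 \<noteq> 0" if "z \<in> - Z" for z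
    using roots_neq[of z] that mult_eq_0_iff[of "z ^ n - 1" "z ^ n + 1"] by (auto simp: algebra_simps)
  then show ?thesis unfolding spin_den_def by (intro holomorphic_intros) auto
qed

lemma spin_wronskian:
  assumes "z \<notin> Z"
  shows "spin1 z * deriv spin2 z - deriv spin1 z * spin2 z = (spin_den z)\<^sup>2 * (P z * dQ z - dP z * Q z)"
proof -
  have d: "(spin_den has_field_derivative deriv spin_den z) (at z)"
    using holomorphic_derivI[OF spin_den_holomorphic open_compl] assms by simp
  have "((\<lambda>z. spin_den z * P z) has_field_derivative deriv spin_den z * P z + dP z * spin_den z) (at z)"
    "((\<lambda>z. spin_den z * Q z) has_field_derivative deriv spin_den z * Q z + dQ z * spin_den z) (at z)"
    by (intro DERIV_mult d P_derivative Q_derivative)+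
  then have "(spin1 has_field_derivative deriv spin_den z * P z + dP z * spin_den z) (at z)"
    "(spin2 has_field_derivative deriv spin_den z * Q z + dQ z * spin_den z) (at z)"
    using assms open_compl spin_PQ by (auto elim!: has_field_derivative_transform_within_open)
  from this[THEN DERIV_imp_deriv] show ?thesis
    unfolding spin_PQ(1,2)[OF assms] by (simp add: algebra_simps power2_eq_square)
qed

text \<open>\<open>P\<close> and \<open>Q\<close> are reciprocal to each other in degree
  \<open>2 * n - 1\<close>, the degree of the Gauss map; this is the half turn on the level of
  polynomials.\<close>

lemma PQ_inversion:
  assumes "z \<noteq> 0"
  shows "P z = z ^ (2 * n - 1) * Q (1 / z)" "Q z = z ^ (2 * n - 1) * P (1 / z)"
proof -
  have e: "z ^ (2 * n - 1) = z ^ n * z ^ (n - 1)" using n by (simp add: power_add[symmetric] mult_2)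
  define y p where "y = z ^ n" and "p = z ^ (n - 1)"
  have ne: "y \<noteq> 0" "p \<noteq> 0" using assms by (simp_all add: y_def p_def)
  have "z ^ (2 * n - 1) * Q (1 / z) = y * p * (1 / p * (of_real (\<beta> + \<gamma>) * (1 / y) + of_real (\<beta> - \<gamma>)))"
    unfolding Q_def e power_one_over y_def p_def by simp
  also have "\<dots> = P z" unfolding P_def y_def[symmetric] using ne by (simp add: field_simps)
  finally show "P z = z ^ (2 * n - 1) * Q (1 / z)" by simp
  have "z ^ (2 * n - 1) * P (1 / z) = y * p * (of_real (\<beta> - \<gamma>) * (1 / y) + of_real (\<beta> + \<gamma>))"
    unfolding P_def e power_one_over y_def p_def by simp
  also have "\<dots> = Q z" unfolding Q_def y_def[symmetric] p_def[symmetric] using ne by (simp add: field_simps)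
  finally show "Q z = z ^ (2 * n - 1) * P (1 / z)" by simp
qed

definition wr :: "complex \<Rightarrow> complex" where
  "wr z = P z * dQ z - dP z * Q z"

text \<open>In the Wronskian the contributions from differentiating \<open>z ^ m\<close> cancel. The
  exponent is \<open>2 * d - 2\<close> for the degree \<open>d = 2 * n - 1\<close>, the number of
  branch points of the Gauss map.\<close>

lemma wr_inversion:
  assumes "z \<noteq> 0"
  shows "wr z = z ^ (4 * n - 4) * wr (1 / z)"
proof -
  define m where "m = 2 * n - 1"
  have m1: "m \<ge> 3" using n by (simp add: m_def)
  define w where "w = 1 / z"
  have inv: "((\<lambda>z. 1 / z) has_field_derivative - (w * w)) (at z)"
    unfolding w_def using assms by (auto intro!: derivative_eq_intros simp: power2_eq_square)
  have pw: "((\<lambda>z. z ^ m) has_field_derivative of_nat m * z ^ (m - 1)) (at z)" by (auto intro!: derivative_eq_intros)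
  have "((\<lambda>z. z ^ m * Q (1 / z)) has_field_derivative of_nat m * z ^ (m - 1) * Q (1/z) + (dQ (1/z) * - (w * w)) * z ^ m) (at z)"
    "((\<lambda>z. z ^ m * P (1 / z)) has_field_derivative of_nat m * z ^ (m - 1) * P (1/z) + (dP (1/z) * - (w * w)) * z ^ m) (at z)"
    by (intro DERIV_mult pw DERIV_chain2[OF Q_derivative inv] DERIV_chain2[OF P_derivative inv])+
  note der = this
  have "(P has_field_derivative of_nat m * z ^ (m - 1) * Q w + (dQ w * - (w * w)) * z ^ m) (at z)"
    by (rule has_field_derivative_transform_within_open[where S = "- {0}", OF der(1)[folded w_def]])
      (use assms PQ_inversion(1) in \<open>simp_all add: m_def open_Compl\<close>)
  moreover have "(Q has_field_derivative of_nat m * z ^ (m - 1) * P w + (dP w * - (w * w)) * z ^ m) (at z)"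
    by (rule has_field_derivative_transform_within_open[where S = "- {0}", OF der(2)[folded w_def]])
      (use assms PQ_inversion(2) in \<open>simp_all add: m_def open_Compl\<close>)
  ultimately have d: "dP z = of_nat m * z ^ (m - 1) * Q w + (dQ w * - (w * w)) * z ^ m"
    "dQ z = of_nat m * z ^ (m - 1) * P w + (dP w * - (w * w)) * z ^ m"
    using P_derivative Q_derivative DERIV_unique by blast+
  have PQ: "P z = z ^ m * Q w" "Q z = z ^ m * P w" using PQ_inversion[OF assms] by (simp_all add: w_def m_def)
  have "wr z = z ^ m * z ^ m * (w * w) * wr w"
    unfolding wr_def PQ d by (simp add: algebra_simps)
  also have "z ^ m = z ^ (m - 1) * z" using m1 by (simp add: power_eq_if)
  also have "z ^ (m - 1) * z * (z ^ (m - 1) * z) * (w * w) = z ^ (m - 1) * z ^ (m - 1)"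
    using assms by (simp add: w_def)
  also have "\<dots> = z ^ (4 * n - 4)"
  proof -
    have "m - 1 + (m - 1) = 4 * n - 4" using n unfolding m_def by linarith
    then show ?thesis by (simp only: power_add[symmetric])
  qed
  finally show ?thesis by (simp add: w_def)
qed

lemma continuous_PQ: "continuous_on S P" "continuous_on S Q" "continuous_on S wr"
  unfolding P_def Q_def wr_def dP_def dQ_def by (intro continuous_intros)+

text \<open>The left side is bounded on the unit disc by compactness, and inversion transforms both
  sides by the same factor. The factor 4 lost comes from \<open>1 + (cmod z)\<^sup>2\<close> being
  at most 2 inside the disc and at most \<open>2 * (cmod z)\<^sup>2\<close> outside.\<close>

lemma curvature_bound_exists:
  "\<exists>K. \<forall>z. 4 * (cmod (wr z))\<^sup>2 / ((cmod (P z))\<^sup>2 + (cmod (Q z))\<^sup>2)\<^sup>2 \<le> K / (1 + (cmod z)\<^sup>2)\<^sup>2"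
proof -
  define G where "G z = 4 * (cmod (wr z))\<^sup>2 / ((cmod (P z))\<^sup>2 + (cmod (Q z))\<^sup>2)\<^sup>2" for z
  have pos: "((cmod (P z))\<^sup>2 + (cmod (Q z))\<^sup>2)\<^sup>2 \<noteq> 0" for z
    using PQ_nonzero[of z] by (auto simp: sum_power2_eq_zero_iff)
  have "continuous_on (cball 0 1) G" unfolding G_def using pos by (intro continuous_intros continuous_PQ) auto
  then have "bounded (G ` cball 0 1)" using compact_continuous_image compact_cball compact_imp_bounded by blast
  then obtain K where K: "\<And>z. z \<in> cball 0 1 \<Longrightarrow> norm (G z) \<le> K" unfolding bounded_iff by blast
  have K0: "K \<ge> 0" using K[of 0] norm_ge_zero[of "G 0"] by simp
  have "G z \<le> 4 * K / (1 + (cmod z)\<^sup>2)\<^sup>2" for z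
  proof (cases "cmod z \<le> 1")
    case True
    then have "(1 + (cmod z)\<^sup>2)\<^sup>2 \<le> 2\<^sup>2" by (intro power_mono) (simp_all add: power_le_one)
    then have "4 * K / 2\<^sup>2 \<le> 4 * K / (1 + (cmod z)\<^sup>2)\<^sup>2" using K0 by (intro divide_left_mono mult_pos_pos) auto
    then show ?thesis using K[of z] True by simp
  next
    case False
    then have z: "z \<noteq> 0" "cmod z > 1" by auto
    define N where "N = cmod z"
    have N: "N > 1" using z by (simp add: N_def)
    define D where "D = (cmod (P (1/z)))\<^sup>2 + (cmod (Q (1/z)))\<^sup>2"
    have D0: "D\<^sup>2 \<noteq> 0" using pos[of "1/z"] by (simp add: D_def)
    have "(cmod (P z))\<^sup>2 + (cmod (Q z))\<^sup>2 = (N ^ (2 * n - 1))\<^sup>2 * D"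
      unfolding PQ_inversion[OF z(1)] D_def N_def by (simp add: norm_mult norm_power power_mult_distrib algebra_simps)
    moreover have "cmod (wr z) = N ^ (4 * n - 4) * cmod (wr (1/z))"
      unfolding wr_inversion[OF z(1)] N_def by (simp add: norm_mult norm_power)
    moreover have "(N ^ (2 * n - 1))\<^sup>2 = N ^ (4 * n - 4) * N\<^sup>2"
    proof -
      have "(2 * n - 1) * 2 = (4 * n - 4) + 2" using n by simp
      then show ?thesis by (simp only: power_mult[symmetric] power_add)
    qed
    ultimately have "G z = G (1 / z) / (N\<^sup>2)\<^sup>2"
      unfolding G_def D_def[symmetric] using N D0 by (simp add: power_mult_distrib)
    also have "\<dots> \<le> K / (N\<^sup>2)\<^sup>2"
      using K[of "1/z"] z by (intro divide_right_mono) (auto simp: norm_divide)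
    also have "\<dots> \<le> 4 * K / (1 + N\<^sup>2)\<^sup>2"
    proof -
      have "(1 + N\<^sup>2)\<^sup>2 \<le> (2 * N\<^sup>2)\<^sup>2" using N by (intro power_mono) (auto simp: one_le_power)
      then have "K * (1 + N\<^sup>2)\<^sup>2 \<le> K * (2 * N\<^sup>2)\<^sup>2" using K0 by (intro mult_left_mono)
      moreover have "N\<^sup>2 > 0" "1 + N\<^sup>2 > 0" using N by (auto intro: add_pos_pos)
      ultimately show ?thesis by (simp add: divide_simps power_mult_distrib mult_ac)
    qed
    finally show ?thesis by (simp add: N_def)
  qed
  then show ?thesis unfolding G_def by blast
qed

lemma spin_normal_eq: "z \<notin> Z \<Longrightarrow> spinor_normal (spin1 z) (spin2 z) = spinor_normal (P z) (Q z)"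
  using spin_PQ[of z] spinor_normal_scale[of "spin_den z" "P z" "Q z"] by simp

text \<open>At a puncture \<open>P\<close> and \<open>Q\<close> take the values \<open>2 * e\<close>
  and \<open>2 * e * cnj \<zeta>\<close>, whose quotient is \<zeta> for either sign of
  \<open>e\<close>.\<close>

lemma normal_at_end:
  assumes "\<zeta> \<in> Z"
  shows "((\<lambda>z. spinor_normal (spin1 z) (spin2 z)) \<longlongrightarrow> hv \<zeta>) (at \<zeta>)"
proof -
  define e :: real where "e = (if \<zeta> ^ n = 1 then \<beta> else \<gamma>)"
  have e: "e \<noteq> 0" using \<beta> \<gamma> by (simp add: e_def)
  have one: "\<zeta> * \<zeta> ^ (n - 1) = \<zeta> ^ n" by (metis n_pos(1) power_eq_if n_pos(2))
  have z0: "\<zeta> \<noteq> 0" by (rule Z_nonzero[OF assms])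
  have cj: "cnj \<zeta> = 1 / \<zeta>" by (rule cnj_Z[OF assms])
  have "P \<zeta> = of_real (2 * e) \<and> Q \<zeta> = of_real (2 * e) * cnj \<zeta>"
  proof (cases "\<zeta> ^ n = 1")
    case True
    then have "\<zeta> ^ (n - 1) = 1 / \<zeta>" using one z0 by (simp add: field_simps)
    then show ?thesis unfolding P_def Q_def e_def cj True by (simp add: field_simps)
  next
    case False
    then have m: "\<zeta> ^ n = -1" using assms Z_iff by blast
    then have "\<zeta> ^ (n - 1) = - 1 / \<zeta>" using one z0 by (simp add: field_simps)
    then show ?thesis unfolding P_def Q_def e_def cj m by (simp add: field_simps)
  qed
  then have "spinor_normal (P \<zeta>) (Q \<zeta>) = spinor_normal (of_real (2 * e) * 1) (of_real (2 * e) * cnj \<zeta>)" by simp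
  also have "\<dots> = spinor_normal 1 (cnj \<zeta>)" by (rule spinor_normal_scale) (use e in simp)
  also have "\<dots> = hv \<zeta>" unfolding spinor_normal_def using norm_Z[OF assms] by (simp add: vec_eq_iff forall_3)
  finally have eq: "spinor_normal (P \<zeta>) (Q \<zeta>) = hv \<zeta>" .
  have "continuous_on UNIV (\<lambda>z. spinor_normal (P z) (Q z))"
  proof -
    have pos: "(cmod (P z))\<^sup>2 + (cmod (Q z))\<^sup>2 \<noteq> 0" for z
      using PQ_nonzero[of z] by (auto simp: sum_power2_eq_zero_iff)
    have q: "continuous_on UNIV (\<lambda>z. inverse ((cmod (P z))\<^sup>2 + (cmod (Q z))\<^sup>2))"
      by (rule continuous_on_inverse) (intro continuous_intros continuous_PQ, use pos in blast)
    show ?thesis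
      unfolding spinor_normal_def divide_inverse mult_1
      by (rule continuous_on_vec3; simp only: vector_scaleR_component vector_3 real_scaleR_def; intro continuous_intros continuous_PQ q)
  qed
  then have "((\<lambda>z. spinor_normal (P z) (Q z)) \<longlongrightarrow> spinor_normal (P \<zeta>) (Q \<zeta>)) (at \<zeta>)"
    by (simp add: continuous_on_def)
  moreover have "eventually (\<lambda>z. z \<notin> Z) (at \<zeta>)"
  proof -
    have "open (- (Z - {\<zeta>}))" using finite_Z by (intro open_Compl finite_imp_closed) auto
    then have "eventually (\<lambda>z. z \<in> - (Z - {\<zeta>})) (at \<zeta>)" by (intro eventually_at_in_open') auto
    then show ?thesis using eventually_neq_at_within[of \<zeta> \<zeta> UNIV] by eventually_elim auto
  qed
  then have "eventually (\<lambda>z. spinor_normal (P z) (Q z) = spinor_normal (spin1 z) (spin2 z)) (at \<zeta>)"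
    by eventually_elim (rule spin_normal_eq[symmetric])
  ultimately show ?thesis unfolding eq by (rule Lim_transform_eventually)
qed

end

locale alternating_surface = alternating n \<beta> \<gamma> for n \<beta> \<gamma> +
  fixes emb :: "real^3 \<Rightarrow> real^3"
  assumes bij_emb_Z: "bij_betw emb UNIV (sphere 0 1 - inv_stereographic ` Z)"

sublocale alternating_surface \<subseteq> sph?: spinor_surface Z emb X spin1 spin2
proof -
  interpret punctured_sphere Z
    by (rule punctured_sphere.intro[OF finite_Z _ inverse_Z]) (use Z_nonzero in blast)
  show "spinor_surface Z emb X spin1 spin2"
    by (intro spinor_surface.intro parametrized_sphere.intro parametrized_sphere_axioms.intro
        spinor_surface_axioms.intro punctured_sphere_axioms spinor_rep_north spinor_rep_south
        bij_emb_Z[folded C_def])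
qed

context alternating_surface
begin

lemma finite_total_curvature: "total_abs_curvature surf imm < \<infinity>"
proof -
  obtain K where K: "\<And>z. 4 * (cmod (wr z))\<^sup>2 / ((cmod (P z))\<^sup>2 + (cmod (Q z))\<^sup>2)\<^sup>2 \<le> K / (1 + (cmod z)\<^sup>2)\<^sup>2"
    using curvature_bound_exists by blast
  show ?thesis
  proof (rule total_abs_curvature_surf)
    fix z assume z: "z \<notin> Z"
    have s: "spin_den z \<noteq> 0" by (rule spin_PQ(3)[OF z])
    have "4 * (cmod (spin1 z * deriv spin2 z - deriv spin1 z * spin2 z))\<^sup>2 / ((cmod (spin1 z))\<^sup>2 + (cmod (spin2 z))\<^sup>2)\<^sup>2
       = 4 * ((cmod (spin_den z))\<^sup>2 * cmod (wr z))\<^sup>2 / ((cmod (spin_den z))\<^sup>2 * ((cmod (P z))\<^sup>2 + (cmod (Q z))\<^sup>2))\<^sup>2"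
      unfolding spin_wronskian[OF z] wr_def[symmetric]
      unfolding spin_PQ(1,2)[OF z] norm_mult norm_power power_mult_distrib distrib_left ..
    also have "\<dots> = 4 * (cmod (wr z))\<^sup>2 / ((cmod (P z))\<^sup>2 + (cmod (Q z))\<^sup>2)\<^sup>2"
    proof -
      have "4 * (k * u)\<^sup>2 / (k * v)\<^sup>2 = 4 * u\<^sup>2 / v\<^sup>2" if "k \<noteq> 0" for k u v :: real
        using that by (simp add: power_mult_distrib)
      then show ?thesis using s by simp
    qed
    finally show "4 * (cmod (spin1 z * deriv spin2 z - deriv spin1 z * spin2 z))\<^sup>2 /
        ((cmod (spin1 z))\<^sup>2 + (cmod (spin2 z))\<^sup>2)\<^sup>2 \<le> K / (1 + (cmod z)\<^sup>2)\<^sup>2"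
      using K[of z] by simp
  next
    have "(1 + (cmod z)\<^sup>2)\<^sup>2 \<noteq> 0" for z using one_plus_norm2_nonzero[of z] by simp
    then show "continuous_on UNIV (\<lambda>z. K / (1 + (cmod z)\<^sup>2)\<^sup>2)" by (intro continuous_intros) auto
  qed (rule nn_integral_inverse_quartic)
qed

lemma end_normal_surf:
  assumes "\<zeta> \<in> Z"
  shows "end_normal surf imm (end_at \<zeta>) (hv \<zeta>)"
  unfolding end_normal_def
proof (rule tendstoI)
  fix e :: real assume "e > 0"
  then have "eventually (\<lambda>z. dist (spinor_normal (spin1 z) (spin2 z)) (hv \<zeta>) < e) (at \<zeta>)"
    by (rule tendstoD[OF normal_at_end[OF assms]])
  then obtain r where r: "r > 0" "\<And>z. z \<noteq> \<zeta> \<Longrightarrow> dist z \<zeta> < r \<Longrightarrow> dist (spinor_normal (spin1 z) (spin2 z)) (hv \<zeta>) < e"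
    unfolding eventually_at by auto
  show "eventually (\<lambda>p. dist (gauss_map surf imm p) (hv \<zeta>) < e) (end_filter surf (end_at \<zeta>))"
    by (rule eventually_end_filter[OF assms r(1)]) (use r(2) in \<open>auto simp: gauss_map_surf dist_commute\<close>)
qed

lemma stereographic_hv: "stereographic (hv z) = z"
  by (simp add: stereographic_def complex_eq_iff)

end

section \<open>Local behaviour at the ends\<close>

context alternating
begin

lemma separation: "\<exists>R>0. \<forall>\<zeta>\<in>Z. \<forall>x\<in>Z - {\<zeta>}. R \<le> cmod (\<zeta> - x)"
proof -
  let ?D = "insert 1 ((\<lambda>(a, b). cmod (a - b)) ` {(a, b). a \<in> Z \<and> b \<in> Z \<and> a \<noteq> b})"
  have "finite {(a, b). a \<in> Z \<and> b \<in> Z \<and> a \<noteq> b}"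
    by (rule finite_subset[of _ "Z \<times> Z"]) (use finite_Z in auto)
  then have fin: "finite ?D" by simp
  have "Min ?D > 0" using fin by (subst Min_gr_iff) auto
  moreover have "Min ?D \<le> cmod (\<zeta> - x)" if "\<zeta> \<in> Z" "x \<in> Z - {\<zeta>}" for \<zeta> x
    using fin that by (intro Min_le) (auto intro!: image_eqI[of _ _ "(\<zeta>, x)"])
  ultimately show ?thesis by blast
qed

definition sep :: real where
  "sep = (SOME R. R > 0 \<and> (\<forall>\<zeta>\<in>Z. \<forall>x\<in>Z - {\<zeta>}. R \<le> cmod (\<zeta> - x)))"

lemma sep: "sep > 0" "\<zeta> \<in> Z \<Longrightarrow> x \<in> Z \<Longrightarrow> x \<noteq> \<zeta> \<Longrightarrow> sep \<le> cmod (\<zeta> - x)"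
  using someI_ex[OF separation] unfolding sep_def[symmetric] by auto

text \<open>Near the end \<open>\<zeta>\<close> we use the coordinate \<open>\<xi> = (z - \<zeta>) / \<zeta>\<close>. The terms of \<open>X\<close> belonging to
  the other ends contribute the real part of a holomorphic function.\<close>

definition Hol :: "complex \<Rightarrow> real^3 \<Rightarrow> complex \<Rightarrow> complex" where
  "Hol \<zeta> v \<xi> = (\<Sum>x\<in>Z - {\<zeta>}.
     of_real (fl x * (hv x \<bullet> v)) * (of_real (ln (cmod (\<zeta> - x))) + Ln (1 + \<zeta> * \<xi> / (\<zeta> - x)))
     - of_real ((wt x)\<^sup>2 * (hv (\<i> * x) \<bullet> v)) * (\<i> * (x / (\<zeta> * (1 + \<xi>) - x)))
     - of_real ((wt x)\<^sup>2 * (vertical \<bullet> v)) * (x / (\<zeta> * (1 + \<xi>) - x) + 1 / 2))"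

text \<open>For \<open>cmod \<xi> < sep\<close> the quotient
  \<open>\<zeta> * \<xi> / (\<zeta> - x)\<close> has modulus below 1, so the argument of
  \<open>Ln\<close> stays in the right half plane, off the branch cut.\<close>

lemma near_end:
  assumes "\<zeta> \<in> Z" "x \<in> Z - {\<zeta>}" "\<xi> \<in> ball 0 sep"
  shows "\<zeta> * (1 + \<xi>) - x \<noteq> 0" "\<zeta> - x \<noteq> 0" "1 + \<zeta> * \<xi> / (\<zeta> - x) \<notin> \<real>\<^sub>\<le>\<^sub>0"
    "\<zeta> * (1 + \<xi>) - x = (\<zeta> - x) * (1 + \<zeta> * \<xi> / (\<zeta> - x))"
proof -
  have s: "sep \<le> cmod (\<zeta> - x)" using sep(2) assms by auto
  then show nz: "\<zeta> - x \<noteq> 0" using sep(1) by auto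
  have "cmod (\<zeta> * \<xi>) < sep" using assms(3) norm_Z[OF assms(1)] by (simp add: norm_mult)
  then have "cmod (\<zeta> * \<xi> / (\<zeta> - x)) < 1" using s nz by (simp add: norm_divide)
  then have "Re (1 + \<zeta> * \<xi> / (\<zeta> - x)) > 0" using abs_Re_le_cmod[of "\<zeta> * \<xi> / (\<zeta> - x)"] by simp
  then show np: "1 + \<zeta> * \<xi> / (\<zeta> - x) \<notin> \<real>\<^sub>\<le>\<^sub>0" by (auto simp: complex_nonpos_Reals_iff)
  show e: "\<zeta> * (1 + \<xi>) - x = (\<zeta> - x) * (1 + \<zeta> * \<xi> / (\<zeta> - x))" using nz by (simp add: field_simps)
  show "\<zeta> * (1 + \<xi>) - x \<noteq> 0" unfolding e using nz np by auto
qed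

lemma Hol_holomorphic: "\<zeta> \<in> Z \<Longrightarrow> Hol \<zeta> v holomorphic_on ball 0 sep"
  unfolding Hol_def using near_end by (intro holomorphic_intros) auto

text \<open>With \<open>z = \<zeta> * (1 + \<xi>)\<close> the term belonging to \<zeta> has
  \<open>\<zeta> / (z - \<zeta>) = 1 / \<xi>\<close> and contains all singular parts. The vector
  \<open>v\<close> will be a member of the frame at \<zeta>, or arbitrary when the direction of
  escape is computed.\<close>

lemma X_expand:
  assumes \<zeta>: "\<zeta> \<in> Z" and \<xi>: "\<xi> \<noteq> 0" "cmod \<xi> < sep"
  shows "\<zeta> * (1 + \<xi>) \<notin> Z"
    and "X (inv_stereographic (\<zeta> * (1 + \<xi>))) \<bullet> v = fl \<zeta> * ln (cmod \<xi>) * (hv \<zeta> \<bullet> v)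
      + (wt \<zeta>)\<^sup>2 * Im (1 / \<xi>) * (hv (\<i> * \<zeta>) \<bullet> v)
      - (wt \<zeta>)\<^sup>2 * (Re (1 / \<xi>) + 1 / 2) * (vertical \<bullet> v) + Re (Hol \<zeta> v \<xi>)"
proof -
  have b: "\<xi> \<in> ball 0 sep" using \<xi> by simp
  have z0: "\<zeta> \<noteq> 0" by (rule Z_nonzero[OF \<zeta>])
  show nZ: "\<zeta> * (1 + \<xi>) \<notin> Z"
  proof
    assume "\<zeta> * (1 + \<xi>) \<in> Z"
    moreover have "\<zeta> * (1 + \<xi>) \<noteq> \<zeta>" using \<xi> z0 by simp
    ultimately show False using near_end(1)[OF \<zeta> _ b, of "\<zeta> * (1 + \<xi>)"] by auto
  qed
  have own: "Xterm \<zeta> (\<zeta> * (1 + \<xi>)) \<bullet> v = fl \<zeta> * ln (cmod \<xi>) * (hv \<zeta> \<bullet> v)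
      + (wt \<zeta>)\<^sup>2 * Im (1 / \<xi>) * (hv (\<i> * \<zeta>) \<bullet> v) - (wt \<zeta>)\<^sup>2 * (Re (1 / \<xi>) + 1 / 2) * (vertical \<bullet> v)"
  proof -
    have d: "\<zeta> * (1 + \<xi>) - \<zeta> = \<zeta> * \<xi>" by (simp add: algebra_simps)
    have q: "\<zeta> / (\<zeta> * \<xi>) = 1 / \<xi>" using z0 by simp
    have m: "cmod (\<zeta> * \<xi>) = cmod \<xi>" using norm_Z[OF \<zeta>] by (simp add: norm_mult)
    show ?thesis unfolding Xterm_def d q m inner_diff_left inner_add_left inner_scaleR_left ..
  qed
  have rest: "Xterm x (\<zeta> * (1 + \<xi>)) \<bullet> v = Re (
     of_real (fl x * (hv x \<bullet> v)) * (of_real (ln (cmod (\<zeta> - x))) + Ln (1 + \<zeta> * \<xi> / (\<zeta> - x)))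
     - of_real ((wt x)\<^sup>2 * (hv (\<i> * x) \<bullet> v)) * (\<i> * (x / (\<zeta> * (1 + \<xi>) - x)))
     - of_real ((wt x)\<^sup>2 * (vertical \<bullet> v)) * (x / (\<zeta> * (1 + \<xi>) - x) + 1 / 2))" if x: "x \<in> Z - {\<zeta>}" for x
  proof -
    note ne = near_end[OF \<zeta> x b]
    define u where "u = x / (\<zeta> * (1 + \<xi>) - x)"
    have nz: "1 + \<zeta> * \<xi> / (\<zeta> - x) \<noteq> 0" using ne(1) unfolding ne(4) by auto
    then have l: "ln (cmod (\<zeta> * (1 + \<xi>) - x)) = ln (cmod (\<zeta> - x)) + Re (Ln (1 + \<zeta> * \<xi> / (\<zeta> - x)))"
      unfolding ne(4) norm_mult using ne(2) by (simp add: ln_mult_pos)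
    have R: "Re (of_real a * (of_real b + c) - of_real d * (\<i> * u) - of_real e * (u + 1 / 2))
      = a * (b + Re c) + d * Im u - e * (Re u + 1 / 2)" for a b d e :: real and c by simp
    show ?thesis
      unfolding Xterm_def l u_def[symmetric] inner_diff_left inner_add_left inner_scaleR_left R
      by (simp add: algebra_simps)
  qed
  have "X (inv_stereographic (\<zeta> * (1 + \<xi>))) = Xterm \<zeta> (\<zeta> * (1 + \<xi>)) + (\<Sum>x\<in>Z - {\<zeta>}. Xterm x (\<zeta> * (1 + \<xi>)))"
    unfolding X_inv_stereographic[OF nZ] by (rule sum.remove[OF finite_Z \<zeta>])
  then have "X (inv_stereographic (\<zeta> * (1 + \<xi>))) \<bullet> v
      = Xterm \<zeta> (\<zeta> * (1 + \<xi>)) \<bullet> v + (\<Sum>x\<in>Z - {\<zeta>}. Xterm x (\<zeta> * (1 + \<xi>)) \<bullet> v)"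
    by (simp only: inner_add_left inner_sum_left)
  also have "(\<Sum>x\<in>Z - {\<zeta>}. Xterm x (\<zeta> * (1 + \<xi>)) \<bullet> v) = Re (Hol \<zeta> v \<xi>)"
    unfolding Hol_def Re_sum by (intro sum.cong refl rest)
  finally show "X (inv_stereographic (\<zeta> * (1 + \<xi>))) \<bullet> v = fl \<zeta> * ln (cmod \<xi>) * (hv \<zeta> \<bullet> v)
      + (wt \<zeta>)\<^sup>2 * Im (1 / \<xi>) * (hv (\<i> * \<zeta>) \<bullet> v)
      - (wt \<zeta>)\<^sup>2 * (Re (1 / \<xi>) + 1 / 2) * (vertical \<bullet> v) + Re (Hol \<zeta> v \<xi>)"
    unfolding own .
qed

lemma Hol_tendsto:
  assumes "\<zeta> \<in> Z"
  shows "((\<lambda>\<xi>. Re (Hol \<zeta> v \<xi>)) \<longlongrightarrow> Re (Hol \<zeta> v 0)) (at 0)"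
proof -
  have "isCont (Hol \<zeta> v) 0"
    using holomorphic_on_imp_continuous_on[OF Hol_holomorphic[OF assms]] sep(1)
    by (simp add: continuous_on_eq_continuous_at)
  then show ?thesis by (intro tendsto_Re) (simp add: isCont_def)
qed

lemma eventually_near: "eventually (\<lambda>\<xi>. \<xi> \<noteq> 0 \<and> cmod \<xi> < sep) (at 0)"
  unfolding eventually_at using sep(1) by (auto intro!: exI[of _ sep])

lemma frame_eq:
  assumes "\<zeta> \<in> Z"
  shows "x = (x \<bullet> hv (\<i> * \<zeta>)) *\<^sub>R hv (\<i> * \<zeta>) + (x \<bullet> vertical) *\<^sub>R vertical + (x \<bullet> hv \<zeta>) *\<^sub>R hv \<zeta>"
    and "(norm x)\<^sup>2 = (x \<bullet> hv (\<i> * \<zeta>))\<^sup>2 + (x \<bullet> vertical)\<^sup>2 + (x \<bullet> hv \<zeta>)\<^sup>2"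
proof -
  show e: "x = (x \<bullet> hv (\<i> * \<zeta>)) *\<^sub>R hv (\<i> * \<zeta>) + (x \<bullet> vertical) *\<^sub>R vertical + (x \<bullet> hv \<zeta>) *\<^sub>R hv \<zeta>"
    using frame_decomposition[OF norm_Z[OF assms], of x] by (simp add: inner_3[of x vertical] add_ac)
  have "x \<bullet> x = x \<bullet> ((x \<bullet> hv (\<i> * \<zeta>)) *\<^sub>R hv (\<i> * \<zeta>) + (x \<bullet> vertical) *\<^sub>R vertical + (x \<bullet> hv \<zeta>) *\<^sub>R hv \<zeta>)"
    using e by simp
  then show "(norm x)\<^sup>2 = (x \<bullet> hv (\<i> * \<zeta>))\<^sup>2 + (x \<bullet> vertical)\<^sup>2 + (x \<bullet> hv \<zeta>)\<^sup>2"
    unfolding power2_norm_eq_inner inner_add_right inner_scaleR_right by (simp add: power2_eq_square)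
qed

lemma frame_inner:
  assumes "\<zeta> \<in> Z"
  shows "hv \<zeta> \<bullet> hv \<zeta> = 1" "hv (\<i> * \<zeta>) \<bullet> hv (\<i> * \<zeta>) = 1" "hv \<zeta> \<bullet> hv (\<i> * \<zeta>) = 0" "hv (\<i> * \<zeta>) \<bullet> hv \<zeta> = 0"
proof -
  have "\<zeta> * cnj \<zeta> = 1" using norm_Z[OF assms] complex_norm_square[of \<zeta>] by simp
  then show "hv \<zeta> \<bullet> hv \<zeta> = 1" "hv (\<i> * \<zeta>) \<bullet> hv (\<i> * \<zeta>) = 1" "hv \<zeta> \<bullet> hv (\<i> * \<zeta>) = 0" "hv (\<i> * \<zeta>) \<bullet> hv \<zeta> = 0"
    unfolding hv_inner by (simp_all add: algebra_simps)
qed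

lemma X_components:
  assumes "\<zeta> \<in> Z" "\<xi> \<noteq> 0" "cmod \<xi> < sep"
  shows "X (inv_stereographic (\<zeta> * (1 + \<xi>))) \<bullet> hv (\<i> * \<zeta>) = (wt \<zeta>)\<^sup>2 * Im (1 / \<xi>) + Re (Hol \<zeta> (hv (\<i> * \<zeta>)) \<xi>)"
    and "X (inv_stereographic (\<zeta> * (1 + \<xi>))) \<bullet> vertical = - (wt \<zeta>)\<^sup>2 * (Re (1 / \<xi>) + 1 / 2) + Re (Hol \<zeta> vertical \<xi>)"
    and "X (inv_stereographic (\<zeta> * (1 + \<xi>))) \<bullet> hv \<zeta> = fl \<zeta> * ln (cmod \<xi>) + Re (Hol \<zeta> (hv \<zeta>) \<xi>)"
  unfolding X_expand(2)[OF assms] frame_inner[OF assms(1)] hv_vertical by simp_all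

lemma norm_ln_tendsto: "((\<lambda>\<xi>::complex. cmod \<xi> * ln (cmod \<xi>)) \<longlongrightarrow> 0) (at 0)"
proof -
  have "((\<lambda>x::real. x * ln x) \<longlongrightarrow> 0) (at_right 0)"
  proof -
    have "((\<lambda>y::real. - (ln y / y)) \<longlongrightarrow> - 0) at_top" by (intro tendsto_minus ln_x_over_x_tendsto_0)
    then have "((\<lambda>x::real. - (ln (inverse x) / inverse x)) \<longlongrightarrow> 0) (at_right 0)"
      using filterlim_compose[OF _ filterlim_inverse_at_top_right] by fastforce
    moreover have "eventually (\<lambda>x::real. - (ln (inverse x) / inverse x) = x * ln x) (at_right 0)"
      unfolding eventually_at_filter by (auto simp: ln_inverse divide_inverse intro!: always_eventually)
    ultimately show ?thesis by (rule Lim_transform_eventually)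
  qed
  moreover have "filterlim (\<lambda>\<xi>::complex. cmod \<xi>) (at_right 0) (at 0)"
    unfolding filterlim_at by (auto intro!: tendsto_eq_intros simp: eventually_at_filter)
  ultimately show ?thesis by (rule filterlim_compose)
qed

text \<open>The pole \<open>1 / \<xi>\<close> dominates the logarithm. The limit serves to replace
  the coordinate size \<open>cmod \<xi>\<close> by the norm of the point in space, which isometries
  change only by a bounded amount.\<close>

lemma scaled_X:
  assumes \<zeta>: "\<zeta> \<in> Z"
  shows "((\<lambda>\<xi>. cmod \<xi> * norm (X (inv_stereographic (\<zeta> * (1 + \<xi>))))) \<longlongrightarrow> (wt \<zeta>)\<^sup>2) (at 0)"
proof -
  define Y where "Y \<xi> = X (inv_stereographic (\<zeta> * (1 + \<xi>)))" for \<xi>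
  define k where "k = (wt \<zeta>)\<^sup>2"
  define r1 where "r1 \<xi> = Re (Hol \<zeta> (hv (\<i> * \<zeta>)) \<xi>)" for \<xi>
  define r2 where "r2 \<xi> = Re (Hol \<zeta> vertical \<xi>) - k / 2" for \<xi>
  define r3 where "r3 \<xi> = Re (Hol \<zeta> (hv \<zeta>) \<xi>)" for \<xi>
  have lims: "(r1 \<longlongrightarrow> r1 0) (at 0)" "(r2 \<longlongrightarrow> r2 0) (at 0)" "(r3 \<longlongrightarrow> r3 0) (at 0)"
    unfolding r1_def r2_def r3_def by (intro tendsto_intros Hol_tendsto \<zeta>)+
  have m: "((\<lambda>\<xi>::complex. cmod \<xi>) \<longlongrightarrow> 0) (at 0)" by (auto intro!: tendsto_eq_intros)
  \<comment> \<open>the squared norm of \<open>\<xi> Y(\<xi>)\<close>; the leading terms contribute \<open>k\<^sup>2 (Im\<^sup>2 + Re\<^sup>2)(\<bar>\<xi>\<bar> / \<xi>) = k\<^sup>2\<close>\<close>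
  have sq: "(cmod \<xi> * norm (Y \<xi>))\<^sup>2 = k\<^sup>2 + 2 * k * (Im (of_real (cmod \<xi>) / \<xi>) * (cmod \<xi> * r1 \<xi>) - Re (of_real (cmod \<xi>) / \<xi>) * (cmod \<xi> * r2 \<xi>))
      + (cmod \<xi> * r1 \<xi>)\<^sup>2 + (cmod \<xi> * r2 \<xi>)\<^sup>2 + (fl \<zeta> * (cmod \<xi> * ln (cmod \<xi>)) + cmod \<xi> * r3 \<xi>)\<^sup>2"
    if "\<xi> \<noteq> 0 \<and> cmod \<xi> < sep" for \<xi>
  proof -
    define M a b where "M = cmod \<xi>" and "a = Im (1 / \<xi>)" and "b = Re (1 / \<xi>)"
    have c: "Y \<xi> \<bullet> hv (\<i> * \<zeta>) = k * a + r1 \<xi>" "Y \<xi> \<bullet> vertical = - k * b + r2 \<xi>"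
      "Y \<xi> \<bullet> hv \<zeta> = fl \<zeta> * ln M + r3 \<xi>"
      using X_components[OF \<zeta>, of \<xi>] that
      unfolding Y_def k_def r1_def r2_def r3_def M_def a_def b_def by (simp_all only: ring_distribs) simp_all
    have q: "Im (of_real (cmod \<xi>) / \<xi>) = M * a" "Re (of_real (cmod \<xi>) / \<xi>) = M * b"
      unfolding M_def a_def b_def by (simp_all add: Im_divide Re_divide)
    have "(cmod (1 / \<xi>))\<^sup>2 = b\<^sup>2 + a\<^sup>2" unfolding a_def b_def by (rule cmod_power2)
    moreover have "cmod (1 / \<xi>) = 1 / M" by (simp add: M_def norm_divide)
    moreover have "M \<noteq> 0" using that by (simp add: M_def)
    ultimately have ab: "M\<^sup>2 * (b\<^sup>2 + a\<^sup>2) = 1" by (metis power_one power_divide nonzero_mult_div_cancel_left power_not_zero times_divide_eq_right mult.right_neutral)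
    have "(M * norm (Y \<xi>))\<^sup>2 = M\<^sup>2 * ((k * a + r1 \<xi>)\<^sup>2 + (- k * b + r2 \<xi>)\<^sup>2 + (fl \<zeta> * ln M + r3 \<xi>)\<^sup>2)"
      unfolding power_mult_distrib frame_eq(2)[OF \<zeta>, of "Y \<xi>"] c ..
    also have "\<dots> = k\<^sup>2 * (M\<^sup>2 * (b\<^sup>2 + a\<^sup>2)) + 2 * k * (M * a * (M * r1 \<xi>) - M * b * (M * r2 \<xi>))
      + (M * r1 \<xi>)\<^sup>2 + (M * r2 \<xi>)\<^sup>2 + (fl \<zeta> * (M * ln M) + M * r3 \<xi>)\<^sup>2"
      by (simp add: power2_eq_square algebra_simps)
    finally show ?thesis unfolding ab q unfolding M_def[symmetric] by simp
  qed
  have z: "((\<lambda>\<xi>. cmod \<xi> * r \<xi>) \<longlongrightarrow> 0) (at 0)" if "(r \<longlongrightarrow> r 0) (at 0)" for r :: "complex \<Rightarrow> real"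
    using tendsto_mult[OF m that] by simp
  have bz: "((\<lambda>\<xi>. g (of_real (cmod \<xi>) / \<xi>) * (cmod \<xi> * r \<xi>)) \<longlongrightarrow> 0) (at 0)"
    if r: "(r \<longlongrightarrow> r 0) (at 0)" and g: "\<And>u. \<bar>g u\<bar> \<le> cmod u" for r g
  proof (rule Lim_null_comparison[OF _ tendsto_norm_zero[OF z[OF r]]])
    have "\<bar>g (of_real (cmod \<xi>) / \<xi>)\<bar> \<le> 1" for \<xi>
      by (rule order_trans[OF g]) (simp add: norm_divide)
    then show "eventually (\<lambda>\<xi>. norm (g (of_real (cmod \<xi>) / \<xi>) * (cmod \<xi> * r \<xi>)) \<le> norm (cmod \<xi> * r \<xi>)) (at 0)"
      by (intro always_eventually allI) (simp add: norm_mult abs_mult mult_left_le_one_le)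
  qed
  have "((\<lambda>\<xi>. k\<^sup>2 + 2 * k * (Im (of_real (cmod \<xi>) / \<xi>) * (cmod \<xi> * r1 \<xi>) - Re (of_real (cmod \<xi>) / \<xi>) * (cmod \<xi> * r2 \<xi>))
      + (cmod \<xi> * r1 \<xi>)\<^sup>2 + (cmod \<xi> * r2 \<xi>)\<^sup>2 + (fl \<zeta> * (cmod \<xi> * ln (cmod \<xi>)) + cmod \<xi> * r3 \<xi>)\<^sup>2)
      \<longlongrightarrow> k\<^sup>2 + 2 * k * (0 - 0) + 0\<^sup>2 + 0\<^sup>2 + (fl \<zeta> * 0 + 0)\<^sup>2) (at 0)"
    by (intro tendsto_intros bz[OF lims(1)] bz[OF lims(2)] z lims norm_ln_tendsto abs_Im_le_cmod abs_Re_le_cmod)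
  then have "((\<lambda>\<xi>. k\<^sup>2 + 2 * k * (Im (of_real (cmod \<xi>) / \<xi>) * (cmod \<xi> * r1 \<xi>) - Re (of_real (cmod \<xi>) / \<xi>) * (cmod \<xi> * r2 \<xi>))
      + (cmod \<xi> * r1 \<xi>)\<^sup>2 + (cmod \<xi> * r2 \<xi>)\<^sup>2 + (fl \<zeta> * (cmod \<xi> * ln (cmod \<xi>)) + cmod \<xi> * r3 \<xi>)\<^sup>2) \<longlongrightarrow> k\<^sup>2) (at 0)"
    by simp
  moreover have "eventually (\<lambda>\<xi>. k\<^sup>2 + 2 * k * (Im (of_real (cmod \<xi>) / \<xi>) * (cmod \<xi> * r1 \<xi>) - Re (of_real (cmod \<xi>) / \<xi>) * (cmod \<xi> * r2 \<xi>))
      + (cmod \<xi> * r1 \<xi>)\<^sup>2 + (cmod \<xi> * r2 \<xi>)\<^sup>2 + (fl \<zeta> * (cmod \<xi> * ln (cmod \<xi>)) + cmod \<xi> * r3 \<xi>)\<^sup>2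
      = (cmod \<xi> * norm (Y \<xi>))\<^sup>2) (at 0)"
    using eventually_near by eventually_elim (rule sq[symmetric])
  ultimately have "((\<lambda>\<xi>. (cmod \<xi> * norm (Y \<xi>))\<^sup>2) \<longlongrightarrow> k\<^sup>2) (at 0)" by (rule Lim_transform_eventually)
  then have "((\<lambda>\<xi>. sqrt ((cmod \<xi> * norm (Y \<xi>))\<^sup>2)) \<longlongrightarrow> sqrt (k\<^sup>2)) (at 0)" by (rule tendsto_real_sqrt)
  moreover have "sqrt (k\<^sup>2) = k" unfolding k_def by (simp only: real_sqrt_abs abs_power2)
  ultimately show ?thesis unfolding real_sqrt_abs by (simp only: Y_def k_def abs_mult abs_norm_cancel)
qed

lemma X_at_top:
  assumes "\<zeta> \<in> Z"
  shows "filterlim (\<lambda>\<xi>. norm (X (inv_stereographic (\<zeta> * (1 + \<xi>))))) at_top (at 0)"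
proof -
  define Y where "Y \<xi> = norm (X (inv_stereographic (\<zeta> * (1 + \<xi>))))" for \<xi>
  have "wt \<zeta> \<noteq> 0" using \<beta> \<gamma> by (simp add: wt_def)
  then have w: "(wt \<zeta>)\<^sup>2 > 0" by simp
  have "filterlim (\<lambda>\<xi>::complex. cmod \<xi>) (at_right 0) (at 0)"
    unfolding filterlim_at by (auto intro!: tendsto_eq_intros simp: eventually_at_filter)
  then have "filterlim (\<lambda>\<xi>::complex. inverse (cmod \<xi>)) at_top (at 0)"
    by (rule filterlim_compose[OF filterlim_inverse_at_top_right])
  then have "filterlim (\<lambda>\<xi>. cmod \<xi> * Y \<xi> * inverse (cmod \<xi>)) at_top (at 0)"
    using filterlim_tendsto_pos_mult_at_top[OF scaled_X[OF assms] w] unfolding Y_def by blast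
  moreover have "eventually (\<lambda>\<xi>. cmod \<xi> * Y \<xi> * inverse (cmod \<xi>) = Y \<xi>) (at 0)"
    by (auto simp: eventually_at_filter intro!: always_eventually)
  ultimately show ?thesis unfolding Y_def[symmetric] by (subst (asm) filterlim_cong[OF refl refl]) auto
qed

text \<open>The constant term of the end when its logarithmic growth is measured by the norm of the
  point instead of \<open>cmod \<xi>\<close>; the second summand is the correction coming from
  \<open>scaled_X\<close>.\<close>

definition offset :: "complex \<Rightarrow> real" where
  "offset \<zeta> = Re (Hol \<zeta> (hv \<zeta>) 0) + fl \<zeta> * ln ((wt \<zeta>)\<^sup>2)"

text \<open>The quantity refers to the image point alone and not to a coordinate on the surface, so
  it can be compared under isometries of space.\<close>

lemma X_log_asymptotics:
  assumes \<zeta>: "\<zeta> \<in> Z"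
  shows "((\<lambda>\<xi>. X (inv_stereographic (\<zeta> * (1 + \<xi>))) \<bullet> hv \<zeta>
     + fl \<zeta> * ln (norm (X (inv_stereographic (\<zeta> * (1 + \<xi>)))))) \<longlongrightarrow> offset \<zeta>) (at 0)"
proof -
  define Y where "Y \<xi> = X (inv_stereographic (\<zeta> * (1 + \<xi>)))" for \<xi>
  have w: "(wt \<zeta>)\<^sup>2 \<noteq> 0" using \<beta> \<gamma> by (simp add: wt_def)
  have "((\<lambda>\<xi>. Re (Hol \<zeta> (hv \<zeta>) \<xi>) + fl \<zeta> * ln (cmod \<xi> * norm (Y \<xi>))) \<longlongrightarrow> offset \<zeta>) (at 0)"
    unfolding offset_def Y_def by (intro tendsto_intros Hol_tendsto \<zeta> scaled_X w)
  moreover have "eventually (\<lambda>\<xi>. norm (Y \<xi>) > 0) (at 0)"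
    using filterlim_at_top_dense[THEN iffD1, OF X_at_top[OF \<zeta>]] unfolding Y_def by blast
  then have "eventually (\<lambda>\<xi>. Re (Hol \<zeta> (hv \<zeta>) \<xi>) + fl \<zeta> * ln (cmod \<xi> * norm (Y \<xi>))
      = Y \<xi> \<bullet> hv \<zeta> + fl \<zeta> * ln (norm (Y \<xi>))) (at 0)"
    using eventually_near
  proof eventually_elim
    case (elim \<xi>)
    have "Y \<xi> \<bullet> hv \<zeta> = fl \<zeta> * ln (cmod \<xi>) + Re (Hol \<zeta> (hv \<zeta>) \<xi>)"
      using X_expand(2)[OF \<zeta>, of \<xi> "hv \<zeta>"] elim frame_inner[OF \<zeta>] unfolding Y_def by simp
    moreover have "ln (cmod \<xi> * norm (Y \<xi>)) = ln (cmod \<xi>) + ln (norm (Y \<xi>))"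
      using elim by (intro ln_mult_pos) auto
    ultimately show ?case by (simp add: algebra_simps)
  qed
  ultimately show ?thesis unfolding Y_def by (rule Lim_transform_eventually)
qed

text \<open>Along the ray \<open>\<xi> = t * e\<close> the surface escapes in a definite direction
  orthogonal to \<open>hv \<zeta>\<close>; every unit vector of that plane occurs for some
  \<open>e\<close>.\<close>

lemma X_direction:
  assumes \<zeta>: "\<zeta> \<in> Z" and e: "cmod e = 1"
  shows "((\<lambda>t. t * (X (inv_stereographic (\<zeta> * (1 + of_real t * e))) \<bullet> v)) \<longlongrightarrow>
     (wt \<zeta>)\<^sup>2 * (Im (1 / e) * (hv (\<i> * \<zeta>) \<bullet> v) - Re (1 / e) * (vertical \<bullet> v))) (at_right 0)"
proof -
  have e0: "e \<noteq> 0" using e by auto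
  have lim: "filterlim (\<lambda>t. of_real t * e) (at 0) (at_right (0::real))"
    unfolding filterlim_at
  proof
    show "eventually (\<lambda>t. of_real t * e \<in> UNIV \<and> of_real t * e \<noteq> 0) (at_right (0::real))"
      using e0 by (auto simp: eventually_at_filter intro!: always_eventually)
    have "((\<lambda>t. of_real t * e) \<longlongrightarrow> of_real 0 * e) (at_right (0::real))"
      by (intro tendsto_intros)
    then show "((\<lambda>t. of_real t * e) \<longlongrightarrow> 0) (at_right (0::real))" by simp
  qed
  have t0: "((\<lambda>t::real. t) \<longlongrightarrow> 0) (at_right 0)" by (rule tendsto_ident_at)
  have pos: "eventually (\<lambda>t::real. t > 0) (at_right 0)" by (auto simp: eventually_at_filter intro!: always_eventually)
  have "((\<lambda>t. cmod (of_real t * e) * ln (cmod (of_real t * e))) \<longlongrightarrow> 0) (at_right 0)"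
    by (rule filterlim_compose[OF norm_ln_tendsto lim])
  moreover have "eventually (\<lambda>t. cmod (of_real t * e) * ln (cmod (of_real t * e)) = t * ln t) (at_right 0)"
    using pos by eventually_elim (simp add: norm_mult e)
  ultimately have tl: "((\<lambda>t::real. t * ln t) \<longlongrightarrow> 0) (at_right 0)" by (rule Lim_transform_eventually)
  have H: "((\<lambda>t. Re (Hol \<zeta> v (of_real t * e))) \<longlongrightarrow> Re (Hol \<zeta> v 0)) (at_right 0)"
    by (rule filterlim_compose[OF Hol_tendsto[OF \<zeta>] lim])
  have "((\<lambda>t. fl \<zeta> * (t * ln t) * (hv \<zeta> \<bullet> v) + (wt \<zeta>)\<^sup>2 * (Im (1 / e) * (hv (\<i> * \<zeta>) \<bullet> v) - (Re (1 / e) + t * (1/2)) * (vertical \<bullet> v))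
      + t * Re (Hol \<zeta> v (of_real t * e))) \<longlongrightarrow>
      fl \<zeta> * 0 * (hv \<zeta> \<bullet> v) + (wt \<zeta>)\<^sup>2 * (Im (1 / e) * (hv (\<i> * \<zeta>) \<bullet> v) - (Re (1 / e) + 0 * (1/2)) * (vertical \<bullet> v))
      + 0 * Re (Hol \<zeta> v 0)) (at_right 0)"
    by (intro tendsto_intros tl t0 H)
  then have "((\<lambda>t. fl \<zeta> * (t * ln t) * (hv \<zeta> \<bullet> v) + (wt \<zeta>)\<^sup>2 * (Im (1 / e) * (hv (\<i> * \<zeta>) \<bullet> v) - (Re (1 / e) + t * (1/2)) * (vertical \<bullet> v))
      + t * Re (Hol \<zeta> v (of_real t * e))) \<longlongrightarrow>
      (wt \<zeta>)\<^sup>2 * (Im (1 / e) * (hv (\<i> * \<zeta>) \<bullet> v) - Re (1 / e) * (vertical \<bullet> v))) (at_right 0)"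
    by simp
  moreover have "eventually (\<lambda>t. of_real t * e \<noteq> 0 \<and> cmod (of_real t * e) < sep) (at_right 0)"
    using filterlim_iff[THEN iffD1, OF lim] eventually_near by blast
  then have "eventually (\<lambda>t. fl \<zeta> * (t * ln t) * (hv \<zeta> \<bullet> v) + (wt \<zeta>)\<^sup>2 * (Im (1 / e) * (hv (\<i> * \<zeta>) \<bullet> v) - (Re (1 / e) + t * (1/2)) * (vertical \<bullet> v))
      + t * Re (Hol \<zeta> v (of_real t * e)) = t * (X (inv_stereographic (\<zeta> * (1 + of_real t * e))) \<bullet> v)) (at_right 0)"
    using pos
  proof eventually_elim
    case (elim t)
    have d: "1 / (of_real t * e) = of_real (1 / t) * (1 / e)" by simp
    have i: "Im (1 / (of_real t * e)) = Im (1 / e) / t" "Re (1 / (of_real t * e)) = Re (1 / e) / t"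
      unfolding d times_complex.sel by simp_all
    have c: "cmod (of_real t * e) = t" using elim by (simp add: norm_mult e)
    show ?case
    proof -
      have E: "X (inv_stereographic (\<zeta> * (1 + of_real t * e))) \<bullet> v = fl \<zeta> * ln t * (hv \<zeta> \<bullet> v)
          + (wt \<zeta>)\<^sup>2 * (Im (1 / e) / t) * (hv (\<i> * \<zeta>) \<bullet> v)
          - (wt \<zeta>)\<^sup>2 * (Re (1 / e) / t + 1 / 2) * (vertical \<bullet> v) + Re (Hol \<zeta> v (of_real t * e))"
        using X_expand(2)[OF \<zeta>, of "of_real t * e" v] elim unfolding i c by blast
      show ?thesis unfolding E using elim by (simp add: field_simps)
    qed
  qed
  ultimately show ?thesis by (rule Lim_transform_eventually)
qed

lemma continuous_on_X: "continuous_on (sphere 0 1 - inv_stereographic ` Z) X"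
proof -
  have ne: "1 - p \<bullet> hv x > 0" if "p \<in> sphere 0 1 - inv_stereographic ` Z" "x \<in> Z" for p x
  proof -
    have x1: "norm (hv x) = 1" using frame_inner(1)[OF that(2)] by (simp add: norm_eq_1)
    have e: "inv_stereographic x = hv x" using norm_Z[OF that(2)] by (simp add: vec_eq_iff forall_3)
    have p1: "norm p = 1" using that by simp
    have "p \<bullet> hv x \<le> 1" using norm_cauchy_schwarz[of p "hv x"] x1 p1 by simp
    moreover have "p \<bullet> hv x \<noteq> 1"
    proof
      assume "p \<bullet> hv x = 1"
      then have "(norm (p - hv x))\<^sup>2 = 0"
        unfolding power2_norm_eq_inner using x1 p1 by (simp add: inner_diff_left inner_diff_right inner_commute norm_eq_1)
      then show False using imageI[OF that(2), of inv_stereographic] e that(1) by simp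
    qed
    ultimately show ?thesis by simp
  qed
  show ?thesis unfolding X_def
    by (intro continuous_intros) (use ne in \<open>force+\<close>)
qed

lemma sequence_to_end:
  assumes q: "\<And>k. q k \<in> sphere 0 1 - inv_stereographic ` Z"
    and lim: "q \<longlonglongrightarrow> inv_stereographic \<zeta>" and \<zeta>: "\<zeta> \<in> Z"
  obtains \<xi> where "filterlim \<xi> (at 0) sequentially"
    "eventually (\<lambda>k. q k = inv_stereographic (\<zeta> * (1 + \<xi> k))) sequentially"
proof
  let ?\<xi> = "\<lambda>k. stereographic (q k) / \<zeta> - 1"
  have z0: "\<zeta> \<noteq> 0" by (rule Z_nonzero[OF \<zeta>])
  have l3: "inv_stereographic \<zeta> $ 3 \<noteq> 1" using inv_stereographic_nth3[of \<zeta>] by linarith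
  have "isCont stereographic (inv_stereographic \<zeta>)"
  proof -
    have "open {p::real^3. p $ 3 \<noteq> 1}" by (intro open_Collect_neq continuous_intros)
    moreover have "continuous_on {p::real^3. p $ 3 \<noteq> 1} stereographic"
      by (rule continuous_on_stereographic[OF continuous_on_id]) auto
    ultimately show ?thesis using l3 by (simp add: continuous_on_eq_continuous_at)
  qed
  then have "(\<lambda>k. stereographic (q k)) \<longlonglongrightarrow> stereographic (inv_stereographic \<zeta>)"
    using lim by (rule isCont_tendsto_compose)
  then have "?\<xi> \<longlonglongrightarrow> \<zeta> / \<zeta> - 1" by (intro tendsto_intros z0) simp_all
  then have l0: "?\<xi> \<longlonglongrightarrow> 0" using z0 by simp
  have "eventually (\<lambda>k. q k $ 3 \<noteq> 1) sequentially"
    using tendsto_imp_eventually_ne[OF tendsto_vec_nth[OF lim] l3] .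
  then have ev: "eventually (\<lambda>k. ?\<xi> k \<noteq> 0 \<and> q k = inv_stereographic (\<zeta> * (1 + ?\<xi> k))) sequentially"
  proof eventually_elim
    case (elim k)
    have "q k \<noteq> north_pole" using elim by (auto simp: north_pole_def)
    then have e: "inv_stereographic (stereographic (q k)) = q k"
      using q[of k] by (intro inv_stereographic_stereographic) auto
    have "\<zeta> * (1 + ?\<xi> k) = stereographic (q k)" using z0 by simp
    moreover have "?\<xi> k \<noteq> 0"
    proof
      assume "?\<xi> k = 0"
      then have "stereographic (q k) = \<zeta>" using z0 by simp
      then show False using imageI[OF \<zeta>, of inv_stereographic] e q[of k] by simp
    qed
    ultimately show ?case using e by simp
  qed
  show "filterlim ?\<xi> (at 0) sequentially"
    unfolding filterlim_at
  proof
    show "eventually (\<lambda>k. ?\<xi> k \<in> UNIV \<and> ?\<xi> k \<noteq> 0) sequentially" using ev by (rule eventually_mono) blast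
  qed (rule l0)
  show "eventually (\<lambda>k. q k = inv_stereographic (\<zeta> * (1 + ?\<xi> k))) sequentially"
    using ev by (rule eventually_mono) blast
qed

end

text \<open>The order of the rows makes the determinant +1 and puts the axis
  \<open>hv \<zeta>\<close> third, which is the direction of the graph in
  \<open>catenoid_end\<close>.\<close>

definition frame :: "complex \<Rightarrow> real^3^3" where
  "frame \<zeta> = vector [hv (\<i> * \<zeta>), vertical, hv \<zeta>]"

lemma frame_mult:
  "(frame \<zeta> *v x) $ 1 = x \<bullet> hv (\<i> * \<zeta>)" "(frame \<zeta> *v x) $ 2 = x \<bullet> vertical" "(frame \<zeta> *v x) $ 3 = x \<bullet> hv \<zeta>"
  by (simp_all add: frame_def matrix_vector_mult_def sum_3 inner_3 mult.commute)

lemma rotation_frame: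
  assumes "cmod \<zeta> = 1"
  shows "rotation_matrix (frame \<zeta>)"
proof -
  have "(Re \<zeta>)\<^sup>2 + (Im \<zeta>)\<^sup>2 = 1" using assms by (simp add: cmod_power2[symmetric])
  then have 1: "Re \<zeta> * Re \<zeta> + Im \<zeta> * Im \<zeta> = 1" "Im \<zeta> * Im \<zeta> + Re \<zeta> * Re \<zeta> = 1" by (simp_all add: power2_eq_square)
  have "det (frame \<zeta>) = 1" using 1 by (simp add: frame_def det_3)
  moreover have r: "row 1 (frame \<zeta>) = hv (\<i> * \<zeta>)" "row 2 (frame \<zeta>) = vertical" "row 3 (frame \<zeta>) = hv \<zeta>"
    by (simp_all add: frame_def row_def vec_eq_iff)
  have "orthogonal_matrix (frame \<zeta>)"
    unfolding orthogonal_matrix_orthonormal_rows forall_3 r orthogonal_def norm_eq_1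
    using 1 by (simp add: inner_3)
  ultimately show ?thesis by (simp add: rotation_matrix_def)
qed

section \<open>Catenoid ends, properness and weights\<close>

context alternating_surface
begin

text \<open>In the frame at \<zeta> the expansion \<open>X_components\<close> becomes the model
  \<open>graph_end\<close> with \<open>a = fl \<zeta>\<close>. In the expansion of the graph the
  logarithm has the coefficient \<open>- fl \<zeta>\<close>.\<close>

lemma catenoid_end_surf:
  assumes \<zeta>: "\<zeta> \<in> Z" and fl0: "fl \<zeta> \<noteq> 0"
  shows "catenoid_end surf imm (end_at \<zeta>)"
proof -
  have z0: "\<zeta> \<noteq> 0" by (rule Z_nonzero[OF \<zeta>])
  have wt0: "wt \<zeta> \<noteq> 0" using \<beta> \<gamma> by (simp add: wt_def)
  \<comment> \<open>The real and imaginary parts of \<open>c / \<xi>\<close> are the singular parts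
    of the two tangential components; the constant 1/2 of the vertical one is absorbed by
    \<open>F2\<close>.\<close>
  define c where "c = - \<i> * of_real ((wt \<zeta>)\<^sup>2)"
  define F2 where "F2 \<xi> = Hol \<zeta> vertical \<xi> - of_real ((wt \<zeta>)\<^sup>2 / 2)" for \<xi>
  interpret ge: graph_end sep c "fl \<zeta>" "Hol \<zeta> (hv (\<i> * \<zeta>))" F2 "Hol \<zeta> (hv \<zeta>)"
    using sep(1) wt0 Hol_holomorphic[OF \<zeta>] unfolding F2_def
    by unfold_locales (auto simp: c_def intro!: holomorphic_intros)
  define \<tau> where "\<tau> \<xi> = \<zeta> * (1 + \<xi>)" for \<xi>
  have inj_\<tau>: "inj \<tau>" using z0 by (auto simp: \<tau>_def inj_def)
  have \<tau>0: "\<tau> 0 = \<zeta>" by (simp add: \<tau>_def)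
  define \<phi> where "\<phi> \<xi> = pt (inv_stereographic (\<tau> \<xi>))" for \<xi>
  have V: "\<xi> \<noteq> 0" "cmod \<xi> < sep" "\<tau> \<xi> \<notin> Z" "cmod \<xi> \<le> sep / 2" if "\<xi> \<in> ge.V" for \<xi>
  proof -
    show 1: "\<xi> \<noteq> 0" "cmod \<xi> < sep" "cmod \<xi> \<le> sep / 2" using ge.V_subset that by auto
    show "\<tau> \<xi> \<notin> Z" unfolding \<tau>_def by (rule X_expand(1)[OF \<zeta> 1(1,2)])
  qed
  have emb\<phi>: "emb (\<phi> \<xi>) = inv_stereographic (\<tau> \<xi>)" if "\<xi> \<in> ge.V" for \<xi>
    using V(3)[OF that] by (simp add: \<phi>_def inv_stereographic_C)
  have pr: "horizontal (frame \<zeta> *v imm (\<phi> \<xi>)) = ge.pr \<xi>" and ht: "(frame \<zeta> *v imm (\<phi> \<xi>)) $ 3 = ge.ht \<xi>"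
    if "\<xi> \<in> ge.V" for \<xi>
  proof -
    have Re: "Re (c / \<xi>) = (wt \<zeta>)\<^sup>2 * Im (1 / \<xi>)" "Im (c / \<xi>) = - (wt \<zeta>)\<^sup>2 * Re (1 / \<xi>)"
    proof -
      have "c / \<xi> = - \<i> * of_real ((wt \<zeta>)\<^sup>2) * (1 / \<xi>)" by (simp add: c_def)
      then show "Re (c / \<xi>) = (wt \<zeta>)\<^sup>2 * Im (1 / \<xi>)" "Im (c / \<xi>) = - (wt \<zeta>)\<^sup>2 * Re (1 / \<xi>)"
        by (simp_all only: times_complex.sel Re_complex_of_real Im_complex_of_real uminus_complex.sel imaginary_unit.sel) simp_all
    qed
    have R2: "Re (F2 \<xi>) = Re (Hol \<zeta> vertical \<xi>) - (wt \<zeta>)\<^sup>2 / 2" by (simp add: F2_def)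
    have gen: "Complex (a + p) (- k * (b + 1 / 2) + q) = u + Complex p (q - k / 2)"
      if "Re u = a" "Im u = - k * b" for a b p q k u
      by (rule complex_eqI) (use that in \<open>simp_all add: algebra_simps\<close>)
    note comp = X_components[OF \<zeta> V(1,2)[OF that], folded \<tau>_def]
    show "horizontal (frame \<zeta> *v imm (\<phi> \<xi>)) = ge.pr \<xi>"
      unfolding horizontal_def frame_mult ge.pr_def ge.S_def o_def emb\<phi>[OF that] comp R2
      by (rule gen[OF Re])
    show "(frame \<zeta> *v imm (\<phi> \<xi>)) $ 3 = ge.ht \<xi>"
      unfolding frame_mult ge.ht_def ge.\<sigma>_def o_def emb\<phi>[OF that] comp ..
  qed
  \<comment> \<open>The core of \<open>A\<close> is a compact set whose complement has at \<zeta>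
    exactly the region graphed by the model as a component; at the other punctures small discs
    serve.\<close>
  define A where "A z = (if z = \<zeta> then \<tau> ` insert 0 ge.V else ball z (sep / 2))" for z
  have A\<zeta>: "A \<zeta> - {\<zeta>} = \<tau> ` ge.V"
  proof -
    have "\<zeta> \<notin> \<tau> ` ge.V" using V(1) inj_\<tau> \<tau>0 by (metis image_iff injD)
    then show ?thesis by (simp add: A_def \<tau>0)
  qed
  have Asub: "A \<zeta> \<subseteq> cball \<zeta> (sep / 2)"
  proof -
    have "cmod (\<tau> \<xi> - \<zeta>) = cmod \<xi>" for \<xi>
      using norm_Z[OF \<zeta>] by (simp add: \<tau>_def algebra_simps norm_mult)
    then show ?thesis using V(4) sep(1) by (auto simp: A_def dist_norm norm_minus_commute)
  qed
  have iso: "isolating A"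
    unfolding isolating_def
  proof (intro conjI ballI)
    fix z assume z: "z \<in> Z"
    have hom: "open (\<tau> ` S)" if "open S" for S
    proof -
      have "\<tau> ` S = (\<lambda>w. w / \<zeta> - 1) -` S"
      proof (intro equalityI subsetI)
        fix w assume "w \<in> (\<lambda>w. w / \<zeta> - 1) -` S"
        then have "w / \<zeta> - 1 \<in> S" "\<tau> (w / \<zeta> - 1) = w" using z0 by (auto simp: \<tau>_def)
        then show "w \<in> \<tau> ` S" by (metis imageI)
      qed (use z0 in \<open>auto simp: \<tau>_def\<close>)
      moreover have "open ((\<lambda>w. w / \<zeta> - 1) -` S)"
        by (rule open_vimage[OF that]) (intro continuous_intros, use z0 in auto)
      ultimately show ?thesis by simp
    qed
    show "open (A z)" using hom[OF ge.open_V0] by (simp add: A_def)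
    show "z \<in> A z" using sep(1) \<tau>0 by (auto simp: A_def)
    show "connected (A z - {z})"
    proof (cases "z = \<zeta>")
      case True
      have "connected (\<tau> ` ge.V)"
        by (intro connected_continuous_image ge.connected_V) (auto simp: \<tau>_def intro!: continuous_intros)
      then show ?thesis using A\<zeta> True by simp
    next
      case False
      then show ?thesis by (simp add: A_def connected_punctured_ball)
    qed
  next
    have dist: "A x \<inter> A y = {}" if "x \<in> Z" "y \<in> Z" "x \<noteq> y" "y \<noteq> \<zeta>" for x y
    proof -
      have "A x \<subseteq> cball x (sep / 2)" using Asub by (auto simp: A_def)
      moreover have "cball x (sep / 2) \<inter> ball y (sep / 2) = {}"
      proof (rule ccontr)
        assume "\<not> ?thesis"
        then obtain u where "dist x u \<le> sep / 2" "dist y u < sep / 2" by auto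
        then have "dist x y < sep" using dist_triangle2[of x y u] by linarith
        then show False using sep(2)[of x y] that by (auto simp: dist_norm)
      qed
      moreover have "A y = ball y (sep / 2)" using that by (simp add: A_def)
      ultimately show ?thesis by blast
    qed
    show "disjoint_family_on A Z"
      unfolding disjoint_family_on_def using dist by (metis inf_commute)
  qed
  define K where "K = core A"
  have eK: "end_at \<zeta> K = \<phi> ` ge.V"
    unfolding K_def end_at_core[OF iso \<zeta>] unfolding A\<zeta> nbh_def \<phi>_def by (simp add: image_image)
  have "inj_on \<phi> ge.V"
  proof (rule inj_onI)
    fix x y assume xy: "x \<in> ge.V" "y \<in> ge.V" "\<phi> x = \<phi> y"
    then have "inv_stereographic (\<tau> x) = inv_stereographic (\<tau> y)" using emb\<phi> by metis
    then show "x = y" using inj_inv_stereographic inj_\<tau> by (auto dest: injD)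
  qed
  then have b\<phi>: "bij_betw \<phi> ge.V (end_at \<zeta> K)" unfolding eK by (rule inj_on_imp_bij_betw)
  have "bij_betw ((\<lambda>p. horizontal (frame \<zeta> *v imm p)) \<circ> \<phi>) ge.V (- cball 0 ge.Rw)"
    using bij_betw_cong[THEN iffD1, OF _ ge.bij_betw_pr] pr by (metis (mono_tags, lifting) o_apply)
  then have bij: "bij_betw (\<lambda>p. horizontal (frame \<zeta> *v imm p)) (end_at \<zeta> K) (- cball 0 ge.Rw)"
    using bij_betw_comp_iff[OF b\<phi>] by blast
  have graph: "(frame \<zeta> *v imm p) $ 3 = ge.f (horizontal (frame \<zeta> *v imm p))" if p: "p \<in> end_at \<zeta> K" for p
  proof -
    from p obtain \<xi> where \<xi>: "\<xi> \<in> ge.V" "p = \<phi> \<xi>" unfolding eK by blast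
    show ?thesis unfolding \<xi>(2) pr[OF \<xi>(1)] ht[OF \<xi>(1)] by (rule ge.ht_eq[OF \<xi>(1)])
  qed
  obtain S where S: "\<And>w. cmod w > ge.Rw \<Longrightarrow> \<exists>D. (ge.f has_derivative D) (at w) \<and> (\<forall>h. \<bar>D h\<bar> \<le> S * cmod h)"
    using ge.f_bounded_slope by blast
  obtain b c1 c2 where as: "(\<lambda>w. ge.f w - (- fl \<zeta> * ln (norm w) + b + (c1 * Re w + c2 * Im w) / (norm w)\<^sup>2))
     \<in> O[at_infinity](\<lambda>w. 1 / (norm w)\<^sup>2)"
    using ge.f_asymptotics by blast
  have "\<exists>B. \<forall>z\<in>- cball 0 ge.Rw. \<exists>D. (ge.f has_derivative D) (at z) \<and> (\<forall>h. \<bar>D h\<bar> \<le> B * norm h)"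
    using S by (intro exI[of _ S]) auto
  moreover have "compactin (topo surf) K" using compactin_core[OF iso] by (simp add: K_def)
  ultimately show ?thesis
    unfolding catenoid_end_def
    using rotation_frame[OF norm_Z[OF \<zeta>]] bij graph as fl0 compact_cball[of "0::complex" ge.Rw] neg_equal_0_iff_equal by blast
qed

lemma sequence_limit_end:
  assumes q: "\<And>k::nat. q k \<in> C" and lim: "q \<longlonglongrightarrow> l" and l: "l \<notin> C"
  obtains \<zeta> \<xi> where "\<zeta> \<in> Z" "filterlim \<xi> (at 0) sequentially"
    "eventually (\<lambda>k. q k = inv_stereographic (\<zeta> * (1 + \<xi> k))) sequentially"
proof -
  have "l \<in> sphere 0 1"
    by (rule closed_sequentially[OF closed_sphere _ lim]) (use q in \<open>auto simp: C_def\<close>)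
  then obtain \<zeta> where \<zeta>: "\<zeta> \<in> Z" "l = inv_stereographic \<zeta>" using l by (auto simp: C_def)
  obtain \<xi> where "filterlim \<xi> (at 0) sequentially" "eventually (\<lambda>k. q k = inv_stereographic (\<zeta> * (1 + \<xi> k))) sequentially"
    using sequence_to_end[of q \<zeta>] q lim \<zeta> unfolding C_def by blast
  then show ?thesis using that \<zeta>(1) by blast
qed

text \<open>A sequence with bounded image cannot approach a puncture, where \<open>X\<close> tends
  to infinity; so the sublevel sets are sequentially compact.\<close>

lemma proper_surf: "\<exists>K. compact K \<and> K \<subseteq> C \<and> (\<forall>p\<in>C. norm (X p) \<le> B \<longrightarrow> p \<in> K)"
proof -
  define K where "K = {p \<in> C. norm (X p) \<le> B}"
  have "seq_compact K"
    unfolding seq_compact_def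
  proof (intro allI impI)
    fix q :: "nat \<Rightarrow> real^3" assume q: "\<forall>k. q k \<in> K"
    then have "\<forall>k. q k \<in> sphere 0 1" by (auto simp: K_def C_def)
    then obtain l r where lr: "strict_mono (r :: nat \<Rightarrow> nat)" "(q \<circ> r) \<longlonglongrightarrow> l"
      using compact_sphere[of "0::real^3" 1] unfolding compact_eq_seq_compact_metric seq_compact_def by metis
    have qr: "(q \<circ> r) k \<in> C" "norm (X ((q \<circ> r) k)) \<le> B" for k using q by (auto simp: K_def)
    have lC: "l \<in> C"
    proof (rule ccontr)
      assume "l \<notin> C"
      then obtain \<zeta> \<xi> where \<zeta>: "\<zeta> \<in> Z" and \<xi>: "filterlim \<xi> (at 0) sequentially"
        and e: "eventually (\<lambda>k. (q \<circ> r) k = inv_stereographic (\<zeta> * (1 + \<xi> k))) sequentially"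
        using sequence_limit_end[OF qr(1) lr(2)] by blast
      have "eventually (\<lambda>k. norm (X (inv_stereographic (\<zeta> * (1 + \<xi> k)))) > B) sequentially"
        using filterlim_compose[OF X_at_top[OF \<zeta>] \<xi>] unfolding filterlim_at_top_dense by blast
      with e have "eventually (\<lambda>k. False) sequentially"
        by eventually_elim (metis qr(2) not_le)
      then show False by simp
    qed
    have "(\<lambda>k. X ((q \<circ> r) k)) \<longlonglongrightarrow> X l"
      using continuous_on_tendsto_compose[OF continuous_on_X[folded C_def] lr(2) lC] qr(1) by simp
    then have "norm (X l) \<le> B"
      by (rule LIMSEQ_le_const2[OF tendsto_norm]) (use qr(2) in blast)
    then show "\<exists>l\<in>K. \<exists>r. strict_mono (r :: nat \<Rightarrow> nat) \<and> (q \<circ> r) \<longlonglongrightarrow> l"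
      using lC lr by (auto simp: K_def)
  qed
  then have "compact K" by (simp add: compact_eq_seq_compact_metric)
  then show ?thesis by (intro exI[of _ K]) (auto simp: K_def)
qed

lemma complete_minimal_ftc_surf: "complete_minimal_ftc surf imm"
  unfolding complete_minimal_ftc_def
  using oriented_surface_surf immersion_surf minimal_surf complete_immersion_surf[OF proper_surf]
    finite_total_curvature by blast

text \<open>Only the simple pole at \<zeta> contributes: the double pole has a primitive, and the
  terms of the other punctures are holomorphic in the disc of radius \<open>sep\<close>.\<close>

lemma residue_end:
  assumes \<zeta>: "\<zeta> \<in> Z" and r: "0 < r" "r < sep"
  shows "((\<lambda>z. weierstrass_vec (spin1 z) (spin2 z) $ j) has_contour_integral
     (2 * of_real pi * \<i> * of_real (fl \<zeta> * hv \<zeta> $ j))) (circlepath \<zeta> r)"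
proof -
  have "0 \<notin> path_image (circlepath 0 r)" using r by simp
  define \<kappa> where "\<kappa> = \<i> * \<zeta> * of_real ((wt \<zeta>)\<^sup>2) * of_real (hv (\<i> * \<zeta>) $ j) + \<zeta> * of_real ((wt \<zeta>)\<^sup>2) * of_real (vertical $ j)"
  have 1: "((\<lambda>z. of_real (fl \<zeta> * hv \<zeta> $ j) / (z - \<zeta>)) has_contour_integral
     (2 * of_real pi * \<i> * of_real (fl \<zeta> * hv \<zeta> $ j))) (circlepath \<zeta> r)"
    by (rule Cauchy_integral_circlepath_simple) (use r in \<open>auto intro!: holomorphic_intros\<close>)
  have 2: "((\<lambda>z. \<kappa> / (z - \<zeta>)\<^sup>2) has_contour_integral 0) (circlepath \<zeta> r)"
  proof (rule Cauchy_theorem_primitive[where S = "- {\<zeta>}" and f = "\<lambda>z. - \<kappa> / (z - \<zeta>)"])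
    fix x assume "x \<in> - {\<zeta>}"
    then show "((\<lambda>z. - \<kappa> / (z - \<zeta>)) has_field_derivative \<kappa> / (x - \<zeta>)\<^sup>2) (at x within - {\<zeta>})"
      by (auto intro!: derivative_eq_intros simp: power2_eq_square)
  qed (use r in auto)
  have 3: "((\<lambda>z. dXterm x z $ j) has_contour_integral 0) (circlepath \<zeta> r)" if x: "x \<in> Z - {\<zeta>}" for x
  proof (rule Cauchy_theorem_disc_simple[where a = \<zeta> and e = sep])
    have "z - x \<noteq> 0" if "z \<in> ball \<zeta> sep" for z
      using that sep(2)[of \<zeta> x] \<zeta> x by (auto simp: dist_norm)
    then show "(\<lambda>z. dXterm x z $ j) holomorphic_on ball \<zeta> sep"
      unfolding dXterm_def vec_lambda_beta by (intro holomorphic_intros) auto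
  qed (use r in \<open>auto simp: path_image_circlepath\<close>)
  have "((\<lambda>z. of_real (fl \<zeta> * hv \<zeta> $ j) / (z - \<zeta>) + \<kappa> / (z - \<zeta>)\<^sup>2 + (\<Sum>x\<in>Z - {\<zeta>}. dXterm x z $ j)) has_contour_integral
     (2 * of_real pi * \<i> * of_real (fl \<zeta> * hv \<zeta> $ j) + 0 + (\<Sum>x\<in>Z - {\<zeta>}. 0))) (circlepath \<zeta> r)"
    by (intro has_contour_integral_add has_contour_integral_sum 1 2 3) (use finite_Z in auto)
  then have "((\<lambda>z. of_real (fl \<zeta> * hv \<zeta> $ j) / (z - \<zeta>) + \<kappa> / (z - \<zeta>)\<^sup>2 + (\<Sum>x\<in>Z - {\<zeta>}. dXterm x z $ j)) has_contour_integral
     (2 * of_real pi * \<i> * of_real (fl \<zeta> * hv \<zeta> $ j))) (circlepath \<zeta> r)" by simp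
  moreover have "of_real (fl \<zeta> * hv \<zeta> $ j) / (z - \<zeta>) + \<kappa> / (z - \<zeta>)\<^sup>2 + (\<Sum>x\<in>Z - {\<zeta>}. dXterm x z $ j)
      = weierstrass_vec (spin1 z) (spin2 z) $ j" if z: "z \<in> path_image (circlepath \<zeta> r)" for z
  proof -
    have "z \<noteq> \<zeta>" "cmod (z - \<zeta>) < sep" using z r by (auto simp: dist_norm norm_minus_commute)
    then have nZ: "z \<notin> Z" using sep(2)[OF \<zeta>, of z] by (auto simp: norm_minus_commute)
    have "dXterm \<zeta> z $ j = of_real (fl \<zeta> * hv \<zeta> $ j) / (z - \<zeta>) + \<kappa> / (z - \<zeta>)\<^sup>2"
      unfolding dXterm_def vec_lambda_beta \<kappa>_def by (simp add: add_divide_distrib)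
    then show ?thesis
      unfolding weierstrass_sum[OF nZ, symmetric] sum_component by (simp add: sum.remove[OF finite_Z \<zeta>])
  qed
  ultimately show ?thesis by (rule has_contour_integral_eq)
qed

text \<open>By \<open>cross_spinor_normal\<close> and \<open>residue_end\<close> the flux is
  \<open>- \<i> * 2 * pi * \<i> = 2 * pi\<close> times the real vector
  \<open>fl \<zeta> *\<^sub>R hv \<zeta>\<close>; the absolute value is due to the negative fluxes
  of one kind.\<close>

lemma end_weight_surf:
  assumes \<zeta>: "\<zeta> \<in> Z"
  shows "end_weight surf imm (end_at \<zeta>) (2 * pi * \<bar>fl \<zeta>\<bar>)"
proof -
  \<comment> \<open>Below the separation, so the closed disc contains no other puncture.\<close>
  define r where "r = sep / 2"
  have r: "r > 0" "r < sep" using sep(1) by (simp_all add: r_def)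
  define g where "g y = inv_stereographic (\<zeta> + of_real r * y)" for y
  define h where "h = pt \<circ> g"
  define \<alpha> where "\<alpha> t = h (cis (2 * pi * t))" for t
  define c where "c = circlepath \<zeta> r"
  have nZ: "\<zeta> + of_real r * y \<notin> Z" if "y \<noteq> 0" "cmod y \<le> 1" for y
  proof
    assume "\<zeta> + of_real r * y \<in> Z"
    moreover have "cmod (of_real r * y) \<le> r * 1" unfolding norm_mult using r that by (intro mult_mono) auto
    moreover have "of_real r * y \<noteq> 0" using r that by simp
    ultimately show False using sep(2)[OF \<zeta>, of "\<zeta> + of_real r * y"] r by auto
  qed
  have gC: "g y \<in> C" if "y \<in> cball 0 1 - {0}" for y
    using nZ[of y] that by (simp add: g_def inv_stereographic_C)
  have emb_h: "emb (h y) = g y" if "y \<in> cball 0 1 - {0}" for y using gC[OF that] by (simp add: h_def)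
  have emb_map: "embedding_map (top_of_set (cball 0 1 - {0})) (topo surf) h"
  proof -
    let ?S = "cball 0 1 - {0::complex}"
    have "homeomorphic_maps (top_of_set ?S) (top_of_set (g ` ?S)) g (\<lambda>p. (stereographic p - \<zeta>) / of_real r)"
      unfolding homeomorphic_maps_def
    proof (intro conjI)
      show "continuous_map (top_of_set ?S) (top_of_set (g ` ?S)) g"
        unfolding continuous_map_subtopology_eu g_def by (auto intro!: continuous_intros)
      have inv_g: "(stereographic (g y) - \<zeta>) / of_real r = y" for y using r by (simp add: g_def)
      show "continuous_map (top_of_set (g ` ?S)) (top_of_set ?S) (\<lambda>p. (stereographic p - \<zeta>) / of_real r)"
        unfolding continuous_map_subtopology_eu
      proof
        have "p $ 3 \<noteq> 1" if "p \<in> g ` ?S" for p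
          using that inv_stereographic_nth3 unfolding g_def by (metis imageE less_irrefl)
        then show "continuous_on (g ` ?S) (\<lambda>p. (stereographic p - \<zeta>) / of_real r)"
          using r by (intro continuous_intros) auto
        show "(\<lambda>p. (stereographic p - \<zeta>) / of_real r) \<in> g ` ?S \<rightarrow> ?S" using inv_g by auto
      qed
      show "\<forall>x\<in>topspace (top_of_set ?S). (stereographic (g x) - \<zeta>) / of_real r = x" using inv_g by simp
      show "\<forall>y\<in>topspace (top_of_set (g ` ?S)). g ((stereographic y - \<zeta>) / of_real r) = y" using inv_g by auto
    qed
    then have "homeomorphic_map (top_of_set ?S) (top_of_set (g ` ?S)) g" by (rule homeomorphic_maps_imp_map)
    moreover have "subtopology (top_of_set C) (g ` ?S) = top_of_set (g ` ?S)"
      using gC by (simp add: subtopology_subtopology Int_absorb1 image_subset_iff)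
    ultimately have "embedding_map (top_of_set ?S) (top_of_set C) g" by (simp add: embedding_map_def)
    moreover have "embedding_map (top_of_set C) T pt"
    proof -
      have "homeomorphic_map (top_of_set C) T pt"
        using homeomorphic_maps_emb homeomorphic_maps_sym homeomorphic_maps_imp_map by blast
      then show ?thesis unfolding embedding_map_def using homeomorphic_imp_surjective_map by fastforce
    qed
    ultimately show ?thesis unfolding h_def topo_surf by (rule embedding_map_compose)
  qed
  have lim: "filterlim h (end_filter surf (end_at \<zeta>)) (at 0)"
    unfolding h_def g_def o_def
  proof (rule filterlim_end_filter[OF \<zeta>])
    have "((\<lambda>y. \<zeta> + of_real r * y) \<longlongrightarrow> \<zeta> + of_real r * 0) (at 0)" by (intro tendsto_intros)
    then show "((\<lambda>y. \<zeta> + of_real r * y) \<longlongrightarrow> \<zeta>) (at 0)" by simp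
    show "eventually (\<lambda>y. \<zeta> + of_real r * y \<noteq> \<zeta>) (at 0)"
      using r by (auto simp: eventually_at_filter intro!: always_eventually)
  qed
  have cis_c: "\<zeta> + of_real r * cis (2 * pi * t) = c t" for t
    unfolding c_def circlepath cis_conv_exp by (simp add: mult_ac)
  have cnZ: "c t \<notin> Z" for t using nZ[of "cis (2 * pi * t)"] unfolding cis_c by simp
  have emb\<alpha>: "emb (\<alpha> t) = inv_stereographic (c t)" for t
    unfolding \<alpha>_def by (subst emb_h) (simp_all add: g_def cis_c)
  have X\<alpha>: "(imm \<circ> \<alpha>) t = X (inv_stereographic (c t))" for t by (simp add: emb\<alpha>)
  define c' where "c' t = 2 * pi * \<i> * r * exp (2 * of_real pi * \<i> * of_real t)" for t :: real
  define D where "D t = reV (c' t *s weierstrass_vec (spin1 (c t)) (spin2 (c t)))" for t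
  have dc: "(c has_vector_derivative c' t) (at t)" for t
    unfolding c_def c'_def by (rule has_vector_derivative_circlepath)
  have dX: "((imm \<circ> \<alpha>) has_vector_derivative D t) (at t)" for t
  proof -
    have "((\<lambda>z. X (inv_stereographic z)) \<circ> c has_vector_derivative D t) (at t)"
      unfolding D_def
      using vector_derivative_diff_chain_within[OF dc has_derivative_at_withinI[OF X_derivative[OF cnZ]]] by simp
    moreover have "(\<lambda>z. X (inv_stereographic z)) \<circ> c = imm \<circ> \<alpha>" using X\<alpha> by auto
    ultimately show ?thesis by simp
  qed
  have contD: "continuous_on UNIV D"
  proof -
    have c: "continuous_on UNIV c" using dc by (intro continuous_at_imp_continuous_on ballI has_vector_derivative_continuous) blast
    have s: "continuous_on UNIV (\<lambda>t. f (c t))" if "f holomorphic_on - Z" for f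
      by (rule continuous_on_compose2[OF holomorphic_on_imp_continuous_on[OF that] c]) (use cnZ in auto)
    show ?thesis unfolding D_def
      by (intro continuous_on_reV_weierstrass s spin_holomorphic) (auto simp: c'_def intro!: continuous_intros)
  qed
  have loop: "loop_around_end surf imm (end_at \<zeta>) \<alpha>"
    unfolding loop_around_end_def
  proof (intro exI conjI allI)
    show "(imm \<circ> \<alpha>) C1_differentiable_on UNIV"
      unfolding C1_differentiable_on_def using dX contD by blast
  qed (fact emb_map lim \<alpha>_def)+
  have \<alpha>_pt: "\<alpha> t = pt (inv_stereographic (c t))" for t using emb\<alpha> pt_emb by metis
  have integrand: "cross3 (vector_derivative (imm \<circ> \<alpha>) (at t)) (gauss_map surf imm (\<alpha> t))
      = reV ((- \<i> * c' t) *s weierstrass_vec (spin1 (c t)) (spin2 (c t)))" for t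
    unfolding vector_derivative_at[OF dX] D_def \<alpha>_pt gauss_map_surf[OF cnZ]
    by (rule cross_spinor_normal[OF spin_nonzero[OF cnZ]])
  have comp: "((\<lambda>t. Re ((- \<i> * c' t) * weierstrass_vec (spin1 (c t)) (spin2 (c t)) $ j)) has_integral
      2 * pi * (fl \<zeta> * hv \<zeta> $ j)) {0..1}" for j
  proof -
    have "((\<lambda>t. weierstrass_vec (spin1 (c t)) (spin2 (c t)) $ j * c' t) has_integral
        2 * of_real pi * \<i> * of_real (fl \<zeta> * hv \<zeta> $ j)) {0..1}"
      using residue_end[OF \<zeta> r, of j] unfolding has_contour_integral c_def[symmetric] vector_derivative_at[OF dc] .
    then have "((\<lambda>t. - \<i> * (weierstrass_vec (spin1 (c t)) (spin2 (c t)) $ j * c' t)) has_integral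
        - \<i> * (2 * of_real pi * \<i> * of_real (fl \<zeta> * hv \<zeta> $ j))) {0..1}" by (rule has_integral_mult_right)
    then have "((\<lambda>t. Re (- \<i> * (weierstrass_vec (spin1 (c t)) (spin2 (c t)) $ j * c' t))) has_integral
        Re (- \<i> * (2 * of_real pi * \<i> * of_real (fl \<zeta> * hv \<zeta> $ j)))) {0..1}"
      by (rule has_integral_linear[OF _ bounded_linear_Re, unfolded o_def])
    moreover have "- \<i> * (w * k) = (- \<i> * k) * w" for w k :: complex by simp
    moreover have "Re (- \<i> * (2 * of_real pi * \<i> * of_real (fl \<zeta> * hv \<zeta> $ j))) = 2 * pi * (fl \<zeta> * hv \<zeta> $ j)" by simp
    ultimately show ?thesis by (simp only:)
  qed
  have "((\<lambda>t. reV ((- \<i> * c' t) *s weierstrass_vec (spin1 (c t)) (spin2 (c t)))) has_integral (2 * pi * fl \<zeta>) *\<^sub>R hv \<zeta>) {0..1}"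
    unfolding has_integral_componentwise_iff[of _ "(2 * pi * fl \<zeta>) *\<^sub>R hv \<zeta>"]
  proof
    fix b :: "real^3" assume "b \<in> Basis"
    then obtain j where b: "b = axis j 1" by (auto simp: Basis_vec_def)
    have p: "((2 * pi * fl \<zeta>) *\<^sub>R hv \<zeta>) $ j = 2 * pi * (fl \<zeta> * hv \<zeta> $ j)" by simp
    show "((\<lambda>t. reV ((- \<i> * c' t) *s weierstrass_vec (spin1 (c t)) (spin2 (c t))) \<bullet> b) has_integral ((2 * pi * fl \<zeta>) *\<^sub>R hv \<zeta>) \<bullet> b) {0..1}"
      unfolding b cart_eq_inner_axis[symmetric] reV_nth vector_smult_component p by (rule comp)
  qed
  then have "flux surf imm \<alpha> = (2 * pi * fl \<zeta>) *\<^sub>R hv \<zeta>"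
    unfolding flux_def integrand by (rule integral_unique)
  moreover have "norm (hv \<zeta>) = 1" using frame_inner(1)[OF \<zeta>] by (simp add: norm_eq_1)
  ultimately have "norm (flux surf imm \<alpha>) = 2 * pi * \<bar>fl \<zeta>\<bar>" by (simp add: abs_mult)
  then show ?thesis unfolding end_weight_def using loop by blast
qed

end

section \<open>Symmetries\<close>

context alternating
begin

text \<open>After the substitution \<open>x = \<zeta> * u\<close> the sum depends on \<zeta> only
  through the kinds of the products, so offsets of different ends can be compared term by term. The
  poles contribute \<open>(1 + Re u) / 2\<close> because \<open>cmod u = 1\<close>.\<close>

lemma offset_formula:
  assumes \<zeta>: "\<zeta> \<in> Z"
  shows "offset \<zeta> = (\<Sum>u\<in>Z - {1}. fl (\<zeta> * u) * Re u * ln (cmod (1 - u)) - (wt (\<zeta> * u))\<^sup>2 * (1 + Re u) / 2) + fl \<zeta> * ln ((wt \<zeta>)\<^sup>2)"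
proof -
  have z0: "\<zeta> \<noteq> 0" by (rule Z_nonzero[OF \<zeta>])
  have z1: "cmod \<zeta> = 1" by (rule norm_Z[OF \<zeta>])
  have mem: "\<zeta> * u \<in> Z" if "u \<in> Z" for u
    using that \<zeta> by (auto simp: Z_iff power_mult_distrib)
  have mem': "x / \<zeta> \<in> Z" if "x \<in> Z" for x
    using that \<zeta> z0 by (auto simp: Z_iff power_divide simp del: divide_eq_0_iff)
  have summand: "Re (of_real (fl x * (hv x \<bullet> hv \<zeta>)) * (of_real (ln (cmod (\<zeta> - x))) + Ln (1 + \<zeta> * 0 / (\<zeta> - x)))
     - of_real ((wt x)\<^sup>2 * (hv (\<i> * x) \<bullet> hv \<zeta>)) * (\<i> * (x / (\<zeta> * (1 + 0) - x)))
     - of_real ((wt x)\<^sup>2 * (vertical \<bullet> hv \<zeta>)) * (x / (\<zeta> * (1 + 0) - x) + 1 / 2))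
     = fl (\<zeta> * u) * Re u * ln (cmod (1 - u)) - (wt (\<zeta> * u))\<^sup>2 * (1 + Re u) / 2"
    if u: "u \<in> Z - {1}" and x: "x = \<zeta> * u" for u x
  proof -
    have cz: "\<zeta> * cnj \<zeta> = 1" using z1 complex_norm_square[of \<zeta>] by simp
    have i1: "hv x \<bullet> hv \<zeta> = Re u" unfolding hv_inner x
      using cz by (metis mult.assoc mult.commute mult.right_neutral)
    have i2: "hv (\<i> * x) \<bullet> hv \<zeta> = - Im u"
    proof -
      have e: "(\<i> * (\<zeta> * u)) * cnj \<zeta> = \<i> * u * (\<zeta> * cnj \<zeta>)" by (simp only: mult_ac)
      show ?thesis unfolding hv_inner x e cz by simp
    qed
    have d: "\<zeta> - x = \<zeta> * (1 - u)" by (simp add: x algebra_simps)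
    have l: "ln (cmod (\<zeta> - x)) = ln (cmod (1 - u))" unfolding d norm_mult z1 by simp
    have f: "Im (x / (\<zeta> - x)) = Im (u / (1 - u))" unfolding d unfolding x using z0 by simp
    have u1: "(Re u)\<^sup>2 + (Im u)\<^sup>2 = 1" using norm_Z[of u] u by (simp add: cmod_power2[symmetric])
    have ne: "u \<noteq> 1" using u by simp
    have c1: "Re u \<noteq> 1"
    proof
      assume "Re u = 1"
      then show False using u1 ne by (simp add: complex_eq_iff)
    qed
    have m: "(cmod (1 - u))\<^sup>2 = 2 * (1 - Re u)"
      unfolding cmod_power2 using u1 by (simp add: power2_eq_square algebra_simps)
    have "Im (u / (1 - u)) = Im u / (2 * (1 - Re u))"
      unfolding m[symmetric] Im_divide cmod_power2 by (simp add: algebra_simps)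
    then have "Im u * Im (u / (1 - u)) = (Im u)\<^sup>2 / (2 * (1 - Re u))" by (simp add: power2_eq_square)
    also have "(Im u)\<^sup>2 = (1 - Re u) * (1 + Re u)" using u1 by (simp add: power2_eq_square algebra_simps)
    also have "(1 - Re u) * (1 + Re u) / (2 * (1 - Re u)) = (1 + Re u) / 2"
      using c1 nonzero_mult_divide_mult_cancel_left[of "1 - Re u" "1 + Re u" 2] by (simp only: mult.commute[of 2])
    finally have e: "Im u * Im (x / (\<zeta> - x)) = (1 + Re u) / 2" unfolding f .
    have gen: "Re (of_real a * (of_real b + Ln 1) - of_real (k * (- d)) * (\<i> * q) - of_real (k * 0) * r) = a * b - k * (d * Im q)"
      for a b k d :: real and q r by simp
    have a: "1 + \<zeta> * 0 / (\<zeta> - x) = 1" "\<zeta> * (1 + 0) - x = \<zeta> - x" by simp_all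
    show ?thesis unfolding i1 i2 l hv_vertical a gen e unfolding x by simp
  qed
  have "Re (Hol \<zeta> (hv \<zeta>) 0) = (\<Sum>u\<in>Z - {1}. fl (\<zeta> * u) * Re u * ln (cmod (1 - u)) - (wt (\<zeta> * u))\<^sup>2 * (1 + Re u) / 2)"
    unfolding Hol_def Re_sum
  proof (rule sum.reindex_bij_witness[where i = "\<lambda>u. \<zeta> * u" and j = "\<lambda>x. x / \<zeta>"])
    fix x assume x: "x \<in> Z - {\<zeta>}"
    show "\<zeta> * (x / \<zeta>) = x" using z0 by simp
    show "x / \<zeta> \<in> Z - {1}" using x mem'[of x] z0 by auto
    then show "fl (\<zeta> * (x / \<zeta>)) * Re (x / \<zeta>) * ln (cmod (1 - x / \<zeta>)) - (wt (\<zeta> * (x / \<zeta>)))\<^sup>2 * (1 + Re (x / \<zeta>)) / 2 =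
      Re (of_real (fl x * (hv x \<bullet> hv \<zeta>)) * (of_real (ln (cmod (\<zeta> - x))) + Ln (1 + \<zeta> * 0 / (\<zeta> - x)))
     - of_real ((wt x)\<^sup>2 * (hv (\<i> * x) \<bullet> hv \<zeta>)) * (\<i> * (x / (\<zeta> * (1 + 0) - x)))
     - of_real ((wt x)\<^sup>2 * (vertical \<bullet> hv \<zeta>)) * (x / (\<zeta> * (1 + 0) - x) + 1 / 2))"
      by (intro summand[symmetric]) (use z0 in auto)
  next
    fix u assume u: "u \<in> Z - {1}"
    show "\<zeta> * u / \<zeta> = u" using z0 by simp
    show "\<zeta> * u \<in> Z - {\<zeta>}" using u mem[of u] z0 by auto
  qed
  then show ?thesis by (simp add: offset_def)
qed

text \<open>If the two kinds have opposite fluxes, the logarithms of the distances cancel at each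
  \<open>u\<close>, and the squared weights add up to a constant. What remains is the sum of
  \<open>1 + Re u\<close> over the roots other than 1, which is \<open>2 * n - 2\<close>.\<close>

lemma offset_sum:
  assumes \<zeta>: "\<zeta> \<in> Zr 1" "\<zeta>' \<in> Zr (-1)" and fl0: "fl \<zeta> + fl \<zeta>' = 0"
  shows "offset \<zeta> + offset \<zeta>' = fl \<zeta> * (ln (\<beta>\<^sup>2) - ln (\<gamma>\<^sup>2)) - (real n - 1) * (\<beta>\<^sup>2 + \<gamma>\<^sup>2)"
proof -
  have Z: "\<zeta> \<in> Z" "\<zeta>' \<in> Z" using \<zeta> by (auto simp: Z_def)
  have ne: "(1::complex) \<noteq> - 1" by simp
  have u: "fl (\<zeta> * u) + fl (\<zeta>' * u) = 0" "(wt (\<zeta> * u))\<^sup>2 + (wt (\<zeta>' * u))\<^sup>2 = \<beta>\<^sup>2 + \<gamma>\<^sup>2" if "u \<in> Z" for u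
  proof -
    have p: "(\<zeta> * u) ^ n = u ^ n" "(\<zeta>' * u) ^ n = - (u ^ n)" "\<zeta> ^ n = 1" "\<zeta>' ^ n = -1"
      using \<zeta> by (simp_all add: Zr_def power_mult_distrib)
    from that consider "u ^ n = 1" | "u ^ n = -1" unfolding Z_iff by blast
    then show "fl (\<zeta> * u) + fl (\<zeta>' * u) = 0" "(wt (\<zeta> * u))\<^sup>2 + (wt (\<zeta>' * u))\<^sup>2 = \<beta>\<^sup>2 + \<gamma>\<^sup>2"
      using fl0 unfolding fl_def wt_def p by (cases; simp)+
  qed
  have "offset \<zeta> + offset \<zeta>' = (\<Sum>u\<in>Z - {1}. (fl (\<zeta> * u) + fl (\<zeta>' * u)) * (Re u * ln (cmod (1 - u)))
      - ((wt (\<zeta> * u))\<^sup>2 + (wt (\<zeta>' * u))\<^sup>2) * ((1 + Re u) / 2)) + (fl \<zeta> * ln ((wt \<zeta>)\<^sup>2) + fl \<zeta>' * ln ((wt \<zeta>')\<^sup>2))"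
    unfolding offset_formula[OF Z(1)] offset_formula[OF Z(2)]
    by (simp add: sum.distrib sum_subtractf algebra_simps add_divide_distrib)
  also have "(\<Sum>u\<in>Z - {1}. (fl (\<zeta> * u) + fl (\<zeta>' * u)) * (Re u * ln (cmod (1 - u)))
      - ((wt (\<zeta> * u))\<^sup>2 + (wt (\<zeta>' * u))\<^sup>2) * ((1 + Re u) / 2)) = (\<Sum>u\<in>Z - {1}. - ((\<beta>\<^sup>2 + \<gamma>\<^sup>2) / 2) * (1 + Re u))"
    by (intro sum.cong refl) (simp add: u)
  also have "\<dots> = - ((\<beta>\<^sup>2 + \<gamma>\<^sup>2) / 2) * (\<Sum>u\<in>Z - {1}. 1 + Re u)" by (rule sum_distrib_left[symmetric])
  also have "(\<Sum>u\<in>Z - {1}. 1 + Re u) = 2 * real n - 2"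
  proof -
    have 1: "1 \<in> Z" by (simp add: Z_iff)
    have "(\<Sum>u\<in>Z. 1 + Re u) = 2 * real n"
      unfolding sum.distrib Re_sum[symmetric] sum_Z sum_Zr by (simp add: card_Zr)
    then show ?thesis using sum.remove[OF finite_Z 1, of "\<lambda>u. 1 + Re u"] by simp
  qed
  also have "fl \<zeta> * ln ((wt \<zeta>)\<^sup>2) + fl \<zeta>' * ln ((wt \<zeta>')\<^sup>2) = fl \<zeta> * (ln (\<beta>\<^sup>2) - ln (\<gamma>\<^sup>2))"
  proof -
    have "fl \<zeta>' = - fl \<zeta>" using fl0 by simp
    then show ?thesis unfolding wt_Zr(1)[OF \<zeta>(1)] wt_Zr(2)[OF \<zeta>(2)] by (simp add: algebra_simps)
  qed
  finally show ?thesis by (simp add: field_simps)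
qed

end

section \<open>How an isometry acts on the ends\<close>

context alternating_surface
begin

abbreviation image_surf :: "(real^3) set" where
  "image_surf \<equiv> X ` C"

text \<open>By compactness of the sphere a subsequence converges there; since \<open>X\<close> is
  continuous off the punctures, the limit is a puncture.\<close>

lemma escape:
  assumes q: "\<And>k::nat. q k \<in> C" and inf: "filterlim (\<lambda>k. norm (X (q k))) at_top sequentially"
  obtains \<zeta> r where "\<zeta> \<in> Z" "strict_mono (r :: nat \<Rightarrow> nat)"
    "(\<lambda>k. X (q (r k)) \<bullet> hv \<zeta> + fl \<zeta> * ln (norm (X (q (r k))))) \<longlonglongrightarrow> offset \<zeta>"
proof -
  have "\<forall>k. q k \<in> sphere 0 1" using q by (auto simp: C_def)
  then obtain l r where lr: "strict_mono (r :: nat \<Rightarrow> nat)" "(q \<circ> r) \<longlonglongrightarrow> l"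
    using compact_sphere[of "0::real^3" 1] unfolding compact_eq_seq_compact_metric seq_compact_def by metis
  have infr: "filterlim (\<lambda>k. norm (X ((q \<circ> r) k))) at_top sequentially"
    using filterlim_compose[OF inf filterlim_subseq[OF lr(1)]] by (simp add: o_def)
  have lC: "l \<notin> C"
  proof
    assume l: "l \<in> C"
    have "(\<lambda>k. X ((q \<circ> r) k)) \<longlonglongrightarrow> X l"
      using continuous_on_tendsto_compose[OF continuous_on_X[folded C_def] lr(2) l] q by simp
    then have "(\<lambda>k. norm (X ((q \<circ> r) k))) \<longlonglongrightarrow> norm (X l)" by (rule tendsto_norm)
    then show False using not_tendsto_and_filterlim_at_infinity[OF _ _ filterlim_at_top_imp_at_infinity[OF infr]] by simp
  qed
  obtain \<zeta> \<xi> where \<zeta>: "\<zeta> \<in> Z" and \<xi>: "filterlim \<xi> (at 0) sequentially"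
    and e: "eventually (\<lambda>k. (q \<circ> r) k = inv_stereographic (\<zeta> * (1 + \<xi> k))) sequentially"
    by (rule sequence_limit_end[OF _ lr(2) lC]) (simp add: q, blast)
  have "(\<lambda>k. X (inv_stereographic (\<zeta> * (1 + \<xi> k))) \<bullet> hv \<zeta> + fl \<zeta> * ln (norm (X (inv_stereographic (\<zeta> * (1 + \<xi> k)))))) \<longlonglongrightarrow> offset \<zeta>"
    by (rule filterlim_compose[OF X_log_asymptotics[OF \<zeta>] \<xi>])
  moreover have "eventually (\<lambda>k. X (inv_stereographic (\<zeta> * (1 + \<xi> k))) \<bullet> hv \<zeta> + fl \<zeta> * ln (norm (X (inv_stereographic (\<zeta> * (1 + \<xi> k)))))
      = X (q (r k)) \<bullet> hv \<zeta> + fl \<zeta> * ln (norm (X (q (r k))))) sequentially"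
    using e by eventually_elim simp
  ultimately have "(\<lambda>k. X (q (r k)) \<bullet> hv \<zeta> + fl \<zeta> * ln (norm (X (q (r k))))) \<longlonglongrightarrow> offset \<zeta>" by (rule Lim_transform_eventually)
  then show ?thesis using that \<zeta> lr(1) by blast
qed

text \<open>Along the axis the growth is only logarithmic in the norm, so the direction of escape is
  asymptotically orthogonal to it.\<close>

lemma escape_sequence:
  assumes y: "\<And>k::nat. y k \<in> image_surf" and inf: "filterlim (\<lambda>k. norm (y k)) at_top sequentially"
  obtains \<zeta> r where "\<zeta> \<in> Z" "strict_mono (r :: nat \<Rightarrow> nat)"
    "(\<lambda>k. y (r k) \<bullet> hv \<zeta> + fl \<zeta> * ln (norm (y (r k)))) \<longlonglongrightarrow> offset \<zeta>"
    "(\<lambda>k. y (r k) \<bullet> hv \<zeta> / norm (y (r k))) \<longlonglongrightarrow> 0"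
proof -
  have "\<forall>k. \<exists>p. p \<in> C \<and> y k = X p" using y by blast
  from choice[OF this] obtain q where q: "\<And>k. q k \<in> C" "\<And>k. y k = X (q k)" by blast
  have yq: "y = (\<lambda>k. X (q k))" using q(2) by blast
  obtain \<zeta> r where \<zeta>: "\<zeta> \<in> Z" and r: "strict_mono (r :: nat \<Rightarrow> nat)"
    and lim: "(\<lambda>k. y (r k) \<bullet> hv \<zeta> + fl \<zeta> * ln (norm (y (r k)))) \<longlonglongrightarrow> offset \<zeta>"
    unfolding yq by (rule escape[OF q(1) inf[unfolded yq]]) blast
  have infr: "filterlim (\<lambda>k. norm (y (r k))) at_top sequentially"
    using filterlim_compose[OF inf filterlim_subseq[OF r]] by simp
  have "(\<lambda>k. (y (r k) \<bullet> hv \<zeta> + fl \<zeta> * ln (norm (y (r k)))) / norm (y (r k)) - fl \<zeta> * (ln (norm (y (r k))) / norm (y (r k)))) \<longlonglongrightarrow> 0 - fl \<zeta> * 0"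
    by (intro tendsto_diff tendsto_mult tendsto_const filterlim_compose[OF ln_x_over_x_tendsto_0 infr]
        real_tendsto_divide_at_top[OF lim infr])
  then have "(\<lambda>k. y (r k) \<bullet> hv \<zeta> / norm (y (r k))) \<longlonglongrightarrow> 0"
    by (simp add: add_divide_distrib)
  then show ?thesis using that \<zeta> r lim by blast
qed

text \<open>Iterates of the translation escape along a line. At the end they reach, \<open>b\<close>
  must be orthogonal to the axis, so the component along the axis stays constant, against its
  logarithmic growth with coefficient \<open>fl \<zeta> \<noteq> 0\<close>.\<close>

lemma translation_trivial:
  assumes fl0: "\<And>\<zeta>. \<zeta> \<in> Z \<Longrightarrow> fl \<zeta> \<noteq> 0" and sub: "(\<lambda>x. x + b) ` image_surf \<subseteq> image_surf"
  shows "b = 0"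
proof (rule ccontr)
  assume b: "b \<noteq> 0"
  obtain x where x: "x \<in> image_surf" using poles_C by blast
  define y where "y k = x + real k *\<^sub>R b" for k
  have y: "y k \<in> image_surf" for k
  proof (induction k)
    case (Suc k)
    then have "y k + b \<in> image_surf" using sub by blast
    moreover have "y k + b = y (Suc k)" by (simp add: y_def algebra_simps)
    ultimately show ?case by simp
  qed (use x in \<open>simp add: y_def\<close>)
  have lin: "filterlim (\<lambda>k. norm b * real k) at_top sequentially"
    using b by (intro filterlim_tendsto_pos_mult_at_top[OF tendsto_const _ filterlim_real_sequentially]) simp
  have ge: "- norm x + norm b * real k \<le> norm (y k)" for k
    using norm_triangle_ineq2[of "real k *\<^sub>R b" "- x"] by (simp add: y_def add.commute mult.commute)
  have inf: "filterlim (\<lambda>k. norm (y k)) at_top sequentially"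
    by (rule filterlim_at_top_mono[OF filterlim_tendsto_add_at_top[OF tendsto_const lin]])
      (use ge in \<open>intro always_eventually allI, assumption\<close>)
  obtain \<zeta> r where \<zeta>: "\<zeta> \<in> Z" and r: "strict_mono (r :: nat \<Rightarrow> nat)"
    and lim: "(\<lambda>k. y (r k) \<bullet> hv \<zeta> + fl \<zeta> * ln (norm (y (r k)))) \<longlonglongrightarrow> offset \<zeta>"
    and lim0: "(\<lambda>k. y (r k) \<bullet> hv \<zeta> / norm (y (r k))) \<longlonglongrightarrow> 0"
    using escape_sequence[OF y inf] by blast
  have rinf: "filterlim (\<lambda>k. real (r k)) at_top sequentially"
    by (rule filterlim_compose[OF filterlim_real_sequentially filterlim_subseq[OF r]])
  have infr: "filterlim (\<lambda>k. norm (y (r k))) at_top sequentially"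
    using filterlim_compose[OF inf filterlim_subseq[OF r]] by simp
  have "(\<lambda>k. inverse (real (r k)) *\<^sub>R x + b) \<longlonglongrightarrow> 0 *\<^sub>R x + b"
    by (intro tendsto_intros filterlim_compose[OF tendsto_inverse_0_at_top[OF filterlim_ident] rinf])
  then have yr: "(\<lambda>k. inverse (real (r k)) *\<^sub>R x + b) \<longlonglongrightarrow> b" by simp
  have ev: "eventually (\<lambda>k. real (r k) > 0 \<and> norm (y (r k)) > 0) sequentially"
    by (rule eventually_conj[OF filterlim_at_top_dense[THEN iffD1, OF rinf, rule_format, of 0]
          filterlim_at_top_dense[THEN iffD1, OF infr, rule_format, of 0]])
  have "(\<lambda>k. (y (r k) \<bullet> hv \<zeta> / norm (y (r k))) * norm (inverse (real (r k)) *\<^sub>R x + b)) \<longlonglongrightarrow> 0 * norm b"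
    by (intro tendsto_mult lim0 tendsto_norm yr)
  moreover have "eventually (\<lambda>k. (y (r k) \<bullet> hv \<zeta> / norm (y (r k))) * norm (inverse (real (r k)) *\<^sub>R x + b)
      = (inverse (real (r k)) *\<^sub>R x + b) \<bullet> hv \<zeta>) sequentially"
    using ev
  proof eventually_elim
    case (elim k)
    have "inverse (real (r k)) *\<^sub>R x + b = inverse (real (r k)) *\<^sub>R y (r k)"
      using elim by (simp add: y_def scaleR_add_right)
    then show ?case using elim by simp
  qed
  ultimately have "(\<lambda>k. (inverse (real (r k)) *\<^sub>R x + b) \<bullet> hv \<zeta>) \<longlonglongrightarrow> 0 * norm b" by (rule Lim_transform_eventually)
  moreover have "(\<lambda>k. (inverse (real (r k)) *\<^sub>R x + b) \<bullet> hv \<zeta>) \<longlonglongrightarrow> b \<bullet> hv \<zeta>" by (intro tendsto_inner yr tendsto_const)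
  ultimately have "b \<bullet> hv \<zeta> = 0" using LIMSEQ_unique by fastforce
  then have "y k \<bullet> hv \<zeta> = x \<bullet> hv \<zeta>" for k by (simp add: y_def inner_add_left)
  then have "(\<lambda>k. x \<bullet> hv \<zeta> + fl \<zeta> * ln (norm (y (r k)))) \<longlonglongrightarrow> offset \<zeta>" using lim by simp
  then have "(\<lambda>k. (x \<bullet> hv \<zeta> + fl \<zeta> * ln (norm (y (r k))) - x \<bullet> hv \<zeta>) / fl \<zeta>) \<longlonglongrightarrow> (offset \<zeta> - x \<bullet> hv \<zeta>) / fl \<zeta>"
    using fl0[OF \<zeta>] by (intro tendsto_divide tendsto_diff tendsto_const)
  then have "(\<lambda>k. ln (norm (y (r k)))) \<longlonglongrightarrow> (offset \<zeta> - x \<bullet> hv \<zeta>) / fl \<zeta>" using fl0[OF \<zeta>] by simp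
  moreover have "filterlim (\<lambda>k. ln (norm (y (r k)))) at_top sequentially" by (rule filterlim_compose[OF ln_at_top infr])
  ultimately show False
    using not_tendsto_and_filterlim_at_infinity[OF _ _ filterlim_at_top_imp_at_infinity] by (metis sequentially_bot)
qed

text \<open>Follow a ray into \<zeta>, apply the isometry and let the image escape to some end
  \<zeta>'. To leading order this compares directions of escape. The axes are compared only
  conditionally, since one ray does not yet determine the image of the axis.\<close>

lemma isometry_direction:
  assumes A: "orthogonal_transformation A" and sub: "(\<lambda>x. A x + b) ` image_surf \<subseteq> image_surf"
    and \<zeta>: "\<zeta> \<in> Z" and e: "cmod e = 1"
  obtains \<zeta>' where "\<zeta>' \<in> Z"
    "A (Im (1 / e) *\<^sub>R hv (\<i> * \<zeta>) - Re (1 / e) *\<^sub>R vertical) \<bullet> hv \<zeta>' = 0"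
    "\<And>\<epsilon>. A (hv \<zeta>) = \<epsilon> *\<^sub>R hv \<zeta>' \<Longrightarrow> \<epsilon> * \<epsilon> = 1 \<Longrightarrow> fl \<zeta>' = \<epsilon> * fl \<zeta> \<and> offset \<zeta>' - \<epsilon> * offset \<zeta> = b \<bullet> hv \<zeta>'"
proof -
  have lin: "linear A" and inner: "A v \<bullet> A w = v \<bullet> w" and nA: "norm (A v) = norm v" for v w
    using A by (simp_all add: orthogonal_transformation_def orthogonal_transformation_norm A)
  \<comment> \<open>The shift by 2 keeps \<open>t k\<close> strictly below \<open>sep\<close> also
    for \<open>k = 0\<close>.\<close>
  define t where "t k = sep / real (k + 2)" for k
  have t: "0 < t k" "t k < sep" for k using sep(1) by (simp_all add: t_def field_simps add_pos_nonneg)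
  have "(\<lambda>k. sep * inverse (real (k + 2))) \<longlonglongrightarrow> sep * 0"
    by (intro tendsto_mult tendsto_const LIMSEQ_ignore_initial_segment[OF lim_inverse_n])
  then have t0: "t \<longlonglongrightarrow> 0" by (simp add: t_def[abs_def] divide_inverse)
  have tr: "filterlim t (at_right 0) sequentially" unfolding filterlim_at using t0 t(1) less_imp_neq[OF t(1), symmetric] by simp
  define p where "p k = inv_stereographic (\<zeta> * (1 + of_real (t k) * e))" for k
  have \<xi>: "of_real (t k) * e \<noteq> 0" "cmod (of_real (t k) * e) = t k" for k using t[of k] e by (auto simp: norm_mult)
  have te: "filterlim (\<lambda>k. of_real (t k) * e) (at 0) sequentially"
    unfolding filterlim_at
  proof
    have "(\<lambda>k. of_real (t k) * e) \<longlonglongrightarrow> of_real 0 * e" by (intro tendsto_intros t0)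
    then show "(\<lambda>k. of_real (t k) * e) \<longlonglongrightarrow> 0" by simp
  qed (use \<xi> in auto)
  define Y where "Y k = X (p k)" for k
  have "p k \<in> C" for k
    using X_expand(1)[OF \<zeta> \<xi>(1), of k] \<xi>(2)[of k] t[of k] by (simp add: p_def inv_stereographic_C)
  then have YS: "Y k \<in> image_surf" for k by (simp add: Y_def)
  have Yinf: "filterlim (\<lambda>k. norm (Y k)) at_top sequentially"
    unfolding Y_def p_def by (rule filterlim_compose[OF X_at_top[OF \<zeta>] te])
  have Ylog: "(\<lambda>k. Y k \<bullet> hv \<zeta> + fl \<zeta> * ln (norm (Y k))) \<longlonglongrightarrow> offset \<zeta>"
    unfolding Y_def p_def by (rule filterlim_compose[OF X_log_asymptotics[OF \<zeta>] te])
  have Ynorm: "(\<lambda>k. t k * norm (Y k)) \<longlonglongrightarrow> (wt \<zeta>)\<^sup>2"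
    using filterlim_compose[OF scaled_X[OF \<zeta>] te] unfolding Y_def p_def \<xi>(2) .
  define u where "u = Im (1 / e) *\<^sub>R hv (\<i> * \<zeta>) - Re (1 / e) *\<^sub>R vertical"
  have Ydir: "(\<lambda>k. t k * (Y k \<bullet> v)) \<longlonglongrightarrow> (wt \<zeta>)\<^sup>2 * (u \<bullet> v)" for v
    using filterlim_compose[OF X_direction[OF \<zeta> e] tr] unfolding Y_def p_def u_def
    by (simp only: inner_diff_left inner_scaleR_left)
  define y where "y k = A (Y k) + b" for k
  have y: "y k \<in> image_surf" for k using sub YS by (auto simp: y_def)
  have ge: "- norm b + norm (Y k) \<le> norm (y k)" for k
    using norm_triangle_ineq2[of "A (Y k)" "- b"] nA[of "Y k"] by (simp add: y_def)
  have inf: "filterlim (\<lambda>k. norm (y k)) at_top sequentially"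
    by (rule filterlim_at_top_mono[OF filterlim_tendsto_add_at_top[OF tendsto_const Yinf]])
      (use ge in \<open>intro always_eventually allI, assumption\<close>)
  obtain \<zeta>' r where \<zeta>': "\<zeta>' \<in> Z" and r: "strict_mono (r :: nat \<Rightarrow> nat)"
    and lim: "(\<lambda>k. y (r k) \<bullet> hv \<zeta>' + fl \<zeta>' * ln (norm (y (r k)))) \<longlonglongrightarrow> offset \<zeta>'"
    and lim0: "(\<lambda>k. y (r k) \<bullet> hv \<zeta>' / norm (y (r k))) \<longlonglongrightarrow> 0"
    using escape_sequence[OF y inf] by blast
  note sub_r = filterlim_compose[OF _ filterlim_subseq[OF r]]
  have wt0: "(wt \<zeta>)\<^sup>2 \<noteq> 0" using \<beta> \<gamma> by (simp add: wt_def)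
  \<comment> \<open>The translation part is bounded, hence invisible in the ratio of the norms; so
    the logarithms of the two norms may be exchanged in the limit.\<close>
  have ratio: "(\<lambda>k. norm (y (r k)) / norm (Y (r k))) \<longlonglongrightarrow> 1"
  proof -
    have "(\<lambda>k. norm b / norm (Y (r k))) \<longlonglongrightarrow> 0"
      by (rule real_tendsto_divide_at_top[OF tendsto_const sub_r[OF Yinf]])
    moreover have "eventually (\<lambda>k. norm (norm (y (r k)) / norm (Y (r k)) - 1) \<le> norm b / norm (Y (r k))) sequentially"
      using filterlim_at_top_dense[THEN iffD1, OF sub_r[OF Yinf], rule_format, of 0]
    proof eventually_elim
      case (elim k)
      have "\<bar>norm (y (r k)) - norm (Y (r k))\<bar> \<le> norm b"
        using norm_triangle_ineq3[of "y (r k)" "A (Y (r k))"] nA by (simp add: y_def)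
      moreover have "norm (y (r k)) / norm (Y (r k)) - 1 = (norm (y (r k)) - norm (Y (r k))) / norm (Y (r k))"
        using elim by (simp add: diff_divide_distrib)
      ultimately show ?case using elim by (simp add: abs_divide divide_right_mono)
    qed
    ultimately have "(\<lambda>k. norm (y (r k)) / norm (Y (r k)) - 1) \<longlonglongrightarrow> 0" by (rule Lim_null_comparison[rotated])
    then show ?thesis by (simp add: LIM_zero_iff)
  qed
  have ev: "eventually (\<lambda>k. norm (Y (r k)) > 0 \<and> norm (y (r k)) > 0) sequentially"
    using filterlim_at_top_dense[THEN iffD1, OF sub_r[OF Yinf], rule_format, of 0]
      filterlim_at_top_dense[THEN iffD1, OF sub_r[OF inf], rule_format, of 0] by (rule eventually_conj)
  have "A u \<bullet> hv \<zeta>' = 0"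
  proof -
    define v where "v = adjoint A (hv \<zeta>')"
    have v: "A x \<bullet> hv \<zeta>' = x \<bullet> v" for x unfolding v_def by (simp add: adjoint_clauses(1)[OF lin])
    have "(\<lambda>k. (t (r k) * norm (Y (r k))) * (norm (y (r k)) / norm (Y (r k))) * (y (r k) \<bullet> hv \<zeta>' / norm (y (r k)))) \<longlonglongrightarrow> (wt \<zeta>)\<^sup>2 * 1 * 0"
      by (intro tendsto_mult ratio lim0 sub_r[OF Ynorm])
    moreover have "eventually (\<lambda>k. (t (r k) * norm (Y (r k))) * (norm (y (r k)) / norm (Y (r k))) * (y (r k) \<bullet> hv \<zeta>' / norm (y (r k)))
        = t (r k) * (Y (r k) \<bullet> v) + t (r k) * (b \<bullet> hv \<zeta>')) sequentially"
      using ev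
    proof eventually_elim
      case (elim k)
      have "y (r k) \<bullet> hv \<zeta>' = Y (r k) \<bullet> v + b \<bullet> hv \<zeta>'" by (simp add: y_def inner_add_left v)
      moreover have "(a * p) * (c / p) * (w / c) = a * w" if "p \<noteq> 0" "c \<noteq> 0" for a p c w :: real using that by simp
      ultimately show ?case using elim by (simp only: distrib_left[symmetric]) simp
    qed
    ultimately have "(\<lambda>k. t (r k) * (Y (r k) \<bullet> v) + t (r k) * (b \<bullet> hv \<zeta>')) \<longlonglongrightarrow> (wt \<zeta>)\<^sup>2 * 1 * 0" by (rule Lim_transform_eventually)
    moreover have "(\<lambda>k. t (r k) * (Y (r k) \<bullet> v) + t (r k) * (b \<bullet> hv \<zeta>')) \<longlonglongrightarrow> (wt \<zeta>)\<^sup>2 * (u \<bullet> v) + 0 * (b \<bullet> hv \<zeta>')"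
      by (intro tendsto_add tendsto_mult tendsto_const sub_r[OF Ydir] sub_r[OF t0])
    ultimately have "(wt \<zeta>)\<^sup>2 * 1 * 0 = (wt \<zeta>)\<^sup>2 * (u \<bullet> v) + 0 * (b \<bullet> hv \<zeta>')" by (rule LIMSEQ_unique)
    then show ?thesis using wt0 v by simp
  qed
  moreover have "fl \<zeta>' = \<epsilon> * fl \<zeta> \<and> offset \<zeta>' - \<epsilon> * offset \<zeta> = b \<bullet> hv \<zeta>'" if Ae: "A (hv \<zeta>) = \<epsilon> *\<^sub>R hv \<zeta>'" and \<epsilon>: "\<epsilon> * \<epsilon> = 1" for \<epsilon>
  proof -
    have "\<epsilon> *\<^sub>R A (hv \<zeta>) = hv \<zeta>'" unfolding Ae scaleR_scaleR \<epsilon> by simp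
    then have yy: "y k \<bullet> hv \<zeta>' = \<epsilon> * (Y k \<bullet> hv \<zeta>) + b \<bullet> hv \<zeta>'" for k
      unfolding y_def inner_add_left by (metis inner inner_scaleR_right)
    \<comment> \<open>Subtracting the two asymptotic laws leaves \<open>c\<close> times a logarithm
      that tends to infinity, with the finite limit \<open>L\<close>. Hence \<open>c = 0\<close>,
      and then \<open>L = 0\<close>.\<close>
    define L where "L = offset \<zeta>' - \<epsilon> * offset \<zeta> - b \<bullet> hv \<zeta>'"
    define c where "c = fl \<zeta>' - \<epsilon> * fl \<zeta>"
    have "(\<lambda>k. (y (r k) \<bullet> hv \<zeta>' + fl \<zeta>' * ln (norm (y (r k)))) - \<epsilon> * (Y (r k) \<bullet> hv \<zeta> + fl \<zeta> * ln (norm (Y (r k)))) - b \<bullet> hv \<zeta>'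
        - fl \<zeta>' * ln (norm (y (r k)) / norm (Y (r k)))) \<longlonglongrightarrow> offset \<zeta>' - \<epsilon> * offset \<zeta> - b \<bullet> hv \<zeta>' - fl \<zeta>' * ln 1"
      by (intro tendsto_diff tendsto_mult tendsto_const lim sub_r[OF Ylog] tendsto_ln ratio) simp
    moreover have "eventually (\<lambda>k. (y (r k) \<bullet> hv \<zeta>' + fl \<zeta>' * ln (norm (y (r k)))) - \<epsilon> * (Y (r k) \<bullet> hv \<zeta> + fl \<zeta> * ln (norm (Y (r k)))) - b \<bullet> hv \<zeta>'
        - fl \<zeta>' * ln (norm (y (r k)) / norm (Y (r k))) = c * ln (norm (Y (r k)))) sequentially"
      using ev by eventually_elim (simp add: yy ln_div c_def algebra_simps)
    ultimately have "(\<lambda>k. c * ln (norm (Y (r k)))) \<longlonglongrightarrow> offset \<zeta>' - \<epsilon> * offset \<zeta> - b \<bullet> hv \<zeta>' - fl \<zeta>' * ln 1"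
      by (rule Lim_transform_eventually)
    then have cl: "(\<lambda>k. c * ln (norm (Y (r k)))) \<longlonglongrightarrow> L" by (simp add: L_def)
    have c0: "c = 0"
    proof (rule ccontr)
      assume c: "c \<noteq> 0"
      have "(\<lambda>k. c * ln (norm (Y (r k))) / c) \<longlonglongrightarrow> L / c" by (intro tendsto_divide cl tendsto_const c)
      then have "(\<lambda>k. ln (norm (Y (r k)))) \<longlonglongrightarrow> L / c" using c by simp
      moreover have "filterlim (\<lambda>k. ln (norm (Y (r k)))) at_top sequentially" by (rule filterlim_compose[OF ln_at_top sub_r[OF Yinf]])
      ultimately show False
        using not_tendsto_and_filterlim_at_infinity[OF _ _ filterlim_at_top_imp_at_infinity] by (metis sequentially_bot)
    qed
    then have "L = 0" using cl LIMSEQ_unique[OF _ tendsto_const] by fastforce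
    then show ?thesis using c0 by (simp add: L_def c_def)
  qed
  ultimately show ?thesis using that \<zeta>' unfolding u_def by blast
qed

text \<open>Infinitely many rays but finitely many ends: two rays with independent directions reach
  the same \<zeta>'. So \<open>A\<close> maps the plane orthogonal to \<open>hv \<zeta>\<close> to
  the one orthogonal to \<open>hv \<zeta>'\<close>, and therefore axis to axis up to sign.\<close>

lemma isometry_end:
  assumes A: "orthogonal_transformation A" and sub: "(\<lambda>x. A x + b) ` image_surf \<subseteq> image_surf" and \<zeta>: "\<zeta> \<in> Z"
  obtains \<zeta>' \<epsilon> where "\<zeta>' \<in> Z" "\<epsilon> = 1 \<or> \<epsilon> = -1" "A (hv \<zeta>) = \<epsilon> *\<^sub>R hv \<zeta>'"
    "fl \<zeta>' = \<epsilon> * fl \<zeta>" "offset \<zeta>' - \<epsilon> * offset \<zeta> = b \<bullet> hv \<zeta>'"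
proof -
  have lin: "linear A" and inner: "A v \<bullet> A w = v \<bullet> w" for v w
    using A by (simp_all add: orthogonal_transformation_def)
  \<comment> \<open>Different slopes \<open>s\<close> give linearly independent directions of
    escape, and there are infinitely many.\<close>
  define e where "e s = sgn (Complex 1 (real s))" for s
  have e: "cmod (e s) = 1" for s by (simp add: e_def norm_sgn complex_eq_iff)
  define good where "good s \<zeta>' \<longleftrightarrow> \<zeta>' \<in> Z \<and> A (Im (1 / e s) *\<^sub>R hv (\<i> * \<zeta>) - Re (1 / e s) *\<^sub>R vertical) \<bullet> hv \<zeta>' = 0 \<and>
    (\<forall>\<epsilon>. A (hv \<zeta>) = \<epsilon> *\<^sub>R hv \<zeta>' \<longrightarrow> \<epsilon> * \<epsilon> = 1 \<longrightarrow> fl \<zeta>' = \<epsilon> * fl \<zeta> \<and> offset \<zeta>' - \<epsilon> * offset \<zeta> = b \<bullet> hv \<zeta>')" for s \<zeta>'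
  have "\<exists>\<zeta>'. good s \<zeta>'" for s unfolding good_def by (rule isometry_direction[OF A sub \<zeta> e[of s]]) blast
  then obtain g where g: "\<And>s. good s (g s)" by metis
  have "\<not> inj g"
  proof
    assume "inj g"
    moreover have "finite (range g)" by (rule finite_subset[OF _ finite_Z]) (use g in \<open>auto simp: good_def\<close>)
    ultimately show False using finite_imageD infinite_UNIV_nat by blast
  qed
  then obtain s1 s2 where s: "s1 \<noteq> s2" "g s1 = g s2" by (auto simp: inj_def)
  define \<zeta>' where "\<zeta>' = g s1"
  have good: "good s1 \<zeta>'" "good s2 \<zeta>'" using g[of s1] g[of s2] s by (simp_all add: \<zeta>'_def)
  define a1 a2 where "a1 = A (hv (\<i> * \<zeta>)) \<bullet> hv \<zeta>'" and "a2 = A vertical \<bullet> hv \<zeta>'"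
  have eq: "real k * a1 + a2 = 0" if "good k \<zeta>'" for k
  proof -
    define N where "N = cmod (Complex 1 (real k))"
    have N: "N \<noteq> 0" by (simp add: N_def complex_eq_iff)
    have "1 / e k = cnj (e k)"
      using e[of k] by (metis complex_div_cnj mult_1 of_real_1 one_power2 div_by_1)
    then have i: "Im (1 / e k) = - (real k / N)" "Re (1 / e k) = 1 / N"
      by (simp_all add: e_def sgn_div_norm N_def divide_inverse mult.commute)
    have "Im (1 / e k) * a1 - Re (1 / e k) * a2 = 0"
      using that unfolding good_def a1_def a2_def
      by (simp add: linear_diff[OF lin] linear_scale[OF lin] inner_diff_left)
    then have "N * (Im (1 / e k) * a1 - Re (1 / e k) * a2) = 0" by simp
    then show ?thesis unfolding i using N by (simp add: algebra_simps)
  qed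
  have "(real s1 - real s2) * a1 = 0" using eq[OF good(1)] eq[OF good(2)] unfolding left_diff_distrib by linarith
  then have a: "a1 = 0" "a2 = 0" using s eq[OF good(1)] by auto
  have \<zeta>'Z: "\<zeta>' \<in> Z" using good by (simp add: good_def)
  define \<epsilon> where "\<epsilon> = A (hv \<zeta>) \<bullet> hv \<zeta>'"
  define v where "v = adjoint A (hv \<zeta>')"
  have v: "A x \<bullet> hv \<zeta>' = x \<bullet> v" for x unfolding v_def by (simp add: adjoint_clauses(1)[OF lin])
  have vv: "v = \<epsilon> *\<^sub>R hv \<zeta>"
    using frame_eq(1)[OF \<zeta>, of v] a unfolding a1_def a2_def v \<epsilon>_def by (simp add: inner_commute)
  have surjA: "surj A" using orthogonal_transformation_surj[OF A] .
  then obtain x where x: "A x = hv \<zeta>'" by (metis surjD)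
  have "x = v"
  proof -
    have "w \<bullet> x = w \<bullet> v" for w using inner[of w x] v[of w] x by simp
    then have "(x - v) \<bullet> (x - v) = 0" by (simp add: inner_diff_right)
    then show ?thesis by simp
  qed
  then have Ae: "hv \<zeta>' = \<epsilon> *\<^sub>R A (hv \<zeta>)" using x vv linear_scale[OF lin] by metis
  have "1 = \<epsilon> * \<epsilon>"
    using frame_inner(1)[OF \<zeta>'Z] frame_inner(1)[OF \<zeta>] inner[of "hv \<zeta>" "hv \<zeta>"] unfolding Ae by simp
  then have ee: "\<epsilon> * \<epsilon> = 1" by simp
  then have Ae': "A (hv \<zeta>) = \<epsilon> *\<^sub>R hv \<zeta>'" unfolding Ae scaleR_scaleR by simp
  have "\<epsilon> = 1 \<or> \<epsilon> = -1" using ee by (metis square_eq_1_iff)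
  then show ?thesis using that[OF \<zeta>'Z _ Ae'] good(1) Ae' ee unfolding good_def by blast
qed

end

text \<open>Normal form of the linear maps that respect the vertical axis and act by similarities on
  the horizontal plane: multiplication by \<eta>, after conjugation if \<open>c\<close> holds, and
  the factor \<open>s\<close> on the axis. For \<open>\<eta> ^ n = 1\<close> and \<open>s\<close>
  equal to 1 or -1 these are the elements of the dihedral group.\<close>

definition act :: "bool \<Rightarrow> complex \<Rightarrow> real \<Rightarrow> real^3 \<Rightarrow> real^3" where
  "act c \<eta> s x = hv (\<eta> * (if c then cnj (horizontal x) else horizontal x)) + (s * x $ 3) *\<^sub>R vertical"

lemma horizontal_hv [simp]: "horizontal (hv z) = z" "horizontal vertical = 0"
  by (simp_all add: horizontal_def complex_eq_iff)

lemma hv_0 [simp]: "hv 0 = 0"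
  by (simp add: vec_eq_iff forall_3)

lemma act_hv: "act c \<eta> s (hv z) = hv (\<eta> * (if c then cnj z else z))" and act_vertical: "act c \<eta> s vertical = s *\<^sub>R vertical"
  by (simp_all add: act_def)

lemma act_nth: "act c \<eta> s x $ 1 = Re (\<eta> * (if c then cnj (horizontal x) else horizontal x))"
  "act c \<eta> s x $ 2 = Im (\<eta> * (if c then cnj (horizontal x) else horizontal x))" "act c \<eta> s x $ 3 = s * x $ 3"
  by (simp_all add: act_def)

lemma linear_act: "linear (act c \<eta> s)"
  by (rule linearI; simp only: vec_eq_iff forall_3 vector_add_component vector_scaleR_component act_nth; cases c)
    (simp_all add: horizontal_def algebra_simps)

lemma act_inner:
  assumes "cmod \<eta> = 1" "s * s = 1"
  shows "act c \<eta> s x \<bullet> act c \<eta> s y = x \<bullet> y"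
proof -
  have e: "\<eta> * cnj \<eta> = 1" using assms complex_norm_square[of \<eta>] by simp
  have "act c \<eta> s x \<bullet> act c \<eta> s y = Re ((\<eta> * cnj \<eta>) * ((if c then cnj (horizontal x) else horizontal x) *
      cnj (if c then cnj (horizontal y) else horizontal y))) + (s * s) * (x $ 3 * y $ 3)"
    unfolding inner_3 act_nth by (simp add: algebra_simps)
  then show ?thesis unfolding e assms by (cases c) (simp_all add: horizontal_def inner_3)
qed

lemma orthogonal_act: "cmod \<eta> = 1 \<Longrightarrow> s * s = 1 \<Longrightarrow> orthogonal_transformation (act c \<eta> s)"
  by (simp add: orthogonal_transformation_def linear_act act_inner)

lemma act_comp:
  "act True \<eta> 1 \<circ> act True 1 1 = act False \<eta> 1" "act c \<eta> 1 \<circ> act False 1 (-1) = act c \<eta> (-1)"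
  by (rule ext, cases c; simp add: act_def vec_eq_iff forall_3 horizontal_def)+

section \<open>Mirror reflections as generators\<close>

lemma reflection_hyperplane:
  assumes \<nu>: "norm \<nu> = 1"
  shows "reflection {x. x \<bullet> \<nu> = 0} x = x - (2 * (x \<bullet> \<nu>)) *\<^sub>R \<nu>"
proof -
  let ?P = "{x. x \<bullet> \<nu> = 0}" and ?f = "x - (x \<bullet> \<nu>) *\<^sub>R \<nu>"
  have n1: "\<nu> \<bullet> \<nu> = 1" using \<nu> by (simp add: norm_eq_1)
  have P: "?P = {x. \<nu> \<bullet> x = 0}" by (simp add: inner_commute)
  have "?f = closest_point ?P x"
  proof (rule closest_point_unique)
    show "convex ?P" "closed ?P" unfolding P by (rule convex_hyperplane closed_hyperplane)+
    show "?f \<in> ?P" by (simp add: inner_diff_left n1)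
    show "\<forall>z\<in>?P. dist x ?f \<le> dist x z"
    proof
      fix z assume "z \<in> ?P"
      then have "\<bar>x \<bullet> \<nu>\<bar> = \<bar>(x - z) \<bullet> \<nu>\<bar>" by (simp add: inner_diff_left)
      also have "\<dots> \<le> norm (x - z) * norm \<nu>" by (rule Cauchy_Schwarz_ineq2)
      finally show "dist x ?f \<le> dist x z" using \<nu> by (simp add: dist_norm)
    qed
  qed
  then have "closest_point ?P x = ?f" by simp
  show ?thesis unfolding reflection_def \<open>closest_point ?P x = ?f\<close> by (simp add: vec_eq_iff algebra_simps)
qed

text \<open>A reflection at angle \<theta> is conjugation carried along by the rotation by \<theta>,
  so the angle doubles; multiples of \<open>pi / n\<close> thus give all n-th roots of
  unity.\<close>

lemma reflection_mirror:
  "reflection {x. x \<bullet> hv (- \<i> * cis \<theta>) = 0} = act True (cis (2 * \<theta>)) 1"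
  "reflection {x. x \<bullet> vertical = 0} = act False 1 (-1)"
proof -
  have sc: "(sin \<theta>)\<^sup>2 + (cos \<theta>)\<^sup>2 = 1" by simp
  have "norm (hv (- \<i> * cis \<theta>)) = 1" using sc by (simp add: norm_eq_1 inner_3 power2_eq_square)
  note r = reflection_hyperplane[OF this]
  show "reflection {x. x \<bullet> hv (- \<i> * cis \<theta>) = 0} = act True (cis (2 * \<theta>)) 1"
  proof
    fix x
    have c1: "cos (2 * \<theta>) = 1 - 2 * (sin \<theta> * sin \<theta>)" by (simp add: cos_double_sin power2_eq_square)
    have c2: "1 - 2 * (sin \<theta> * sin \<theta>) = 2 * (cos \<theta> * cos \<theta>) - 1" using sc by (simp add: power2_eq_square)
    have s: "sin (2 * \<theta>) = 2 * (sin \<theta> * cos \<theta>)" by (simp add: sin_double)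
    have i: "x \<bullet> hv (- \<i> * cis \<theta>) = x $ 1 * sin \<theta> - x $ 2 * cos \<theta>" by (simp add: inner_3)
    have 1: "x $ 1 - 2 * (x $ 1 * sin \<theta> - x $ 2 * cos \<theta>) * sin \<theta> = cos (2 * \<theta>) * x $ 1 + sin (2 * \<theta>) * x $ 2"
      unfolding c1 s by (simp add: algebra_simps)
    have 2: "x $ 2 - 2 * (x $ 1 * sin \<theta> - x $ 2 * cos \<theta>) * (- cos \<theta>) = sin (2 * \<theta>) * x $ 1 - cos (2 * \<theta>) * x $ 2"
      unfolding c1 c2 s by (simp add: algebra_simps)
    show "reflection {x. x \<bullet> hv (- \<i> * cis \<theta>) = 0} x = act True (cis (2 * \<theta>)) 1 x"
      unfolding r i vec_eq_iff forall_3 act_nth vector_minus_component vector_scaleR_component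
      using 1 2 by (simp add: horizontal_def)
  qed
  have "norm vertical = 1" by (simp add: norm_eq_1)
  note r = reflection_hyperplane[OF this]
  show "reflection {x. x \<bullet> vertical = 0} = act False 1 (-1)"
    by (rule ext) (unfold r, simp add: vec_eq_iff forall_3 act_nth horizontal_def inner_3)
qed

lemma reflections_mirror_planes:
  assumes "n > 0"
  shows "reflection ` mirror_planes n = insert (act False 1 (-1)) ((\<lambda>k. act True (cis (2 * pi * real k / real n)) 1) ` {..<n})"
proof -
  define mir where "mir k = {x::real^3. x \<bullet> hv (- \<i> * cis (real k * pi / real n)) = 0}" for k
  have m0: "{x::real^3. x $ 2 = 0} = mir 0" by (simp add: mir_def inner_3)
  have v: "{x::real^3. x $ 3 = 0} = {x. x \<bullet> vertical = 0}" by (simp add: inner_3)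
  have mk: "{x::real^3. x $ 1 = cot (real k * pi / real n) * x $ 2} = mir k" if "1 \<le> k" "k \<le> n - 1" for k
  proof -
    define \<theta> where "\<theta> = real k * pi / real n"
    \<comment> \<open>A positive sine allows the equation with the cotangent to be multiplied
      out.\<close>
    have "0 < \<theta>" "\<theta> < pi" using that by (simp_all add: \<theta>_def field_simps)
    then have "sin \<theta> > 0" by (rule sin_gt_zero)
    moreover have "x \<bullet> hv (- \<i> * cis \<theta>) = x $ 1 * sin \<theta> - x $ 2 * cos \<theta>" for x by (simp add: inner_3)
    ultimately show ?thesis unfolding mir_def \<theta>_def[symmetric] by (simp add: cot_def eq_divide_eq mult.commute)
  qed
  have "{{x::real^3. x $ 1 = cot (real i * pi / real n) * x $ 2} | i. 1 \<le> i \<and> i \<le> n - 1} = mir ` {1..n - 1}"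
  proof -
    have "{i. 1 \<le> i \<and> i \<le> n - 1} = {1..n - 1}" by auto
    then show ?thesis unfolding setcompr_eq_image by (intro image_cong) (simp_all only: mk atLeastAtMost_iff)
  qed
  moreover have "{..<n} = insert 0 {1..n - 1}" using assms by auto
  ultimately have "mirror_planes n = insert {x. x \<bullet> vertical = 0} (mir ` {..<n})"
    unfolding mirror_planes_def m0 v by auto
  moreover have "reflection (mir k) = act True (cis (2 * pi * real k / real n)) 1" for k
  proof -
    have "2 * (real k * pi / real n) = 2 * pi * real k / real n" by simp
    then show ?thesis using reflection_mirror(1)[of "real k * pi / real n"] by (simp only: mir_def)
  qed
  ultimately show ?thesis by (simp add: image_image reflection_mirror(2))
qed

lemma bij_act: "cmod \<eta> = 1 \<Longrightarrow> s * s = 1 \<Longrightarrow> bij (act c \<eta> s)"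
  by (rule orthogonal_transformation_bij[OF orthogonal_act])

lemma Bij_UNIV: "f \<in> Bij UNIV \<longleftrightarrow> bij f"
  by (simp add: Bij_def)

lemma BijGroup_UNIV:
  "bij f \<Longrightarrow> bij g \<Longrightarrow> mult (BijGroup UNIV) f g = f \<circ> g" "one (BijGroup UNIV) = id"
  "bij f \<Longrightarrow> m_inv (BijGroup UNIV) f = inv_into UNIV f"
proof -
  show "bij f \<Longrightarrow> m_inv (BijGroup UNIV) f = inv_into UNIV f"
    by (simp add: inv_BijGroup Bij_UNIV restrict_def)
qed (auto simp: BijGroup_def Bij_UNIV compose_def fun_eq_iff)

text \<open>Rotations are products of two vertical mirrors, and the horizontal mirror supplies the
  sign \<open>s\<close>.\<close>

lemma act_in_dihedral:
  assumes n: "n > 0" and \<eta>: "\<eta> ^ n = 1" and s: "s = 1 \<or> s = -1"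
  shows "act c \<eta> s \<in> dihedral_Z2 n"
proof -
  let ?G = "generate (BijGroup UNIV) (reflection ` mirror_planes n)"
  have T: "act True \<eta> 1 \<in> ?G" if "\<eta> ^ n = 1" for \<eta>
  proof -
    have "\<eta> \<in> (\<lambda>k. cis (2 * pi * real k / real n)) ` {..<n}"
      using Complex.bij_betw_roots_unity[OF n] that unfolding bij_betw_def by blast
    then show ?thesis by (intro generate.incl) (auto simp: reflections_mirror_planes[OF n])
  qed
  have m: "cmod \<eta> = 1" using \<eta> n by (metis power_eq_1_iff not_gr_zero)
  have b: "bij (act True \<eta> 1)" "bij (act True 1 1)" "bij (act c \<eta> 1)" "bij (act False 1 (-1))" using bij_act m by simp_all
  have one: "act c \<eta> 1 \<in> ?G"
  proof (cases c)
    case False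
    have "mult (BijGroup UNIV) (act True \<eta> 1) (act True 1 1) \<in> ?G" by (intro generate.eng T \<eta>) simp
    then show ?thesis using False b by (simp add: BijGroup_UNIV act_comp)
  qed (use T[OF \<eta>] in simp)
  have "act False 1 (-1) \<in> ?G" by (intro generate.incl) (simp add: reflections_mirror_planes[OF n])
  then have "mult (BijGroup UNIV) (act c \<eta> 1) (act False 1 (-1)) \<in> ?G" by (intro generate.eng one)
  then have "act c \<eta> (-1) \<in> ?G" using b by (simp add: BijGroup_UNIV act_comp)
  then show ?thesis using one s unfolding dihedral_Z2_def by auto
qed

section \<open>The symmetry group is the dihedral group\<close>

context alternating_surface
begin

text \<open>An n-th root of unity \<eta> permutes the punctures of each kind, and the sign
  \<open>s\<close> fixes all horizontal axes, so \<open>X_equivariant\<close> applies.\<close>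

lemma act_preserves:
  assumes \<eta>: "\<eta> ^ n = 1" and s: "s * s = 1"
  shows "act c \<eta> s ` image_surf = image_surf"
proof -
  define \<sigma> where "\<sigma> = act c \<eta> s"
  define \<pi> where "\<pi> x = \<eta> * (if c then cnj x else x)" for x
  have m: "cmod \<eta> = 1" using \<eta> n_pos by (metis power_eq_1_iff)
  have e0: "\<eta> \<noteq> 0" using m by auto
  have o: "orthogonal_transformation \<sigma>" unfolding \<sigma>_def using orthogonal_act m s by blast
  have pn: "(\<pi> x) ^ n = x ^ n" if "x \<in> Z" for x
  proof -
    have "cnj (x ^ n) = x ^ n" using that unfolding Z_iff by (metis complex_cnj_minus complex_cnj_one)
    then show ?thesis using \<eta> by (simp add: \<pi>_def power_mult_distrib)
  qed
  have sub: "\<pi> ` Z \<subseteq> Z" using pn by (auto simp: Z_iff)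
  have inj: "inj_on \<pi> Z" using e0 by (auto simp: \<pi>_def inj_on_def)
  have \<pi>: "bij_betw \<pi> Z Z" using endo_inj_surj[OF finite_Z sub inj] inj by (simp add: bij_betw_def)
  have \<sigma>hv: "\<sigma> (hv x) = hv (\<pi> x)" for x by (simp add: \<sigma>_def \<pi>_def act_hv)
  have eq: "X (\<sigma> p) = \<sigma> (X p)" for p
    by (rule X_equivariant[OF _ _ \<pi> \<sigma>hv pn]) (simp_all add: \<sigma>_def linear_act act_inner m s)
  have hvZ: "inv_stereographic x = hv x" if "x \<in> Z" for x using norm_Z[OF that] by (simp add: vec_eq_iff forall_3)
  have "inv_stereographic ` Z = hv ` Z" using hvZ by auto
  then have "\<sigma> ` inv_stereographic ` Z = inv_stereographic ` Z"
    using \<pi> hvZ \<sigma>hv unfolding bij_betw_def by (metis (no_types, lifting) image_cong image_image)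
  moreover have "\<sigma> ` sphere 0 1 = sphere 0 1"
  proof -
    have nm: "norm (\<sigma> x) = norm x" for x by (rule orthogonal_transformation_norm[OF o])
    show ?thesis
    proof (intro equalityI subsetI)
      fix y :: "real^3" assume y: "y \<in> sphere 0 1"
      obtain x where x: "y = \<sigma> x" using surjD[OF orthogonal_transformation_surj[OF o]] by blast
      then have "x \<in> sphere 0 1" using y nm[of x] by simp
      then show "y \<in> \<sigma> ` sphere 0 1" using x by blast
    qed (use nm in auto)
  qed
  moreover have "inj \<sigma>" by (rule orthogonal_transformation_inj[OF o])
  ultimately have "\<sigma> ` C = C" unfolding C_def by (simp add: image_set_diff)
  then have "X ` C = X ` \<sigma> ` C" by simp
  also have "\<dots> = \<sigma> ` X ` C" by (simp add: image_image eq)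
  finally show ?thesis by (simp add: \<sigma>_def)
qed

lemma dihedral_preserves:
  assumes "g \<in> dihedral_Z2 n"
  shows "bij g \<and> (\<forall>x y. dist (g x) (g y) = dist x y) \<and> g ` image_surf = image_surf"
  using assms unfolding dihedral_Z2_def
proof (induction rule: generate.induct)
  have gen: "bij h \<and> (\<forall>x y. dist (h x) (h y) = dist x y) \<and> h ` image_surf = image_surf"
    if h: "h \<in> reflection ` mirror_planes n" for h
  proof -
    obtain c \<eta> s where e: "h = act c \<eta> s" "\<eta> ^ n = 1" "s * s = 1"
    proof -
      have root: "cis (2 * pi * real k / real n) ^ n = 1" for k
      proof -
        have "real n * (2 * pi * real k / real n) = 2 * pi * real k" using n_pos by simp
        then show ?thesis unfolding Complex.DeMoivre by (simp only: cis_multiple_2pi[OF Ints_of_nat])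
      qed
      from h consider "h = act False 1 (-1)" | k where "h = act True (cis (2 * pi * real k / real n)) 1"
        unfolding reflections_mirror_planes[OF n_pos(1)] by blast
      then show ?thesis
      proof cases
        case 1
        show ?thesis by (rule that[OF 1]) simp_all
      next
        case (2 k)
        show ?thesis by (rule that[OF 2 root]) simp
      qed
    qed
    have m: "cmod \<eta> = 1" using e(2) n_pos by (metis power_eq_1_iff)
    have o: "orthogonal_transformation h" using orthogonal_act[OF m e(3)] e(1) by simp
    then have d: "dist (h x) (h y) = dist x y" for x y
      by (simp add: orthogonal_transformation_isometry)
    have "h ` image_surf = image_surf" unfolding e(1) by (rule act_preserves[OF e(2,3)])
    then show ?thesis using orthogonal_transformation_bij[OF o] d by (intro conjI allI)
  qed
  {
    case one
    then show ?case by (simp add: BijGroup_UNIV bij_id[unfolded id_def] id_def)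
  next
    case (incl h)
    then show ?case using gen by blast
  next
    case (inv h)
    note h = gen[OF inv]
    then have b: "bij h" by blast
    have "dist (inv_into UNIV h x) (inv_into UNIV h y) = dist x y" for x y
    proof -
      have "h (inv_into UNIV h z) = z" for z by (rule surj_f_inv_f[OF bij_is_surj[OF b]])
      then show ?thesis using h by metis
    qed
    moreover have "inv_into UNIV h ` image_surf = image_surf"
    proof -
      have "inv_into UNIV h ` h ` image_surf = image_surf" by (rule image_inv_f_f[OF bij_is_inj[OF b]])
      then show ?thesis using h by simp
    qed
    ultimately show ?case using b by (simp add: BijGroup_UNIV bij_imp_bij_inv)
  next
    case (eng h1 h2)
    then have b: "bij h1" "bij h2" and d: "\<And>x y. dist (h1 x) (h1 y) = dist x y" "\<And>x y. dist (h2 x) (h2 y) = dist x y"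
      and i: "h1 ` image_surf = image_surf" "h2 ` image_surf = image_surf" by blast+
    have "dist ((h1 \<circ> h2) x) ((h1 \<circ> h2) y) = dist x y" for x y by (simp add: d)
    moreover have "(h1 \<circ> h2) ` image_surf = image_surf" by (simp only: image_comp[symmetric] i)
    ultimately show ?case unfolding BijGroup_UNIV(1)[OF b] using bij_comp[OF b(2,1)] by blast
  }
qed

text \<open>The linear part \<open>A\<close> of a symmetry is determined up to the sign on the
  vertical axis by the axes at 1 and at the adjacent puncture \<omega>. The issue is to show
  \<open>\<eta> ^ n = 1\<close>: an axis that \<open>A\<close> reverses goes over to the other kind,
  and for even \<open>n\<close> such a map would lie outside the group.\<close>

lemma symmetry_group_surf:
  assumes pos: "\<And>x. x \<in> Zr 1 \<Longrightarrow> fl x > 0" and neg: "\<And>x. x \<in> Zr (-1) \<Longrightarrow> fl x < 0"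
    and balance: "\<And>x. x \<in> Zr (-1) \<Longrightarrow> fl 1 + fl x = 0 \<Longrightarrow> fl 1 * (ln (\<beta>\<^sup>2) - ln (\<gamma>\<^sup>2)) \<noteq> (real n - 1) * (\<beta>\<^sup>2 + \<gamma>\<^sup>2)"
  shows "symmetry_group surf imm = dihedral_Z2 n"
proof -
  have "emb ` UNIV = C" using bij_emb by (simp add: bij_betw_def)
  then have im: "imm ` topspace (topo surf) = image_surf" by (simp only: topo_surf topspace_T image_comp[symmetric])
  have sub1: "dihedral_Z2 n \<subseteq> symmetry_group surf imm"
    using dihedral_preserves unfolding symmetry_group_def im by blast
  have fl0: "fl x \<noteq> 0" if "x \<in> Z" for x using that pos neg unfolding Z_def by force
  have "f \<in> dihedral_Z2 n" if f: "f \<in> symmetry_group surf imm" for f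
  proof -
    have iso: "dist (f x) (f y) = dist x y" and fS: "f ` image_surf = image_surf" for x y
      using f unfolding symmetry_group_def im by auto
    define A b where "A x = f x - f 0" and "b = f 0" for x
    have A: "orthogonal_transformation A"
      unfolding orthogonal_transformation_isometry using iso by (simp add: A_def dist_norm)
    have fA: "f = (\<lambda>x. A x + b)" by (simp add: A_def b_def)
    have lin: "linear A" and inner: "A v \<bullet> A w = v \<bullet> w" for v w
      using A by (simp_all add: orthogonal_transformation_def)
    have sub: "(\<lambda>x. A x + b) ` image_surf \<subseteq> image_surf" using fS fA by simp
    note E = isometry_end[OF A sub]
    have one: "1 \<in> Z" "1 \<in> Zr 1" by (simp_all add: Z_iff Zr_def)
    define \<omega> where "\<omega> = cis (pi / n)"
    have \<omega>: "\<omega> \<in> Z" by (simp add: Z_iff \<omega>_def Complex.DeMoivre)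
    have s\<omega>: "Im \<omega> > 0" unfolding \<omega>_def using n by (simp add: sin_gt_zero field_simps)
    obtain \<zeta>1 \<epsilon>1 where 1: "\<zeta>1 \<in> Z" "\<epsilon>1 = 1 \<or> \<epsilon>1 = -1" "A (hv 1) = \<epsilon>1 *\<^sub>R hv \<zeta>1" "fl \<zeta>1 = \<epsilon>1 * fl 1"
      "offset \<zeta>1 - \<epsilon>1 * offset 1 = b \<bullet> hv \<zeta>1" using E[OF one(1)] by blast
    obtain \<zeta>2 \<epsilon>2 where 2: "A (hv \<omega>) = \<epsilon>2 *\<^sub>R hv \<zeta>2" using E[OF \<omega>] by blast
    define \<eta> where "\<eta> = of_real \<epsilon>1 * \<zeta>1"
    have A1: "A (hv 1) = hv \<eta>" by (simp only: 1(3) \<eta>_def hv_scale)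
    have \<eta>1: "cmod \<eta> = 1" using 1(2) norm_Z[OF 1(1)] by (auto simp: \<eta>_def norm_mult)
    \<comment> \<open>\<open>hv \<i>\<close> is a combination of \<open>hv 1\<close> and
      \<open>hv \<omega>\<close>, which are independent since \<open>Im \<omega> > 0\<close>; so its
      image is horizontal too.\<close>
    define \<kappa> where "\<kappa> = of_real (1 / Im \<omega>) * (of_real \<epsilon>2 * \<zeta>2 - of_real (Re \<omega>) * \<eta>)"
    have Ai: "A (hv \<i>) = hv \<kappa>"
    proof -
      have "hv \<i> = (1 / Im \<omega>) *\<^sub>R (hv \<omega> - Re \<omega> *\<^sub>R hv 1)" using s\<omega> by (simp add: vec_eq_iff forall_3)
      then have "A (hv \<i>) = (1 / Im \<omega>) *\<^sub>R (A (hv \<omega>) - Re \<omega> *\<^sub>R A (hv 1))"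
        by (simp add: linear_scale[OF lin] linear_diff[OF lin])
      also have "\<dots> = hv \<kappa>" unfolding 2 A1 \<kappa>_def by (simp add: vec_eq_iff forall_3)
      finally show ?thesis .
    qed
    have "hv \<i> = hv (\<i> * 1)" by simp
    then have in1: "hv \<kappa> \<bullet> hv \<kappa> = 1" "hv \<kappa> \<bullet> hv \<eta> = 0"
      unfolding A1[symmetric] Ai[symmetric] inner using frame_inner[OF one(1)] by auto
    have "\<eta> * cnj \<eta> = 1" using \<eta>1 complex_norm_square[of \<eta>] by simp
    \<comment> \<open>Orthogonality to \<open>hv \<eta>\<close> and length one leave only \<i>, a
      rotation, and -\<i>, a reflection.\<close>
    define \<mu> where "\<mu> = \<kappa> * cnj \<eta>"
    have \<kappa>\<mu>: "\<kappa> = \<eta> * \<mu>" using \<open>\<eta> * cnj \<eta> = 1\<close> by (simp add: \<mu>_def mult.left_commute)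
    have "Re \<mu> = 0" using in1(2) by (simp only: hv_inner \<mu>_def)
    moreover have "cmod \<mu> = 1"
    proof -
      have "Re (\<kappa> * cnj \<kappa>) = 1" using in1(1) by (simp only: hv_inner)
      then have "(cmod \<kappa>)\<^sup>2 = 1" unfolding complex_norm_square[symmetric] by simp
      then have "cmod \<kappa> = 1" by (simp add: power2_eq_1_iff) (metis norm_ge_zero not_one_le_zero neg_0_le_iff_le)
      then show ?thesis using \<eta>1 by (simp add: \<mu>_def norm_mult)
    qed
    then have "(Re \<mu>)\<^sup>2 + (Im \<mu>)\<^sup>2 = 1" by (simp add: cmod_power2[symmetric])
    ultimately have "(Im \<mu>)\<^sup>2 = 1" by simp
    then have \<mu>: "\<mu> = \<i> \<or> \<mu> = - \<i>" using \<open>Re \<mu> = 0\<close> by (auto simp: power2_eq_1_iff complex_eq_iff)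
    define c where "c \<longleftrightarrow> \<mu> = - \<i>"
    define s where "s = A vertical $ 3"
    have ph: "A vertical \<bullet> hv \<eta> = 0" "A vertical \<bullet> hv (\<i> * \<eta>) = 0"
    proof -
      show "A vertical \<bullet> hv \<eta> = 0" unfolding A1[symmetric] inner by simp
      have "A vertical \<bullet> hv \<kappa> = 0" unfolding Ai[symmetric] inner by simp
      moreover have "hv \<kappa> = Im \<mu> *\<^sub>R hv (\<i> * \<eta>)" using \<mu> unfolding \<kappa>\<mu> by (auto simp: vec_eq_iff forall_3)
      ultimately show "A vertical \<bullet> hv (\<i> * \<eta>) = 0" using \<mu> by auto
    qed
    have Av: "A vertical = s *\<^sub>R vertical"
      using frame_decomposition[OF \<eta>1, of "A vertical"] ph by (simp add: s_def)
    have ss: "s * s = 1" using inner[of vertical vertical] unfolding Av by simp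
    then have s: "s = 1 \<or> s = -1" by (metis square_eq_1_iff)
    have Aact: "A x = act c \<eta> s x" for x
    proof -
      have "x = x $ 1 *\<^sub>R hv 1 + x $ 2 *\<^sub>R hv \<i> + x $ 3 *\<^sub>R vertical" by (simp add: vec_eq_iff forall_3)
      then have "A x = x $ 1 *\<^sub>R A (hv 1) + x $ 2 *\<^sub>R A (hv \<i>) + x $ 3 *\<^sub>R A vertical"
        using linear_add[OF lin] linear_scale[OF lin] by metis
      also have "\<dots> = x $ 1 *\<^sub>R hv \<eta> + x $ 2 *\<^sub>R hv (\<eta> * \<mu>) + (s * x $ 3) *\<^sub>R vertical"
        unfolding A1 Ai Av \<kappa>\<mu> by (simp add: mult.commute)
      also have "\<dots> = act c \<eta> s x"
        using \<mu> by (cases c) (auto simp: c_def vec_eq_iff forall_3 act_nth horizontal_def complex_eq_iff algebra_simps)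
      finally show ?thesis .
    qed
    have \<eta>n: "\<eta> ^ n = 1"
    proof (cases "\<epsilon>1 = 1")
      case True
      then have "fl \<zeta>1 > 0" using 1(4) pos[OF one(2)] by simp
      then have "\<zeta>1 \<notin> Zr (-1)" using neg by fastforce
      then show ?thesis using 1(1) True by (simp add: \<eta>_def Z_def Zr_def)
    next
      case False
      \<comment> \<open>The axis is reversed, so by the signs of the fluxes \<zeta>1 is of the other
        kind. For odd \<open>n\<close> its negative is again an n-th root of 1.\<close>
      then have m: "\<epsilon>1 = -1" using 1(2) by blast
      then have f1: "fl \<zeta>1 = - fl 1" using 1(4) by simp
      then have \<zeta>1: "\<zeta>1 \<in> Zr (-1)" using 1(1) pos[of \<zeta>1] pos[OF one(2)] by (auto simp: Z_def)
      have \<eta>\<zeta>: "\<eta> = - \<zeta>1" by (simp add: \<eta>_def m)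
      show ?thesis
      proof (cases "odd n")
        case True
        then show ?thesis using \<zeta>1 by (simp add: \<eta>\<zeta> Zr_def)
      next
        case even: False
        \<comment> \<open>The end at -1 is of the same kind as the one at 1 and its image lies on
          the opposite half of the axis, so adding the two offset relations eliminates the
          translation \<open>b\<close>. What remains contradicts \<open>balance\<close>.\<close>
        then have mone: "-1 \<in> Z" "-1 \<in> Zr 1" by (simp_all add: Z_iff Zr_def)
        obtain \<zeta>3 \<epsilon>3 where 3: "\<zeta>3 \<in> Z" "\<epsilon>3 = 1 \<or> \<epsilon>3 = -1" "A (hv (-1)) = \<epsilon>3 *\<^sub>R hv \<zeta>3" "fl \<zeta>3 = \<epsilon>3 * fl (-1)"
          "offset \<zeta>3 - \<epsilon>3 * offset (-1) = b \<bullet> hv \<zeta>3" using E[OF mone(1)] by blast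
        have "hv (-1) = (-1) *\<^sub>R hv 1" by (simp add: vec_eq_iff forall_3)
        then have "A (hv (-1)) = (-1) *\<^sub>R hv \<eta>" using linear_scale[OF lin] A1 by metis
        also have "\<dots> = hv \<zeta>1" by (simp add: \<eta>\<zeta> vec_eq_iff forall_3)
        finally have "hv \<zeta>1 = \<epsilon>3 *\<^sub>R hv \<zeta>3" using 3(3) by simp
        then have \<zeta>13: "\<zeta>1 = of_real \<epsilon>3 * \<zeta>3" by (simp add: vec_eq_iff forall_3 complex_eq_iff)
        have "\<zeta>1 ^ n = \<zeta>3 ^ n" using 3(2) even unfolding \<zeta>13 by auto
        then have \<zeta>3: "\<zeta>3 \<in> Zr (-1)" using \<zeta>1 by (simp add: Zr_def)
        have "fl (-1) = fl 1" using even by (simp add: fl_def)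
        have e3: "\<epsilon>3 = -1"
        proof (rule ccontr)
          assume "\<epsilon>3 \<noteq> -1"
          then show False using 3(2,4) pos[OF mone(2)] neg[OF \<zeta>3] by auto
        qed
        have f3: "fl (-1) + fl \<zeta>3 = 0" "fl 1 + fl \<zeta>1 = 0" using 3(4) e3 f1 by simp_all
        have "hv \<zeta>3 = - hv \<zeta>1" by (simp add: \<zeta>13 e3 vec_eq_iff forall_3)
        then have "(offset (-1) + offset \<zeta>3) + (offset 1 + offset \<zeta>1) = 0"
          using 1(5) 3(5) m e3 by (simp add: inner_minus_right)
        then have "fl 1 * (ln (\<beta>\<^sup>2) - ln (\<gamma>\<^sup>2)) - (real n - 1) * (\<beta>\<^sup>2 + \<gamma>\<^sup>2) = 0"
          unfolding offset_sum[OF mone(2) \<zeta>3 f3(1)] offset_sum[OF one(2) \<zeta>1 f3(2)] \<open>fl (-1) = fl 1\<close> by linarith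
        then show ?thesis using balance[OF \<zeta>1 f3(2)] by simp
      qed
    qed
    have Ad: "A = act c \<eta> s" using Aact by blast
    \<comment> \<open>Since \<open>A\<close> alone preserves the surface, so does the translation by
      \<open>b\<close>, which is therefore trivial.\<close>
    have AS: "A ` image_surf = image_surf" unfolding Ad by (rule act_preserves[OF \<eta>n ss])
    have "(\<lambda>x. x + b) ` image_surf = (\<lambda>x. x + b) ` A ` image_surf" using AS by simp
    also have "\<dots> = f ` image_surf" by (simp add: fA image_image)
    finally have "(\<lambda>x. x + b) ` image_surf \<subseteq> image_surf" using fS by simp
    then have "b = 0" using translation_trivial fl0 by blast
    then have "f = act c \<eta> s" using fA Aact by auto
    then show ?thesis using act_in_dihedral[OF n_pos(1) \<eta>n s] by simp
  qed
  then show ?thesis using sub1 by blast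
qed

end

section \<open>Choice of the weights\<close>

text \<open>Schroeder-Bernstein: three reals are coded by one through an injective pairing, and the
  code is sent to a real coordinate above 2, away from the punctures on the unit circle.\<close>

lemma exists_parametrization:
  assumes Z: "\<And>z. z \<in> Z \<Longrightarrow> cmod z = 1"
  shows "\<exists>emb :: real^3 \<Rightarrow> real^3. bij_betw emb UNIV (sphere 0 1 - inv_stereographic ` Z)"
proof -
  have "infinite (UNIV :: real set)" by (rule infinite_UNIV_char_0)
  from card_of_ordLeq[THEN iffD2, OF ordIso_imp_ordLeq[OF card_of_Times_same_infinite[OF this]]]
  obtain j :: "real \<times> real \<Rightarrow> real" where j: "inj j" by auto
  define f :: "real^3 \<Rightarrow> real^3" where "f v = inv_stereographic (of_real (2 + exp (j (v $ 1, j (v $ 2, v $ 3)))))" for v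
  have "inj f"
  proof (rule injI)
    fix v w assume "f v = f w"
    then have "of_real (2 + exp (j (v $ 1, j (v $ 2, v $ 3)))) = complex_of_real (2 + exp (j (w $ 1, j (w $ 2, w $ 3))))"
      unfolding f_def by (rule injD[OF inj_inv_stereographic])
    then have "j (v $ 1, j (v $ 2, v $ 3)) = j (w $ 1, j (w $ 2, w $ 3))" by (simp only: of_real_eq_iff add_left_cancel exp_inj_iff)
    then have "v $ 1 = w $ 1" "j (v $ 2, v $ 3) = j (w $ 2, w $ 3)" using injD[OF j] by blast+
    moreover from this have "v $ 2 = w $ 2" "v $ 3 = w $ 3" using injD[OF j] by blast+
    ultimately show "v = w" by (simp add: vec_eq_iff forall_3)
  qed
  moreover have "f v \<in> sphere 0 1 - inv_stereographic ` Z" for v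
  proof -
    have "cmod (of_real (2 + exp x)) \<noteq> 1" for x :: real
      unfolding norm_of_real using exp_gt_zero[of x] by linarith
    then show ?thesis using Z inv_stereographic_sphere injD[OF inj_inv_stereographic] unfolding f_def by blast
  qed
  ultimately show ?thesis
    by (intro Schroeder_Bernstein[of f UNIV _ "\<lambda>x. x"]) auto
qed

text \<open>The parameter \<open>s = - \<gamma> / \<beta>\<close> is the smaller root of \<open>(n - 1) s\<^sup>2 - n (1 + w) s + w (n - 1)\<close>; this
  equation says that the two fluxes have ratio \<open>- w\<close>.\<close>

definition flux_ratio :: "nat \<Rightarrow> real \<Rightarrow> real" where
  "flux_ratio n w = (real n * (1 + w) - sqrt ((real n * (1 + w))\<^sup>2 - 4 * w * (real n - 1)\<^sup>2)) / (2 * (real n - 1))"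

text \<open>The normalization that gives the first kind of ends weight one, that is
  \<open>fl = 1 / (2 * pi)\<close>.\<close>

definition flux_beta :: "nat \<Rightarrow> real \<Rightarrow> real" where
  "flux_beta n w = sqrt (1 / (2 * pi) / ((real n - 1) - real n * flux_ratio n w))"

definition flux_gamma :: "nat \<Rightarrow> real \<Rightarrow> real" where
  "flux_gamma n w = - flux_ratio n w * flux_beta n w"

text \<open>The discriminant is positive because \<open>4 * w \<le> (1 + w)\<^sup>2\<close>. The
  smaller root is the one for which the first flux, a positive multiple of
  \<open>(n - 1) - n * s\<close>, is positive; \<open>s < 1\<close> later gives
  \<open>\<beta> + \<gamma> \<noteq> 0\<close>.\<close>

lemma flux_ratio:
  assumes n: "n \<ge> 2" and w: "w > 0"
  shows "(real n - 1) * (flux_ratio n w)\<^sup>2 - real n * (1 + w) * flux_ratio n w + w * (real n - 1) = 0"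
    and "0 < flux_ratio n w" "real n * flux_ratio n w < real n - 1" "flux_ratio n w < 1"
proof -
  define m where "m = real n"
  define s where "s = flux_ratio n w"
  define D where "D = (m * (1 + w))\<^sup>2 - 4 * w * (m - 1)\<^sup>2"
  define q where "q = sqrt D"
  have m: "m \<ge> 2" using n by (simp add: m_def)
  have "4 * w * (m - 1)\<^sup>2 < 4 * w * m\<^sup>2" using w m by (intro mult_strict_left_mono power_strict_mono) auto
  also have "4 * w * m\<^sup>2 \<le> (m * (1 + w))\<^sup>2"
  proof -
    have "(m * (1 + w))\<^sup>2 - 4 * w * m\<^sup>2 = (m * (1 - w))\<^sup>2" by (simp add: power2_eq_square algebra_simps)
    then show ?thesis using zero_le_power2[of "m * (1 - w)"] by linarith
  qed
  finally have D: "D > 0" by (simp add: D_def)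
  have q2: "q * q = D" using D by (simp add: q_def)
  have q0: "q > 0" using D by (simp add: q_def)
  have sq: "2 * (m - 1) * s = m * (1 + w) - q"
    using m by (simp add: s_def flux_ratio_def m_def[symmetric] D_def[symmetric] q_def[symmetric])
  have "4 * (m - 1) * ((m - 1) * s\<^sup>2 - m * (1 + w) * s + w * (m - 1)) =
      (2 * (m - 1) * s)\<^sup>2 - 2 * (m * (1 + w)) * (2 * (m - 1) * s) + 4 * w * (m - 1)\<^sup>2"
    by (simp add: power2_eq_square algebra_simps)
  also have "\<dots> = q * q - D" unfolding sq D_def by (simp add: power2_eq_square algebra_simps)
  also have "\<dots> = 0" by (simp add: q2)
  finally have root: "(m - 1) * s\<^sup>2 - m * (1 + w) * s + w * (m - 1) = 0" using m by simp
  then show "(real n - 1) * (flux_ratio n w)\<^sup>2 - real n * (1 + w) * flux_ratio n w + w * (real n - 1) = 0"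
    by (simp add: s_def m_def)
  have "q < m * (1 + w)"
  proof (rule power2_less_imp_less)
    show "q\<^sup>2 < (m * (1 + w))\<^sup>2" using q2 w m by (simp add: D_def power2_eq_square[of q])
    show "0 \<le> m * (1 + w)" using m w by simp
  qed
  then have "0 < 2 * (m - 1) * s" using sq by simp
  then have "0 < s" using m by (simp add: zero_less_mult_iff)
  then show "0 < flux_ratio n w" by (simp add: s_def)
  \<comment> \<open>the quadratic is negative at \<open>(m - 1) / m\<close>, which therefore lies between its roots\<close>
  have ms: "m * s < m - 1"
  proof (rule ccontr)
    assume "\<not> m * s < m - 1"
    then have h: "m * s - (m - 1) \<ge> 0" by simp
    have "2 * (m - 1)\<^sup>2 \<le> m * (2 * (m - 1) * s)"
      using mult_left_mono[OF h, of "2 * (m - 1)"] m by (simp add: power2_eq_square algebra_simps)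
    then have u: "m * q \<le> m * (m * (1 + w)) - 2 * (m - 1)\<^sup>2" unfolding sq by (simp add: algebra_simps)
    have "(m * q)\<^sup>2 \<le> (m * (m * (1 + w)) - 2 * (m - 1)\<^sup>2)\<^sup>2"
      using u m q0 by (intro power_mono) auto
    moreover have "(m * q)\<^sup>2 = m\<^sup>2 * D" by (simp add: power_mult_distrib power2_eq_square[of q] q2)
    moreover have "(m * (m * (1 + w)) - 2 * (m - 1)\<^sup>2)\<^sup>2 - m\<^sup>2 * D = 4 * (m - 1)\<^sup>2 * ((m - 1)\<^sup>2 - m\<^sup>2)"
      unfolding D_def by (simp add: power2_eq_square algebra_simps)
    moreover have "4 * (m - 1)\<^sup>2 * ((m - 1)\<^sup>2 - m\<^sup>2) < 0"
    proof (rule mult_pos_neg)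
      show "4 * (m - 1)\<^sup>2 > 0" using m by simp
      have "(m - 1)\<^sup>2 < m\<^sup>2" using m by (intro power_strict_mono) auto
      then show "(m - 1)\<^sup>2 - m\<^sup>2 < 0" by simp
    qed
    ultimately show False by linarith
  qed
  then show "real n * flux_ratio n w < real n - 1" by (simp add: s_def m_def)
  have "m * s < m * 1" using ms by simp
  then have "s < 1" using m by (simp only: mult_less_cancel_left_pos)
  then show "flux_ratio n w < 1" by (simp add: s_def)
qed

lemma flux_beta:
  assumes n: "n \<ge> 2" and w: "w > 0"
  shows "flux_beta n w > 0" "(flux_beta n w)\<^sup>2 * ((real n - 1) - real n * flux_ratio n w) = 1 / (2 * pi)"
proof -
  have d: "(real n - 1) - real n * flux_ratio n w > 0" using flux_ratio(3)[OF assms] by simp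
  then show "flux_beta n w > 0" by (simp add: flux_beta_def)
  have "(flux_beta n w)\<^sup>2 = 1 / (2 * pi) / ((real n - 1) - real n * flux_ratio n w)"
    unfolding flux_beta_def using d by (intro real_sqrt_pow2) simp
  then show "(flux_beta n w)\<^sup>2 * ((real n - 1) - real n * flux_ratio n w) = 1 / (2 * pi)" using d by simp
qed

lemma flux_even:
  assumes n: "n \<ge> 2" and w: "w > 0"
  shows "flux_beta n w * ((real n - 1) * flux_beta n w + real n * flux_gamma n w) = 1 / (2 * pi)"
proof -
  have "flux_beta n w * ((real n - 1) * flux_beta n w + real n * flux_gamma n w)
      = (flux_beta n w)\<^sup>2 * ((real n - 1) - real n * flux_ratio n w)"
    unfolding flux_gamma_def by (simp add: power2_eq_square algebra_simps)
  then show ?thesis using flux_beta(2)[OF assms] by simp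
qed

lemma flux_odd:
  assumes n: "n \<ge> 2" and w: "w > 0"
  shows "flux_gamma n w * ((real n - 1) * flux_gamma n w + real n * flux_beta n w) = - w / (2 * pi)"
proof -
  define s b where "s = flux_ratio n w" and "b = flux_beta n w"
  have "(real n - 1) * s\<^sup>2 - real n * s = - w * ((real n - 1) - real n * s)"
    using flux_ratio(1)[OF assms, folded s_def] by (simp add: algebra_simps)
  moreover have "flux_gamma n w * ((real n - 1) * flux_gamma n w + real n * flux_beta n w) = b\<^sup>2 * ((real n - 1) * s\<^sup>2 - real n * s)"
    unfolding flux_gamma_def s_def[symmetric] b_def[symmetric] by (simp add: power2_eq_square algebra_simps)
  ultimately have "flux_gamma n w * ((real n - 1) * flux_gamma n w + real n * flux_beta n w) = - w * (b\<^sup>2 * ((real n - 1) - real n * s))"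
    by (simp only: mult_ac)
  then show ?thesis using flux_beta(2)[OF assms, folded s_def b_def] by simp
qed

lemma alternating_flux:
  assumes n: "n \<ge> 2" and w: "w > 0"
  shows "alternating n (flux_beta n w) (flux_gamma n w)"
proof
  show "n \<ge> 2" by (rule n)
  show "flux_beta n w \<noteq> 0" using flux_beta(1)[OF assms] by simp
  show "flux_gamma n w \<noteq> 0" using flux_beta(1)[OF assms] flux_ratio(2)[OF assms] by (simp add: flux_gamma_def)
  have "flux_beta n w + flux_gamma n w = flux_beta n w * (1 - flux_ratio n w)" by (simp add: flux_gamma_def algebra_simps)
  then show "flux_beta n w + flux_gamma n w \<noteq> 0" using flux_beta(1)[OF assms] flux_ratio(4)[OF assms] by simp
qed

lemma flux_continuous:
  assumes n: "n \<ge> 2"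
  shows "continuous_on {0<..} (flux_beta n)" "continuous_on {0<..} (flux_gamma n)"
proof -
  have r: "continuous_on {0<..} (flux_ratio n)"
    unfolding flux_ratio_def using n by (intro continuous_intros) auto
  show b: "continuous_on {0<..} (flux_beta n)"
    unfolding flux_beta_def using flux_ratio(3)[OF n] by (intro continuous_intros r) force+
  show "continuous_on {0<..} (flux_gamma n)"
    unfolding flux_gamma_def by (intro continuous_intros r b)
qed

text \<open>The logarithmic terms of opposite ends cannot cancel. Only \<open>w = 1\<close> matters, where \<open>s\<close> is close to
  \<open>0.268\<close> for \<open>n = 2\<close> and at least \<open>0.38\<close> for \<open>n \<ge> 3\<close>; the exceptional value lies strictly in between.\<close>

lemma log_balance:
  fixes s :: real
  assumes n: "n \<ge> 2" and s: "0 < s" "real n * s < real n - 1" and eq: "(real n - 1) * (1 + s\<^sup>2) = 2 * real n * s"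
  shows "(1 - s\<^sup>2) * (- ln s) \<noteq> 1 + s\<^sup>2"
proof (cases "n = 2")
  case True
  have e: "1 + s\<^sup>2 = 4 * s" and h: "s < 1 / 2" using eq s(2) True by simp_all
  \<comment> \<open>The exact root is \<open>2 - sqrt 3\<close>, about 0.268. The bounds 0.27 for
    \<open>s\<close> and 1.18 for \<open>- ln s\<close> are just sharp enough for the final
    comparison, which needs \<open>8.72 * s < 2.36\<close>.\<close>
  have s27: "s < 27 / 100"
  proof (rule ccontr)
    assume "\<not> s < 27 / 100"
    then have "(s - 27 / 100) * (4 - s - 27 / 100) \<ge> 0" using h by (intro mult_nonneg_nonneg) auto
    moreover have "(s - 27 / 100) * (4 - s - 27 / 100) = 4 * s - s\<^sup>2 - 10071 / 10000"
      by (simp add: power2_eq_square field_simps)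
    ultimately show False using e by linarith
  qed
  \<comment> \<open>A quarter of 1.18 is small enough for the quadratic upper bound of the
    exponential function to be useful.\<close>
  have "exp (118 / 100 :: real) = exp (295 / 1000) ^ 4" by (simp add: exp_of_nat_mult[symmetric])
  also have "\<dots> \<le> (1 + 295 / 1000 + (295 / 1000)\<^sup>2) ^ 4" by (intro power_mono exp_bound) auto
  also have "\<dots> < 100 / 27" by (simp add: power2_eq_square eval_nat_numeral)
  also have "\<dots> < 1 / s" using s27 s(1) by (simp add: field_simps)
  finally have "ln (exp (118 / 100)) < ln (1 / s)" by (subst ln_less_cancel_iff) (use s in auto)
  then have l: "118 / 100 < - ln s" using s(1) by (simp add: ln_div)
  have p: "1 - s\<^sup>2 = 2 * (1 - 2 * s)" using e by simp
  have "4 * s < 118 / 100 * (2 * (1 - 2 * s))" using s27 by (simp add: algebra_simps)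
  also have "\<dots> < (- ln s) * (2 * (1 - 2 * s))" using l h by (intro mult_strict_right_mono) auto
  finally show ?thesis unfolding p e by (simp add: mult.commute)
next
  case False
  then have n3: "real n \<ge> 3" using n by simp
  have s1: "s < 1"
  proof (rule ccontr)
    assume "\<not> s < 1"
    then have "real n * 1 \<le> real n * s" by (intro mult_left_mono) auto
    then show False using s(2) by simp
  qed
  \<comment> \<open>For \<open>n \<ge> 3\<close> this yields
    \<open>s \<ge> (3 - sqrt 5) / 2\<close>, about 0.382, so that 3/8 is a valid lower bound; its
    inverse 8/3 is still below \<open>exp 1\<close>.\<close>
  have "(real n - 1) * (1 + s\<^sup>2 - 3 * s) = (3 - real n) * s" using eq by (simp add: algebra_simps)
  also have "\<dots> \<le> 0" using n3 s(1) by (intro mult_nonpos_nonneg) auto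
  finally have "1 + s\<^sup>2 - 3 * s \<le> 0" using n3 by (simp add: mult_le_0_iff)
  then have "s > 3 / 8"
  proof (rule contrapos_pp)
    assume "\<not> s > 3 / 8"
    then have "(3 / 8 - s) * (3 - s - 3 / 8) \<ge> 0" by (intro mult_nonneg_nonneg) auto
    moreover have "(3 / 8 - s) * (3 - s - 3 / 8) = s\<^sup>2 - 3 * s + 63 / 64" by (simp add: power2_eq_square field_simps)
    ultimately show "\<not> 1 + s\<^sup>2 - 3 * s \<le> 0" by linarith
  qed
  have "1 / s < 8 / 3" using \<open>s > 3 / 8\<close> by (simp add: field_simps)
  also have "8 / 3 < (1 + 1 / 4 + (1 / 4)\<^sup>2 / 2 :: real) ^ 4" by (simp add: power2_eq_square eval_nat_numeral)
  also have "\<dots> \<le> exp (1 / 4) ^ 4" by (intro power_mono exp_lower_Taylor_quadratic) auto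
  also have "\<dots> = exp 1" by (simp add: exp_of_nat_mult[symmetric])
  finally have "ln (1 / s) < ln (exp 1)" by (subst ln_less_cancel_iff) (use s in auto)
  then have l: "- ln s < 1" using s(1) by (simp add: ln_div)
  have "1 - s\<^sup>2 > 0" using s1 s(1) by (simp add: power_less_one_iff)
  then have "(1 - s\<^sup>2) * (- ln s) < (1 - s\<^sup>2) * 1" using l by (intro mult_strict_left_mono) auto
  also have "\<dots> < 1 + s\<^sup>2" using s(1) by simp
  finally show ?thesis by simp
qed

text \<open>The normalization replaces \<open>1 / (2 * pi)\<close> by
  \<open>b\<^sup>2 * ((n - 1) - n * s)\<close>, and for \<open>w = 1\<close> the quadratic equation
  says \<open>2 * ((n - 1) - n * s) = (n - 1) * (1 - s\<^sup>2)\<close>. After cancelling common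
  factors \<open>log_balance\<close> remains.\<close>

lemma flux_balance:
  assumes n: "n \<ge> 2" and w: "w = 1"
  shows "1 / (2 * pi) * (ln ((flux_beta n w)\<^sup>2) - ln ((flux_gamma n w)\<^sup>2)) \<noteq>
    (real n - 1) * ((flux_beta n w)\<^sup>2 + (flux_gamma n w)\<^sup>2)"
proof
  define s b where "s = flux_ratio n w" and "b = flux_beta n w"
  have w0: "w > 0" using w by simp
  have s: "0 < s" "real n * s < real n - 1" using flux_ratio(2,3)[OF n w0] by (simp_all add: s_def)
  have b: "b > 0" "b\<^sup>2 * ((real n - 1) - real n * s) = 1 / (2 * pi)" using flux_beta[OF n w0] by (simp_all add: s_def b_def)
  have eq: "(real n - 1) * (1 + s\<^sup>2) = 2 * real n * s"
    using flux_ratio(1)[OF n w0, folded s_def] unfolding w by (simp add: algebra_simps)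
  have g: "flux_gamma n w = - (s * b)" by (simp add: flux_gamma_def s_def b_def)
  assume "1 / (2 * pi) * (ln ((flux_beta n w)\<^sup>2) - ln ((flux_gamma n w)\<^sup>2)) = (real n - 1) * ((flux_beta n w)\<^sup>2 + (flux_gamma n w)\<^sup>2)"
  note A = this
  have g2: "(flux_gamma n w)\<^sup>2 = s\<^sup>2 * b\<^sup>2" unfolding g power2_minus power_mult_distrib ..
  have L: "ln (s\<^sup>2 * b\<^sup>2) = 2 * ln s + ln (b\<^sup>2)" using s(1) b(1) by (simp add: ln_mult_pos ln_realpow)
  have e: "ln (b\<^sup>2) - (2 * ln s + ln (b\<^sup>2)) = - 2 * ln s" by simp
  have "1 / (2 * pi) * (- 2 * ln s) = (real n - 1) * (b\<^sup>2 + s\<^sup>2 * b\<^sup>2)"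
    using A unfolding b_def[symmetric] g2 L e .
  then have "b\<^sup>2 * ((real n - 1) - real n * s) * (- 2 * ln s) = (real n - 1) * (b\<^sup>2 + s\<^sup>2 * b\<^sup>2)"
    unfolding b(2) .
  also have "\<dots> = b\<^sup>2 * ((real n - 1) * (1 + s\<^sup>2))" by (simp add: algebra_simps)
  finally have "b\<^sup>2 * (((real n - 1) - real n * s) * (- 2 * ln s)) = b\<^sup>2 * ((real n - 1) * (1 + s\<^sup>2))"
    by (simp only: mult.assoc)
  then have "((real n - 1) - real n * s) * (- 2 * ln s) = (real n - 1) * (1 + s\<^sup>2)"
    by (rule mult_left_cancel[THEN iffD1, rotated]) (use b(1) in simp)
  moreover have "2 * ((real n - 1) - real n * s) = (real n - 1) * (1 - s\<^sup>2)" using eq by (simp add: algebra_simps)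
  ultimately have "(real n - 1) * ((1 - s\<^sup>2) * (- ln s)) = (real n - 1) * (1 + s\<^sup>2)"
    by (metis (no_types, opaque_lifting) mult.assoc mult.left_commute mult_minus_left mult_minus_right)
  then have "(1 - s\<^sup>2) * (- ln s) = 1 + s\<^sup>2"
    by (rule mult_left_cancel[THEN iffD1, rotated]) (use n in simp)
  then show False using log_balance[OF n s eq] by simp
qed

text \<open>The values of \<open>fl\<close> are 1 and \<open>- w\<close> divided by
  \<open>2 * pi\<close>, so they cancel only for \<open>w = 1\<close>, the case settled by
  \<open>flux_balance\<close>.\<close>

lemma symmetry_group_flux:
  assumes n: "n \<ge> 2" and w: "w > 0" and S: "alternating_surface n (flux_beta n w) (flux_gamma n w) emb"
  shows "symmetry_group (parametrized_sphere.surf (alternating.Z n) emb)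
    (alternating.X n (flux_beta n w) (flux_gamma n w) \<circ> emb) = dihedral_Z2 n"
proof -
  interpret alternating_surface n "flux_beta n w" "flux_gamma n w" emb by (rule S)
  have even: "fl x = 1 / (2 * pi)" if "x \<in> Zr 1" for x using fl_Zr(1)[OF that] flux_even[OF n w] by simp
  have odd: "fl x = - w / (2 * pi)" if "x \<in> Zr (-1)" for x using fl_Zr(2)[OF that] flux_odd[OF n w] by simp
  have one: "1 \<in> Zr 1" by (simp add: Zr_def)
  show ?thesis
  proof (rule symmetry_group_surf)
    fix x assume x: "x \<in> Zr (-1)" and "fl 1 + fl x = 0"
    then have "w = 1" unfolding even[OF one] odd[OF x] by (simp add: field_simps)
    then show "fl 1 * (ln ((flux_beta n w)\<^sup>2) - ln ((flux_gamma n w)\<^sup>2)) \<noteq> (real n - 1) * ((flux_beta n w)\<^sup>2 + (flux_gamma n w)\<^sup>2)"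
      unfolding even[OF one] by (rule flux_balance[OF n])
  qed (use w in \<open>simp_all add: even odd\<close>)
qed

text \<open>The punctures do not depend on \<open>w\<close>, so all surfaces share one domain and
  only the coefficients vary; this is what makes them a one-parameter family.\<close>

lemma continuous_on_family:
  assumes n: "n \<ge> 2"
  shows "continuous_on ({0<..} \<times> (sphere 0 1 - inv_stereographic ` alternating.Z n))
    (\<lambda>(w, q). alternating.X n (flux_beta n w) (flux_gamma n w) q)"
proof -
  interpret a: alternating n "flux_beta n 1" "flux_gamma n 1" by (rule alternating_flux[OF n]) simp
  define S :: "(real \<times> (real^3)) set" where "S = {0<..} \<times> (sphere 0 1 - inv_stereographic ` a.Z)"
  have X: "alternating.X n (flux_beta n w) (flux_gamma n w) q = (\<Sum>x\<in>a.Z.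
      ((if x ^ n = 1 then flux_beta n w * ((real n - 1) * flux_beta n w + real n * flux_gamma n w)
        else flux_gamma n w * ((real n - 1) * flux_gamma n w + real n * flux_beta n w)) / 2 * ln (1 - q \<bullet> hv x)) *\<^sub>R hv x
     - ((if x ^ n = 1 then flux_beta n w else flux_gamma n w)\<^sup>2 / (2 * (1 - q \<bullet> hv x))) *\<^sub>R (q - (q \<bullet> hv x) *\<^sub>R hv x))"
    if "w > 0" for w q
  proof -
    interpret alternating n "flux_beta n w" "flux_gamma n w" by (rule alternating_flux[OF n that])
    show ?thesis unfolding X_def fl_def wt_def ..
  qed
  have ne: "1 - snd u \<bullet> hv x > 0" if u: "u \<in> S" and x: "x \<in> a.Z" for u x
  proof -
    have x1: "norm (hv x) = 1" using a.frame_inner(1)[OF x] by (simp add: norm_eq_1)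
    have e: "inv_stereographic x = hv x" using a.norm_Z[OF x] by (simp add: vec_eq_iff forall_3)
    have p1: "norm (snd u) = 1" and np: "snd u \<notin> inv_stereographic ` a.Z" using u by (auto simp: S_def)
    have "snd u \<bullet> hv x \<le> 1" using norm_cauchy_schwarz[of "snd u" "hv x"] x1 p1 by simp
    moreover have "snd u \<bullet> hv x \<noteq> 1"
    proof
      assume "snd u \<bullet> hv x = 1"
      then have "(norm (snd u - hv x))\<^sup>2 = 0"
        unfolding power2_norm_eq_inner using x1 p1 by (simp add: inner_diff_left inner_diff_right inner_commute norm_eq_1)
      then show False using imageI[OF x, of inv_stereographic] e np by simp
    qed
    ultimately show ?thesis by simp
  qed
  have b: "continuous_on S (\<lambda>u. flux_beta n (fst u))" and g: "continuous_on S (\<lambda>u. flux_gamma n (fst u))"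
    by (rule continuous_on_compose2[OF flux_continuous(1)[OF n] continuous_on_fst[OF continuous_on_id]]
        continuous_on_compose2[OF flux_continuous(2)[OF n] continuous_on_fst[OF continuous_on_id]]; auto simp: S_def)+
  have fc: "continuous_on S (\<lambda>u. (if x ^ n = 1 then flux_beta n (fst u) * ((real n - 1) * flux_beta n (fst u) + real n * flux_gamma n (fst u))
        else flux_gamma n (fst u) * ((real n - 1) * flux_gamma n (fst u) + real n * flux_beta n (fst u))))" for x
    by (cases "x ^ n = 1") (auto intro!: continuous_intros b g)
  have wc: "continuous_on S (\<lambda>u. if x ^ n = 1 then flux_beta n (fst u) else flux_gamma n (fst u))" for x
    by (cases "x ^ n = 1") (auto intro!: b g)
  have "continuous_on S (\<lambda>u. \<Sum>x\<in>a.Z.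
      ((if x ^ n = 1 then flux_beta n (fst u) * ((real n - 1) * flux_beta n (fst u) + real n * flux_gamma n (fst u))
        else flux_gamma n (fst u) * ((real n - 1) * flux_gamma n (fst u) + real n * flux_beta n (fst u))) / 2 * ln (1 - snd u \<bullet> hv x)) *\<^sub>R hv x
     - ((if x ^ n = 1 then flux_beta n (fst u) else flux_gamma n (fst u))\<^sup>2 / (2 * (1 - snd u \<bullet> hv x))) *\<^sub>R (snd u - (snd u \<bullet> hv x) *\<^sub>R hv x))"
    by (intro continuous_on_sum continuous_on_diff continuous_on_scaleR continuous_on_mult continuous_on_divide continuous_on_ln
        continuous_on_power continuous_on_inner continuous_on_const continuous_on_snd continuous_on_id fc wc)
      (use ne in \<open>force+\<close>)
  then show ?thesis
    unfolding S_def[symmetric]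
  proof (rule continuous_on_eq)
    fix u assume "u \<in> S"
    then obtain w q where u: "u = (w, q)" "w > 0" by (auto simp: S_def)
    show "(\<Sum>x\<in>a.Z.
      ((if x ^ n = 1 then flux_beta n (fst u) * ((real n - 1) * flux_beta n (fst u) + real n * flux_gamma n (fst u))
        else flux_gamma n (fst u) * ((real n - 1) * flux_gamma n (fst u) + real n * flux_beta n (fst u))) / 2 * ln (1 - snd u \<bullet> hv x)) *\<^sub>R hv x
     - ((if x ^ n = 1 then flux_beta n (fst u) else flux_gamma n (fst u))\<^sup>2 / (2 * (1 - snd u \<bullet> hv x))) *\<^sub>R (snd u - (snd u \<bullet> hv x) *\<^sub>R hv x))
      = (case u of (w, q) \<Rightarrow> alternating.X n (flux_beta n w) (flux_gamma n w) q)"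
      unfolding u(1) case_prod_conv fst_conv snd_conv X[OF u(2)] ..
  qed
qed

theorem theorem1p4:
  fixes n :: nat
  assumes "n \<ge> 2"
  shows "\<exists>(M :: (real^3) surface) (AW :: real \<Rightarrow> real^3 \<Rightarrow> real^3).
    continuous_map (prod_topology (top_of_set {0<..}) (topo M)) euclidean (\<lambda>(w, p). AW w p) \<and>
    (\<forall>w>0.
      complete_minimal_ftc M (AW w) \<and>
      genus_zero M \<and>
      card (ends M) = 2 * n \<and>
      (\<forall>e\<in>ends M. catenoid_end M (AW w) e) \<and>
      (\<exists>E. bij_betw E {..<2 * n} (ends M) \<and>
        (\<exists>A::real^3^3. rotation_matrix A \<and>
          (\<forall>k<2 * n. \<exists>\<nu>. end_normal M (AW w) (E k) \<nu> \<and>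
             stereographic (A *v \<nu>) = cis (2 * pi * real k / real (2 * n)))) \<and>
        (\<forall>k<2 * n. end_weight M (AW w) (E k) (if even k then 1 else w))) \<and>
      (\<exists>T. rigid_motion T \<and>
        symmetry_group M (AW w) = (\<lambda>g. T \<circ> g \<circ> inv_into UNIV T) ` dihedral_Z2 n))"
proof -
  let ?b = "flux_beta n" and ?g = "flux_gamma n"
  interpret a: alternating n "?b 1" "?g 1" by (rule alternating_flux[OF assms]) simp
  obtain emb :: "real^3 \<Rightarrow> real^3" where emb: "bij_betw emb UNIV (sphere 0 1 - inv_stereographic ` alternating.Z n)"
    using exists_parametrization[OF a.norm_Z] by blast
  have S: "alternating_surface n (?b w) (?g w) emb" if "w > 0" for w
    by (intro alternating_surface.intro alternating_surface_axioms.intro alternating_flux[OF assms that])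
      (use emb in simp)
  \<comment> \<open>The surface and its ends depend on \<open>n\<close> and \<open>emb\<close>
    alone; this instance at parameter 1 names them for all \<open>w\<close>.\<close>
  interpret s1: alternating_surface n "?b 1" "?g 1" emb by (rule S) simp
  define M where "M = parametrized_sphere.surf (alternating.Z n) emb"
  define AW where "AW w = alternating.X n (?b w) (?g w) \<circ> emb" for w
  have "continuous_map (prod_topology (top_of_set {0<..}) (topo M)) euclidean (\<lambda>(w, p). AW w p)"
  proof -
    have "continuous_map (prod_topology (top_of_set {0<..}) (topo M)) (prod_topology (top_of_set {0<..}) (top_of_set s1.C)) (\<lambda>(w, p). (w, emb p))"
      unfolding continuous_map_prod_top M_def using s1.continuous_map_emb by (simp add: continuous_map_id)
    moreover have "continuous_map (prod_topology (top_of_set {0<..}) (top_of_set s1.C)) euclidean (\<lambda>(w, q). alternating.X n (?b w) (?g w) q)"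
      using continuous_on_family[OF assms] unfolding prod_topology_subtopology_eu s1.C_def[symmetric] by simp
    ultimately have "continuous_map (prod_topology (top_of_set {0<..}) (topo M)) euclidean
        ((\<lambda>(w, q). alternating.X n (?b w) (?g w) q) \<circ> (\<lambda>(w, p). (w, emb p)))" by (rule continuous_map_compose)
    moreover have "(\<lambda>(w, q). alternating.X n (?b w) (?g w) q) \<circ> (\<lambda>(w, p). (w, emb p)) = (\<lambda>(w, p). AW w p)"
      by (auto simp: AW_def)
    ultimately show ?thesis by simp
  qed
  moreover have "complete_minimal_ftc M (AW w) \<and> genus_zero M \<and> card (ends M) = 2 * n \<and>
      (\<forall>e\<in>ends M. catenoid_end M (AW w) e) \<and>
      (\<exists>E. bij_betw E {..<2 * n} (ends M) \<and>
        (\<exists>A::real^3^3. rotation_matrix A \<and>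
          (\<forall>k<2 * n. \<exists>\<nu>. end_normal M (AW w) (E k) \<nu> \<and>
             stereographic (A *v \<nu>) = cis (2 * pi * real k / real (2 * n)))) \<and>
        (\<forall>k<2 * n. end_weight M (AW w) (E k) (if even k then 1 else w))) \<and>
      (\<exists>T. rigid_motion T \<and>
        symmetry_group M (AW w) = (\<lambda>g. T \<circ> g \<circ> inv_into UNIV T) ` dihedral_Z2 n)" if w: "w > 0" for w
  proof -
    interpret alternating_surface n "?b w" "?g w" emb by (rule S[OF w])
    have even: "fl x = 1 / (2 * pi)" if "x \<in> Zr 1" for x using fl_Zr(1)[OF that] flux_even[OF assms w] by simp
    have odd: "fl x = - w / (2 * pi)" if "x \<in> Zr (-1)" for x using fl_Zr(2)[OF that] flux_odd[OF assms w] by simp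
    have fl0: "fl x \<noteq> 0" if "x \<in> Z" for x using that even odd w by (auto simp: Z_def)
    \<comment> \<open>Indexing by the roots of unity in cyclic order makes the kinds alternate: even
      \<open>k\<close> gives an n-th root of 1, odd \<open>k\<close> one of -1.\<close>
    define E where "E k = s1.end_at (cis (2 * pi * real k / real (2 * n)))" for k
    have roots: "bij_betw (\<lambda>k. cis (2 * pi * real k / real (2 * n))) {..<2 * n} Z"
    proof -
      have "{z::complex. z ^ (2 * n) = 1} = Z"
        by (auto simp: Z_iff mult.commute[of 2 n] power_mult power2_eq_1_iff)
      then show ?thesis using Complex.bij_betw_roots_unity[of "2 * n"] n_pos by simp
    qed
    then have rZ: "cis (2 * pi * real k / real (2 * n)) \<in> Z" if "k < 2 * n" for k using that by (auto simp: bij_betw_def)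
    have bij: "bij_betw E {..<2 * n} (ends s1.surf)"
      using bij_betw_trans[OF roots inj_on_imp_bij_betw[OF s1.inj_on_end_at]] unfolding s1.ends_surf E_def o_def .
    have parity: "cis (2 * pi * real k / real (2 * n)) \<in> Zr (if even k then 1 else -1)" for k
    proof -
      have "real n * (2 * pi * real k / real (2 * n)) = real k * pi" using n_pos by simp
      then have "cis (2 * pi * real k / real (2 * n)) ^ n = cis pi ^ k" unfolding Complex.DeMoivre by (simp add: mult.commute)
      then show ?thesis by (simp add: Zr_def cis_pi)
    qed
    have normal: "end_normal s1.surf imm (E k) (hv (cis (2 * pi * real k / real (2 * n))))" if "k < 2 * n" for k
      unfolding E_def by (rule end_normal_surf[OF rZ[OF that]])
    have weight: "end_weight s1.surf imm (E k) (if even k then 1 else w)" if "k < 2 * n" for k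
    proof -
      have "2 * pi * \<bar>fl (cis (2 * pi * real k / real (2 * n)))\<bar> = (if even k then 1 else w)"
        using parity[of k] even odd w by (cases "even k") auto
      then show ?thesis using end_weight_surf[OF rZ[OF that]] unfolding E_def by simp
    qed
    have rot: "rotation_matrix (mat 1 :: real^3^3)" by (simp add: rotation_matrix_def orthogonal_matrix_id)
    have normals: "\<exists>\<nu>. end_normal s1.surf imm (E k) \<nu> \<and> stereographic ((mat 1 :: real^3^3) *v \<nu>) = cis (2 * pi * real k / real (2 * n))"
      if "k < 2 * n" for k
      by (rule exI[of _ "hv (cis (2 * pi * real k / real (2 * n)))"])
        (simp only: matrix_vector_mul_lid stereographic_hv normal[OF that] simp_thms)
    \<comment> \<open>The mirror planes of the surface are already those of
      \<open>dihedral_Z2\<close>, so the motion is the identity.\<close>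
    have rigid: "rigid_motion (id :: real^3 \<Rightarrow> real^3)"
      unfolding rigid_motion_def using rot by (intro exI[of _ "mat 1"] exI[of _ 0]) auto
    have sym: "symmetry_group s1.surf imm = (\<lambda>g. id \<circ> g \<circ> inv_into UNIV id) ` dihedral_Z2 n"
      using symmetry_group_flux[OF assms w S[OF w]] by (simp add: inv_id)
    have cat: "\<forall>e\<in>ends s1.surf. catenoid_end s1.surf imm e"
      unfolding s1.ends_surf using catenoid_end_surf fl0 by blast
    have card: "card (ends s1.surf) = 2 * n" unfolding s1.card_ends by (rule card_Z)
    have "\<exists>E. bij_betw E {..<2 * n} (ends s1.surf) \<and>
        (\<exists>A::real^3^3. rotation_matrix A \<and>
          (\<forall>k<2 * n. \<exists>\<nu>. end_normal s1.surf imm (E k) \<nu> \<and>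
             stereographic (A *v \<nu>) = cis (2 * pi * real k / real (2 * n)))) \<and>
        (\<forall>k<2 * n. end_weight s1.surf imm (E k) (if even k then 1 else w))"
    proof (intro exI[of _ E] conjI)
      show "\<exists>A::real^3^3. rotation_matrix A \<and> (\<forall>k<2 * n. \<exists>\<nu>. end_normal s1.surf imm (E k) \<nu> \<and>
             stereographic (A *v \<nu>) = cis (2 * pi * real k / real (2 * n)))"
        using rot normals by (intro exI[of _ "mat 1"] conjI) blast+
    qed (use bij weight in blast)+
    moreover have "\<exists>T. rigid_motion T \<and> symmetry_group s1.surf imm = (\<lambda>g. T \<circ> g \<circ> inv_into UNIV T) ` dihedral_Z2 n"
      using rigid sym by blast
    ultimately show ?thesis
      unfolding M_def AW_def using complete_minimal_ftc_surf s1.genus_zero_surf card cat by (intro conjI)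
  qed
  ultimately show ?thesis by blast
qed

end
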